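(* Let $F\colon\mathbb{T}^2\to\mathbb{T}^2$ be a homeomorphism homotopic to the identity which satisfies the curve intersection property, and let $f\colon\mathbb{R}^2\to\mathbb{R}^2$ be a lift of $F$. Suppose the rotation set $\rho(f)$ has empty interior in $\mathbb{R}^2$. Then every rational point of $\rho(f)$ is realized by a periodic orbit; that is, whenever $p_1,p_2,q$ are integers with $q\geq 1$, $\gcd(p_1,p_2,q)=1$ and $(p_1/q,p_2/q)\in\rho(f)$, there exists $x\in\mathbb{R}^2$ such that $f^q(x)=x+(p_1,p_2)$.
   Context: $\mathbb{T}^2=\mathbb{R}^2/\mathbb{Z}^2$, with canonical projection $\pi\colon\mathbb{R}^2\to\mathbb{T}^2$. A lift of $F$ is a homeomorphism $f$ of $\mathbb{R}^2$ with $\pi f=F\pi$; since $F$ is homotopic to the identity, $f$ commutes with all integer translations. The rotation set of $f$ is $$\rho(f)=\bigcap_{m=1}^{\infty}\overline{\bigcup_{n=m}^{\infty}\left\{\frac{f^n(x)-x}{n}:x\in\mathbb{R}^2\right\}}\subset\mathbb{R}^2.$$ Changing the lift translates $\rho(f)$ by an element of $\mathbb{Z}^2$. A closed curve in $\mathbb{T}^2$ is essential if it is homotopically non-trivial. A free curve for $F$ is an essential simple closed curve $\gamma\subset\mathbb{T}^2$ with $F(\gamma)\cap\gamma=\emptyset$. $F$ has the curve intersection property if it has no free curves, i.e. every essential simple closed curve in $\mathbb{T}^2$ intersects its image under $F$. *)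

theory Defs
  imports "HOL-Analysis.Analysis"
begin

definition int_translate :: "real \<times> real \<Rightarrow> real \<times> real \<Rightarrow> bool" where
  "int_translate x y \<longleftrightarrow> fst x - fst y \<in> \<int> \<and> snd x - snd y \<in> \<int>"

lemma equivp_int_translate: "equivp int_translate"
proof (rule equivpI)
  show "reflp int_translate"
    by (simp add: reflp_def int_translate_def)
  show "symp int_translate"
    unfolding symp_def int_translate_def by (metis Ints_minus minus_diff_eq)
  show "transp int_translate"
    unfolding transp_def int_translate_def
    by (metis Ints_add diff_add_cancel add_diff_eq)
qed

quotient_type torus = "real \<times> real" / int_translate
  by (rule equivp_int_translate)

definition torus_proj :: "real \<times> real \<Rightarrow> torus" where
  "torus_proj = abs_torus"

instantiation torus :: topological_space
begin

text \<open>The quotient topology.\<close>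

definition open_torus :: "torus set \<Rightarrow> bool" where
  "open_torus U \<longleftrightarrow> open (torus_proj -` U)"

instance
proof
  show "open (UNIV :: torus set)"
    by (simp add: open_torus_def)
  show "open (S \<inter> T)" if "open S" "open T" for S T :: "torus set"
    using that by (simp add: open_torus_def vimage_Int open_Int)
  show "open (\<Union>K)" if "\<forall>S\<in>K. open S" for K :: "torus set set"
    using that by (auto simp: open_torus_def vimage_Union)
qed

end

lemma torus_proj_eq_iff: "torus_proj x = torus_proj y \<longleftrightarrow> int_translate x y"
  by (simp add: torus_proj_def torus.abs_eq_iff)

lemma surj_torus_proj: "surj torus_proj"
  unfolding torus_proj_def by (metis Quotient3_torus Quotient3_abs_rep surj_def)

lemma quotient_map_torus_proj: "quotient_map euclidean euclidean torus_proj"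
  using surj_torus_proj
  by (simp add: quotient_map_def open_torus_def vimage_def)

definition is_lift :: "(torus \<Rightarrow> torus) \<Rightarrow> (real \<times> real \<Rightarrow> real \<times> real) \<Rightarrow> bool" where
  "is_lift F f \<longleftrightarrow>
     homeomorphic_map euclidean euclidean f \<and> torus_proj \<circ> f = F \<circ> torus_proj"

definition rotation_set :: "(real \<times> real \<Rightarrow> real \<times> real) \<Rightarrow> (real \<times> real) set" where
  "rotation_set f =
     (\<Inter>m\<in>{1::nat..}. closure (\<Union>n\<in>{m..}. {((f ^^ n) x - x) /\<^sub>R real n | x. True}))"

text \<open>
  Closed curves are loops parametrized by the unit interval. Homotopically trivial means
  freely homotopic, through closed curves, to a constant.
\<close>

definition essential_curve :: "(real \<Rightarrow> torus) \<Rightarrow> bool" where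
  "essential_curve \<gamma> \<longleftrightarrow>
     path \<gamma> \<and> pathfinish \<gamma> = pathstart \<gamma> \<and>
     \<not> (\<exists>a. homotopic_loops UNIV \<gamma> (\<lambda>t. a))"

definition free_curve :: "(torus \<Rightarrow> torus) \<Rightarrow> (real \<Rightarrow> torus) \<Rightarrow> bool" where
  "free_curve F \<gamma> \<longleftrightarrow>
     simple_path \<gamma> \<and> essential_curve \<gamma> \<and> F ` path_image \<gamma> \<inter> path_image \<gamma> = {}"

definition curve_intersection_property :: "(torus \<Rightarrow> torus) \<Rightarrow> bool" where
  "curve_intersection_property F \<longleftrightarrow> \<not> (\<exists>\<gamma>. free_curve F \<gamma>)"

end

theory Submission
  imports Defs
begin

text \<open>
  Suppose that $f^q - p$ has no fixed point. By Brouwer's theory of fixed point free plane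
  homeomorphisms it has no closed $\<delta>$-chain for some $\<delta> > 0$. Hence, for large $N$, the
  graph of $f$ on the squares of side $1/N$ has no closed walk of length $n$ and translation $v$ for
  which $\<mu> = q v - n p$ vanishes.

  The absence of free curves puts the $\<mu>$ of all closed walks into one closed half plane
  $l \<cdot> \<mu> \<ge> 0$: take an invariant set $V$ of squares, maximal subject to its complement having an
  unbounded component, and a strongly connected class $C$ of squares just below it in the order of
  reachability. No closed walk has $\<mu> = 0$, so the walks inside $C$ lie in a half plane, and the
  sublevel sets of $l$ on $V \<union> C$ form an attracting family of plane regions that sweeps every
  orbit, and then every closed walk, along with it.

  Since $p/q$ lies in the rotation set, closed walks with $l \<cdot> \<mu> = 0$ exist in both
  directions. So $l$ is a multiple of a primitive integer vector $u$, and their limits at fine scales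
  are two points of the line $u \<cdot> x = \<alpha>$ through $p/q$, on either side of $p/q$, whose rates are
  attained by $f^m$ in every direction for every $m$. If the speed in direction $u$ did not reach the
  integer $\<lfloor>\<alpha>\<rfloor> + 1$, a half plane could be deformed to one mapped into its own interior both by a
  translate of $f$ and by a translate of $f^{-1}$, and its boundary would contain a free curve.
  Otherwise there is a third such point off the line, and three non-collinear points of this kind give
  the rotation set non-empty interior, as in the theorem of Misiurewicz and Ziemian.
\<close>

section \<open>Lifts of torus maps\<close>

text \<open>Two scales carry the argument. Closed walks survive perturbation but need not be
  followed by orbits, while the rotation set speaks of orbits. So \<open>nozero\<close> is obtained
  at one scale \<open>N\<close> and inherited by every multiple \<open>k * N\<close>, since fine
  walks project to coarse ones. At scale \<open>N\<close>, integrality of \<mu> and a pigeonhole on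
  the \<open>N * N\<close> residues keep the rates of neutral walks away from p/q by a fixed amount;
  as \<open>k\<close> grows, walks of fixed length turn into orbit segments.

  The half plane is the hard point: each strongly connected class has one, but those of different
  classes might be opposite. The class \<open>C\<close> is therefore taken exactly where adding it
  to \<open>V\<close> destroys the last unbounded region. There a level set of \<open>C\<close> cuts
  the plane up to pockets of bounded size; larger pockets would be essential and have a frontier
  along which a free curve runs.

  Coprimality enters through \<mu> = 0: it forces q to divide n, so that the walk splits into blocks
  of q steps, a chain for f^q - p.\<close>

definition zv :: "int \<times> int \<Rightarrow> real \<times> real" where
  "zv v = (of_int (fst v), of_int (snd v))"

lemma zv_simps [simp]: "fst (zv v) = of_int (fst v)" "snd (zv v) = of_int (snd v)" "zv 0 = 0"
  by (auto simp: zv_def zero_prod_def)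

lemma zv_add: "zv (v + w) = zv v + zv w"
  and zv_diff: "zv (v - w) = zv v - zv w"
  and zv_uminus: "zv (- v) = - zv v"
  by (auto simp: zv_def plus_prod_def minus_prod_def uminus_prod_def)

lemma zv_eq_iff [simp]: "zv v = zv w \<longleftrightarrow> v = w"
  by (auto simp: zv_def prod_eq_iff)

lemma zv_eq_0_iff [simp]: "zv v = 0 \<longleftrightarrow> v = 0"
  using zv_eq_iff[of v 0] by simp

lemma continuous_on_unit_intervals:
  fixes h :: "real \<Rightarrow> 'a::topological_space"
  assumes "\<And>k::int. continuous_on {of_int k..of_int k + 1} h"
  shows "continuous_on UNIV h"
  unfolding continuous_on_eq_continuous_at[OF open_UNIV]
proof
  fix x :: real
  define k where "k = \<lfloor>x\<rfloor>"
  \<comment> \<open>Two consecutive closed intervals, because their union is a neighbourhood of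
    \<open>x\<close> even when \<open>x\<close> is the integer \<open>k\<close>.\<close>
  have "continuous_on ({of_int (k - 1)..of_int (k - 1) + 1} \<union> {of_int k..of_int k + 1}) h"
    by (intro continuous_on_closed_Un assms) auto
  then have "continuous_on {of_int k - 1<..<of_int k + 1} h"
    by (rule continuous_on_subset) auto
  moreover have "x \<in> {of_int k - 1<..<of_int k + 1}" unfolding k_def by (simp; linarith)
  ultimately show "isCont h x"
    by (simp add: continuous_on_eq_continuous_at)
qed

text \<open>For a positive scale \<open>M\<close> this is both a node of the grid next to
  \<open>p\<close> and the label of a square of side 1/\<open>M\<close> that contains
  \<open>p\<close>.\<close>

definition lattice_cell :: "nat \<Rightarrow> real \<times> real \<Rightarrow> int \<times> int" where
  "lattice_cell M p = (\<lfloor>real M * fst p\<rfloor>, \<lfloor>real M * snd p\<rfloor>)"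

definition imul :: "int \<Rightarrow> int \<times> int \<Rightarrow> int \<times> int" where
  "imul k v = (k * fst v, k * snd v)"

lemma zv_imul: "zv (imul k v) = of_int k *\<^sub>R zv v"
  by (simp add: imul_def zv_def)

lemma unit_square_representative:
  obtains y v where "y \<in> {0..1} \<times> {0..1}" "x = y + zv v"
proof (rule that[of "(frac (fst x), frac (snd x))" "(\<lfloor>fst x\<rfloor>, \<lfloor>snd x\<rfloor>)"])
  show "(frac (fst x), frac (snd x)) \<in> {0..1} \<times> {0..1}"
    by (auto simp: frac_ge_0 less_imp_le[OF frac_lt_1])
qed (simp add: prod_eq_iff frac_def)

lemma compact_unit_square: "compact ({0..1} \<times> {0..1} :: (real \<times> real) set)"
  by (intro compact_Times) auto

lemma periodic_attains_inf:
  fixes h :: "real \<times> real \<Rightarrow> real"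
  assumes "continuous_on UNIV h" "\<And>x v. h (x + zv v) = h x"
  obtains z where "\<And>x. h z \<le> h x"
proof -
  have "\<exists>z\<in>{0..1} \<times> {0..1}. \<forall>x\<in>{0..1} \<times> {0..1}. h z \<le> h x"
    by (intro continuous_attains_inf compact_unit_square continuous_on_subset[OF assms(1)]) auto
  then show ?thesis by (metis that unit_square_representative assms(2))
qed

lemma periodic_attains_sup:
  fixes h :: "real \<times> real \<Rightarrow> real"
  assumes "continuous_on UNIV h" "\<And>x v. h (x + zv v) = h x"
  obtains z where "\<And>x. h x \<le> h z"
  using periodic_attains_inf[of "\<lambda>x. - h x"] assms by (metis continuous_on_minus neg_le_iff_le)

text \<open>
  For closed $\<int>^2$-invariant $B$ disjoint from its image, a connected subset of $B$ containing two
  points that differ by a non-zero lattice vector can be approximated by the lift of a free curve.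
\<close>

definition no_free_continuum :: "(real \<times> real \<Rightarrow> real \<times> real) \<Rightarrow> bool" where
  "no_free_continuum f \<longleftrightarrow> (\<forall>B \<Phi> x W. closed B \<longrightarrow> (\<forall>b v. b \<in> B \<longrightarrow> b + zv v \<in> B) \<longrightarrow> f ` B \<inter> B = {} \<longrightarrow>
     connected \<Phi> \<longrightarrow> \<Phi> \<subseteq> B \<longrightarrow> x \<in> \<Phi> \<longrightarrow> x + zv W \<in> \<Phi> \<longrightarrow> W = 0)"

text \<open>The inverse \<open>fi\<close> is a parameter, so that the inverse, the iterates and the
  integer translates of a lift are instances again. Later arguments are applied to
  \<open>fi\<close>, to \<open>f ^^ n\<close> and to maps such as \<open>f ^^ k\<close> minus a
  lattice vector.\<close>

locale lift_map =
  fixes f fi :: "real \<times> real \<Rightarrow> real \<times> real"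
  assumes hom: "homeomorphism UNIV UNIV f fi"
    and comm: "f (x + zv v) = f x + zv v"
begin

lemma f_fi [simp]: "f (fi x) = x" and fi_f [simp]: "fi (f x) = x"
  by (rule homeomorphism_apply2[OF hom] homeomorphism_apply1[OF hom]; simp)+

lemma cont: "continuous_on UNIV f" and conti: "continuous_on UNIV fi"
  by (rule homeomorphism_cont1[OF hom] homeomorphism_cont2[OF hom])+

lemma f_eq_iff [simp]: "f x = f y \<longleftrightarrow> x = y"
  by (metis fi_f)

lemma image_eq_vimage: "f ` A = fi -` A"
proof (intro equalityI subsetI)
  fix x assume "x \<in> fi -` A"
  then have "f (fi x) \<in> f ` A" by blast
  then show "x \<in> f ` A" by simp
qed auto

lemma open_image: "open A \<Longrightarrow> open (f ` A)"
  unfolding image_eq_vimage by (rule open_vimage[OF _ conti])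

lemma closed_image: "closed A \<Longrightarrow> closed (f ` A)"
  unfolding image_eq_vimage by (rule closed_vimage[OF _ conti])

lemma connected_image: "connected A \<Longrightarrow> connected (f ` A)"
  by (rule connected_continuous_image[OF continuous_on_subset[OF cont]]) auto

lemma fi_comm: "fi (x + zv v) = fi x + zv v"
  by (metis comm f_fi fi_f)

lemma inverse: "lift_map fi f"
  by unfold_locales (use hom fi_comm in \<open>auto simp: homeomorphism_symD\<close>)

lemma funpow_comm: "(f ^^ n) (x + zv v) = (f ^^ n) x + zv v"
  by (induction n arbitrary: x) (auto simp: comm)

lemma funpow: "lift_map (f ^^ n) (fi ^^ n)"
proof
  show "homeomorphism UNIV UNIV (f ^^ n) (fi ^^ n)"
  proof (induction n)
    case 0
    then show ?case by (auto simp: homeomorphism_def)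
  next
    case (Suc n)
    show ?case
      using homeomorphism_compose[OF Suc hom] unfolding funpow.simps(2)[of n f] funpow_Suc_right[of n fi] .
  qed
qed (rule funpow_comm)

lemma translate: "lift_map (\<lambda>x. f x + zv w) (\<lambda>x. fi (x - zv w))"
proof
  show "homeomorphism UNIV UNIV (\<lambda>x. f x + zv w) (\<lambda>x. fi (x - zv w))"
    unfolding homeomorphism_def
  proof (intro conjI ballI)
    show "continuous_on UNIV (\<lambda>x. f x + zv w)" by (intro continuous_intros cont)
    show "continuous_on UNIV (\<lambda>x. fi (x - zv w))" by (intro continuous_on_compose2[OF conti] continuous_intros) auto
    show "range (\<lambda>x. f x + zv w) = UNIV" by (rule surjI[of _ "\<lambda>x. fi (x - zv w)"]) simp
    show "range (\<lambda>x. fi (x - zv w)) = UNIV" by (rule surjI[of _ "\<lambda>x. f x + zv w"]) simp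
  qed auto
qed (simp add: comm algebra_simps)

lemma bounded_displacement: obtains B where "B \<ge> 0" "\<And>x. dist (f x) x \<le> B"
proof -
  obtain z where z: "\<And>x. dist (f x) x \<le> dist (f z) z"
    by (rule periodic_attains_sup[of "\<lambda>x. dist (f x) x"]) (auto intro!: continuous_intros cont simp: comm)
  then show ?thesis by (rule that[rotated]) simp
qed

lemma uniformly_continuous:
  assumes "e > 0"
  obtains d where "d > 0" "\<And>x y :: real \<times> real. dist x y < d \<Longrightarrow> dist (f x) (f y) < e"
proof -
  \<comment> \<open>A lattice translation brings \<open>x\<close> into the unit square; a point at
    distance below 1 from it then lies in this larger square, which explains the minimum with 1
    below.\<close>
  have "uniformly_continuous_on ({-1..2} \<times> {-1..2}) f"
    by (intro compact_uniformly_continuous compact_Times continuous_on_subset[OF cont]) auto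
  then obtain d where d: "d > 0" "\<And>x y. x \<in> {-1..2} \<times> {-1..2} \<Longrightarrow> y \<in> {-1..2} \<times> {-1..2} \<Longrightarrow> dist x y < d \<Longrightarrow> dist (f x) (f y) < e"
    using assms unfolding uniformly_continuous_on_def by (metis dist_commute)
  show ?thesis
  proof (rule that[of "min d 1"])
    fix x y :: "real \<times> real" assume xy: "dist x y < min d 1"
    obtain x' v where x': "x' \<in> {0..1} \<times> {0..1}" "x = x' + zv v" by (rule unit_square_representative)
    define y' where "y' = y - zv v"
    have dxy: "dist x' y' = dist x y" by (simp add: x' y'_def dist_norm algebra_simps)
    have "\<bar>fst x' - fst y'\<bar> < 1" "\<bar>snd x' - snd y'\<bar> < 1"
      using dist_fst_le[of x' y'] dist_snd_le[of x' y'] xy dxy by (auto simp: dist_real_def)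
    then have "y' \<in> {-1..2} \<times> {-1..2}" "x' \<in> {-1..2} \<times> {-1..2}" using x' by (auto simp: mem_Times_iff)
    then have "dist (f x') (f y') < e" using d(2) xy dxy by auto
    moreover have "f x = f x' + zv v" "f y = f y' + zv v" using comm[of x' v] comm[of y' v] by (auto simp: x' y'_def)
    ultimately show "dist (f x) (f y) < e" by simp
  qed (use d in auto)
qed

end

section \<open>Brouwer theory without the plane translation theorem\<close>

text \<open>The difference is a continuous logarithm of the constant \<open>c\<close>. Its possible
  values are 2\<pi> apart, so it is constant on a connected set. Comparing this constant at two
  points replaces all computation of winding numbers below.\<close>

lemma exp_eq_continuous_diff_constant:
  fixes h1 h2 :: "'a::topological_space \<Rightarrow> complex"
  assumes S: "connected S" and h1: "continuous_on S h1" and h2: "continuous_on S h2"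
    and c: "\<And>x. x \<in> S \<Longrightarrow> exp (h1 x) = c * exp (h2 x)"
    and x: "x \<in> S" and y: "y \<in> S"
  shows "h1 x - h2 x = h1 y - h2 y"
proof -
  define k where "k = (\<lambda>x. h1 x - h2 x)"
  have ek: "exp (k x) = c" if "x \<in> S" for x
    using c[OF that] by (simp add: k_def exp_diff)
  have "k constant_on S"
  proof (rule continuous_discrete_range_constant[OF S])
    show "continuous_on S k" unfolding k_def by (intro continuous_intros h1 h2)
    fix x assume x: "x \<in> S"
    show "\<exists>e>0. \<forall>y. y \<in> S \<and> k y \<noteq> k x \<longrightarrow> e \<le> norm (k y - k x)"
    proof (intro exI conjI allI impI)
      show "0 < 2 * pi" by simp
      fix y assume y: "y \<in> S \<and> k y \<noteq> k x"
      then have "exp (k y) = exp (k x)" using ek x by simp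
      then obtain n :: int where n: "k y = k x + (of_int (2 * n) * pi) * \<i>"
        using exp_eq by metis
      with y have "n \<noteq> 0" by auto
      then have "\<bar>real_of_int n\<bar> \<ge> 1" by linarith
      then have "\<bar>real_of_int n\<bar> * (2 * pi) \<ge> 1 * (2 * pi)"
        by (intro mult_right_mono) auto
      moreover have "norm (k y - k x) = \<bar>real_of_int n\<bar> * (2 * pi)"
        using n by (simp add: norm_mult)
      ultimately show "2 * pi \<le> norm (k y - k x)" by simp
    qed
  qed
  then show ?thesis using x y unfolding constant_on_def k_def by metis
qed

text \<open>A shear carries the product of the punctured plane with the plane onto this set.\<close>

lemma connected_off_diagonal: "connected {(z, y). z \<noteq> (y::complex)}"
proof -
  have "connected ((-{0::complex}) \<times> (UNIV::complex set))"
    by (intro connected_Times connected_punctured_universe) auto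
  then have "connected ((\<lambda>(u, y). (y + u, y)) ` ((-{0::complex}) \<times> (UNIV::complex set)))"
    by (rule connected_continuous_image[rotated]) (auto intro!: continuous_intros simp: case_prod_unfold)
  moreover have "(\<lambda>(u, y). (y + u, y)) ` ((-{0::complex}) \<times> (UNIV::complex set)) = {(z, y). z \<noteq> y}"
  proof (intro equalityI subsetI)
    fix p assume "p \<in> {(z, y). z \<noteq> (y::complex)}"
    then have "p = (\<lambda>(u, y). (y + u, y)) (fst p - snd p, snd p)" "(fst p - snd p, snd p) \<in> (-{0}) \<times> UNIV"
      by auto
    then show "p \<in> (\<lambda>(u, y). (y + u, y)) ` ((-{0::complex}) \<times> (UNIV::complex set))" by blast
  qed auto
  ultimately show ?thesis by simp
qed

text \<open>This is the increment of \<open>k\<close> over the chord from \<open>y\<close> stretched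
  by 1/(1 - t), divided by the stretched chord. The increment stays below 2 \<open>B\<close> while
  the chord grows without bound, so the quotient tends to 0, the value that the factor 1 - t gives
  at t = 1.\<close>

lemma tendsto_difference_quotient_at_infinity_aux:
  fixes k :: "complex \<Rightarrow> complex"
  assumes k: "continuous_on UNIV k" and B: "\<And>z. norm (k z) \<le> B"
  shows "continuous_on ({0..1::real} \<times> {(z, y). z \<noteq> y})
    (\<lambda>(t, z, y). of_real (1 - t) * (k (y + (z - y) / of_real (1 - t)) - k y) / (z - y))"
    (is "continuous_on ?D ?H")
  unfolding continuous_on_eq_continuous_within
proof
  fix p :: "real \<times> complex \<times> complex" assume "p \<in> ?D"
  then obtain t z y where p: "p = (t, z, y)" and t: "0 \<le> t" "t \<le> 1" and zy: "z \<noteq> y" by auto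
  have kc: "isCont k w" for w using k by (simp add: continuous_on_eq_continuous_at)
  show "continuous (at p within ?D) ?H"
  proof (cases "t = 1")
    case False
    define w where "w = (\<lambda>p::real \<times> complex \<times> complex. snd (snd p) + (fst (snd p) - snd (snd p)) / of_real (1 - fst p))"
    have "isCont w (t, z, y)"
      unfolding w_def using False by (intro continuous_intros) auto
    then have kw: "isCont (\<lambda>p. k (w p)) (t, z, y)"
      by (rule isCont_o2[OF _ kc])
    have ky: "isCont (\<lambda>p::real \<times> complex \<times> complex. k (snd (snd p))) (t, z, y)"
      by (rule isCont_o2[OF _ kc]) (intro continuous_intros)
    have "isCont (\<lambda>p. of_real (1 - fst p) * (k (w p) - k (snd (snd p))) / (fst (snd p) - snd (snd p))) (t, z, y)"
    proof (rule continuous_divide[OF continuous_mult[OF _ continuous_diff[OF kw ky]]])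
      show "isCont (\<lambda>p::real \<times> complex \<times> complex. complex_of_real (1 - fst p)) (t, z, y)"
        "isCont (\<lambda>p::real \<times> complex \<times> complex. fst (snd p) - snd (snd p)) (t, z, y)"
        by (intro continuous_intros)+
    qed (use zy in auto)
    note this[unfolded w_def]
    then show ?thesis
      unfolding p case_prod_unfold by (rule continuous_at_imp_continuous_within)
  next
    case True
    have "B \<ge> 0" using B[of 0] norm_ge_zero order_trans by blast
    have "((\<lambda>p. (1 - fst p) * (2 * B) / norm (fst (snd p) - snd (snd p))) \<longlongrightarrow> (1 - t) * (2 * B) / norm (z - y)) (at (t, z, y) within ?D)"
      using zy by (intro tendsto_intros tendsto_eq_intros | simp)+
    then have l: "((\<lambda>p. (1 - fst p) * (2 * B) / norm (fst (snd p) - snd (snd p))) \<longlongrightarrow> 0) (at (t, z, y) within ?D)"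
      using True by simp
    have "(?H \<longlongrightarrow> 0) (at (t, z, y) within ?D)"
    proof (rule Lim_null_comparison[OF _ l])
      have "norm (?H p) \<le> (1 - fst p) * (2 * B) / norm (fst (snd p) - snd (snd p))" if "p \<in> ?D" for p
      proof -
        obtain s a b where p: "p = (s, a, b)" by (metis prod.exhaust)
        have s: "0 \<le> s" "s \<le> 1" using that p by auto
        have "norm (k (b + (a - b) / of_real (1 - s)) - k b) \<le> 2 * B"
          using norm_triangle_ineq4[of "k (b + (a - b) / of_real (1 - s))" "k b"] B[of b] B[of "b + (a - b) / of_real (1 - s)"]
          by linarith
        then have "(1 - s) * norm (k (b + (a - b) / of_real (1 - s)) - k b) / norm (a - b) \<le> (1 - s) * (2 * B) / norm (a - b)"
          using s by (intro divide_right_mono mult_left_mono) auto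
        moreover have "norm (of_real (1 - s) :: complex) = 1 - s"
          using s by (metis abs_of_nonneg diff_ge_0_iff_ge norm_of_real)
        ultimately show ?thesis unfolding p using s
          by (simp only: norm_divide norm_mult prod.case fst_conv snd_conv)
      qed
      then show "\<forall>\<^sub>F p in at (t, z, y) within ?D. norm (?H p) \<le> (1 - fst p) * (2 * B) / norm (fst (snd p) - snd (snd p))"
        by (simp add: eventually_at_filter)
    qed
    then show ?thesis using True by (simp add: p continuous_within)
  qed
qed

text \<open>Moving \<open>z\<close> away from \<open>y\<close> to infinity along a ray deforms the
  difference quotient to the constant 1, because the displacement of \<open>g\<close> is bounded;
  injectivity keeps it away from 0 on the way. An inessential map into the punctured plane has a
  logarithm. The constant by which this logarithm and its flip differ changes sign under the flip,
  so it is 0.\<close>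

lemma exists_log_difference_quotient:
  fixes g :: "complex \<Rightarrow> complex"
  assumes g: "continuous_on UNIV g" and inj: "inj g" and B: "\<And>z. norm (g z - z) \<le> B"
  obtains L where "continuous_on {(z, y). z \<noteq> y} (\<lambda>(z, y). L z y)"
    "\<And>z y. z \<noteq> y \<Longrightarrow> (g z - g y) / (z - y) = exp (L z y)"
    "\<And>z y. z \<noteq> y \<Longrightarrow> L z y = L y z"
proof -
  define k where "k = (\<lambda>z. g z - z)"
  define S where "S = {(z, y). z \<noteq> (y::complex)}"
  define H where "H = (\<lambda>(t::real, z, y). 1 + of_real (1 - t) * (k (y + (z - y) / of_real (1 - t)) - k y) / (z - y))"
  have kc: "continuous_on UNIV k" unfolding k_def by (intro continuous_intros g)
  have cH: "continuous_on ({0..1} \<times> S) H"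
    using continuous_on_add[OF continuous_on_const tendsto_difference_quotient_at_infinity_aux[OF kc, of B], of 1] B
    unfolding H_def S_def by (simp add: case_prod_unfold k_def)
  have quot: "1 + (k z - k y) / (z - y) = (g z - g y) / (z - y)" if "z \<noteq> y" for z y
    using that by (simp add: k_def field_simps)
  have nz: "H (t, z, y) \<noteq> 0" if "t \<in> {0..1}" "z \<noteq> y" for t z y
  proof (cases "t = 1")
    case False
    define u where "u = (z - y) / of_real (1 - t)"
    have u: "u \<noteq> 0" "z - y = of_real (1 - t) * u" using that False by (auto simp: u_def)
    have "of_real (1 - t) \<noteq> (0::complex)" using False by simp
    then have "H (t, z, y) = 1 + (k (y + u) - k y) / u"
      unfolding H_def prod.case u_def[symmetric] u(2) by simp
    also have "\<dots> = (g (y + u) - g y) / u"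
      using quot[of "y + u" y] u by simp
    finally show ?thesis using u inj by (simp add: inj_eq)
  qed (simp add: H_def)
  have "homotopic_with_canon (\<lambda>h. True) S (-{0}) (\<lambda>p. H (0, p)) (\<lambda>p. 1)"
    unfolding homotopic_with_def
  proof (intro exI conjI ballI allI)
    show "continuous_map (prod_topology (top_of_set {0..1}) (top_of_set S)) (top_of_set (-{0})) (\<lambda>(t, z, y). H (t, z, y))"
      using cH nz by (auto simp: continuous_map_in_subtopology S_def case_prod_unfold simp flip: subtopology_Times)
  qed (auto simp: H_def case_prod_unfold)
  then obtain l where l1: "continuous_on S l" "\<And>p. p \<in> S \<Longrightarrow> H (0, p) = exp (l p)"
    using inessential_eq_continuous_logarithm[of S "\<lambda>p. H (0, p)"] by blast
  have l: "continuous_on S l" "\<And>p. p \<in> S \<Longrightarrow> (g (fst p) - g (snd p)) / (fst p - snd p) = exp (l p)"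
    using l1 quot by (auto simp: H_def S_def)
  have conS: "connected S" unfolding S_def by (rule connected_off_diagonal)
  define l' where "l' = (\<lambda>p. l (snd p, fst p))"
  have l'c: "continuous_on S l'"
    unfolding l'_def by (rule continuous_on_compose2[OF l(1)]) (auto intro!: continuous_intros simp: S_def)
  have sym: "l (z, y) = l (y, z)" if zy: "z \<noteq> y" for z y
  proof -
    have "l (z, y) - l' (z, y) = l (y, z) - l' (y, z)"
    proof (rule exp_eq_continuous_diff_constant[OF conS l(1) l'c, of 1])
      fix p assume p: "p \<in> S"
      then have "(snd p, fst p) \<in> S" by (auto simp: S_def)
      then have "exp (l' p) = (g (snd p) - g (fst p)) / (snd p - fst p)"
        using l(2)[of "(snd p, fst p)"] by (simp add: l'_def)
      also have "\<dots> = exp (l p)"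
        using l(2)[OF p] by (metis minus_diff_eq minus_divide_divide)
      finally show "exp (l p) = 1 * exp (l' p)" by simp
    qed (use zy in \<open>auto simp: S_def\<close>)
    then show ?thesis by (simp add: l'_def)
  qed
  show ?thesis
  proof (rule that[of "\<lambda>z y. l (z, y)"])
    show "continuous_on {(z, y). z \<noteq> y} (\<lambda>(z, y). l (z, y))"
      using l(1) by (simp add: S_def case_prod_unfold)
    show "(g z - g y) / (z - y) = exp (l (z, y))" if "z \<noteq> y" for z y
      using l(2)[of "(z, y)"] that by (simp add: S_def)
  qed (use sym in auto)
qed

text \<open>
  A self-crossing of the curve is excluded by the rotation of its chords, as in Hopf's
  Umlaufsatz: a logarithm of the chord $\<beta>(b) - \<beta>(a)$ on the triangle $a < b$, compared along
  $b = a + 1$ with a logarithm of the displacement $g - id$, would have a jump at the crossing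
  that is both zero and an odd multiple of $\<pi>$.
\<close>

lemma no_fixed_point_imp_no_self_crossing:
  fixes g :: "complex \<Rightarrow> complex" and \<beta> :: "real \<Rightarrow> complex"
  assumes g: "continuous_on UNIV g" and inj: "inj g" and B: "\<And>z. norm (g z - z) \<le> B"
    and nofix: "\<And>z. g z \<noteq> z"
    and \<beta>: "continuous_on {0..T} \<beta>" and shift: "\<And>u. 0 \<le> u \<Longrightarrow> u + 1 \<le> T \<Longrightarrow> g (\<beta> u) = \<beta> (u + 1)"
    and inj\<beta>: "inj_on \<beta> {0..<T}" and ret: "\<beta> T = \<beta> t" and t: "0 \<le> t" "t < T - 1" and T: "2 \<le> T"
  shows False
proof -
  obtain L where L: "continuous_on {(z, y). z \<noteq> y} (\<lambda>(z, y). L z y)"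
    "\<And>z y. z \<noteq> y \<Longrightarrow> (g z - g y) / (z - y) = exp (L z y)"
    "\<And>z y. z \<noteq> y \<Longrightarrow> L z y = L y z"
    using exists_log_difference_quotient[OF g inj B] by metis
  have L2: "g z - g y = exp (L z y) * (z - y)" if "z \<noteq> y" for z y
    using L(2)[OF that] that by (simp add: field_simps)
  obtain \<theta> where \<theta>: "continuous_on UNIV \<theta>" "\<And>z. g z - z = exp (\<theta> z)"
  proof (rule continuous_logarithm_on_contractible[of UNIV "\<lambda>z. g z - z"])
    show "continuous_on UNIV (\<lambda>z. g z - z)" by (intro continuous_intros g)
  qed (use nofix in auto)
  define D where "D = {(a, b). 0 \<le> a \<and> a < b \<and> (b < T \<or> b = T \<and> t < a)}"
  have convD: "convex D"
    unfolding convex_alt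
  proof clarify
    fix a b a' b' u :: real
    assume *: "(a, b) \<in> D" "(a', b') \<in> D" "0 \<le> u" "u \<le> 1"
    let ?a = "(1 - u) * a + u * a'" and ?b = "(1 - u) * b + u * b'"
    have 1: "0 \<le> ?a" using * by (auto simp: D_def)
    have 2: "?a < ?b"
    proof (cases "u = 0")
      case False
      then have "u * a' < u * b'" "(1 - u) * a \<le> (1 - u) * b" using * by (auto simp: D_def intro: mult_left_mono)
      then show ?thesis by linarith
    qed (use * in \<open>auto simp: D_def\<close>)
    have 3: "?b < T \<or> ?b = T \<and> t < ?a"
    proof (cases "u = 0 \<or> u = 1")
      case False
      then have u: "0 < u" "u < 1" using * by auto
      have bT: "b \<le> T" "b' \<le> T" using * by (auto simp: D_def)
      show ?thesis
      proof (cases "b = T \<and> b' = T")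
        case True
        then have "t < a" "t < a'" using * by (auto simp: D_def)
        then have "(1 - u) * t < (1 - u) * a" "u * t < u * a'" using u by auto
        then have "t < ?a" by (simp add: algebra_simps)
        then show ?thesis using True by (simp add: algebra_simps)
      next
        case False
        then have "(1 - u) * b + u * b' < (1 - u) * T + u * T"
          using bT u by (smt (verit) mult_left_mono mult_strict_left_mono)
        then show ?thesis by (simp add: algebra_simps)
      qed
    qed (use * in \<open>auto simp: D_def\<close>)
    show "(1 - u) *\<^sub>R (a, b) + u *\<^sub>R (a', b') \<in> D"
      using 1 2 3 by (simp add: D_def)
  qed
  have neq: "\<beta> b \<noteq> \<beta> a" if "(a, b) \<in> D" for a b
  proof (cases "b < T")
    case True
    then have "a \<in> {0..<T}" "b \<in> {0..<T}" "a < b" using that by (auto simp: D_def)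
    then show ?thesis using inj_onD[OF inj\<beta>, of b a] by auto
  next
    case False
    then have "b = T" "t < a" "a < T" using that by (auto simp: D_def)
    then show ?thesis using ret inj_onD[OF inj\<beta>, of t a] t by auto
  qed
  have D_dom: "a \<in> {0..T} \<and> b \<in> {0..T}" if "(a, b) \<in> D" for a b
    using that by (auto simp: D_def)
  have cfst: "continuous_on D (\<lambda>p. \<beta> (fst p))" and csnd: "continuous_on D (\<lambda>p. \<beta> (snd p))"
    by (auto intro!: continuous_on_compose2[OF \<beta>] continuous_intros) (use D_dom in auto)
  obtain \<Theta>' where \<Theta>': "continuous_on D \<Theta>'" "\<And>p. p \<in> D \<Longrightarrow> \<beta> (snd p) - \<beta> (fst p) = exp (\<Theta>' p)"
    using continuous_logarithm_on_contractible[of D "\<lambda>p. \<beta> (snd p) - \<beta> (fst p)"] neq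
      convex_imp_contractible[OF convD] continuous_on_diff[OF csnd cfst] by auto
  define \<Theta> where "\<Theta> = (\<lambda>a b. \<Theta>' (a, b))"
  have \<Theta>: "\<beta> b - \<beta> a = exp (\<Theta> a b)" if "(a, b) \<in> D" for a b
    using \<Theta>'(2)[OF that] by (simp add: \<Theta>_def)
  have i: "\<Theta> u (u + 1) - \<theta> (\<beta> u) = \<Theta> 0 1 - \<theta> (\<beta> 0)" if u: "u \<in> {0..T-1}" for u
  proof -
    have inD: "(v, v + 1) \<in> D" if "v \<in> {0..T-1}" for v
      using that t T by (auto simp: D_def)
    have "\<Theta> u (u + 1) - \<theta> (\<beta> u) = \<Theta> 0 (0 + 1) - \<theta> (\<beta> 0)"
    proof (rule exp_eq_continuous_diff_constant[where S = "{0..T-1}" and c = 1 and ?h1.0 = "\<lambda>u. \<Theta> u (u + 1)" and ?h2.0 = "\<lambda>u. \<theta> (\<beta> u)"])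
      show "continuous_on {0..T-1} (\<lambda>u. \<Theta> u (u + 1))"
        unfolding \<Theta>_def by (intro continuous_on_compose2[OF \<Theta>'(1)] continuous_intros) (use inD in auto)
      show "continuous_on {0..T-1} (\<lambda>u. \<theta> (\<beta> u))"
        by (intro continuous_on_compose2[OF \<theta>(1)] continuous_on_subset[OF \<beta>]) auto
      show "exp (\<Theta> v (v + 1)) = 1 * exp (\<theta> (\<beta> v))" if "v \<in> {0..T-1}" for v
        using \<Theta>[OF inD[OF that]] \<theta>(2)[of "\<beta> v"] shift[of v] that by simp
    qed (use u T in auto)
    then show ?thesis by simp
  qed
  \<comment> \<open>The pairs whose shift by 1 in both coordinates stays in \<open>D\<close>. On
    them \<open>g\<close> maps the chord of (a, b) to the chord of (a + 1, b + 1).\<close>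
  define D0 where "D0 = {(a, b). 0 \<le> a \<and> a < b \<and> (b < T - 1 \<or> b = T - 1 \<and> t - 1 < a)}"
  have convD0: "convex D0"
    unfolding convex_alt
  proof clarify
    fix a b a' b' u :: real
    assume *: "(a, b) \<in> D0" "(a', b') \<in> D0" "0 \<le> u" "u \<le> 1"
    let ?a = "(1 - u) * a + u * a'" and ?b = "(1 - u) * b + u * b'"
    have "(1 - u) *\<^sub>R (a + 1, b + 1) + u *\<^sub>R (a' + 1, b' + 1) \<in> D"
      using * by (intro convexD_alt[OF convD]) (auto simp: D0_def D_def)
    then have "(?a + 1, ?b + 1) \<in> D" by (simp add: algebra_simps)
    moreover have "0 \<le> ?a" using * by (auto simp: D0_def)
    ultimately show "(1 - u) *\<^sub>R (a, b) + u *\<^sub>R (a', b') \<in> D0" by (auto simp: D0_def D_def)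
  qed
  have D0_D: "(a, b) \<in> D" "(a + 1, b + 1) \<in> D" if "(a, b) \<in> D0" for a b
    using that by (auto simp: D_def D0_def)
  have ii: "\<Theta> (a + 1) (b + 1) - (\<Theta> a b + L (\<beta> b) (\<beta> a)) = \<Theta> (a' + 1) (b' + 1) - (\<Theta> a' b' + L (\<beta> b') (\<beta> a'))"
    if ab: "(a, b) \<in> D0" "(a', b') \<in> D0" for a b a' b'
  proof -
    have "(\<lambda>p. \<Theta>' (fst p + 1, snd p + 1)) (a, b) - (\<lambda>p. \<Theta>' p + L (\<beta> (snd p)) (\<beta> (fst p))) (a, b)
        = (\<lambda>p. \<Theta>' (fst p + 1, snd p + 1)) (a', b') - (\<lambda>p. \<Theta>' p + L (\<beta> (snd p)) (\<beta> (fst p))) (a', b')"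
    proof (rule exp_eq_continuous_diff_constant[where S = D0 and c = 1])
      show "connected D0" using convD0 by (rule convex_connected)
      show "continuous_on D0 (\<lambda>p. \<Theta>' (fst p + 1, snd p + 1))"
        by (intro continuous_on_compose2[OF \<Theta>'(1)] continuous_intros) (use D0_D in auto)
      have "continuous_on D0 (\<lambda>p. (\<lambda>(z, y). L z y) (\<beta> (snd p), \<beta> (fst p)))"
      proof (rule continuous_on_compose2[OF L(1)])
        show "continuous_on D0 (\<lambda>p. (\<beta> (snd p), \<beta> (fst p)))"
          by (intro continuous_on_Pair continuous_on_subset[OF csnd] continuous_on_subset[OF cfst]) (use D0_D in auto)
      qed (use neq D0_D in force)
      then show "continuous_on D0 (\<lambda>p. \<Theta>' p + L (\<beta> (snd p)) (\<beta> (fst p)))"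
        by (intro continuous_on_add continuous_on_subset[OF \<Theta>'(1)]) (use D0_D in auto)
      fix p assume p: "p \<in> D0"
      obtain a b where pab: "p = (a, b)" by fastforce
      note d = D0_D[OF p[unfolded pab]]
      have dom: "0 \<le> a" "0 \<le> b" "a + 1 \<le> T" "b + 1 \<le> T" using p pab by (auto simp: D0_def)
      have "exp (\<Theta> (a + 1) (b + 1)) = g (\<beta> b) - g (\<beta> a)"
        using \<Theta>[OF d(2)] shift dom by simp
      also have "\<dots> = exp (L (\<beta> b) (\<beta> a)) * exp (\<Theta> a b)"
        using L2[OF neq[OF d(1)]] \<Theta>[OF d(1)] by simp
      finally show "exp (\<Theta>' (fst p + 1, snd p + 1)) = 1 * exp (\<Theta>' p + L (\<beta> (snd p)) (\<beta> (fst p)))"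
        by (simp add: pab \<Theta>_def exp_add mult.commute)
    qed (use ab in auto)
    then show ?thesis by (simp add: \<Theta>_def)
  qed
  \<comment> \<open>Since \<beta>(T) = \<beta>(t), the chords from \<open>a\<close> to
    \<open>T\<close> and from \<open>t\<close> to \<open>a\<close> are opposite vectors; their
    logarithms differ by one and the same odd multiple of \<pi> i, called \<kappa> below.\<close>
  have iii: "\<Theta> a T - \<Theta> t a = \<Theta> (t + 1) T - \<Theta> t (t + 1)" if a: "a \<in> {t<..<T}" for a
  proof -
    have inD: "(v, T) \<in> D" "(t, v) \<in> D" if "v \<in> {t<..<T}" for v
      using that t T by (auto simp: D_def)
    show ?thesis
    proof (rule exp_eq_continuous_diff_constant[where S = "{t<..<T}" and c = "-1" and ?h1.0 = "\<lambda>u. \<Theta> u T" and ?h2.0 = "\<lambda>u. \<Theta> t u"])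
      show "continuous_on {t<..<T} (\<lambda>u. \<Theta> u T)" "continuous_on {t<..<T} (\<lambda>u. \<Theta> t u)"
        unfolding \<Theta>_def by (intro continuous_on_compose2[OF \<Theta>'(1)] continuous_intros; use inD in auto)+
      show "exp (\<Theta> v T) = - 1 * exp (\<Theta> t v)" if "v \<in> {t<..<T}" for v
        by (simp add: \<Theta>[OF inD(1)[OF that], symmetric] \<Theta>[OF inD(2)[OF that], symmetric] ret)
    qed (use a t in auto)
  qed
  define \<kappa> where "\<kappa> = \<Theta> (t + 1) T - \<Theta> t (t + 1)"
  have e\<kappa>: "exp \<kappa> = -1"
  proof -
    have d: "(t + 1, T) \<in> D" "(t, t + 1) \<in> D" using t T by (auto simp: D_def)
    have "exp (\<Theta> (t + 1) T) = - exp (\<Theta> t (t + 1))"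
      by (simp add: \<Theta>[OF d(1), symmetric] \<Theta>[OF d(2), symmetric] ret)
    then show ?thesis unfolding \<kappa>_def exp_diff by simp
  qed
  \<comment> \<open>The displacement at \<open>g z\<close> is the displacement at \<open>z\<close>
    times the difference quotient of \<open>g\<close> at the pair (g z, z), so the defect of the
    logarithms is a single constant on the plane.\<close>
  have \<theta>C: "\<theta> (g z) - (\<theta> z + L (g z) z) = \<theta> (g y) - (\<theta> y + L (g y) y)" for z y
  proof (rule exp_eq_continuous_diff_constant[where S = UNIV and c = 1 and ?h1.0 = "\<lambda>z. \<theta> (g z)" and ?h2.0 = "\<lambda>z. \<theta> z + L (g z) z"])
    show "continuous_on UNIV (\<lambda>z. \<theta> (g z))"
      by (intro continuous_on_compose2[OF \<theta>(1)] g) auto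
    have "continuous_on UNIV (\<lambda>p. (\<lambda>(z, y). L z y) (g p, p))"
      by (rule continuous_on_compose2[OF L(1)]) (use nofix g in \<open>auto intro!: continuous_intros\<close>)
    then show "continuous_on UNIV (\<lambda>z. \<theta> z + L (g z) z)"
      by (intro continuous_on_add \<theta>(1)) auto
    show "exp (\<theta> (g z)) = 1 * exp (\<theta> z + L (g z) z)" for z
      using \<theta>(2)[of "g z"] \<theta>(2)[of z] L2[OF nofix, of z] by (simp add: exp_add mult.commute)
  qed auto
  have g0: "g (\<beta> 0) = \<beta> 1" using shift[of 0] T by simp
  have gT: "g (\<beta> (T - 1)) = \<beta> T" using shift[of "T - 1"] T by simp
  have "\<Theta> 1 2 - (\<Theta> 0 1 + L (\<beta> 1) (\<beta> 0)) = \<Theta> (t + 1) T - (\<Theta> t (T - 1) + L (\<beta> (T - 1)) (\<beta> t))"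
  proof -
    have "2 < T \<or> T = 2 \<and> t < 1" using t T by linarith
    then show ?thesis using ii[of 0 1 t "T - 1"] t T by (auto simp: D0_def)
  qed
  moreover have "\<theta> (\<beta> 1) - (\<theta> (\<beta> 0) + L (\<beta> 1) (\<beta> 0)) = \<theta> (\<beta> t) - (\<theta> (\<beta> (T - 1)) + L (\<beta> t) (\<beta> (T - 1)))"
    using \<theta>C[of "\<beta> 0" "\<beta> (T - 1)"] g0 gT ret by simp
  moreover have "\<Theta> 1 2 - \<theta> (\<beta> 1) = \<Theta> 0 1 - \<theta> (\<beta> 0)" using i[of 1] T by simp
  moreover have "\<Theta> t (t + 1) - \<theta> (\<beta> t) = \<Theta> (T - 1) T - \<theta> (\<beta> (T - 1))"
    using i[of t] i[of "T - 1"] t T by simp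
  moreover have "L (\<beta> t) (\<beta> (T - 1)) = L (\<beta> (T - 1)) (\<beta> t)"
    by (rule L(3)) (use neq[of t "T - 1"] t in \<open>auto simp: D_def\<close>)
  moreover have "\<Theta> (T - 1) T - \<Theta> t (T - 1) = \<kappa>" using iii[of "T - 1"] t T by (simp add: \<kappa>_def)
  \<comment> \<open>Subtracting the displacement identity from the chord identity cancels all values
    of \<open>L\<close> and leaves the jump twice, once at a = t + 1 and once at a = T - 1. But exp
    \<kappa> = -1.\<close>
  ultimately have "2 * \<kappa> = 0"
    unfolding \<kappa>_def by algebra
  then show False using e\<kappa> by simp
qed

section \<open>Periodic points, translation arcs and closed chains\<close>

lemma continuous_less_nearby:
  fixes h :: "real \<Rightarrow> real"
  assumes "continuous_on UNIV h" "h 0 < r"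
  obtains s where "0 < s" "s < 1" "h s < r"
proof -
  have "(h \<longlongrightarrow> h 0) (at 0)"
    using assms(1) by (simp add: continuous_on_eq_continuous_at isCont_def)
  then have "\<forall>\<^sub>F s in at 0. h s < r" using assms(2) by (rule order_tendstoD)
  then obtain d where d: "d > 0" "\<And>s. s \<noteq> 0 \<Longrightarrow> dist s 0 < d \<Longrightarrow> h s < r"
    unfolding eventually_at by auto
  show ?thesis
    by (rule that[of "min (d/2) (1/2)"]) (use d in auto)
qed

text \<open>A smallest disc about the periodic point \<open>x0\<close> that contains some point
  together with its image has both on its boundary, so two radii form a translation arc through
  \<open>x0\<close>. The successive images of this arc form a half line, and periodicity of
  \<open>x0\<close> makes it meet itself. Stopped at the earliest possible time, it is a curve of
  the kind excluded by \<open>no_fixed_point_imp_no_self_crossing\<close>.\<close>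

lemma brouwer_no_periodic_point:
  fixes g :: "complex \<Rightarrow> complex"
  assumes hom: "homeomorphism UNIV UNIV g gi" and B: "\<And>z. norm (g z - z) \<le> B"
    and nofix: "\<And>z. g z \<noteq> z"
    and n: "n \<ge> 1" and per: "(g ^^ n) x0 = x0"
  shows False
proof -
  have g: "continuous_on UNIV g" and gi: "continuous_on UNIV gi"
    and ggi: "\<And>z. g (gi z) = z" and gig: "\<And>z. gi (g z) = z"
    using hom by (auto simp: homeomorphism_def)
  have inj: "inj g" using gig by (metis injI)
  have n2: "n \<ge> 2"
  proof (rule ccontr)
    assume "\<not> ?thesis"
    then have "n = 1" using n by simp
    then show False using per nofix by simp
  qed
  define m where "m = (\<lambda>a. max (dist a x0) (dist (g a) x0))"
  have mc: "continuous_on UNIV m"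
    unfolding m_def by (intro continuous_intros g)
  obtain z where z: "\<And>a. m z \<le> m a"
  proof -
    have "\<exists>z\<in>cball x0 (m x0). \<forall>a\<in>cball x0 (m x0). m z \<le> m a"
      by (intro continuous_attains_inf continuous_on_subset[OF mc]) (auto simp: m_def)
    then obtain z where z: "z \<in> cball x0 (m x0)" "\<And>a. a \<in> cball x0 (m x0) \<Longrightarrow> m z \<le> m a" by auto
    show ?thesis
    proof (rule that[of z])
      fix a
      show "m z \<le> m a"
      proof (cases "a \<in> cball x0 (m x0)")
        case False
        then have "m x0 \<le> m a" by (auto simp: m_def dist_commute)
        moreover have "m z \<le> m x0" using z(2)[of x0] by (simp add: m_def)
        ultimately show ?thesis by linarith
      qed (use z in auto)
    qed
  qed
  define r where "r = m z"
  have r0: "r > 0"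
  proof (rule ccontr)
    assume "\<not> ?thesis"
    then have "z = x0" "g z = x0" by (auto simp: r_def m_def max_def split: if_splits)
    then show False using nofix by metis
  qed
  \<comment> \<open>Otherwise moving the image, or the point, slightly towards \<open>x0\<close>
    would bring both distances below the minimum \<open>r\<close>.\<close>
  have bd: "dist a x0 = r \<and> dist (g a) x0 = r" if a: "m a \<le> r" for a
  proof -
    have sc: "dist (x0 + of_real (1 - s) * (b - x0)) x0 = (1 - s) * dist b x0" if "s < 1" for s b
      using that by (simp add: dist_norm norm_mult del: of_real_diff)
    have le: "dist a x0 \<le> r" "dist (g a) x0 \<le> r" using a by (auto simp: m_def)
    have "\<not> dist a x0 < r"
    proof
      assume lt: "dist a x0 < r"
      have "continuous_on UNIV (\<lambda>s. dist (gi (x0 + of_real (1 - s) * (g a - x0))) x0)"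
        by (intro continuous_intros continuous_on_compose2[OF gi]) auto
      then obtain s where s: "0 < s" "s < 1" "dist (gi (x0 + of_real (1 - s) * (g a - x0))) x0 < r"
        by (rule continuous_less_nearby[where r = r]) (use lt gig in auto)
      have "dist (g (gi (x0 + of_real (1 - s) * (g a - x0)))) x0 < r"
        unfolding ggi sc[OF s(2)] using s le r0
        by (smt (verit) mult_left_le_one_le mult_less_cancel_right2 zero_le_dist mult_left_mono)
      then have "m (gi (x0 + of_real (1 - s) * (g a - x0))) < r" using s by (simp add: m_def)
      then show False using z r_def by (metis not_le)
    qed
    moreover have "\<not> dist (g a) x0 < r"
    proof
      assume lt: "dist (g a) x0 < r"
      have "continuous_on UNIV (\<lambda>s. dist (g (x0 + of_real (1 - s) * (a - x0))) x0)"
        by (intro continuous_intros continuous_on_compose2[OF g]) auto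
      then obtain s where s: "0 < s" "s < 1" "dist (g (x0 + of_real (1 - s) * (a - x0))) x0 < r"
        by (rule continuous_less_nearby[where r = r]) (use lt gig in auto)
      have "dist (x0 + of_real (1 - s) * (a - x0)) x0 < r"
        unfolding sc[OF s(2)] using s le r0
        by (smt (verit) mult_left_le_one_le mult_less_cancel_right2 zero_le_dist mult_left_mono)
      then have "m (x0 + of_real (1 - s) * (a - x0)) < r" using s by (simp add: m_def)
      then show False using z r_def by (metis not_le)
    qed
    ultimately show ?thesis using le by auto
  qed
  define y where "y = g z"
  have zy: "dist z x0 = r" "dist y x0 = r" using bd[of z] by (auto simp: r_def y_def)
  have yz: "y \<noteq> z" using nofix by (simp add: y_def)
  \<comment> \<open>The radius from \<open>z\<close> to \<open>x0\<close> followed by the radius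
    from \<open>x0\<close> to \<open>y\<close>; truncation by \<open>max\<close> glues them at s =
    1/2.\<close>
  define \<alpha> where "\<alpha> = (\<lambda>s::real. x0 + of_real (max 0 (1 - 2 * s)) * (z - x0) + of_real (max 0 (2 * s - 1)) * (y - x0))"
  have \<alpha>c: "continuous_on UNIV \<alpha>" unfolding \<alpha>_def by (intro continuous_intros)
  have \<alpha>0: "\<alpha> 0 = z" and \<alpha>1: "\<alpha> 1 = y" and \<alpha>h: "\<alpha> (1/2) = x0" by (auto simp: \<alpha>_def)
  have \<alpha>d: "dist (\<alpha> s) x0 = r * \<bar>1 - 2 * s\<bar>" for s
  proof (cases "s \<le> 1/2")
    case True
    then have "\<alpha> s = x0 + of_real (1 - 2 * s) * (z - x0)" by (simp add: \<alpha>_def max_def)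
    then show ?thesis using zy by (simp add: dist_norm norm_mult del: of_real_diff)
  next
    case False
    then have "\<alpha> s = x0 + of_real (2 * s - 1) * (y - x0)" by (simp add: \<alpha>_def max_def)
    then show ?thesis using zy by (simp add: dist_norm norm_mult abs_minus_commute del: of_real_diff)
  qed
  have \<alpha>inj: "inj_on \<alpha> {0..1}"
  proof (rule inj_onI)
    fix s s' assume *: "s \<in> {0..1}" "s' \<in> {0..1}" "\<alpha> s = \<alpha> s'"
    then have ab: "\<bar>1 - 2 * s\<bar> = \<bar>1 - 2 * s'\<bar>" using \<alpha>d[of s] \<alpha>d[of s'] r0 by simp
    show "s = s'"
    proof (rule ccontr)
      assume ne: "s \<noteq> s'"
      then have s': "s' = 1 - s" "s \<noteq> 1/2" using ab by (auto simp: abs_if split: if_splits)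
      have "False" if "u < 1/2" "\<alpha> u = \<alpha> (1 - u)" for u
      proof -
        have "of_real (1 - 2 * u) * (z - x0) = of_real (1 - 2 * u) * (y - x0)"
          using that by (simp add: \<alpha>_def max_def)
        moreover have "of_real (1 - 2 * u) \<noteq> (0::complex)"
          using that(1) by (metis of_real_eq_0_iff diff_gt_0_iff_gt less_irrefl mult.commute pos_less_divide_eq zero_less_numeral)
        ultimately show False using yz by simp
      qed
      from this[of s] this[of s'] show False using s' * by (cases "s < 1/2") auto
    qed
  qed
  \<comment> \<open>The arc meets its image in end points only: a point of the arc whose image lies
    in the disc is on the boundary circle, and so is its image.\<close>
  have hit: "s \<in> {0, 1}" "s' \<in> {0, 1}" if "s \<in> {0..1}" "s' \<in> {0..1}" "g (\<alpha> s') = \<alpha> s" for s s'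
  proof -
    have "m (\<alpha> s') \<le> r"
      unfolding m_def that(3) \<alpha>d using that r0 by (auto simp: abs_if)
    from bd[OF this] have "r * \<bar>1 - 2 * s'\<bar> = r" "r * \<bar>1 - 2 * s\<bar> = r"
      unfolding that(3) \<alpha>d by auto
    then have "\<bar>1 - 2 * s'\<bar> = 1" "\<bar>1 - 2 * s\<bar> = 1" using r0 by auto
    then show "s \<in> {0, 1}" "s' \<in> {0, 1}" by (auto simp: abs_if split: if_splits)
  qed
  \<comment> \<open>The constant value at negative times makes the curve continuous on the whole
    line.\<close>
  define \<beta> where "\<beta> = (\<lambda>u::real. if u < 0 then z else (g ^^ nat \<lfloor>u\<rfloor>) (\<alpha> (u - of_int \<lfloor>u\<rfloor>)))"
  have gn: "continuous_on UNIV (g ^^ k)" for k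
    by (induction k) (auto intro!: continuous_intros continuous_on_compose2[OF g] simp: o_def)
  have \<beta>c: "continuous_on UNIV \<beta>"
  proof (rule continuous_on_unit_intervals)
    fix k :: int
    show "continuous_on {of_int k..of_int k + 1} \<beta>"
    proof (cases "k < 0")
      case True
      then have "\<beta> u = z" if "u \<in> {of_int k..of_int k + 1}" for u :: real
      proof (cases "u < 0")
        case False
        then have "u = 0" using that True by (auto simp: not_less)
        then show ?thesis by (simp add: \<beta>_def \<alpha>0)
      qed (simp add: \<beta>_def)
      then have "continuous_on {of_int k..of_int k + 1} \<beta> \<longleftrightarrow> continuous_on {of_int k..of_int k + 1::real} (\<lambda>_. z)"
        by (intro continuous_on_cong) auto
      then show ?thesis by simp
    next
      case False
      have eq: "\<beta> u = (g ^^ nat k) (\<alpha> (u - of_int k))" if "u \<in> {of_int k..of_int k + 1}" for u :: real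
      proof (cases "u = of_int k + 1")
        case True
        then have "\<lfloor>u\<rfloor> = k + 1" by simp
        then have "\<beta> u = (g ^^ Suc (nat k)) (\<alpha> 0)" using False True by (simp add: \<beta>_def nat_add_distrib)
        also have "\<dots> = (g ^^ nat k) (\<alpha> 1)" by (simp add: funpow_swap1 \<alpha>0 \<alpha>1 y_def)
        finally show ?thesis using True by simp
      next
        case F: False
        then have "\<lfloor>u\<rfloor> = k" using that by (simp add: floor_eq_iff)
        moreover have "\<not> u < 0" using that False by (auto simp: not_less)
        ultimately show ?thesis by (simp add: \<beta>_def)
      qed
      have "continuous_on {of_int k..of_int k + 1} (\<lambda>u::real. (g ^^ nat k) (\<alpha> (u - of_int k)))"
        by (intro continuous_on_compose2[OF gn] continuous_on_compose2[OF \<alpha>c] continuous_intros) auto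
      then show ?thesis by (rule continuous_on_eq) (use eq in auto)
    qed
  qed
  have shift: "g (\<beta> u) = \<beta> (u + 1)" if "0 \<le> u" for u
    using that by (simp add: \<beta>_def nat_add_distrib)
  have shiftn: "\<beta> (u + of_nat k) = (g ^^ k) (\<beta> u)" if "0 \<le> u" for u k
    using that by (induction k) (auto simp: shift[symmetric] add.assoc[symmetric] add.commute[of 1])
  have \<beta>01: "\<beta> u = \<alpha> u" if "0 \<le> u" "u < 1" for u
  proof -
    have "\<lfloor>u\<rfloor> = 0" using that by (simp add: floor_eq_iff)
    then show ?thesis using that by (simp add: \<beta>_def)
  qed
  have \<beta>12: "\<beta> u = g (\<alpha> (u - 1))" if "1 \<le> u" "u < 2" for u
    using shift[of "u - 1"] \<beta>01[of "u - 1"] that by simp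
  \<comment> \<open>Coincidences of the first arc with later parts of the curve. The periodic point,
    at the middle of the arc, provides one at (1/2, 1/2 + n); the coincidence with least later time
    \<open>T\<close> will be the crossing.\<close>
  define S where "S = {p \<in> {0..1::real} \<times> {2..real n + 1}. \<beta> (fst p) = \<beta> (snd p)}"
  have "compact S"
  proof -
    have "closed {p::real \<times> real. \<beta> (fst p) = \<beta> (snd p)}"
      by (intro closed_Collect_eq continuous_on_compose2[OF \<beta>c] continuous_intros) auto
    then have "compact (({0..1::real} \<times> {2..real n + 1}) \<inter> {p. \<beta> (fst p) = \<beta> (snd p)})"
      by (intro compact_Int_closed compact_Times) auto
    then show ?thesis by (simp add: S_def Int_def)
  qed
  moreover have "(1/2, 1/2 + real n) \<in> S"
    using n2 shiftn[of "1/2" n] per by (auto simp: S_def \<beta>01 \<alpha>h)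
  ultimately have "\<exists>p\<in>S. \<forall>p'\<in>S. snd p \<le> snd p'"
    by (intro continuous_attains_inf continuous_intros) auto
  then obtain t T where tT: "(t, T) \<in> S" "\<And>t' T'. (t', T') \<in> S \<Longrightarrow> T \<le> T'" by force
  have early: "b \<ge> 2" if ab: "0 \<le> a" "a < 1" "a < b" "\<beta> a = \<beta> b" for a b
  proof (rule ccontr)
    assume b: "\<not> 2 \<le> b"
    show False
    proof (cases "b < 1")
      case True
      then show False using ab \<beta>01[of a] \<beta>01[of b] inj_onD[OF \<alpha>inj, of a b] by auto
    next
      case False
      then have e: "g (\<alpha> (b - 1)) = \<alpha> a" using b ab \<beta>12[of b] \<beta>01[of a] by simp
      have "b - 1 \<in> {0, 1}" using hit(2)[OF _ _ e] b False ab by auto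
      then have "b = 1" using b by auto
      then have "\<alpha> 1 = \<alpha> a" using e by (simp add: \<alpha>0 \<alpha>1 y_def)
      then show False using inj_onD[OF \<alpha>inj, of 1 a] ab by auto
    qed
  qed
  show False
  proof (rule no_fixed_point_imp_no_self_crossing[OF g inj B nofix, of T \<beta> t])
    show "continuous_on {0..T} \<beta>" using \<beta>c by (rule continuous_on_subset) simp
    show "g (\<beta> u) = \<beta> (u + 1)" if "0 \<le> u" for u by (rule shift[OF that])
    show "\<beta> T = \<beta> t" "0 \<le> t" "2 \<le> T" using tT(1) by (auto simp: S_def)
    show "t < T - 1"
    proof (rule ccontr)
      assume "\<not> ?thesis"
      then have "t = 1" "T = 2" using tT(1) by (auto simp: S_def)
      then show False using tT(1) shift[of 1] nofix[of "\<beta> 1"] by (auto simp: S_def)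
    qed
    \<comment> \<open>A coincidence before \<open>T\<close> is moved back by whole units until its
      earlier time falls into the first arc. It then belongs to \<open>S\<close> with a later time
      below \<open>T\<close>.\<close>
    show "inj_on \<beta> {0..<T}"
    proof (rule linorder_inj_onI)
      fix a b assume ab: "a < b" "a \<in> {0..<T}" "b \<in> {0..<T}"
      show "\<beta> a \<noteq> \<beta> b"
      proof
        assume e: "\<beta> a = \<beta> b"
        define k where "k = nat \<lfloor>a\<rfloor>"
        have k: "real k \<le> a" "a < real k + 1" unfolding k_def using ab by (auto simp: floor_le_iff)
        have "(g ^^ k) (\<beta> (a - k)) = (g ^^ k) (\<beta> (b - k))"
          using shiftn[of "a - k" k] shiftn[of "b - k" k] k ab e by simp
        then have e': "\<beta> (a - k) = \<beta> (b - k)"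
          using inj_fn[OF inj, of k] by (simp add: inj_eq)
        then have "b - k \<ge> 2" using early[of "a - k" "b - k"] k ab by simp
        then have "(a - k, b - k) \<in> S" using e' k ab tT(1) by (auto simp: S_def)
        from tT(2)[OF this] show False using ab by simp
      qed
    qed auto
  qed
qed

text \<open>Of all closed chains take a shortest one. Its jump segments from \<open>g (x i)\<close>
  to \<open>x (Suc i)\<close> are pairwise disjoint, so a homeomorphism supported in small disjoint
  neighbourhoods of them performs all jumps at once. Its composite with \<open>g\<close> has a
  periodic point but no fixed point, since the homeomorphism moves points by less than \<delta>;
  this contradicts \<open>brouwer_no_periodic_point\<close>.\<close>

lemma no_closed_chain_complex:
  fixes g :: "complex \<Rightarrow> complex"
  assumes hom: "homeomorphism UNIV UNIV g gi" and B: "\<And>z. norm (g z - z) \<le> B"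
    and \<delta>: "\<delta> > 0" and free: "\<And>z. dist (g z) z \<ge> \<delta>"
    and n1: "n \<ge> 1" and cl: "x n = x 0" and ch: "\<And>i. i < n \<Longrightarrow> dist (g (x i)) (x (Suc i)) < \<delta>"
  shows False
proof -
  define P where "P = (\<lambda>n. n \<ge> (1::nat) \<and> (\<exists>x. x n = x 0 \<and> (\<forall>i<n. dist (g (x i)) (x (Suc i)) < \<delta>)))"
  have "P n" using n1 cl ch by (auto simp: P_def)
  define N where "N = (LEAST n. P n)"
  have PN: "P N" unfolding N_def using \<open>P n\<close> by (rule LeastI)
  have min: "\<not> P k" if "k < N" for k using that unfolding N_def by (rule not_less_Least)
  from PN obtain x where N1: "N \<ge> 1" and xN: "x N = x 0" and xc: "\<And>i. i < N \<Longrightarrow> dist (g (x i)) (x (Suc i)) < \<delta>"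
    by (auto simp: P_def)
  define X where "X = (\<lambda>k. x (k mod N))"
  have XS: "X (Suc k) = x (Suc (k mod N))" for k
    using xN by (simp add: X_def mod_Suc)
  have Xc: "dist (g (X k)) (X (Suc k)) < \<delta>" for k
    unfolding XS unfolding X_def using xc[of "k mod N"] N1 by simp
  have sep: "dist (g (X i)) (X (Suc j)) \<ge> \<delta>" if ij: "i < N" "j < N" "i \<noteq> j" for i j
  proof (rule ccontr)
    assume c: "\<not> ?thesis"
    define l where "l = (if j < i then i - j else i + N - j)"
    have l: "1 \<le> l" "l < N" "X (j + l) = X i" using ij by (auto simp: l_def X_def)
    define y where "y = (\<lambda>k. if k = l then X (Suc j) else X (Suc j + k))"
    have "P l"
      unfolding P_def
    proof (intro conjI exI[of _ y] allI impI)
      show "y l = y 0" using l by (simp add: y_def)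
      fix k assume k: "k < l"
      show "dist (g (y k)) (y (Suc k)) < \<delta>"
      proof (cases "Suc k = l")
        case True
        then have "Suc (j + k) = j + l" by simp
        moreover have "y k = X (Suc (j + k))" using True by (simp add: y_def)
        ultimately have "y k = X i" using l(3) by metis
        then show ?thesis using True c by (simp add: y_def)
      next
        case False
        then show ?thesis using Xc[of "Suc j + k"] k by (simp add: y_def)
      qed
    qed (use l in simp)
    then show False using min l by blast
  qed
  define p where "p = (\<lambda>i. g (X i))"
  define t where "t = (\<lambda>i. X (Suc i))"
  have pt: "dist (p i) (t i) < \<delta>" for i using Xc by (simp add: p_def t_def)
  define S where "S = (\<lambda>i. closed_segment (p i) (t i))"
  \<comment> \<open>If two segments met, exchanging their ends would not increase the total length,
    so one of the exchanged jumps would be shorter than \<delta>, against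
    \<open>sep\<close>.\<close>
  have Sdisj: "S i \<inter> S j = {}" if ij: "i < N" "j < N" "i \<noteq> j" for i j
  proof (rule ccontr)
    assume "S i \<inter> S j \<noteq> {}"
    then obtain z where z: "z \<in> S i" "z \<in> S j" by blast
    have "dist (p i) (t i) = dist (p i) z + dist z (t i)" "dist (p j) (t j) = dist (p j) z + dist z (t j)"
      using z by (auto simp: S_def between_mem_segment[symmetric] between)
    moreover have "dist (p i) (t j) \<le> dist (p i) z + dist z (t j)" "dist (p j) (t i) \<le> dist (p j) z + dist z (t i)"
      by (rule dist_triangle)+
    moreover have "dist (p i) (t j) \<ge> \<delta>" "dist (p j) (t i) \<ge> \<delta>"
      using sep[of i j] sep[of j i] ij by (auto simp: p_def t_def)
    ultimately show False using pt[of i] pt[of j] by linarith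
  qed
  have "\<exists>d>0. \<forall>u\<in>S i. \<forall>v\<in>S j. d \<le> dist u v" if "i < N" "j < N" "i \<noteq> j" for i j
    using separate_compact_closed[of "S i" "S j"] Sdisj[OF that] by (auto simp: S_def)
  then obtain d where d: "\<And>i j. \<lbrakk>i < N; j < N; i \<noteq> j\<rbrakk> \<Longrightarrow> d i j > 0"
      "\<And>i j u v. \<lbrakk>i < N; j < N; i \<noteq> j; u \<in> S i; v \<in> S j\<rbrakk> \<Longrightarrow> d i j \<le> dist u v"
    by metis
  \<comment> \<open>On the diagonal a third of the room left below \<delta>, so that the
    neighbourhood of a segment keeps diameter below \<delta>; off the diagonal half the distance of
    two segments, so that their neighbourhoods are disjoint.\<close>
  define q where "q = (\<lambda>(i, j). if i = j then (\<delta> - dist (p i) (t i)) / 3 else d i j / 2)"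
  define e where "e = Min (q ` ({..<N} \<times> {..<N}))"
  have ne: "q ` ({..<N} \<times> {..<N}) \<noteq> {}" using N1 by (auto simp: lessThan_empty_iff)
  have e0: "e > 0" unfolding e_def using ne d(1) pt by (subst Min_gr_iff) (auto simp: q_def)
  have eq: "e \<le> q (i, j)" if "i < N" "j < N" for i j
    unfolding e_def using that by (intro Min_le) auto
  define E where "E = (\<lambda>i. \<Union>s\<in>S i. ball s e)"
  have Eopen: "open (E i)" for i by (auto simp: E_def)
  have Econn: "connected (E i)" for i
  proof -
    have "E i = (\<lambda>(s, b). s + b) ` (S i \<times> ball 0 e)"
    proof (intro equalityI subsetI)
      fix z assume "z \<in> E i"
      then obtain s where "s \<in> S i" "dist s z < e" by (auto simp: E_def)
      then have "z = (\<lambda>(s, b). s + b) (s, z - s)" "(s, z - s) \<in> S i \<times> ball 0 e"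
        by (auto simp: dist_norm norm_minus_commute)
      then show "z \<in> (\<lambda>(s, b). s + b) ` (S i \<times> ball 0 e)" by blast
    next
      fix z assume "z \<in> (\<lambda>(s, b). s + b) ` (S i \<times> ball 0 e)"
      then obtain s b where "s \<in> S i" "norm b < e" "z = s + b" by auto
      then show "z \<in> E i" unfolding E_def by (intro UN_I[of s]) (auto simp: dist_norm)
    qed
    moreover have "connected ((\<lambda>(s, b). s + b) ` (S i \<times> ball 0 e))"
      by (intro connected_continuous_image connected_Times) (auto simp: S_def case_prod_unfold intro!: continuous_intros)
    ultimately show ?thesis by simp
  qed
  have Edisj: False if "i < N" "j < N" "i \<noteq> j" "z \<in> E i" "z \<in> E j" for i j z
  proof -
    have "\<exists>s\<in>S i. dist s z < e" "\<exists>s\<in>S j. dist s z < e" using that by (auto simp: E_def)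
    then obtain s s' where s: "s \<in> S i" "dist s z < e" "s' \<in> S j" "dist s' z < e" by blast
    have "d i j \<le> dist s s'" using d(2) that s by blast
    moreover have "dist s s' < 2 * e" using s dist_triangle2[of s s' z] by linarith
    moreover have "e \<le> d i j / 2" using eq[of i j] that by (simp add: q_def)
    ultimately show False by linarith
  qed
  have Ediam: "dist u v < \<delta>" if "i < N" "u \<in> E i" "v \<in> E i" for i u v
  proof -
    have "\<exists>s\<in>S i. dist s u < e" "\<exists>s\<in>S i. dist s v < e" using that by (auto simp: E_def)
    then obtain s s' where s: "s \<in> S i" "dist s u < e" "s' \<in> S i" "dist s' v < e" by blast
    have "dist s s' \<le> dist (p i) (t i)"
      using s(1,3) unfolding S_def by (metis dist_commute dist_in_closed_segment dist_norm dual_order.trans segment_bound1 segment_furthest_le norm_minus_commute)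
    moreover have "e \<le> (\<delta> - dist (p i) (t i)) / 3" using eq[of i i] that by (simp add: q_def)
    moreover have "dist u v \<le> dist s u + dist s s' + dist s' v"
      using dist_triangle[of u v s] dist_triangle[of s v s'] by (simp add: dist_commute)
    ultimately show ?thesis using s pt[of i] by (simp add: field_simps)
  qed
  have ptE: "p i \<in> E i" "t i \<in> E i" for i using e0 by (force simp: E_def S_def)+
  \<comment> \<open>The homeomorphism is composed segment by segment. Disjointness of the
    neighbourhoods ensures that a new factor disturbs no earlier target and that no point is moved
    twice.\<close>
  have "\<exists>h h'. homeomorphism UNIV UNIV h h' \<and> (\<forall>i<k. h (p i) = t i) \<and> (\<forall>z. h z \<noteq> z \<longrightarrow> (\<exists>i<k. z \<in> E i \<and> h z \<in> E i))"
    if "k \<le> N" for k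
    using that
  proof (induction k)
    case 0
    then show ?case by (intro exI[of _ id]) (auto simp: homeomorphism_def)
  next
    case (Suc k)
    then obtain h h' where h: "homeomorphism UNIV UNIV h h'" "\<And>i. i < k \<Longrightarrow> h (p i) = t i"
      "\<And>z. h z \<noteq> z \<Longrightarrow> (\<exists>i<k. z \<in> E i \<and> h z \<in> E i)" by auto
    have "E k \<noteq> {}" using ptE by blast
    then have aff: "affine hull (E k) = UNIV" using affine_hull_open[OF Eopen] by blast
    obtain f f' where f: "homeomorphism UNIV UNIV f f'" "f (p k) = t k" "{x. \<not> (f x = x \<and> f' x = x)} \<subseteq> E k"
      by (rule homeomorphism_moving_point[of "E k" UNIV "p k" "t k"]) (use Eopen Econn ptE aff in auto)
    have finj: "f a = f b \<Longrightarrow> a = b" for a b using f(1) by (metis UNIV_I homeomorphism_apply1)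
    have fE: "f z = z" if "z \<notin> E k" for z using that f(3) by blast
    have hp: "(f \<circ> h) (p i) = t i" if "i < Suc k" for i
    proof (cases "i = k")
      case True
      have "h (p k) = p k" using h(3)[of "p k"] Edisj[of _ k "p k"] ptE Suc.prems by force
      then show ?thesis using True f by simp
    next
      case False
      then show ?thesis using h(2)[of i] that fE[of "t i"] Edisj[of i k "t i"] ptE Suc.prems by force
    qed
    have supp: "\<exists>i<Suc k. z \<in> E i \<and> (f \<circ> h) z \<in> E i" if "(f \<circ> h) z \<noteq> z" for z
    proof (cases "f (h z) = h z")
      case True
      then show ?thesis using that h(3)[of z] by (auto simp: less_Suc_eq)
    next
      case False
      then have 1: "h z \<in> E k" using fE by blast
      have 2: "f (h z) \<in> E k" using fE[of "f (h z)"] finj False by blast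
      have "h z = z"
      proof (rule ccontr)
        assume "h z \<noteq> z"
        then obtain i where "i < k" "h z \<in> E i" using h(3) by blast
        then show False using Edisj[of i k "h z"] 1 Suc.prems by auto
      qed
      then show ?thesis using 1 2 by auto
    qed
    show ?case
      using homeomorphism_compose[OF h(1) f(1)] hp supp by blast
  qed
  from this[of N] obtain h h' where h: "homeomorphism UNIV UNIV h h'" "\<And>i. i < N \<Longrightarrow> h (p i) = t i"
      "\<And>z. h z \<noteq> z \<Longrightarrow> (\<exists>i<N. z \<in> E i \<and> h z \<in> E i)" by auto
  have hsmall: "dist (h z) z < \<delta>" for z
    using h(3)[of z] Ediam[of _ "h z" z] \<delta> by (cases "h z = z") auto
  show False
  proof (rule brouwer_no_periodic_point[OF homeomorphism_compose[OF hom h(1)], of "B + \<delta>" N "X 0"])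
    show "norm ((h \<circ> g) z - z) \<le> B + \<delta>" for z
      using hsmall[of "g z"] B[of z] norm_triangle_ineq[of "h (g z) - g z" "g z - z"] by (simp add: dist_norm)
    show "(h \<circ> g) z \<noteq> z" for z
    proof
      assume e: "(h \<circ> g) z = z"
      have "dist (g z) z < \<delta>" using hsmall[of "g z"] e by (simp add: dist_commute)
      then show False using free[of z] by simp
    qed
    have "((h \<circ> g) ^^ k) (X 0) = X k" if "k \<le> N" for k
      using that h(2) by (induction k) (auto simp: p_def t_def)
    then show "((h \<circ> g) ^^ N) (X 0) = X 0" by (simp add: X_def)
  qed (use N1 in auto)
qed

section \<open>From invariant continua to free curves\<close>

lemma torus_proj_zv [simp]: "torus_proj (x + zv v) = torus_proj x"
  by (simp add: torus_proj_eq_iff int_translate_def)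

lemma torus_proj_eq_imp: "torus_proj x = torus_proj y \<Longrightarrow> \<exists>v. x = y + zv v"
  unfolding torus_proj_eq_iff int_translate_def
  by (auto simp: Ints_def prod_eq_iff algebra_simps)

lemma continuous_on_torus_proj: "continuous_on S torus_proj"
  by (rule continuous_on_subset[of UNIV])
    (auto simp: continuous_on_open_vimage open_torus_def)

text \<open>For \<open>fst\<close> and \<open>snd\<close> these are the two circle-valued
  coordinates of the torus; the choice of representative disappears in \<open>cis\<close>.\<close>

definition torus_coord :: "(real \<times> real \<Rightarrow> real) \<Rightarrow> torus \<Rightarrow> complex" where
  "torus_coord h t = cis (2 * pi * h (rep_torus t))"

lemma cis_2pi_eq_iff: "cis (2 * pi * a) = cis (2 * pi * b) \<longleftrightarrow> a - b \<in> \<int>"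
proof
  assume "a - b \<in> \<int>"
  then have "cis (2 * pi * (a - b)) = 1" by (rule cis_multiple_2pi)
  then have "cis (2 * pi * b) * cis (2 * pi * (a - b)) = cis (2 * pi * b)" by simp
  then show "cis (2 * pi * a) = cis (2 * pi * b)"
    unfolding cis_mult by (simp add: algebra_simps)
next
  assume eq: "cis (2 * pi * a) = cis (2 * pi * b)"
  have "cis (2 * pi * (a - b)) = cis (2 * pi * a) * cis (- (2 * pi * b))"
    unfolding cis_mult by (simp add: algebra_simps)
  also have "\<dots> = 1" unfolding eq cis_mult by simp
  finally have "cos (2 * pi * (a - b)) = 1" by (metis cis.simps(1) one_complex.simps(1))
  then obtain n :: int where "2 * pi * (a - b) = of_int n * 2 * pi" using cos_one_2pi_int by metis
  then have "a - b = of_int n" by simp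
  then show "a - b \<in> \<int>" by simp
qed

lemma rep_torus_proj: "int_translate (rep_torus (torus_proj x)) x"
  unfolding torus_proj_eq_iff[symmetric] unfolding torus_proj_def by (rule Quotient3_abs_rep[OF Quotient3_torus])

lemma torus_coord_fst: "torus_coord fst (torus_proj x) = cis (2 * pi * fst x)"
  and torus_coord_snd: "torus_coord snd (torus_proj x) = cis (2 * pi * snd x)"
  using rep_torus_proj[of x] by (auto simp: torus_coord_def cis_2pi_eq_iff int_translate_def)

lemma continuous_on_torus_coord: "continuous_on UNIV (torus_coord fst)" "continuous_on UNIV (torus_coord snd)"
proof -
  have 1: "torus_proj -` (torus_coord fst -` U) = (\<lambda>x. cis (2 * pi * fst x)) -` U" for U
    by (auto simp: torus_coord_fst)
  have 2: "torus_proj -` (torus_coord snd -` U) = (\<lambda>x. cis (2 * pi * snd x)) -` U" for U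
    by (auto simp: torus_coord_snd)
  have c: "continuous_on UNIV (\<lambda>x::real \<times> real. cis (2 * pi * fst x))" "continuous_on UNIV (\<lambda>x::real \<times> real. cis (2 * pi * snd x))"
    by (auto intro!: continuous_intros simp: cis_conv_exp)
  show "continuous_on UNIV (torus_coord fst)" "continuous_on UNIV (torus_coord snd)"
    unfolding continuous_on_open_vimage[OF open_UNIV] open_torus_def
    using c[unfolded continuous_on_open_vimage[OF open_UNIV]] by (auto simp: 1 2)
qed

text \<open>On a contractible set both circle coordinates have logarithms, and their imaginary parts
  over 2\<pi> are the coordinates of a lift.\<close>

lemma torus_lifting:
  fixes \<phi> :: "'a::real_normed_vector \<Rightarrow> torus"
  assumes \<phi>: "continuous_on S \<phi>" and S: "contractible S"
  obtains \<psi> where "continuous_on S \<psi>" "\<And>x. x \<in> S \<Longrightarrow> torus_proj (\<psi> x) = \<phi> x"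
proof -
  have 1: "continuous_on S (\<lambda>x. torus_coord fst (\<phi> x))" "continuous_on S (\<lambda>x. torus_coord snd (\<phi> x))"
    by (auto intro!: continuous_on_compose2[OF continuous_on_torus_coord(1) \<phi>] continuous_on_compose2[OF continuous_on_torus_coord(2) \<phi>])
  obtain l1 where l1: "continuous_on S l1" "\<And>x. x \<in> S \<Longrightarrow> torus_coord fst (\<phi> x) = exp (l1 x)"
    by (rule continuous_logarithm_on_contractible[OF 1(1) S]) (auto simp: torus_coord_def)
  obtain l2 where l2: "continuous_on S l2" "\<And>x. x \<in> S \<Longrightarrow> torus_coord snd (\<phi> x) = exp (l2 x)"
    by (rule continuous_logarithm_on_contractible[OF 1(2) S]) (auto simp: torus_coord_def)
  have cis: "exp l = cis (2 * pi * (Im l / (2 * pi)))" if "norm (exp l) = 1" for l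
  proof -
    have "Re l = 0" using that by (simp add: norm_exp_eq_Re)
    then have "l = \<i> * of_real (Im l)" by (simp add: complex_eq_iff)
    then show ?thesis by (simp add: cis_conv_exp)
  qed
  show ?thesis
  proof (rule that[of "\<lambda>x. (Im (l1 x) / (2 * pi), Im (l2 x) / (2 * pi))"])
    show "continuous_on S (\<lambda>x. (Im (l1 x) / (2 * pi), Im (l2 x) / (2 * pi)))"
      by (intro continuous_intros l1(1) l2(1)) auto
    fix x assume x: "x \<in> S"
    obtain y where y: "\<phi> x = torus_proj y" using surj_torus_proj by (metis surjD)
    have "norm (exp (l1 x)) = 1" "norm (exp (l2 x)) = 1"
      using l1(2)[OF x] l2(2)[OF x] by (metis norm_cis torus_coord_def)+
    then have "cis (2 * pi * (Im (l1 x) / (2 * pi))) = cis (2 * pi * fst y)" "cis (2 * pi * (Im (l2 x) / (2 * pi))) = cis (2 * pi * snd y)"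
      using l1(2)[OF x] l2(2)[OF x] cis torus_coord_fst[of y] torus_coord_snd[of y] y by metis+
    then show "torus_proj (Im (l1 x) / (2 * pi), Im (l2 x) / (2 * pi)) = \<phi> x"
      unfolding y torus_proj_eq_iff int_translate_def cis_2pi_eq_iff by simp
  qed
qed

lemma continuous_integer_valued_constant:
  fixes d :: "'a::topological_space \<Rightarrow> real \<times> real"
  assumes S: "connected S" and d: "continuous_on S d" and i: "\<And>x. x \<in> S \<Longrightarrow> \<exists>v. d x = zv v"
    and x: "x \<in> S" and y: "y \<in> S"
  shows "d x = d y"
proof -
  have *: "h constant_on S" if h: "continuous_on S h" "\<And>x. x \<in> S \<Longrightarrow> \<exists>n::int. h x = of_int n" for h :: "'a \<Rightarrow> real"
  proof (rule continuous_discrete_range_constant[OF S h(1)])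
    fix x assume x: "x \<in> S"
    show "\<exists>e>0. \<forall>y. y \<in> S \<and> h y \<noteq> h x \<longrightarrow> e \<le> norm (h y - h x)"
    proof (intro exI conjI allI impI)
      fix y assume y: "y \<in> S \<and> h y \<noteq> h x"
      then obtain m n :: int where "h x = of_int m" "h y = of_int n" using h(2) x by metis
      moreover from this have "1 \<le> \<bar>n - m\<bar>" using y by auto
      then have "1 \<le> \<bar>real_of_int (n - m)\<bar>" by linarith
      ultimately show "1 \<le> norm (h y - h x)" by simp
    qed simp
  qed
  have "(\<lambda>x. fst (d x)) constant_on S" "(\<lambda>x. snd (d x)) constant_on S"
    by (intro * continuous_intros d; use i in force)+
  then show ?thesis using x y unfolding constant_on_def by (metis prod_eq_iff)
qed

text \<open>The end displacement of a lifted loop is invariant under free homotopy: on a lift of the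
  homotopy to the square it is continuous in the homotopy parameter and takes lattice values. Two
  lifts of one curve differ by a constant, so the given lifts may be used at the ends.\<close>

lemma torus_homotopy_displacement:
  fixes H :: "real \<times> real \<Rightarrow> torus"
  assumes H: "continuous_on ({0..1} \<times> {0..1}) H" and loop: "\<And>t. t \<in> {0..1} \<Longrightarrow> H (t, 0) = H (t, 1)"
    and c0: "continuous_on {0..1} c0" "\<And>s. s \<in> {0..1} \<Longrightarrow> torus_proj (c0 s) = H (0, s)"
    and c1: "continuous_on {0..1} c1" "\<And>s. s \<in> {0..1} \<Longrightarrow> torus_proj (c1 s) = H (1, s)"
  shows "c0 1 - c0 0 = c1 1 - c1 0"
proof -
  have "contractible ({0..1::real} \<times> {0..1::real})"
    by (intro convex_imp_contractible convex_Times) auto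
  then obtain K where K: "continuous_on ({0..1} \<times> {0..1}) K" "\<And>p. p \<in> {0..1} \<times> {0..1} \<Longrightarrow> torus_proj (K p) = H p"
    using torus_lifting[OF H] by blast
  have ends: "c 1 - c 0 = K (t, 1) - K (t, 0)"
    if c: "continuous_on {0..1} c" "\<And>s. s \<in> {0..1} \<Longrightarrow> torus_proj (c s) = H (t, s)" and t: "t \<in> {0..1}" for c t
  proof -
    have "K (t, 1) - c 1 = K (t, 0) - c 0"
    proof (rule continuous_integer_valued_constant[of "{0..1::real}" "\<lambda>s. K (t, s) - c s"])
      show "continuous_on {0..1} (\<lambda>s. K (t, s) - c s)"
        by (intro continuous_intros c continuous_on_compose2[OF K(1)]) (use t in auto)
      show "\<exists>v. K (t, s) - c s = zv v" if "s \<in> {0..1}" for s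
      proof -
        have "torus_proj (K (t, s)) = torus_proj (c s)" using K(2)[of "(t, s)"] c(2)[OF that] that t by simp
        then show ?thesis using torus_proj_eq_imp by (metis add_diff_cancel_left')
      qed
    qed auto
    then show ?thesis by (simp add: algebra_simps)
  qed
  have "K (0, 1) - K (0, 0) = K (1, 1) - K (1, 0)"
  proof (rule continuous_integer_valued_constant[of "{0..1::real}" "\<lambda>t. K (t, 1) - K (t, 0)"])
    show "continuous_on {0..1} (\<lambda>t. K (t, 1) - K (t, 0))"
      by (intro continuous_intros continuous_on_compose2[OF K(1)]) auto
    show "\<exists>v. K (t, 1) - K (t, 0) = zv v" if "t \<in> {0..1}" for t
    proof -
      have "torus_proj (K (t, 1)) = torus_proj (K (t, 0))" using K(2)[of "(t, 1)"] K(2)[of "(t, 0)"] loop[OF that] that by simp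
      then show ?thesis using torus_proj_eq_imp by (metis add_diff_cancel_left')
    qed
  qed auto
  then show ?thesis using ends[OF c0] ends[OF c1] by simp
qed

text \<open>The homotopy to the identity is applied to the loop covered by the segment from
  \<open>x\<close> to \<open>x + zv v\<close>. The loop and its image under \<open>F\<close> then
  have lifts with equal displacement, which is the commutation with translations.\<close>

lemma is_lift_imp_lift_map:
  assumes "homotopic_with_canon (\<lambda>h. True) UNIV UNIV F id" and "is_lift F f"
  obtains fi where "lift_map f fi"
proof -
  have hf: "homeomorphic_map euclidean euclidean f" and pf: "\<And>x. torus_proj (f x) = F (torus_proj x)"
    using assms(2) by (auto simp: is_lift_def fun_eq_iff)
  obtain fi where fi: "homeomorphic_maps euclidean euclidean f fi"
    using hf homeomorphic_map_maps by blast
  then have hom: "homeomorphism UNIV UNIV f fi"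
    by (auto simp: homeomorphic_maps_def homeomorphism_def) (metis rangeI)+
  have cf: "continuous_on UNIV f" using hom by (simp add: homeomorphism_def)
  obtain h where h: "continuous_on ({0..1} \<times> UNIV) h" "\<And>x. h (0::real, x) = F x" "\<And>x. h (1, x) = x"
  proof -
    have "prod_topology (top_of_set {0..1::real}) (euclidean :: torus topology) = top_of_set ({0..1} \<times> UNIV)"
      by (metis subtopology_Times subtopology_UNIV prod_topology_euclidean)
    then show ?thesis
      using assms(1) that unfolding homotopic_with_def by auto
  qed
  have "f (x + zv v) = f x + zv v" for x v
  proof -
    define c where "c = (\<lambda>s. x + s *\<^sub>R zv v)"
    have "(f \<circ> c) 1 - (f \<circ> c) 0 = c 1 - c 0"
    proof (rule torus_homotopy_displacement[of "\<lambda>p. h (fst p, torus_proj (c (snd p)))"])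
      show "continuous_on ({0..1} \<times> {0..1}) (\<lambda>p. h (fst p, torus_proj (c (snd p))))"
        unfolding c_def
        by (intro continuous_on_compose2[OF h(1)] continuous_on_compose2[OF continuous_on_torus_proj[of UNIV]] continuous_intros) auto
      show "continuous_on {0..1} (f \<circ> c)" "continuous_on {0..1} c"
        unfolding c_def o_def by (intro continuous_on_compose2[OF cf] continuous_intros; simp)+
    qed (auto simp: h pf c_def)
    then show ?thesis by (simp add: c_def algebra_simps)
  qed
  then have "lift_map f fi" using hom by unfold_locales
  then show ?thesis by (rule that)
qed

text \<open>A null homotopy would give the lift the displacement 0 of a constant loop.\<close>

lemma essential_curve_if_displaced:
  assumes c: "continuous_on {0..1} c" and w: "c 1 = c 0 + zv W" "W \<noteq> 0"
  shows "essential_curve (\<lambda>t. torus_proj (c t))"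
  unfolding essential_curve_def
proof (intro conjI notI)
  show "path (\<lambda>t. torus_proj (c t))"
    unfolding path_def by (intro continuous_on_compose2[OF continuous_on_torus_proj c]) auto
  show "pathfinish (\<lambda>t. torus_proj (c t)) = pathstart (\<lambda>t. torus_proj (c t))"
    by (simp add: pathfinish_def pathstart_def w)
  assume "\<exists>a. homotopic_loops UNIV (\<lambda>t. torus_proj (c t)) (\<lambda>t. a)"
  then obtain a where "homotopic_loops UNIV (\<lambda>t. torus_proj (c t)) (\<lambda>t. a)" by blast
  then obtain h where h: "continuous_on ({0..1} \<times> {0..1}) h" "\<And>s. s \<in> {0..1} \<Longrightarrow> h (0::real, s::real) = torus_proj (c s)"
    "\<And>s. s \<in> {0..1} \<Longrightarrow> h (1, s) = a" "\<And>t. t \<in> {0..1} \<Longrightarrow> h (t, 1) = h (t, 0)"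
    unfolding homotopic_loops_def homotopic_with_def
    by (auto simp: pathfinish_def pathstart_def simp flip: subtopology_Times)
  obtain y where y: "a = torus_proj y" using surj_torus_proj by (metis surjD)
  have "c 1 - c 0 = (\<lambda>_. y) 1 - (\<lambda>_. y) (0::real)"
    by (rule torus_homotopy_displacement[OF h(1)]) (use h c y in auto)
  then show False using w by simp
qed

section \<open>Simple lattice polygons along a connected set\<close>

definition ladj :: "int \<times> int \<Rightarrow> int \<times> int \<Rightarrow> bool" where
  "ladj a b \<longleftrightarrow> \<bar>fst a - fst b\<bar> + \<bar>snd a - snd b\<bar> = 1"

definition near_lattice :: "nat \<Rightarrow> (real \<times> real) set \<Rightarrow> int \<times> int \<Rightarrow> bool" where
  "near_lattice M \<Phi> a \<longleftrightarrow> (\<exists>p\<in>\<Phi>. \<bar>real M * fst p - of_int (fst a)\<bar> < 1 \<and> \<bar>real M * snd p - of_int (snd a)\<bar> < 1)"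

definition lattice_step :: "nat \<Rightarrow> (real \<times> real) set \<Rightarrow> int \<times> int \<Rightarrow> int \<times> int \<Rightarrow> bool" where
  "lattice_step M \<Phi> a b \<longleftrightarrow> near_lattice M \<Phi> a \<and> near_lattice M \<Phi> b \<and> ladj a b"

text \<open>Being joined by lattice steps is an equivalence relation that holds between any point
  and all points close to it, hence throughout a connected set.\<close>

lemma lattice_walk_in_connected:
  assumes \<Phi>: "connected \<Phi>" "x \<in> \<Phi>" "y \<in> \<Phi>"
  shows "(lattice_step M \<Phi>)\<^sup>*\<^sup>* (lattice_cell M x) (lattice_cell M y)"
proof (rule connected_equivalence_relation[OF \<Phi>, where R = "\<lambda>x y. (lattice_step M \<Phi>)\<^sup>*\<^sup>* (lattice_cell M x) (lattice_cell M y)"])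
  have "symp (lattice_step M \<Phi>)" by (auto simp: symp_def lattice_step_def ladj_def)
  then have sym: "symp ((lattice_step M \<Phi>)\<^sup>*\<^sup>*)" by (rule symp_rtranclp)
  then show "(lattice_step M \<Phi>)\<^sup>*\<^sup>* (lattice_cell M y) (lattice_cell M x)"
    if "(lattice_step M \<Phi>)\<^sup>*\<^sup>* (lattice_cell M x) (lattice_cell M y)" for x y
    using that by (rule sympD)
  show "(lattice_step M \<Phi>)\<^sup>*\<^sup>* (lattice_cell M x) (lattice_cell M z)"
    if "(lattice_step M \<Phi>)\<^sup>*\<^sup>* (lattice_cell M x) (lattice_cell M y)" "(lattice_step M \<Phi>)\<^sup>*\<^sup>* (lattice_cell M y) (lattice_cell M z)" for x y z
    using that by (rule rtranclp_trans)
  fix p assume p: "p \<in> \<Phi>"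
  define U where "U = {q::real \<times> real. \<bar>real M * fst q - of_int (fst (lattice_cell M p))\<bar> < 1 \<and> \<bar>real M * snd q - of_int (snd (lattice_cell M p))\<bar> < 1}"
  have "open U"
    unfolding U_def by (intro open_Collect_conj open_Collect_less continuous_intros)
  moreover have "p \<in> U" by (auto simp: U_def lattice_cell_def) linarith+
  moreover have "(lattice_step M \<Phi>)\<^sup>*\<^sup>* (lattice_cell M p) (lattice_cell M q)" if q: "q \<in> \<Phi>" "q \<in> U" for q
  proof -
    define a b where "a = lattice_cell M p" and "b = lattice_cell M q"
    have nb: "\<bar>real M * fst q - of_int (fst b)\<bar> < 1" "\<bar>real M * snd q - of_int (snd b)\<bar> < 1"
      by (auto simp: b_def lattice_cell_def; linarith)+
    have na: "\<bar>real M * fst q - of_int (fst a)\<bar> < 1" "\<bar>real M * snd q - of_int (snd a)\<bar> < 1"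
      using q by (auto simp: U_def a_def)
    \<comment> \<open>The two cells differ by at most 1 in each coordinate. The corner that mixes
      their coordinates is near \<open>q\<close> as well and replaces a diagonal move by two
      steps.\<close>
    have 1: "near_lattice M \<Phi> a" "near_lattice M \<Phi> b" "near_lattice M \<Phi> (fst a, snd b)"
      using q na nb by (auto simp: near_lattice_def)
    have "\<bar>real_of_int (fst a - fst b)\<bar> < 2" "\<bar>real_of_int (snd a - snd b)\<bar> < 2" using na nb by auto
    then have d: "\<bar>fst a - fst b\<bar> \<le> 1" "\<bar>snd a - snd b\<bar> \<le> 1" by linarith+
    have 2: "(lattice_step M \<Phi>)\<^sup>*\<^sup>* a (fst a, snd b)"
    proof (cases "snd a = snd b")
      case False
      then show ?thesis using 1 d by (intro r_into_rtranclp) (auto simp: lattice_step_def ladj_def)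
    qed (metis prod.collapse rtranclp.rtrancl_refl)
    have 3: "(lattice_step M \<Phi>)\<^sup>*\<^sup>* (fst a, snd b) b"
    proof (cases "fst a = fst b")
      case False
      then show ?thesis using 1 d by (intro r_into_rtranclp) (auto simp: lattice_step_def ladj_def)
    qed (metis prod.collapse rtranclp.rtrancl_refl)
    show ?thesis using rtranclp_trans[OF 2 3] by (simp add: a_def b_def)
  qed
  ultimately show "\<exists>T. openin (top_of_set \<Phi>) T \<and> p \<in> T \<and> (\<forall>x\<in>T. (lattice_step M \<Phi>)\<^sup>*\<^sup>* (lattice_cell M p) (lattice_cell M x))"
    using p by (intro exI[of _ "\<Phi> \<inter> U"]) (auto simp: openin_open_Int)
qed

text \<open>A shortest walk between nodes that differ by \<open>M\<close> times a non-zero vector is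
  simple modulo \<open>M\<close>: a repetition with non-zero displacement would itself be a shorter
  such walk, and one with displacement 0 can be cut out.\<close>

lemma minimal_lattice_loop:
  assumes walk: "(lattice_step M \<Phi>)\<^sup>*\<^sup>* a0 (a0 + imul (int M) W)" and W: "W \<noteq> 0"
  obtains n a V where "V \<noteq> 0" "\<And>i. i < n \<Longrightarrow> lattice_step M \<Phi> (a i) (a (Suc i))" "a n = a 0 + imul (int M) V"
    "\<And>i j V. i < j \<Longrightarrow> j \<le> n \<Longrightarrow> a j = a i + imul (int M) V \<Longrightarrow> i = 0 \<and> j = n"
proof -
  define Q where "Q = (\<lambda>n. \<exists>a V. (\<forall>i<n. lattice_step M \<Phi> (a i) (a (Suc i))) \<and> V \<noteq> 0 \<and> a n = a 0 + imul (int M) V)"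
  obtain n0 where "(lattice_step M \<Phi> ^^ n0) a0 (a0 + imul (int M) W)"
    using walk rtranclp_imp_relpowp by metis
  then have "Q n0" unfolding Q_def relpowp_fun_conv using W by metis
  define n where "n = (LEAST n. Q n)"
  have "Q n" unfolding n_def using \<open>Q n0\<close> by (rule LeastI)
  have min: "\<not> Q k" if "k < n" for k using that unfolding n_def by (rule not_less_Least)
  from \<open>Q n\<close> obtain a V where a: "\<And>i. i < n \<Longrightarrow> lattice_step M \<Phi> (a i) (a (Suc i))" "V \<noteq> 0" "a n = a 0 + imul (int M) V"
    by (auto simp: Q_def)
  show ?thesis
  proof (rule that[OF a(2,1,3)])
    fix i j V'
    assume ij: "i < j" "j \<le> n" "a j = a i + imul (int M) V'"
    show "i = 0 \<and> j = n"
    proof (rule ccontr)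
      assume ne: "\<not> (i = 0 \<and> j = n)"
      show False
      proof (cases "V' = 0")
        case False
        have "Q (j - i)"
          unfolding Q_def
        proof (intro exI conjI allI impI)
          show "lattice_step M \<Phi> (a (i + k)) (a (i + Suc k))" if "k < j - i" for k
            using a(1)[of "i + k"] that ij by simp
          show "V' \<noteq> 0" by fact
          show "a (i + (j - i)) = a (i + 0) + imul (int M) V'" using ij by simp
        qed
        moreover have "j - i < n" using ij ne by linarith
        ultimately show False using min by blast
      next
        case True
        then have eq: "a j = a i" using ij by (simp add: imul_def zero_prod_def[symmetric])
        define b where "b = (\<lambda>k. if k \<le> i then a k else a (k + (j - i)))"
        have "Q (n - (j - i))"
          unfolding Q_def
        proof (intro exI[of _ b] exI[of _ V] conjI allI impI)
          fix k assume k: "k < n - (j - i)"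
          consider "k < i" | "k = i" | "k > i" by linarith
          then show "lattice_step M \<Phi> (b k) (b (Suc k))"
          proof cases
            case 2
            then have "j < n" using k ij by simp
            then show ?thesis using a(1)[of j] 2 eq ij by (simp add: b_def)
          qed (use a(1)[of k] a(1)[of "k + (j - i)"] k ij in \<open>auto simp: b_def\<close>)
        next
          have "b (n - (j - i)) = a n"
          proof (cases "n - (j - i) \<le> i")
            case True
            then have "n = j" "n - (j - i) = i" using ij by auto
            then show ?thesis using eq by (simp add: b_def)
          next
            case False
            then show ?thesis using ij by (simp add: b_def)
          qed
          then show "b (n - (j - i)) = b 0 + imul (int M) V" using a(3) by (simp add: b_def)
        qed (use a in auto)
        moreover have "n - (j - i) < n" using ij by linarith
        ultimately show False using min by blast
      qed
    qed
  qed
qed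

lemma ladj_cases:
  assumes "ladj a b"
  obtains "b - a = (1, 0)" | "b - a = (-1, 0)" | "b - a = (0, 1)" | "b - a = (0, -1)"
proof -
  have "\<bar>fst (b - a)\<bar> + \<bar>snd (b - a)\<bar> = 1" using assms by (simp add: ladj_def abs_minus_commute)
  then have "(fst (b - a), snd (b - a)) \<in> {(1, 0), (-1, 0), (0, 1), (0, -1)}" by auto
  then show ?thesis using that by (auto simp: prod_eq_iff)
qed

text \<open>Edges are half-open, so a vertex belongs to one end only. What remains is a common start
  at equal parameters, or one edge traversed in both directions; the latter has to be excluded by
  whoever uses this.\<close>

lemma lattice_edges_meet:
  fixes a b d e z :: "int \<times> int" and s t :: real
  assumes eq: "zv a + s *\<^sub>R zv d = zv b + t *\<^sub>R zv e + zv z"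
    and s: "0 \<le> s" "s < 1" and t: "0 \<le> t" "t < 1"
    and d: "d \<in> {(1, 0), (-1, 0), (0, 1), (0, -1)}" and e: "e \<in> {(1, 0), (-1, 0), (0, 1), (0, -1)}"
  shows "s = t \<and> a = b + z \<or> s + t = 1 \<and> e = - d \<and> a + d = b + z"
proof -
  define p q where "p = fst a - fst b - fst z" and "q = snd a - snd b - snd z"
  have p: "of_int p + s * of_int (fst d) - t * of_int (fst e) = 0"
    using arg_cong[OF eq, of fst] by (simp add: p_def)
  have q: "of_int q + s * of_int (snd d) - t * of_int (snd e) = 0"
    using arg_cong[OF eq, of snd] by (simp add: q_def)
  have int0: "n = 0" if "of_int n = x" "-1 < x" "x < 1" for n :: int and x :: real
    using that by linarith
  have int1: "n = 0 \<or> n = 1" if "of_int n = x" "-1 < x" "x < 2" for n :: int and x :: real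
    using that by linarith
  have fin: "a = b + z + (p, q)" by (simp add: p_def q_def prod_eq_iff)
  have d': "fst d = 0 \<and> snd d \<in> {1, -1} \<or> snd d = 0 \<and> fst d \<in> {1, -1}" using d by auto
  have e': "fst e = 0 \<and> snd e \<in> {1, -1} \<or> snd e = 0 \<and> fst e \<in> {1, -1}" using e by auto
  have sgn: "y = x \<or> y = - x" if "x \<in> {1, -1}" "y \<in> {1, -1}" for x y :: int using that by auto
  consider "fst d = 0" "fst e = 0" "snd d = snd e" "snd d \<in> {1,-1}" | "fst d = 0" "fst e = 0" "snd e = - snd d" "snd d \<in> {1,-1}"
    | "snd d = 0" "snd e = 0" "fst d = fst e" "fst d \<in> {1,-1}" | "snd d = 0" "snd e = 0" "fst e = - fst d" "fst d \<in> {1,-1}"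
    | "fst d = 0" "snd e = 0" "snd d \<in> {1,-1}" "fst e \<in> {1,-1}" | "snd d = 0" "fst e = 0" "fst d \<in> {1,-1}" "snd e \<in> {1,-1}"
    using d' e' sgn[of "snd d" "snd e"] sgn[of "fst d" "fst e"] by metis
  then show ?thesis
  proof cases
    case 1
    then have "p = 0" "q = 0" using p q s t int0[of q "(t - s) * of_int (snd d)"] by (auto simp: algebra_simps)
    then show ?thesis using 1 q fin by (auto simp: zero_prod_def[symmetric])
  next
    case 2
    then have p0: "p = 0" using p by simp
    have "- (q * snd d) = 0 \<or> - (q * snd d) = 1"
      by (rule int1[of _ "s + t"]) (use 2 q s t in \<open>auto simp: algebra_simps\<close>)
    then show ?thesis
    proof
      assume "- (q * snd d) = 0"
      then have "q = 0" using 2 by auto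
      then have "s = 0" "t = 0" using q 2 s t by auto
      then show ?thesis using fin p0 \<open>q = 0\<close> by (simp add: zero_prod_def[symmetric])
    next
      assume "- (q * snd d) = 1"
      then have "q = - snd d" using 2 by auto
      then show ?thesis using fin p0 2 q by (auto simp: prod_eq_iff)
    qed
  next
    case 3
    then have "q = 0" "p = 0" using p q s t int0[of p "(t - s) * of_int (fst d)"] by (auto simp: algebra_simps)
    then show ?thesis using 3 p fin by (auto simp: zero_prod_def[symmetric])
  next
    case 4
    then have q0: "q = 0" using q by simp
    have "- (p * fst d) = 0 \<or> - (p * fst d) = 1"
      by (rule int1[of _ "s + t"]) (use 4 p s t in \<open>auto simp: algebra_simps\<close>)
    then show ?thesis
    proof
      assume "- (p * fst d) = 0"
      then have "p = 0" using 4 by auto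
      then have "s = 0" "t = 0" using p 4 s t by auto
      then show ?thesis using fin q0 \<open>p = 0\<close> by (simp add: zero_prod_def[symmetric])
    next
      assume "- (p * fst d) = 1"
      then have "p = - fst d" using 4 by auto
      then show ?thesis using fin q0 4 p by (auto simp: prod_eq_iff)
    qed
  next
    case 5
    then have "p = 0" "q = 0" using p q s t int0[of p "t * of_int (fst e)"] int0[of q "- s * of_int (snd d)"] by (auto simp: algebra_simps)
    then show ?thesis using 5 p q fin by (auto simp: zero_prod_def[symmetric])
  next
    case 6
    then have "p = 0" "q = 0" using p q s t int0[of q "t * of_int (snd e)"] int0[of p "- s * of_int (fst d)"] by (auto simp: algebra_simps)
    then show ?thesis using 6 p q fin by (auto simp: zero_prod_def[symmetric])
  qed
qed

text \<open>\<open>B\<close> has positive distance from its image. At a scale finer than this gap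
  and than the modulus of continuity of \<open>f\<close>, a lattice polygon along \<Phi> is still
  disjoint from all translates of its image. Minimality makes its projection simple, and the
  non-zero displacement makes it essential.\<close>

lemma curve_intersection_imp_no_free_continuum:
  assumes lm: "lift_map f fi" and F: "is_lift F f" and cip: "curve_intersection_property F"
  shows "no_free_continuum f"
  unfolding no_free_continuum_def
proof (intro allI impI; rule ccontr)
  fix B \<Phi> :: "(real \<times> real) set" and x W
  assume B: "closed B" "\<forall>b v. b \<in> B \<longrightarrow> b + zv v \<in> B" "f ` B \<inter> B = {}"
    and \<Phi>: "connected \<Phi>" "\<Phi> \<subseteq> B" "x \<in> \<Phi>" "x + zv W \<in> \<Phi>" and W: "W \<noteq> 0"
  interpret lift_map f fi by fact
  have pf: "\<And>x. torus_proj (f x) = F (torus_proj x)"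
    using F by (auto simp: is_lift_def fun_eq_iff)
  obtain \<eta> where \<eta>: "\<eta> > 0" "\<And>b c. b \<in> B \<Longrightarrow> c \<in> B \<Longrightarrow> \<eta> \<le> dist (f b) c"
  proof -
    have "compact (f ` (B \<inter> {0..1} \<times> {0..1}))"
      by (intro compact_continuous_image continuous_on_subset[OF cont] closed_Int_compact B compact_unit_square) auto
    then obtain \<eta> where \<eta>: "\<eta> > 0" "\<forall>b\<in>f ` (B \<inter> {0..1} \<times> {0..1}). \<forall>c\<in>B. \<eta> \<le> dist b c"
      using separate_compact_closed[of "f ` (B \<inter> {0..1} \<times> {0..1})" B] B by blast
    show ?thesis
    proof (rule that[OF \<eta>(1)])
      fix b c assume bc: "b \<in> B" "c \<in> B"
      obtain y v where y: "y \<in> {0..1} \<times> {0..1}" "b = y + zv v" by (rule unit_square_representative)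
      have "y = b + zv (- v)" using y by (simp add: zv_uminus)
      then have "y \<in> B" using B bc by blast
      moreover have "c + zv (- v) \<in> B" using B bc by blast
      ultimately have "\<eta> \<le> dist (f y) (c + zv (- v))" using \<eta>(2) y by blast
      also have "\<dots> = dist (f b) c" by (simp add: y comm dist_norm zv_uminus algebra_simps)
      finally show "\<eta> \<le> dist (f b) c" .
    qed
  qed
  obtain d where d: "d > 0" "\<And>x y. dist x y < d \<Longrightarrow> dist (f x) (f y) < \<eta> / 2"
    using uniformly_continuous[of "\<eta> / 2"] \<eta> by auto
  \<comment> \<open>The polygon stays within 4/\<open>M\<close> of \<Phi>; this must be below
    \<open>d\<close> and below \<eta>/2. The summand 3 forces at least three edges.\<close>
  obtain M0 :: nat where M0: "real M0 > 4 / d + 8 / \<eta> + 3" using reals_Archimedean2 by blast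
  have M: "real M0 > 4 / d" "real M0 > 8 / \<eta>" "M0 \<ge> 3"
  proof -
    have "4 / d > 0" "8 / \<eta> > 0" using d \<eta> by auto
    then show "real M0 > 4 / d" "real M0 > 8 / \<eta>" using M0 by linarith+
    have "real M0 > 3" using M0 \<open>4 / d > 0\<close> \<open>8 / \<eta> > 0\<close> by linarith
    then show "M0 \<ge> 3" by linarith
  qed
  define M where "M = M0"
  have M: "real M > 0" "4 / real M < d" "4 / real M < \<eta> / 2" "M \<ge> 3"
    using M d \<eta> by (auto simp: M_def field_simps)
  have "lattice_cell M (x + zv W) = lattice_cell M x + imul (int M) W"
  proof -
    have *: "\<lfloor>real M * (y + of_int k)\<rfloor> = \<lfloor>real M * y\<rfloor> + int M * k" for y k
    proof -
      have "real M * (y + of_int k) = real M * y + of_int (int M * k)" by (simp add: algebra_simps)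
      then show ?thesis by (simp only: floor_add_int[symmetric])
    qed
    show ?thesis by (simp add: lattice_cell_def imul_def *)
  qed
  then have "(lattice_step M \<Phi>)\<^sup>*\<^sup>* (lattice_cell M x) (lattice_cell M x + imul (int M) W)"
    using lattice_walk_in_connected[OF \<Phi>(1,3,4), of M] by simp
  then obtain n a V where V: "V \<noteq> 0" and a: "\<And>i. i < n \<Longrightarrow> lattice_step M \<Phi> (a i) (a (Suc i))"
    and an: "a n = a 0 + imul (int M) V"
    and simple: "\<And>i j V. i < j \<Longrightarrow> j \<le> n \<Longrightarrow> a j = a i + imul (int M) V \<Longrightarrow> i = 0 \<and> j = n"
    using minimal_lattice_loop[OF _ W] by metis
  \<comment> \<open>With at most two edges the polygon could run back and forth along one edge, the
    case of opposite edges in \<open>inj\<close>.\<close>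
  have n3: "n \<ge> 3"
  proof -
    have "\<bar>fst (a k) - fst (a 0)\<bar> + \<bar>snd (a k) - snd (a 0)\<bar> \<le> int k" if "k \<le> n" for k
      using that
    proof (induction k)
      case (Suc k)
      then have "ladj (a k) (a (Suc k))" using a[of k] by (simp add: lattice_step_def)
      then show ?case using Suc by (simp add: ladj_def)
    qed simp
    from this[of n] have "\<bar>int M * fst V\<bar> + \<bar>int M * snd V\<bar> \<le> int n" by (simp add: an imul_def)
    moreover have "\<bar>fst V\<bar> + \<bar>snd V\<bar> \<ge> 1" using V by (auto simp: prod_eq_iff)
    then have "int M * (\<bar>fst V\<bar> + \<bar>snd V\<bar>) \<ge> int M * 1" by (intro mult_left_mono) auto
    ultimately show ?thesis using M by (simp add: abs_mult algebra_simps)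
  qed
  \<comment> \<open>Indices are clamped to 0..n, so that the polygon is defined and continuous on
    the whole line.\<close>
  define A where "A = (\<lambda>k::int. a (nat (max 0 (min k (int n)))))"
  define c where "c = (\<lambda>u::real. (1 / real M) *\<^sub>R (zv (A \<lfloor>u\<rfloor>) + (u - of_int \<lfloor>u\<rfloor>) *\<^sub>R (zv (A (\<lfloor>u\<rfloor> + 1)) - zv (A \<lfloor>u\<rfloor>))))"
  have cc: "continuous_on UNIV c"
  proof (rule continuous_on_unit_intervals)
    fix k :: int
    show "continuous_on {of_int k..of_int k + 1} c"
    proof (rule continuous_on_eq)
      show "continuous_on {of_int k..of_int k + 1} (\<lambda>u. (1 / real M) *\<^sub>R (zv (A k) + (u - of_int k) *\<^sub>R (zv (A (k + 1)) - zv (A k))))"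
        by (intro continuous_intros)
      fix u :: real assume u: "u \<in> {of_int k..of_int k + 1}"
      show "(1 / real M) *\<^sub>R (zv (A k) + (u - of_int k) *\<^sub>R (zv (A (k + 1)) - zv (A k))) = c u"
      proof (cases "u = of_int k + 1")
        case True
        then have "\<lfloor>u\<rfloor> = k + 1" by simp
        then show ?thesis using True by (simp add: c_def)
      next
        case False
        then have "\<lfloor>u\<rfloor> = k" using u by (simp add: floor_eq_iff)
        then show ?thesis by (simp add: c_def)
      qed
    qed
  qed
  define dd where "dd = (\<lambda>i. a (Suc i) - a i)"
  have dd: "dd i \<in> {(1, 0), (-1, 0), (0, 1), (0, -1)}" if "i < n" for i
    using a[OF that] unfolding lattice_step_def dd_def by (auto elim!: ladj_cases)
  have edge: "c u = (1 / real M) *\<^sub>R (zv (a i) + (u - real i) *\<^sub>R zv (dd i))"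
    if "real i \<le> u" "u < real i + 1" "i < n" for u i
  proof -
    have "\<lfloor>u\<rfloor> = int i" using that by (simp add: floor_eq_iff)
    moreover have "A (int i) = a i" "A (int i + 1) = a (Suc i)" using that by (auto simp: A_def nat_add_distrib min_def)
    ultimately show ?thesis by (simp add: c_def dd_def zv_diff)
  qed
  have c0: "c 0 = (1 / real M) *\<^sub>R zv (a 0)" using edge[of 0 0] n3 by simp
  have "A (int n) = a n" "A (int n + 1) = a n" by (auto simp: A_def)
  then have cn0: "c (real n) = (1 / real M) *\<^sub>R zv (a n)" by (simp add: c_def)
  have cn: "c (real n) = c 0 + zv V"
    using M by (simp add: cn0 c0 an zv_add zv_imul scaleR_add_right)
  have idx: "\<exists>i<n. real i \<le> u \<and> u < real i + 1" if "0 \<le> u" "u < real n" for u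
  proof -
    have "real (nat \<lfloor>u\<rfloor>) \<le> u" "u < real (nat \<lfloor>u\<rfloor>) + 1" using that by linarith+
    moreover from this have "nat \<lfloor>u\<rfloor> < n" using that by linarith
    ultimately show ?thesis by blast
  qed
  have simple': "i = j" if "i < n" "j < n" "a i = a j + imul (int M) V'" for i j V'
  proof (rule ccontr)
    assume "i \<noteq> j"
    then consider "j < i" | "i < j" by linarith
    then show False
    proof cases
      case 1
      have "j = 0 \<and> i = n" by (rule simple[OF 1 _ that(3)]) (use that(1) in linarith)
      then show ?thesis using that(1) by simp
    next
      case 2
      have "a j = a i + imul (int M) (- V')" using that(3) by (simp add: imul_def prod_eq_iff)
      then have "i = 0 \<and> j = n" by (rule simple[OF 2 _ , rotated]) (use that(2) in linarith)
      then show ?thesis using that(2) by simp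
    qed
  qed
  have next': "(j = Suc i \<or> Suc i = n \<and> j = 0)" if "i < n" "j < n" "a (Suc i) = a j + imul (int M) V'" for i j V'
  proof (cases "Suc i = n")
    case True
    then have h0: "a 0 = a j + imul (int M) (V' - V)" using that(3) an by (simp add: imul_def prod_eq_iff algebra_simps)
    have "0 = j" by (rule simple'[OF _ that(2) h0]) (use that(1) in linarith)
    then show ?thesis using True by simp
  next
    case False
    have "Suc i = j" by (rule simple'[OF _ that(2,3)]) (use that(1) False in linarith)
    then show ?thesis by simp
  qed
  have inj: "u = v" if uv: "0 \<le> u" "u < real n" "0 \<le> v" "v < real n" and e: "c u = c v + zv z" for u v z
  proof -
    obtain i where i: "i < n" "real i \<le> u" "u < real i + 1" using idx uv by blast
    obtain j where j: "j < n" "real j \<le> v" "v < real j + 1" using idx uv by blast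
    have "real M *\<^sub>R c u = real M *\<^sub>R (c v + zv z)" using e by simp
    then have "zv (a i) + (u - real i) *\<^sub>R zv (dd i) = zv (a j) + (v - real j) *\<^sub>R zv (dd j) + zv (imul (int M) z)"
      unfolding edge[OF i(2,3,1)] edge[OF j(2,3,1)] using M by (simp add: scaleR_add_right zv_imul)
    from lattice_edges_meet[OF this _ _ _ _ dd[OF i(1)] dd[OF j(1)]] i j
    consider "u - real i = v - real j" "a i = a j + imul (int M) z"
      | "dd j = - dd i" "a i + dd i = a j + imul (int M) z" by auto
    then show ?thesis
    proof cases
      case 1
      then show ?thesis using simple'[OF i(1) j(1) 1(2)] by simp
    next
      case 2
      have e1: "a (Suc i) = a j + imul (int M) z" using 2 by (simp add: dd_def)
      have "a (Suc j) = a j + dd j" by (simp add: dd_def)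
      also have "\<dots> = a i + imul (int M) (- z)" using 2 by (simp add: imul_def prod_eq_iff)
      finally have e2: "a (Suc j) = a i + imul (int M) (- z)" .
      show ?thesis using next'[OF i(1) j(1) e1] next'[OF j(1) i(1) e2] n3 by auto
    qed
  qed
  have near: "\<exists>p\<in>\<Phi>. dist (c u) p \<le> 4 / real M" if u: "0 \<le> u" "u < real n" for u
  proof -
    obtain i where i: "i < n" "real i \<le> u" "u < real i + 1" using idx u by blast
    obtain p where p: "p \<in> \<Phi>" "\<bar>real M * fst p - of_int (fst (a i))\<bar> < 1" "\<bar>real M * snd p - of_int (snd (a i))\<bar> < 1"
      using a[OF i(1)] by (auto simp: lattice_step_def near_lattice_def)
    have ub: "0 \<le> u - real i" "u - real i \<le> 1" using i by auto
    have D: "\<bar>real_of_int (fst (dd i))\<bar> \<le> 1" "\<bar>real_of_int (snd (dd i))\<bar> \<le> 1" using dd[OF i(1)] by auto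
    have "\<bar>(u - real i) * of_int (fst (dd i))\<bar> \<le> 1 * 1" "\<bar>(u - real i) * of_int (snd (dd i))\<bar> \<le> 1 * 1"
      unfolding abs_mult using ub D by (intro mult_mono; simp)+
    then have "\<bar>real M * fst (c u - p)\<bar> \<le> 2" "\<bar>real M * snd (c u - p)\<bar> \<le> 2"
      using p M unfolding edge[OF i(2,3,1)] by (auto simp: algebra_simps)
    moreover have "\<bar>y\<bar> \<le> 2 / real M" if "\<bar>real M * y\<bar> \<le> 2" for y
      using that M by (simp add: abs_mult field_simps)
    ultimately have "\<bar>fst (c u - p)\<bar> \<le> 2 / real M" "\<bar>snd (c u - p)\<bar> \<le> 2 / real M"
      by blast+
    moreover have "dist (c u) p \<le> \<bar>fst (c u - p)\<bar> + \<bar>snd (c u - p)\<bar>"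
      unfolding dist_norm norm_prod_def using sqrt_sum_squares_le_sum_abs by simp
    ultimately show ?thesis using p by (intro bexI[of _ p]) auto
  qed
  define \<gamma> where "\<gamma> = (\<lambda>t. torus_proj (c (real n * t)))"
  have cn_cont: "continuous_on {0..1} (\<lambda>t. c (real n * t))"
    by (intro continuous_on_compose2[OF cc] continuous_intros) auto
  have \<gamma>01: "\<gamma> 1 = \<gamma> 0" by (simp add: \<gamma>_def cn)
  have reduce: "\<exists>u. 0 \<le> u \<and> u < real n \<and> \<gamma> t = torus_proj (c u) \<and> (u = real n * t \<or> u = 0 \<and> t = 1)" if "t \<in> {0..1}" for t
  proof (cases "t = 1")
    case True
    then show ?thesis using \<gamma>01 n3 by (intro exI[of _ 0]) (auto simp: \<gamma>_def)
  next
    case False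
    then show ?thesis using that n3 by (intro exI[of _ "real n * t"]) (auto simp: \<gamma>_def)
  qed
  have "free_curve F \<gamma>"
    unfolding free_curve_def
  proof (intro conjI)
    show "essential_curve \<gamma>"
      unfolding \<gamma>_def by (rule essential_curve_if_displaced[OF cn_cont, of V]) (use cn V in auto)
    show "simple_path \<gamma>"
      unfolding simple_path_def loop_free_def
    proof (intro conjI ballI impI)
      show "path \<gamma>" using \<open>essential_curve \<gamma>\<close> by (simp add: essential_curve_def)
      fix s t :: real assume st: "s \<in> {0..1}" "t \<in> {0..1}" "\<gamma> s = \<gamma> t"
      obtain u where u: "0 \<le> u" "u < real n" "\<gamma> s = torus_proj (c u)" "u = real n * s \<or> u = 0 \<and> s = 1"
        using reduce st by blast
      obtain v where v: "0 \<le> v" "v < real n" "\<gamma> t = torus_proj (c v)" "v = real n * t \<or> v = 0 \<and> t = 1"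
        using reduce st by blast
      obtain z where "c u = c v + zv z" using torus_proj_eq_imp[of "c u" "c v"] u v st by auto
      then have "u = v" using inj u v by blast
      then show "s = t \<or> s = 0 \<and> t = 1 \<or> s = 1 \<and> t = 0" using u v n3 by auto
    qed
    show "F ` path_image \<gamma> \<inter> path_image \<gamma> = {}"
    proof (rule ccontr)
      assume "F ` path_image \<gamma> \<inter> path_image \<gamma> \<noteq> {}"
      then obtain y where "y \<in> F ` path_image \<gamma>" "y \<in> path_image \<gamma>" by blast
      then obtain s t where st: "s \<in> {0..1}" "t \<in> {0..1}" "F (\<gamma> s) = \<gamma> t"
        unfolding path_image_def by (metis imageE)
      obtain u where u: "0 \<le> u" "u < real n" "\<gamma> s = torus_proj (c u)" using reduce st by blast
      obtain v where v: "0 \<le> v" "v < real n" "\<gamma> t = torus_proj (c v)" using reduce st by blast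
      have "torus_proj (f (c u)) = torus_proj (c v)" using st u v by (simp add: pf)
      then obtain z where z: "f (c u) = c v + zv z" using torus_proj_eq_imp by blast
      obtain p where p: "p \<in> \<Phi>" "dist (c u) p \<le> 4 / real M" using near u by blast
      obtain r where r: "r \<in> \<Phi>" "dist (c v) r \<le> 4 / real M" using near v by blast
      have "\<eta> \<le> dist (f p) (r + zv z)" using \<eta>(2)[of p "r + zv z"] p r \<Phi> B by blast
      also have "\<dots> \<le> dist (f p) (f (c u)) + dist (f (c u)) (r + zv z)" by (rule dist_triangle)
      also have "dist (f p) (f (c u)) < \<eta> / 2" using d(2)[of p "c u"] p M by (simp add: dist_commute)
      also have "dist (f (c u)) (r + zv z) < \<eta> / 2" using r M by (simp add: z)
      finally show False by simp
    qed
  qed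
  then show False using cip by (auto simp: curve_intersection_property_def)
qed

section \<open>Periodic graphs\<close>

lemma imul_simps [simp]: "fst (imul k v) = k * fst v" "snd (imul k v) = k * snd v"
  "imul 0 v = 0" "imul 1 v = v" "imul k 0 = 0"
  by (auto simp: imul_def zero_prod_def)

lemma imul_add: "imul k (v + w) = imul k v + imul k w" "imul (j + k) v = imul j v + imul k v"
  and imul_diff: "imul k (v - w) = imul k v - imul k w" "imul (j - k) v = imul j v - imul k v"
  and imul_minus: "imul k (- v) = - imul k v" "imul (- k) v = - imul k v"
  by (auto simp: prod_eq_iff algebra_simps)

lemma relpowp_segment:
  assumes "\<And>i. i < n \<Longrightarrow> E (p i) (p (Suc i))" "i \<le> j" "j \<le> n"
  shows "(E ^^ (j - i)) (p i) (p j)"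
  unfolding relpowp_fun_conv
  by (rule exI[of _ "\<lambda>k. p (i + k)"]) (use assms in auto)

lemma relpowp_trans: "(E ^^ n) a b \<Longrightarrow> (E ^^ m) b c \<Longrightarrow> (E ^^ (n + m)) a c"
  by (auto simp: relpowp_add)

text \<open>Pigeonhole for \<open>N * N + 1\<close> nodes and \<open>N * N\<close> residue classes
  modulo \<open>N\<close>. This count is the source of the factors \<open>N * N\<close> in later
  bounds.\<close>

lemma two_congruent_nodes:
  fixes p :: "nat \<Rightarrow> int \<times> int"
  assumes "N > 0"
  obtains i j v where "i < j" "j \<le> N * N" "p j = p i + imul (int N) v"
proof -
  define r where "r = (\<lambda>i. (fst (p i) mod int N, snd (p i) mod int N))"
  have "r ` {0..N * N} \<subseteq> {0..<int N} \<times> {0..<int N}" using assms by (auto simp: r_def)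
  then have "card (r ` {0..N * N}) \<le> card ({0..<int N} \<times> {0..<int N})" by (intro card_mono) auto
  also have "\<dots> < card {0..N * N}" by (simp add: card_cartesian_product)
  finally have "\<not> inj_on r {0..N * N}" by (metis card_image less_irrefl)
  then obtain i j where ij: "i \<le> N * N" "j \<le> N * N" "i < j" "r i = r j"
    unfolding inj_on_def by (metis atLeastAtMost_iff nat_neq_iff)
  then have "int N dvd fst (p j) - fst (p i)" "int N dvd snd (p j) - snd (p i)"
    by (auto simp: r_def mod_eq_dvd_iff dvd_diff_commute)
  then obtain x y where "fst (p j) - fst (p i) = int N * x" "snd (p j) - snd (p i) = int N * y" by (auto elim!: dvdE)
  then have "p j = p i + imul (int N) (x, y)" by (auto simp: prod_eq_iff)
  then show ?thesis using that ij by blast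
qed

text \<open>Nodes label squares of side 1/\<open>N\<close>, so a lattice translation of the plane
  moves nodes by \<open>N\<close> times a vector; modulo these translations there are finitely many
  nodes.\<close>

locale periodic_graph =
  fixes E :: "int \<times> int \<Rightarrow> int \<times> int \<Rightarrow> bool" and N :: nat
  assumes N: "N > 0" and E_translate: "E a b \<Longrightarrow> E (a + imul (int N) v) (b + imul (int N) v)"
begin

lemma walk_translate: "(E ^^ n) a b \<Longrightarrow> (E ^^ n) (a + imul (int N) v) (b + imul (int N) v)"
  by (induction n arbitrary: b) (auto intro: E_translate)

definition closed_walk :: "int \<times> int \<Rightarrow> nat \<Rightarrow> int \<times> int \<Rightarrow> bool" where
  "closed_walk a n v \<longleftrightarrow> n \<ge> 1 \<and> (E ^^ n) a (a + imul (int N) v)"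

lemma closed_walk_add:
  assumes "closed_walk a n v" "closed_walk a m w"
  shows "closed_walk a (n + m) (v + w)"
proof -
  have "(E ^^ m) (a + imul (int N) v) (a + imul (int N) w + imul (int N) v)"
    using assms walk_translate by (auto simp: closed_walk_def)
  then show ?thesis
    using assms relpowp_trans[where E = E and a = a and b = "a + imul (int N) v" and n = n and m = m]
    by (auto simp: closed_walk_def imul_add algebra_simps)
qed

lemma closed_walk_mult:
  assumes "closed_walk a n v" "k \<ge> 1"
  shows "closed_walk a (k * n) (imul (int k) v)"
  using assms(2)
proof (induction k rule: dec_induct)
  case (step k)
  then show ?case using closed_walk_add[OF step.IH assms(1)] by (simp add: imul_add algebra_simps)
qed (use assms in simp)

lemma split_long_walk:
  assumes w: "(E ^^ n) a b" and n: "n > N * N"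
  obtains x n1 n2 m v where "m \<ge> 1" "m \<le> N * N" "n = n1 + m + n2" "(E ^^ n1) a x" "(E ^^ m) x (x + imul (int N) v)"
    "(E ^^ n2) (x + imul (int N) v) b"
proof -
  obtain p where p: "p 0 = a" "p n = b" "\<And>i. i < n \<Longrightarrow> E (p i) (p (Suc i))"
    using w unfolding relpowp_fun_conv by blast
  obtain i j v where ij: "i < j" "j \<le> N * N" "p j = p i + imul (int N) v"
    using two_congruent_nodes[OF N, of p] by blast
  note seg = relpowp_segment[where p = p and n = n and E = E, OF p(3)]
  show ?thesis
  proof (rule that[of "j - i" i "n - j" "p i" v])
    show "(E ^^ i) a (p i)" using seg[of 0 i] ij n p by simp
    show "(E ^^ (j - i)) (p i) (p i + imul (int N) v)" using seg[of i j] ij n by simp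
    show "(E ^^ (n - j)) (p i + imul (int N) v) b" using seg[of j n] ij n p by simp
  qed (use ij n in auto)
qed

text \<open>Cutting out closed pieces of length at most \<open>N * N\<close>, each of which gains
  its share, leaves a walk of length at most \<open>N * N\<close>. The constant pays for this
  remainder: \<open>S\<close> for the loss in each step and the absolute value of \<open>c\<close>
  for the gain it ought to have made.\<close>

lemma walk_lower_bound:
  fixes l :: "int \<times> int \<Rightarrow> real"
  assumes add: "\<And>v w. l (v + w) = l v + l w"
    and S: "S \<ge> 0" "\<And>a b. E a b \<Longrightarrow> l b - l a \<ge> - S"
    and cyc: "\<And>a n v. closed_walk a n v \<Longrightarrow> n \<le> N * N \<Longrightarrow> l (imul (int N) v) \<ge> real n * c"
    and w: "(E ^^ n) a b"
  shows "l b - l a \<ge> real n * c - real (N * N) * (S + \<bar>c\<bar>)"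
  using w
proof (induction n arbitrary: b rule: less_induct)
  case (less n)
  show ?case
  proof (cases "n \<le> N * N")
    case True
    have "l b - l a \<ge> - (real n * S)" using less.prems
    proof (induction n arbitrary: b)
      case (Suc n)
      then obtain d where "(E ^^ n) a d" "E d b" by auto
      then show ?case using Suc.IH[of d] S(2)[of d b] by (simp add: algebra_simps)
    qed simp
    moreover have "real n * (S + \<bar>c\<bar>) \<le> real (N * N) * (S + \<bar>c\<bar>)"
      using True S by (intro mult_right_mono) (auto simp flip: of_nat_mult)
    moreover have "real n * c \<le> real n * \<bar>c\<bar>" by (intro mult_left_mono) auto
    ultimately show ?thesis by (simp add: algebra_simps)
  next
    case False
    then obtain x n1 n2 m v where s: "m \<ge> 1" "m \<le> N * N" "n = n1 + m + n2" "(E ^^ n1) a x" "(E ^^ m) x (x + imul (int N) v)"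
      "(E ^^ n2) (x + imul (int N) v) b"
      using split_long_walk[OF less.prems] by (metis not_le)
    have "(E ^^ n2) x (b + imul (int N) (- v))"
      using walk_translate[OF s(6), of "- v"] by (simp add: imul_minus)
    then have "(E ^^ (n1 + n2)) a (b + imul (int N) (- v))" using relpowp_trans s(4) by metis
    then have "l (b + imul (int N) (- v)) - l a \<ge> real (n1 + n2) * c - real (N * N) * (S + \<bar>c\<bar>)"
      by (intro less.IH) (use s in auto)
    moreover have "l b = l (b + imul (int N) (- v)) + l (imul (int N) v)"
      by (simp add: add[symmetric] imul_minus)
    moreover have "l (imul (int N) v) \<ge> real m * c" using cyc[of x m v] s by (simp add: closed_walk_def)
    ultimately show ?thesis by (simp add: s(3) algebra_simps)
  qed
qed

end

section \<open>Semigroups of integer vectors\<close>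

definition idet :: "int \<times> int \<Rightarrow> int \<times> int \<Rightarrow> int" where
  "idet a b = fst a * snd b - snd a * fst b"

definition idot :: "int \<times> int \<Rightarrow> int \<times> int \<Rightarrow> int" where
  "idot a b = fst a * fst b + snd a * snd b"

lemma idot_pos: "a \<noteq> 0 \<Longrightarrow> idot a a > 0"
  by (auto simp: idot_def prod_eq_iff) (metis mult_eq_0_iff not_sum_squares_lt_zero not_less_iff_gr_or_eq sum_squares_eq_zero_iff)+

lemma semigroup_imul:
  assumes add: "\<And>s t. s \<in> S \<Longrightarrow> t \<in> S \<Longrightarrow> s + t \<in> S" and s: "s \<in> S" and k: "k > 0"
  shows "imul k s \<in> S"
  using k
proof (induction k rule: int_gr_induct)
  case (step i)
  then show ?case using add[OF step.IH s] by (simp add: imul_add)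
qed (use s in simp)

text \<open>Fix \<open>s0\<close> in the semigroup. Positive combinations of elements on opposite
  sides of the line through \<open>s0\<close> can be made to fall on this line, and there they lie
  on the side of \<open>s0\<close>, for otherwise 0 would be a combination. This orders the slopes
  of the two sides, and a number between them gives the normal.\<close>

lemma integer_semigroup_half_plane:
  assumes add: "\<And>s t. s \<in> S \<Longrightarrow> t \<in> S \<Longrightarrow> s + t \<in> S" and z: "0 \<notin> S"
  obtains u :: "real \<times> real" where "u \<noteq> 0" "\<And>s. s \<in> S \<Longrightarrow> u \<bullet> zv s \<ge> 0"
proof (cases "S = {}")
  case True
  then show ?thesis using that[of "(1, 0)"] by (auto simp: zero_prod_def)
next
  case False
  then obtain s0 where s0: "s0 \<in> S" by blast
  then have s0n: "s0 \<noteq> 0" using z by blast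
  have d0: "idot s0 s0 > 0" using idot_pos[OF s0n] .
  have ident: "imul (idot s0 s0) w = imul (idot s0 w) s0" if "idet s0 w = 0" for w
    using that by (auto simp: idot_def idet_def prod_eq_iff) algebra+
  have Z0: "idot s0 s \<ge> 0" if "s \<in> S" "idet s0 s = 0" for s
  proof (rule ccontr)
    assume "\<not> ?thesis"
    then have "imul (idot s0 s0) s \<in> S" "imul (- idot s0 s) s0 \<in> S"
      using semigroup_imul[of S] add that s0 d0 by auto
    then have "imul (idot s0 s0) s + imul (- idot s0 s) s0 \<in> S" by (rule add)
    then show False using ident[OF that(2)] z by (simp add: imul_minus)
  qed
  consider "\<forall>s\<in>S. idet s0 s \<ge> 0" | "\<forall>s\<in>S. idet s0 s \<le> 0" | "\<exists>s\<in>S. idet s0 s > 0" "\<exists>s\<in>S. idet s0 s < 0"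
    by force
  then show ?thesis
  proof cases
    case 1
    show ?thesis
    proof (rule that[of "zv (- snd s0, fst s0)"])
      show "zv (- snd s0, fst s0) \<noteq> 0" using s0n by (auto simp: prod_eq_iff)
      fix s assume "s \<in> S"
      then have "real_of_int (idet s0 s) \<ge> 0" using 1 by simp
      then show "0 \<le> zv (- snd s0, fst s0) \<bullet> zv s" by (simp add: idet_def inner_prod_def algebra_simps)
    qed
  next
    case 2
    show ?thesis
    proof (rule that[of "zv (snd s0, - fst s0)"])
      show "zv (snd s0, - fst s0) \<noteq> 0" using s0n by (auto simp: prod_eq_iff)
      fix s assume "s \<in> S"
      then have "real_of_int (idet s0 s) \<le> 0" using 2 by simp
      then show "0 \<le> zv (snd s0, - fst s0) \<bullet> zv s" by (simp add: idet_def inner_prod_def algebra_simps)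
    qed
  next
    case 3
    \<comment> \<open>The quotient is the value of \<open>r\<close> for which
      \<open>idot s0 s + r * idet s0 s\<close> vanishes. It bounds \<open>r\<close> from below if
      the determinant is positive and from above if it is negative.\<close>
    define X where "X = (\<lambda>s. - (real_of_int (idot s0 s) / real_of_int (idet s0 s))) ` {s \<in> S. idet s0 s > 0}"
    define Y where "Y = (\<lambda>s. - (real_of_int (idot s0 s) / real_of_int (idet s0 s))) ` {s \<in> S. idet s0 s < 0}"
    have ne: "X \<noteq> {}" "Y \<noteq> {}" using 3 by (auto simp: X_def Y_def)
    have le: "x \<le> y" if "x \<in> X" "y \<in> Y" for x y
    proof -
      obtain s where s: "s \<in> S" "idet s0 s > 0" "x = - (real_of_int (idot s0 s) / real_of_int (idet s0 s))"
        using \<open>x \<in> X\<close> by (auto simp: X_def)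
      obtain t where t: "t \<in> S" "idet s0 t < 0" "y = - (real_of_int (idot s0 t) / real_of_int (idet s0 t))"
        using \<open>y \<in> Y\<close> by (auto simp: Y_def)
      define w where "w = imul (- idet s0 t) s + imul (idet s0 s) t"
      have wS: "w \<in> S" unfolding w_def using semigroup_imul[of S] add s t by auto
      have "idet s0 w = 0" by (simp add: w_def idet_def algebra_simps)
      then have "idot s0 w \<ge> 0" using Z0 wS by blast
      then have "real_of_int (idot s0 w) \<ge> 0" by simp
      then have "- real_of_int (idet s0 t) * real_of_int (idot s0 s) + real_of_int (idet s0 s) * real_of_int (idot s0 t) \<ge> 0"
        by (simp add: w_def idot_def algebra_simps)
      moreover have "x * real_of_int (idet s0 s) = - real_of_int (idot s0 s)" "y * real_of_int (idet s0 t) = - real_of_int (idot s0 t)"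
        using s t by auto
      moreover have "(y - x) * (real_of_int (idet s0 s) * - real_of_int (idet s0 t))
          = - (y * real_of_int (idet s0 t)) * real_of_int (idet s0 s) + (x * real_of_int (idet s0 s)) * real_of_int (idet s0 t)"
        by (simp add: algebra_simps)
      ultimately have "(y - x) * (real_of_int (idet s0 s) * - real_of_int (idet s0 t)) \<ge> 0"
        by (simp only:) (simp add: algebra_simps)
      moreover have "real_of_int (idet s0 s) * - real_of_int (idet s0 t) > 0" using s t by (intro mult_pos_pos) auto
      ultimately have "y - x \<ge> 0" by (metis zero_le_mult_iff not_le)
      then show ?thesis by simp
    qed
    define r where "r = Sup X"
    have bdd: "bdd_above X" using le ne by (metis bdd_above.I ex_in_conv)
    have rX: "x \<le> r" if "x \<in> X" for x unfolding r_def using that bdd by (rule cSup_upper)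
    have rY: "r \<le> y" if "y \<in> Y" for y unfolding r_def using ne le that by (intro cSup_least) auto
    define u where "u = zv s0 + r *\<^sub>R zv (- snd s0, fst s0)"
    have u: "u \<bullet> zv s = real_of_int (idot s0 s) + r * real_of_int (idet s0 s)" for s
      by (simp add: u_def inner_prod_def idot_def idet_def algebra_simps)
    show ?thesis
    proof (rule that[of u])
      show "u \<noteq> 0"
      proof
        assume "u = 0"
        then show False using u[of s0] d0 by (simp add: idet_def)
      qed
      fix s assume s: "s \<in> S"
      consider "idet s0 s = 0" | "idet s0 s > 0" | "idet s0 s < 0" by linarith
      then show "0 \<le> u \<bullet> zv s"
      proof cases
        case 1
        then show ?thesis using Z0[OF s] by (simp add: u)
      next
        case 2
        then have "- (real_of_int (idot s0 s) / real_of_int (idet s0 s)) \<le> r"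
          by (intro rX) (use s in \<open>auto simp: X_def\<close>)
        then show ?thesis using 2 by (simp add: u field_simps)
      next
        case 3
        then have "r \<le> - (real_of_int (idot s0 s) / real_of_int (idet s0 s))"
          by (intro rY) (use s in \<open>auto simp: Y_def\<close>)
        then show ?thesis using 3 by (simp add: u field_simps)
      qed
    qed
  qed
qed

section \<open>The graph of a lift on small squares\<close>

definition sq :: "nat \<Rightarrow> int \<times> int \<Rightarrow> (real \<times> real) set" where
  "sq N a = {p. of_int (fst a) \<le> real N * fst p \<and> real N * fst p \<le> of_int (fst a) + 1 \<and>
     of_int (snd a) \<le> real N * snd p \<and> real N * snd p \<le> of_int (snd a) + 1}"

definition pos :: "nat \<Rightarrow> int \<times> int \<Rightarrow> real \<times> real" where
  "pos N a = (1 / real N) *\<^sub>R zv a"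

lemma sq_translate: "N > 0 \<Longrightarrow> x + zv v \<in> sq N (a + imul (int N) v) \<longleftrightarrow> x \<in> sq N a"
  by (simp add: sq_def algebra_simps)

lemma cell_in_sq: "p \<in> sq N (lattice_cell N p)"
  by (simp add: sq_def lattice_cell_def)

lemma pos_in_sq: "N > 0 \<Longrightarrow> pos N a \<in> sq N a"
  by (simp add: sq_def pos_def)

lemma pos_translate: "N > 0 \<Longrightarrow> pos N (a + imul (int N) v) = pos N a + zv v"
  by (simp add: pos_def zv_add zv_imul scaleR_add_right)

lemma dist_prod_le_sum: "dist x y \<le> \<bar>fst x - fst y\<bar> + \<bar>snd x - snd (y :: real \<times> real)\<bar>"
  unfolding dist_prod_def dist_real_def using sqrt_sum_squares_le_sum_abs by simp

lemma sq_diameter: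
  assumes N: "N > 0" and "x \<in> sq N a" "y \<in> sq N a"
  shows "dist x y \<le> 2 / real N"
proof -
  have "\<bar>real N * (fst x - fst y)\<bar> \<le> 1" "\<bar>real N * (snd x - snd y)\<bar> \<le> 1"
    using assms by (auto simp: sq_def algebra_simps)
  moreover have "\<bar>z\<bar> \<le> 1 / real N" if "\<bar>real N * z\<bar> \<le> 1" for z
    using that N by (simp add: abs_mult field_simps)
  ultimately have "\<bar>fst x - fst y\<bar> \<le> 1 / real N" "\<bar>snd x - snd y\<bar> \<le> 1 / real N" by blast+
  then show ?thesis using dist_prod_le_sum[of x y] by simp
qed

lemma sq_refine:
  assumes N: "N > 0" and k: "k > 0"
  shows "sq (k * N) a \<subseteq> sq N (fst a div int k, snd a div int k)"
proof
  fix x assume x: "x \<in> sq (k * N) a"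
  have *: "of_int (m div int k) \<le> y \<and> y \<le> of_int (m div int k) + 1"
    if "of_int m \<le> real k * y" "real k * y \<le> of_int m + 1" for m y
  proof -
    have "m = int k * (m div int k) + m mod int k" by simp
    then have m: "real_of_int m = real k * of_int (m div int k) + of_int (m mod int k)"
      by (metis of_int_add of_int_mult of_int_of_nat_eq)
    have "0 \<le> m mod int k" "m mod int k + 1 \<le> int k" using k by auto (metis of_nat_0_less_iff pos_mod_bound zless_imp_add1_zle)
    then have "0 \<le> real_of_int (m mod int k)" "real_of_int (m mod int k) + 1 \<le> real k" by linarith+
    then have "real k * of_int (m div int k) \<le> real k * y" "real k * y \<le> real k * (of_int (m div int k) + 1)"
    proof -
      have "real k * (of_int (m div int k) + 1) = real k * of_int (m div int k) + real k" by (simp add: distrib_left)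
      then show "real k * of_int (m div int k) \<le> real k * y" "real k * y \<le> real k * (of_int (m div int k) + 1)"
        using that m \<open>0 \<le> real_of_int (m mod int k)\<close> \<open>real_of_int (m mod int k) + 1 \<le> real k\<close> by linarith+
    qed
    moreover have "0 < real k" using k by simp
    ultimately show ?thesis using mult_left_le_imp_le[of "real k"] by blast
  qed
  show "x \<in> sq N (fst a div int k, snd a div int k)"
    using x *[of "fst a" "real N * fst x"] *[of "snd a" "real N * snd x"] by (simp add: sq_def mult.assoc)
qed

lemma average_block:
  fixes y :: "nat \<Rightarrow> real \<times> real"
  assumes "n \<ge> 1"
  obtains i where "i < n" "\<nu> \<bullet> (y (Suc i * m) - y (i * m)) \<ge> \<nu> \<bullet> (y (n * m) - y 0) / real n"
proof -
  define s where "s = \<nu> \<bullet> (y (n * m) - y 0) / real n"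
  have "(\<Sum>i<n. \<nu> \<bullet> (y (Suc i * m) - y (i * m))) = \<nu> \<bullet> (y (n * m) - y 0)"
    by (induction n) (auto simp: algebra_simps)
  also have "\<dots> = (\<Sum>i<n. s)" using assms by (simp add: s_def)
  finally have eq: "(\<Sum>i<n. \<nu> \<bullet> (y (Suc i * m) - y (i * m))) = (\<Sum>i<n. s)" .
  have "\<not> (\<forall>i<n. \<nu> \<bullet> (y (Suc i * m) - y (i * m)) < s)"
  proof
    assume *: "\<forall>i<n. \<nu> \<bullet> (y (Suc i * m) - y (i * m)) < s"
    have "{..<n} \<noteq> {}" using assms by (auto simp: lessThan_empty_iff)
    then have "(\<Sum>i<n. \<nu> \<bullet> (y (Suc i * m) - y (i * m))) < (\<Sum>i<n. s)"
      using * by (intro sum_strict_mono) auto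
    then show False using eq by simp
  qed
  then show ?thesis using that by (auto simp: s_def not_less)
qed

context lift_map
begin

text \<open>The support function form of the statement that \<open>m\<close> times \<open>P\<close>
  lies in the convex hull of the displacements of \<open>f ^^ m\<close>, for every
  \<open>m\<close>.\<close>

definition realizable :: "real \<times> real \<Rightarrow> bool" where
  "realizable P \<longleftrightarrow> (\<forall>m\<ge>1. \<forall>\<nu>. \<exists>x. \<nu> \<bullet> ((f ^^ m) x - x) \<ge> real m * (\<nu> \<bullet> P))"

text \<open>
  The slack $1/N$ makes the image of a union of squares lie in the interior of the union of their
  successors.
\<close>

definition edge :: "nat \<Rightarrow> int \<times> int \<Rightarrow> int \<times> int \<Rightarrow> bool" where
  "edge N a b \<longleftrightarrow> (\<exists>x\<in>sq N a. \<exists>y\<in>sq N b. dist (f x) y \<le> 1 / real N)"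

lemma periodic_graph: "N > 0 \<Longrightarrow> periodic_graph (edge N) N"
proof
  fix a b v assume N: "N > 0" and "edge N a b"
  then obtain x y where xy: "x \<in> sq N a" "y \<in> sq N b" "dist (f x) y \<le> 1 / real N" by (auto simp: edge_def)
  then show "edge N (a + imul (int N) v) (b + imul (int N) v)"
    unfolding edge_def using N
    by (intro bexI[of _ "x + zv v"] bexI[of _ "y + zv v"]) (auto simp: sq_translate comm)
qed auto

lemma edge_cells: "edge N (lattice_cell N x) (lattice_cell N (f x))"
  unfolding edge_def by (intro bexI[of _ x] bexI[of _ "f x"] cell_in_sq) auto

lemma orbit_walk: "(edge N ^^ n) (lattice_cell N x) (lattice_cell N ((f ^^ n) x))"
proof (induction n)
  case (Suc n)
  show ?case using relcomppI[of "edge N ^^ n" _ _ "edge N", OF Suc edge_cells] by simp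
qed simp

lemma edge_refine:
  assumes N: "N > 0" and k: "k > 0" and e: "edge (k * N) a b"
  shows "edge N (fst a div int k, snd a div int k) (fst b div int k, snd b div int k)"
proof -
  obtain x y where xy: "x \<in> sq (k * N) a" "y \<in> sq (k * N) b" "dist (f x) y \<le> 1 / real (k * N)"
    using e by (auto simp: edge_def)
  have "1 / real (k * N) \<le> 1 / real N" using N k by (simp add: frac_le)
  then show ?thesis unfolding edge_def using xy sq_refine[OF N k] by (meson order_trans subsetD)
qed

lemma walk_refine:
  assumes N: "N > 0" and k: "k > 0"
  shows "(edge (k * N) ^^ n) a b \<Longrightarrow> (edge N ^^ n) (fst a div int k, snd a div int k) (fst b div int k, snd b div int k)"
proof (induction n arbitrary: b)
  case (Suc n)
  then obtain c where "(edge (k * N) ^^ n) a c" "edge (k * N) c b" by auto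
  then show ?case using Suc.IH[of c] edge_refine[OF N k, of c b] by auto
qed auto

text \<open>Integer division by \<open>k\<close> maps the graph at scale \<open>k * N\<close> to the
  graph at scale \<open>N\<close>, keeping length and displacement of closed walks. What is excluded
  at one scale is thus excluded at all its multiples.\<close>

lemma closed_walk_refine:
  assumes N: "N > 0" and k: "k > 0" and w: "periodic_graph.closed_walk (edge (k * N)) (k * N) a n v"
  shows "periodic_graph.closed_walk (edge N) N (fst a div int k, snd a div int k) n v"
proof -
  have g: "periodic_graph (edge (k * N)) (k * N)" "periodic_graph (edge N) N" using N k by (auto intro!: periodic_graph)
  have *: "(m + int (k * N) * j) div int k = m div int k + int N * j" for m j
  proof -
    have "m + int (k * N) * j = m + int k * (int N * j)" by simp
    then show ?thesis using k by (simp only: div_mult_self2)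
  qed
  show ?thesis
    using w walk_refine[OF N k, of n a "a + imul (int (k * N)) v"]
    by (simp add: periodic_graph.closed_walk_def[OF g(1)] periodic_graph.closed_walk_def[OF g(2)] *[unfolded of_nat_mult] plus_prod_def)
qed

text \<open>The bound has to be the same for all scales, because the scale tends to infinity while
  rates are compared. The 5 consists of 2 + 2 for the diameters of two squares and 1 for the slack,
  all largest at \<open>N\<close> = 1.\<close>

lemma edge_bound:
  obtains D where "D \<ge> 0" "\<And>N a b. N > 0 \<Longrightarrow> edge N a b \<Longrightarrow> dist (pos N a) (pos N b) \<le> D"
proof -
  obtain B where B: "B \<ge> 0" "\<And>x. dist (f x) x \<le> B" using bounded_displacement by blast
  show ?thesis
  proof (rule that[of "B + 5"])
    fix N a b assume N: "N > 0" and "edge N a b"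
    then obtain x y where xy: "x \<in> sq N a" "y \<in> sq N b" "dist (f x) y \<le> 1 / real N" by (auto simp: edge_def)
    have "dist (pos N a) x \<le> 2 / real N" "dist y (pos N b) \<le> 2 / real N"
      using sq_diameter[OF N pos_in_sq[OF N] xy(1)] sq_diameter[OF N xy(2) pos_in_sq[OF N]] by auto
    moreover have "dist (pos N a) (pos N b) \<le> dist (pos N a) x + dist x (f x) + dist (f x) y + dist y (pos N b)"
      using dist_triangle[of "pos N a" "pos N b" x] dist_triangle[of x "pos N b" "f x"] dist_triangle[of "f x" "pos N b" y] by linarith
    moreover have "1 / real N \<le> 1" using N by simp
    moreover have "2 / real N \<le> 2" using N by (simp add: field_simps)
    ultimately show "dist (pos N a) (pos N b) \<le> B + 5" using xy(3) B(2)[of x] by (simp add: dist_commute)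
  qed (use B in auto)
qed

lemma walk_bound:
  assumes N: "N > 0" and D: "\<And>a b. edge N a b \<Longrightarrow> dist (pos N a) (pos N b) \<le> D"
  shows "(edge N ^^ n) a b \<Longrightarrow> dist (pos N a) (pos N b) \<le> real n * D"
proof (induction n arbitrary: b)
  case (Suc n)
  then obtain c where "(edge N ^^ n) a c" "edge N c b" by auto
  then show ?case using Suc.IH[of c] D[of c b] dist_triangle[of "pos N a" "pos N b" "pos N c"] by (simp add: algebra_simps)
qed auto

text \<open>Only a fixed number \<open>m\<close> of steps is followed: errors of order
  1/\<open>N\<close> pass through \<open>m\<close> moduli of continuity, so the scale required
  depends on \<open>m\<close>.\<close>

lemma walk_tracks_orbit:
  assumes "\<epsilon> > 0"
  shows "\<exists>N0. \<forall>N\<ge>N0. \<forall>a b. (edge N ^^ m) a b \<longrightarrow> dist ((f ^^ m) (pos N a)) (pos N b) < \<epsilon>"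
  using assms
proof (induction m arbitrary: \<epsilon>)
  case 0
  then show ?case by auto
next
  case (Suc m)
  obtain d where d: "d > 0" "\<And>x y. dist x y < d \<Longrightarrow> dist (f x) (f y) < \<epsilon> / 4"
    using uniformly_continuous[of "\<epsilon> / 4"] Suc.prems by auto
  obtain N0 where N0: "\<And>N a b. N \<ge> N0 \<Longrightarrow> (edge N ^^ m) a b \<Longrightarrow> dist ((f ^^ m) (pos N a)) (pos N b) < d"
    using Suc.IH[OF d(1)] by blast
  obtain N1 :: nat where N1: "real N1 > 2 / d + 6 / \<epsilon>" using reals_Archimedean2 by blast
  have pos: "2 / d > 0" "6 / \<epsilon> > 0" using d Suc.prems by auto
  show ?case
  proof (intro exI[of _ "max N0 N1"] allI impI)
    fix N a b assume N: "max N0 N1 \<le> N" and w: "(edge N ^^ Suc m) a b"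
    have "real N \<ge> real N1" using N by simp
    then have Nr: "real N > 2 / d" "real N > 6 / \<epsilon>" using N1 pos by linarith+
    have N0': "N > 0" by (rule ccontr) (use Nr pos in auto)
    have small: "2 / real N < d" "3 / real N < \<epsilon> / 2" using Nr N0' d Suc.prems by (auto simp: field_simps)
    obtain c where c: "(edge N ^^ m) a c" "edge N c b" using w by auto
    obtain x y where xy: "x \<in> sq N c" "y \<in> sq N b" "dist (f x) y \<le> 1 / real N" using c by (auto simp: edge_def)
    have 1: "dist (f ((f ^^ m) (pos N a))) (f (pos N c)) < \<epsilon> / 4" using d(2) N0[of N a c] N c by simp
    have "dist (pos N c) x < d" using sq_diameter[OF N0' pos_in_sq[OF N0'] xy(1)] small by linarith
    then have 2: "dist (f (pos N c)) (f x) < \<epsilon> / 4" by (rule d(2))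
    have 3: "dist y (pos N b) \<le> 2 / real N" using sq_diameter[OF N0' xy(2) pos_in_sq[OF N0']] .
    have "dist (f ((f ^^ m) (pos N a))) (pos N b) \<le> dist (f ((f ^^ m) (pos N a))) (f (pos N c)) + dist (f (pos N c)) (f x) + dist (f x) y + dist y (pos N b)"
      using dist_triangle[of "f ((f ^^ m) (pos N a))" "pos N b" "f (pos N c)"] dist_triangle[of "f (pos N c)" "pos N b" "f x"] dist_triangle[of "f x" "pos N b" y] by linarith
    also have "\<dots> < \<epsilon> / 4 + \<epsilon> / 4 + 1 / real N + 2 / real N"
      using 1 2 3 xy(3) by linarith
    also have "\<dots> < \<epsilon>" using small N0' by (simp add: field_simps)
    finally show "dist ((f ^^ Suc m) (pos N a)) (pos N b) < \<epsilon>" by simp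
  qed
qed

end

section \<open>Three non-collinear rotation vectors\<close>

text \<open>The arc and its unit translate lie on one side of the axis and end on it. As the arc
  spans more than 1, their end points interlace, and the Fashoda theorem makes them meet. The factor
  \<sigma> treats both sides of the axis alike.\<close>

lemma arcs_interlaced_on_axis_meet:
  fixes h :: "real \<Rightarrow> real \<times> real"
  assumes \<sigma>: "\<sigma> \<noteq> 0" and h: "path h" and upper: "\<And>s. s \<in> {0..1} \<Longrightarrow> \<sigma> * snd (h s) \<ge> 0"
    and s0: "snd (h 0) = 0" and s1: "snd (h 1) = 0" and gap: "fst (h 1) - fst (h 0) > 1"
  obtains s t where "s \<in> {0..1}" "t \<in> {0..1}" "h s = h t + (1, 0)"
proof -
  define vec where "vec = (\<lambda>z::real \<times> real. (\<chi> i. if i = 1 then fst z else \<sigma> * snd z) :: real ^ 2)"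
  have vec: "vec z $ 1 = fst z" "vec z $ 2 = \<sigma> * snd z" for z by (auto simp: vec_def)
  have vc: "continuous_on UNIV vec"
    unfolding vec_def
  proof (rule continuous_on_vec_lambda)
    fix i :: 2
    show "continuous_on UNIV (\<lambda>x. if i = 1 then fst x else \<sigma> * snd x)"
      by (cases "i = 1") (auto intro!: continuous_intros)
  qed
  define F where "F = (\<lambda>s. vec (h s))"
  define G where "G = (\<lambda>s. vec (h s + (1, 0)))"
  have pF: "path F" and pG: "path G"
    using h unfolding path_def F_def G_def by (auto intro!: continuous_on_compose2[OF vc] continuous_intros)
  have "bounded (path_image F \<union> path_image G)"
    using pF pG by (simp add: bounded_path_image)
  then obtain R where R: "\<And>x. x \<in> path_image F \<union> path_image G \<Longrightarrow> norm x \<le> R" by (auto simp: bounded_iff)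
  have R': "\<bar>x $ 1\<bar> \<le> R" "\<bar>x $ 2\<bar> \<le> R" if "x \<in> path_image F \<union> path_image G" for x
    using R[OF that] component_le_norm_cart[of x 1] component_le_norm_cart[of x 2] by auto
  define a where "a = (\<chi> i. if i = 1 then - R else 0 :: real ^ 2)"
  define b where "b = (\<chi> i. R :: real ^ 2)"
  have in_box: "x \<in> cbox a b" if "x \<in> path_image F \<union> path_image G" for x
  proof -
    have "x $ 2 \<ge> 0" using that upper by (auto simp: path_image_def F_def G_def vec)
    then show ?thesis using R'[OF that] by (auto simp: mem_box_cart a_def b_def forall_2)
  qed
  obtain z where z: "z \<in> path_image F" "z \<in> path_image G"
  proof (rule fashoda_interlace[OF pF pG, of a b])
    show "path_image F \<subseteq> cbox a b" "path_image G \<subseteq> cbox a b" using in_box by auto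
  qed (use s0 s1 gap in \<open>auto simp: pathstart_def pathfinish_def F_def G_def vec a_def\<close>)
  from z(1) obtain s where s: "s \<in> {0..1}" "z = vec (h s)" by (auto simp: path_image_def F_def)
  from z(2) obtain t where t: "t \<in> {0..1}" "z = vec (h t + (1, 0))" by (auto simp: path_image_def G_def)
  have st: "s \<in> {0..1}" "t \<in> {0..1}" "vec (h s) = vec (h t + (1, 0))" using s t by auto
  then have "vec (h s) $ 1 = vec (h t + (1, 0)) $ 1" "vec (h s) $ 2 = vec (h t + (1, 0)) $ 2" by simp_all
  then have "h s = h t + (1, 0)" using \<sigma> by (auto simp: vec prod_eq_iff)
  then show ?thesis using that st by blast
qed

text \<open>Otherwise a path in \<open>E\<close> between the two rays contains a piece that leaves
  the axis at an abscissa at least 1, returns to it at one at most -1 and stays on one side in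
  between. This piece spans more than 1, so it meets its unit translate.\<close>

lemma path_connected_meets_short_segment:
  assumes E: "path_connected E" and disj: "\<And>x. x \<in> E \<Longrightarrow> x + (1, 0) \<notin> E"
    and a: "(a, 0) \<in> E" "a > 0" and b: "(- b, 0) \<in> E" "b > (0::real)"
  obtains t :: real where "\<bar>t\<bar> < 1" "(t, 0::real) \<in> E"
proof (rule ccontr)
  assume c: "\<not> thesis"
  note out = that
  have far: "\<bar>t\<bar> \<ge> 1" if "(t, 0) \<in> E" for t using c out[of t] that by linarith
  obtain g where g: "path g" "path_image g \<subseteq> E" "pathstart g = (a, 0)" "pathfinish g = (- b, 0)"
    using E a b unfolding path_connected_def by blast
  have gE: "g s \<in> E" if "s \<in> {0..1}" for s using g(2) that by (auto simp: path_image_def)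
  have gc: "continuous_on {0..1} g" using g(1) by (simp add: path_def)
  have axis: "fst (g s) \<ge> 1 \<or> fst (g s) \<le> -1" if "s \<in> {0..1}" "snd (g s) = 0" for s
  proof -
    have "(fst (g s), 0) \<in> E" using gE[OF that(1)] that(2) by (metis prod.collapse)
    then show ?thesis using far by force
  qed
  \<comment> \<open>The piece runs from the last visit to the right part of the axis to the first
    visit to the left part after it.\<close>
  define S1 where "S1 = {0..1} \<inter> g -` {z. snd z = 0 \<and> 1 \<le> fst z}"
  have "compact S1"
    unfolding compact_eq_bounded_closed
  proof
    show "bounded S1" by (rule bounded_subset[of "{0..1}"]) (auto simp: S1_def)
    show "closed S1" unfolding S1_def
      by (intro continuous_closed_preimage gc closed_Collect_conj closed_Collect_eq closed_Collect_le continuous_intros closed_atLeastAtMost)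
  qed
  moreover have "0 \<in> S1" using g(3) axis[of 0] a by (auto simp: S1_def pathstart_def)
  ultimately obtain s0 where s0: "s0 \<in> S1" "\<And>s. s \<in> S1 \<Longrightarrow> s \<le> s0"
    using continuous_attains_sup[of S1 "\<lambda>s. s"] by (metis continuous_on_id empty_iff)
  define S2 where "S2 = {s0..1} \<inter> g -` {z. snd z = 0 \<and> fst z \<le> -1}"
  have "compact S2"
    unfolding compact_eq_bounded_closed
  proof
    show "bounded S2" by (rule bounded_subset[of "{s0..1}"]) (auto simp: S2_def)
    show "closed S2" unfolding S2_def
      by (intro continuous_closed_preimage continuous_on_subset[OF gc] closed_Collect_conj closed_Collect_eq closed_Collect_le continuous_intros)
        (use s0 in \<open>auto simp: S1_def\<close>)
  qed
  moreover have "1 \<in> S2" using g(4) axis[of 1] b s0 by (auto simp: S1_def S2_def pathfinish_def)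
  ultimately obtain s1 where s1: "s1 \<in> S2" "\<And>s. s \<in> S2 \<Longrightarrow> s1 \<le> s"
    using continuous_attains_inf[of S2 "\<lambda>s. s"] by (metis continuous_on_id empty_iff)
  have e0: "snd (g s0) = 0" "fst (g s0) \<ge> 1" "s0 \<in> {0..1}" using s0 by (auto simp: S1_def)
  have e1: "snd (g s1) = 0" "fst (g s1) \<le> -1" "s1 \<in> {0..1}" "s0 \<le> s1" using s1 e0 by (auto simp: S2_def)
  have nz: "snd (g s) \<noteq> 0" if "s \<in> {s0<..<s1}" for s
  proof
    assume z: "snd (g s) = 0"
    have s01: "s \<in> {0..1}" using that e0 e1 by auto
    from axis[OF s01 z] show False
    proof
      assume "1 \<le> fst (g s)"
      then have "s \<in> S1" using z s01 by (simp add: S1_def)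
      then show False using s0(2)[of s] that by simp
    next
      assume "fst (g s) \<le> -1"
      then have "s \<in> S2" using z s01 that by (simp add: S2_def)
      then show False using s1(2)[of s] that by simp
    qed
  qed
  have conn: "connected ((\<lambda>s. snd (g s)) ` {s0<..<s1})"
    by (intro connected_continuous_image continuous_intros continuous_on_subset[OF gc]) (use e0 e1 in auto)
  have "\<exists>\<sigma>\<in>{1, -1::real}. \<forall>s\<in>{s0..s1}. \<sigma> * snd (g s) \<ge> 0"
  proof (rule ccontr)
    assume n: "\<not> ?thesis"
    then obtain s s' where ss: "s \<in> {s0..s1}" "snd (g s) < 0" "s' \<in> {s0..s1}" "snd (g s') > 0"
      by (auto simp: not_le)
    then have "s \<in> {s0<..<s1}" "s' \<in> {s0<..<s1}" using e0 e1 by (auto simp: less_le)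
    then have "0 \<in> (\<lambda>s. snd (g s)) ` {s0<..<s1}"
      using conn ss unfolding connected_iff_interval by (metis imageI less_imp_le)
    then show False using nz by auto
  qed
  then obtain \<sigma> where \<sigma>: "\<sigma> \<in> {1, -1::real}" "\<And>s. s \<in> {s0..s1} \<Longrightarrow> \<sigma> * snd (g s) \<ge> 0" by blast
  \<comment> \<open>The piece is reversed, so that it runs from left to right as the interlacing
    lemma requires.\<close>
  define h where "h = (\<lambda>u. g (s1 + u * (s0 - s1)))"
  have rng: "s1 + u * (s0 - s1) \<in> {s0..s1}" if "u \<in> {0..1}" for u
  proof -
    have "0 \<le> u * (s1 - s0)" "u * (s1 - s0) \<le> 1 * (s1 - s0)" using that e1 mult_right_mono[of u 1 "s1 - s0"] by auto
    then show ?thesis by (auto simp: algebra_simps)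
  qed
  obtain s t where "s \<in> {0..1}" "t \<in> {0..1}" "h s = h t + (1, 0)"
  proof (rule arcs_interlaced_on_axis_meet[of \<sigma> h])
    show "path h" unfolding path_def h_def
      by (intro continuous_on_compose2[OF gc] continuous_intros) (use rng e0 e1 in force)
    show "\<sigma> * snd (h s) \<ge> 0" if "s \<in> {0..1}" for s unfolding h_def by (intro \<sigma>(2) rng that)
  qed (use \<sigma> e0 e1 in \<open>auto simp: h_def\<close>)
  moreover have "h s \<in> E" if "s \<in> {0..1}" for s
    unfolding h_def using rng[OF that] e0 e1 by (intro gE) auto
  ultimately show False using disj by metis
qed

text \<open>If some ray misses \<open>E\<close>, cut the plane along it; the arguments of points of
  \<open>E\<close> then form an interval. If its length were at most \<pi> + 2\<kappa>, the support
  of \<open>E\<close> in the direction opposite to the middle of the interval would be at most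
  \<open>C\<close> times \<kappa>, less than \<open>e\<close>. So the interval is longer and
  contains, for all directions near a suitable one, the direction and its opposite.\<close>

lemma opposite_rays_hit:
  fixes E :: "complex set"
  assumes E: "connected E" "0 \<notin> E" and bd: "\<And>z. z \<in> E \<Longrightarrow> norm z \<le> C"
    and hull: "\<And>\<theta>. \<exists>z\<in>E. Re (cnj (cis \<theta>) * z) \<ge> e" and \<kappa>: "0 < \<kappa>" "\<kappa> \<le> 1" and small: "C * \<kappa> < e"
  obtains \<phi> where "\<And>\<psi>. \<bar>\<psi> - \<phi>\<bar> < \<kappa> \<Longrightarrow> (\<exists>r>0. of_real r * cis \<psi> \<in> E) \<and> (\<exists>r>0. - (of_real r * cis \<psi>) \<in> E)"
proof -
  have minus: "- (of_real r * cis \<psi>) = of_real r * cis (\<psi> + pi)" for r \<psi>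
    by (simp add: cis_mult[symmetric] cis_pi)
  show ?thesis
  proof (cases "\<forall>\<psi>. \<exists>r>0. of_real r * cis \<psi> \<in> E")
    case True
    then show ?thesis using that[of 0] unfolding minus by blast
  next
    case False
    then obtain \<psi>0 where \<psi>0: "\<And>r. r > 0 \<Longrightarrow> of_real r * cis \<psi>0 \<notin> E" by blast
    \<comment> \<open>Turns the missed ray onto the negative real axis, the cut of the principal
      logarithm.\<close>
    define c where "c = cis (pi - \<psi>0)"
    define E' where "E' = (\<lambda>z. z * c) ` E"
    have cinv: "cis (\<psi>0 - pi) * c = 1" by (simp add: c_def cis_mult)
    have memE: "z * cis (\<psi>0 - pi) \<in> E" if "z \<in> E'" for z
    proof -
      from that obtain y where y: "y \<in> E" "z = y * c" by (auto simp: E'_def)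
      then have "z * cis (\<psi>0 - pi) = y" using cinv by (metis mult.assoc mult.commute mult.right_neutral)
      then show ?thesis using y(1) by simp
    qed
    have neg: "z \<notin> \<real>\<^sub>\<le>\<^sub>0" if "z \<in> E'" for z
    proof
      assume "z \<in> \<real>\<^sub>\<le>\<^sub>0"
      then obtain r where r: "z = of_real r" "r \<le> 0" by (auto simp: nonpos_Reals_def)
      have m: "z * cis (\<psi>0 - pi) \<in> E" by (rule memE[OF that])
      have "z * cis (\<psi>0 - pi) = of_real (- r) * cis \<psi>0"
        using r by (simp add: cis_divide[symmetric] cis_pi)
      then show False using m \<psi>0[of "- r"] r E(2) by (cases "r = 0") auto
    qed
    define A where "A = (\<lambda>z. Im (Ln z)) ` E'"
    have "connected E'" unfolding E'_def by (intro connected_continuous_image E continuous_intros)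
    then have "connected A" unfolding A_def by (intro connected_continuous_image continuous_intros) (use neg in auto)
    then have int: "\<And>x y z. x \<in> A \<Longrightarrow> y \<in> A \<Longrightarrow> x \<le> z \<Longrightarrow> z \<le> y \<Longrightarrow> z \<in> A"
      unfolding connected_iff_interval by blast
    have z0: "z \<noteq> 0" if "z \<in> E'" for z using neg[OF that] by auto
    have polar: "z = of_real (norm z) * cis (Im (Ln z))" if "z \<in> E'" for z
    proof -
      have "z = exp (Ln z)" using z0[OF that] by simp
      also have "\<dots> = of_real (exp (Re (Ln z))) * cis (Im (Ln z))" by (rule exp_eq_polar)
      finally show ?thesis using z0[OF that] by simp
    qed
    have Ab: "- pi \<le> x" "x \<le> pi" if "x \<in> A" for x
      using that z0 by (auto simp: A_def intro: less_imp_le mpi_less_Im_Ln Im_Ln_le_pi)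
    have "E \<noteq> {}" using hull by blast
    then have Ane: "A \<noteq> {}" by (simp add: A_def E'_def)
    have bA: "bdd_below A" "bdd_above A"
      by (rule bdd_belowI, erule Ab(1)) (rule bdd_aboveI, erule Ab(2))
    define a b where "a = Inf A" and "b = Sup A"
    have ab: "a \<le> x" "x \<le> b" if "x \<in> A" for x
      using that bA by (auto simp: a_def b_def intro: cInf_lower cSup_upper)
    have ray: "\<exists>r>0. of_real r * cis (\<theta> + \<psi>0 - pi) \<in> E" if r: "a < \<theta>" "\<theta> < b" for \<theta>
    proof -
      obtain x where x: "x \<in> A" "x < \<theta>" using cInf_lessD[OF Ane, of \<theta>] r by (auto simp: a_def)
      obtain y where y: "y \<in> A" "\<theta> < y" using less_cSupD[OF Ane, of \<theta>] r by (auto simp: b_def)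
      have "\<theta> \<in> A" using int[OF x(1) y(1)] x y by simp
      then obtain z where z: "z \<in> E'" "\<theta> = Im (Ln z)" by (auto simp: A_def)
      have "z * cis (\<psi>0 - pi) = of_real (norm z) * cis (\<theta> + \<psi>0 - pi)"
        by (subst polar[OF z(1)]) (simp add: z(2) cis_mult algebra_simps)
      then show ?thesis using memE[OF z(1)] z0[OF z(1)] by (intro exI[of _ "norm z"]) auto
    qed
    show ?thesis
    proof (cases "b - a > pi + 2 * \<kappa>")
      case True
      show ?thesis
      \<comment> \<open>The middle of the angles \<theta> for which both \<theta> and \<theta> +
        \<pi> lie between \<open>a\<close> and \<open>b\<close>, turned back.\<close>
      proof (rule that[of "(a + b - pi) / 2 + \<psi>0 - pi"])
        fix \<psi> assume \<psi>: "\<bar>\<psi> - ((a + b - pi) / 2 + \<psi>0 - pi)\<bar> < \<kappa>"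
        define \<theta> where "\<theta> = \<psi> - \<psi>0 + pi"
        have "\<bar>\<theta> - (a + b - pi) / 2\<bar> < \<kappa>" using \<psi> by (simp add: \<theta>_def algebra_simps)
        then have "a < \<theta>" "\<theta> + pi < b" using True by (auto simp: field_simps abs_less_iff)
        then have "\<exists>r>0. of_real r * cis (\<theta> + \<psi>0 - pi) \<in> E" "\<exists>r>0. of_real r * cis (\<theta> + pi + \<psi>0 - pi) \<in> E"
          by (intro ray; simp add: pi_gt_zero less_trans[of a \<theta>] less_trans[of \<theta> "\<theta> + pi" b])+
        then show "(\<exists>r>0. of_real r * cis \<psi> \<in> E) \<and> (\<exists>r>0. - (of_real r * cis \<psi>) \<in> E)"
          unfolding minus by (simp add: \<theta>_def algebra_simps)
      qed
    next
      case F: False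
      define m where "m = (a + b) / 2"
      obtain z where z: "z \<in> E" "Re (cnj (cis (m + \<psi>0)) * z) \<ge> e" using hull by blast
      define y where "y = z * c"
      have y: "y \<in> E'" using z by (auto simp: y_def E'_def)
      have "z = y * cis (\<psi>0 - pi)" using cinv by (simp add: y_def mult.commute mult.left_commute)
      then have "z = of_real (norm y) * cis (Im (Ln y)) * cis (\<psi>0 - pi)" using polar[OF y] by simp
      then have "cnj (cis (m + \<psi>0)) * z = of_real (norm y) * cis (Im (Ln y) - m - pi)"
        by (simp add: cis_cnj cis_mult algebra_simps)
      then have Re: "Re (cnj (cis (m + \<psi>0)) * z) = norm y * cos (Im (Ln y) - m - pi)" by simp
      have "Im (Ln y) \<in> A" using y by (auto simp: A_def)
      then have d: "\<bar>Im (Ln y) - m\<bar> \<le> pi / 2 + \<kappa>" using ab[of "Im (Ln y)"] F by (auto simp: m_def field_simps abs_le_iff)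
      have "cos (Im (Ln y) - m - pi) = - cos \<bar>Im (Ln y) - m\<bar>"
        by (simp add: cos_diff)
      also have "cos \<bar>Im (Ln y) - m\<bar> \<ge> cos (pi / 2 + \<kappa>)"
        using d \<kappa> pi_gt3 by (intro cos_monotone_0_pi_le) auto
      then have "- cos \<bar>Im (Ln y) - m\<bar> \<le> sin \<kappa>" by (simp add: cos_add)
      also have "sin \<kappa> \<le> \<kappa>" using \<kappa> by (simp add: sin_x_le_x)
      finally have "norm y * cos (Im (Ln y) - m - pi) \<le> norm y * \<kappa>" by (intro mult_left_mono) auto
      also have "norm y * \<kappa> = norm z * \<kappa>" by (simp add: y_def c_def norm_mult)
      also have "norm z * \<kappa> \<le> C * \<kappa>" using bd[OF z(1)] \<kappa> by (intro mult_right_mono) auto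
      finally show ?thesis using z(2) Re small by linarith
    qed
  qed
qed

text \<open>Rounding a vector of large length \<open>B\<close> changes it by at most 2 and hence
  turns it by less than \<kappa>; \<open>R\<close> serves all directions.\<close>

lemma integer_direction:
  assumes "\<kappa> > 0"
  shows "\<exists>R. \<forall>\<phi>. \<exists>w. w \<noteq> 0 \<and> norm (zv w) \<le> R \<and> (\<exists>\<psi> r. \<bar>\<psi> - \<phi>\<bar> < \<kappa> \<and> r > 0 \<and> zv w = r *\<^sub>R (cos \<psi>, sin \<psi>))"
proof -
  have "isCont Arg 1" by (rule continuous_at_Arg) auto
  then obtain d where d: "d > 0" "\<And>z. dist z 1 < d \<Longrightarrow> dist (Arg z) (Arg 1) < \<kappa>"
    unfolding continuous_at_eps_delta using assms by metis
  obtain B0 :: nat where B0: "real B0 > 2 / d + 2" using reals_Archimedean2 by blast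
  define B where "B = real B0"
  have "2 / d > 0" using d by simp
  then have B: "B > 2 / d" "B > 2" using B0 unfolding B_def by linarith+
  show ?thesis
  proof (rule exI[of _ "B + 2"], rule allI)
    fix \<phi>
    define w where "w = (\<lfloor>B * cos \<phi>\<rfloor>, \<lfloor>B * sin \<phi>\<rfloor>)"
    define wc where "wc = Complex (of_int (fst w)) (of_int (snd w))"
    have "norm (wc - of_real B * cis \<phi>) \<le> \<bar>Re (wc - of_real B * cis \<phi>)\<bar> + \<bar>Im (wc - of_real B * cis \<phi>)\<bar>"
      by (rule cmod_le)
    also have "\<dots> \<le> 1 + 1" by (intro add_mono; simp add: wc_def w_def; linarith)
    finally have n2: "norm (wc - of_real B * cis \<phi>) \<le> 2" by simp
    define \<zeta> where "\<zeta> = wc * cis (- \<phi>) / of_real B"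
    have wz: "wc = of_real B * \<zeta> * cis \<phi>" using B by (simp add: \<zeta>_def cis_mult mult.assoc)
    have "\<zeta> - 1 = (wc - of_real B * cis \<phi>) * cis (- \<phi>) / of_real B"
      using B by (simp add: \<zeta>_def field_simps cis_mult)
    then have "norm (\<zeta> - 1) = norm (wc - of_real B * cis \<phi>) / B" using B by (simp add: norm_mult norm_divide)
    then have n1: "norm (\<zeta> - 1) \<le> 2 / B" using n2 B by (simp add: divide_right_mono)
    moreover have "2 / B < d" "2 / B < 1" using B d by (auto simp: field_simps)
    ultimately have "dist \<zeta> 1 < d" "\<zeta> \<noteq> 0" by (auto simp: dist_norm)
    then have A: "\<bar>Arg \<zeta>\<bar> < \<kappa>" using d(2)[of \<zeta>] by (simp add: dist_real_def)
    have nz: "norm \<zeta> > 0" using \<open>\<zeta> \<noteq> 0\<close> by simp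
    have "\<zeta> = of_real (norm \<zeta>) * cis (Arg \<zeta>)" by (metis rcis_cmod_Arg rcis_def)
    then have "wc = of_real (B * norm \<zeta>) * cis (Arg \<zeta> + \<phi>)" using wz by (simp add: cis_mult[symmetric] mult.assoc)
    then have eq: "Re wc = B * norm \<zeta> * cos (Arg \<zeta> + \<phi>)" "Im wc = B * norm \<zeta> * sin (Arg \<zeta> + \<phi>)"
      by (metis Re_complex_of_real Im_complex_of_real Re_complex_div_eq_0 cis.sel complex_scaleR scaleR_conv_of_real complex.sel cis_conv_exp mult.commute scaleR_complex.sel)+
    have zw: "zv w = (B * norm \<zeta>) *\<^sub>R (cos (Arg \<zeta> + \<phi>), sin (Arg \<zeta> + \<phi>))"
      using eq by (simp add: zv_def wc_def)
    have "norm (zv w) = norm wc" by (simp add: norm_prod_def wc_def cmod_def)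
    also have "\<dots> \<le> norm (wc - of_real B * cis \<phi>) + norm (of_real B * cis \<phi>)" by (metis diff_add_cancel norm_triangle_ineq)
    also have "\<dots> \<le> B + 2" using n2 B by (simp add: norm_mult)
    finally have "norm (zv w) \<le> B + 2" .
    moreover have "w \<noteq> 0"
    proof
      assume "w = 0"
      then have "wc = 0" by (simp add: wc_def complex_eq_iff)
      then show False using wz nz B by simp
    qed
    ultimately show "\<exists>w. w \<noteq> 0 \<and> norm (zv w) \<le> B + 2 \<and> (\<exists>\<psi> r. \<bar>\<psi> - \<phi>\<bar> < \<kappa> \<and> r > 0 \<and> zv w = r *\<^sub>R (cos \<psi>, sin \<psi>))"
      using zw A nz B by (intro exI[of _ w] conjI exI[of _ "Arg \<zeta> + \<phi>"] exI[of _ "B * norm \<zeta>"]) auto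
  qed
qed

text \<open>Bezout coefficients of the primitive vector \<open>w0\<close> provide integer
  coordinates of determinant 1 in which it is the first basis vector.\<close>

lemma unimodular_coordinates:
  fixes w :: "int \<times> int"
  assumes "w \<noteq> 0"
  obtains g w0 L where "g > 0" "w = imul g w0" "w0 \<noteq> 0" "linear (L :: real \<times> real \<Rightarrow> real \<times> real)" "inj L" "L (zv w0) = (1, 0)"
proof -
  define g where "g = gcd (fst w) (snd w)"
  have g: "g > 0" using assms by (auto simp: g_def prod_eq_iff gcd_pos_int)
  define w0 where "w0 = (fst w div g, snd w div g)"
  have w: "w = imul g w0" by (simp add: w0_def g_def imul_def)
  have "coprime (fst w0) (snd w0)"
    unfolding w0_def g_def fst_conv snd_conv using assms by (intro div_gcd_coprime) (auto simp: prod_eq_iff)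
  then have "gcd (fst w0) (snd w0) = 1" by simp
  then obtain x y where xy: "x * fst w0 + y * snd w0 = 1" using bezout_int[of "fst w0" "snd w0"] by auto
  then have xyr: "real_of_int x * of_int (fst w0) + of_int y * of_int (snd w0) = 1"
    by (metis of_int_1 of_int_add of_int_mult)
  define L where "L = (\<lambda>z::real \<times> real. (fst z * of_int x + snd z * of_int y, of_int (fst w0) * snd z - of_int (snd w0) * fst z))"
  show ?thesis
  proof (rule that[OF g w])
    show "w0 \<noteq> 0" using xy by auto
    show "linear L" by (rule linearI) (auto simp: L_def algebra_simps)
    show "inj L"
    proof (rule injI)
      fix a b assume "L a = L b"
      then have e: "fst a * of_int x + snd a * of_int y = fst b * of_int x + snd b * of_int y"
        "of_int (fst w0) * snd a - of_int (snd w0) * fst a = of_int (fst w0) * snd b - of_int (snd w0) * fst b"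
        by (auto simp: L_def)
      have "fst a = fst b" "snd a = snd b" using e xyr by algebra+
      then show "a = b" by (simp add: prod_eq_iff)
    qed
    show "L (zv w0) = (1, 0)" using xyr by (simp add: L_def mult.commute)
  qed
qed

lemma half_open_square_representative:
  obtains y v where "y \<in> {0..<1} \<times> {0..<1}" "x = y + zv v"
proof (rule that[of "(frac (fst x), frac (snd x))" "(\<lfloor>fst x\<rfloor>, \<lfloor>snd x\<rfloor>)"])
  show "(frac (fst x), frac (snd x)) \<in> {0..<1} \<times> {0..<1}"
    by (auto simp: frac_ge_0 frac_lt_1)
qed (simp add: prod_eq_iff frac_def)

text \<open>The order of quantifiers matters: \<open>R\<close> depends on \<kappa> alone, so one
  \<open>R\<close> serves all iterates of a map, whose displacement bound \<open>C\<close> and hull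
  radius \<open>e\<close> grow at the same rate. The image of the unit square meets the line of a
  short integer vector \<open>w\<close> on both sides of the origin. Being disjoint from its lattice
  translates, it meets this line no farther from the origin than the primitive vector of
  \<open>w\<close>.\<close>

lemma bounded_return:
  assumes \<kappa>: "\<kappa> > 0"
  shows "\<exists>R. \<forall>\<phi> \<phi>i C e. lift_map \<phi> \<phi>i \<longrightarrow> (\<forall>x. norm (\<phi> x - x) \<le> C) \<longrightarrow>
      (\<forall>\<nu>. norm \<nu> = 1 \<longrightarrow> (\<exists>x. \<nu> \<bullet> (\<phi> x - x) \<ge> e)) \<longrightarrow> e \<ge> \<kappa> * C \<longrightarrow> e \<ge> 4 + \<kappa> \<longrightarrow> (\<exists>x. norm (\<phi> x - x) \<le> R)"
proof -
  define \<kappa>0 where "\<kappa>0 = min (\<kappa> / 4) 1"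
  have \<kappa>0: "0 < \<kappa>0" "\<kappa>0 \<le> 1" "\<kappa>0 \<le> \<kappa> / 4" using \<kappa> by (auto simp: \<kappa>0_def)
  obtain R where R: "\<forall>\<phi>. \<exists>w. w \<noteq> 0 \<and> norm (zv w) \<le> R \<and> (\<exists>\<psi> r. \<bar>\<psi> - \<phi>\<bar> < \<kappa>0 \<and> r > 0 \<and> zv w = r *\<^sub>R (cos \<psi>, sin \<psi>))"
    using integer_direction[OF \<kappa>0(1)] by (elim exE)
  have R0: "R \<ge> 0" using spec[OF R, of 0] by (meson norm_ge_zero order_trans)
  show ?thesis
  proof (rule exI[of _ "R + 2"], intro allI impI)
    fix \<phi> \<phi>i :: "real \<times> real \<Rightarrow> real \<times> real" and C e :: real
    assume lm: "lift_map \<phi> \<phi>i" and bd': "\<forall>x. norm (\<phi> x - x) \<le> C"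
      and hull': "\<forall>\<nu>. norm \<nu> = 1 \<longrightarrow> (\<exists>x. \<nu> \<bullet> (\<phi> x - x) \<ge> e)" and e: "e \<ge> \<kappa> * C" "e \<ge> 4 + \<kappa>"
    note bd = spec[OF bd'] and hull = hull'[rule_format]
    interpret lift_map \<phi> \<phi>i by fact
    \<comment> \<open>Half-open, so that distinct lattice translates of the square are
      disjoint.\<close>
    define D where "D = ({0..<1} \<times> {0..<1} :: (real \<times> real) set)"
    have Dn: "norm x \<le> 2" if "x \<in> D" for x
    proof -
      have "norm x \<le> \<bar>fst x\<bar> + \<bar>snd x\<bar>" using dist_prod_le_sum[of x 0] by (simp add: dist_norm)
      then show ?thesis using that by (auto simp: D_def mem_Times_iff)
    qed
    have close: "norm (\<phi> x - x) \<le> R + 2" if "x \<in> D" "norm (\<phi> x) \<le> R" for x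
      using norm_triangle_ineq4[of "\<phi> x" x] Dn[OF that(1)] that(2) by linarith
    show "\<exists>x. norm (\<phi> x - x) \<le> R + 2"
    proof (cases "0 \<in> \<phi> ` D")
      case True
      then obtain x where "x \<in> D" "\<phi> x = 0" by auto
      then show ?thesis using close[of x] R0 by (intro exI[of _ x]) auto
    next
      case False
      define cx where "cx = (\<lambda>z::real \<times> real. Complex (fst z) (snd z))"
      have cxn: "norm (cx z) = norm z" for z by (simp add: cx_def cmod_def norm_prod_def)
      have cxc: "continuous_on UNIV cx"
        unfolding cx_def Complex_eq by (intro continuous_intros)
      have cxi: "cx a = cx b \<longleftrightarrow> a = b" for a b by (auto simp: cx_def prod_eq_iff)
      have cD: "connected D" "path_connected D" unfolding D_def
        by (auto intro!: convex_connected convex_imp_path_connected convex_Times)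
      define E where "E = cx ` \<phi> ` D"
      have E1: "connected E" unfolding E_def
        by (intro connected_continuous_image continuous_on_subset[OF cxc] continuous_on_subset[OF cont] cD) auto
      have E2: "0 \<notin> E"
      proof
        assume "0 \<in> E"
        then obtain z where "0 = cx z" "z \<in> \<phi> ` D" unfolding E_def by (rule imageE)
        then have "z = 0" by (simp add: cx_def complex_eq_iff prod_eq_iff)
        then show False using False \<open>z \<in> \<phi> ` D\<close> by simp
      qed
      have E3: "norm z \<le> C + 2" if z: "z \<in> E" for z
      proof -
        from z obtain x where "x \<in> D" "z = cx (\<phi> x)" by (auto simp: E_def)
        then show ?thesis using bd[of x] Dn[of x] norm_triangle_ineq[of "\<phi> x - x" x] cxn by simp
      qed
      have E4: "\<exists>z\<in>E. Re (cnj (cis \<theta>) * z) \<ge> e - 2" for \<theta>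
      proof -
        define \<nu> where "\<nu> = (cos \<theta>, sin \<theta>)"
        have n1: "norm \<nu> = 1" by (simp add: \<nu>_def norm_prod_def)
        obtain x where x: "\<nu> \<bullet> (\<phi> x - x) \<ge> e" using hull[OF n1] by blast
        obtain y v where y: "y \<in> D" "x = y + zv v" unfolding D_def by (rule half_open_square_representative)
        have "\<nu> \<bullet> (\<phi> y - y) \<ge> e" using x by (simp add: y comm)
        moreover have "\<bar>\<nu> \<bullet> y\<bar> \<le> 2" using Cauchy_Schwarz_ineq2[of \<nu> y] n1 Dn[OF y(1)] by simp
        ultimately have "\<nu> \<bullet> \<phi> y \<ge> e - 2" by (simp add: inner_diff_right)
        moreover have "Re (cnj (cis \<theta>) * cx (\<phi> y)) = \<nu> \<bullet> \<phi> y" by (simp add: \<nu>_def cx_def inner_prod_def)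
        ultimately show ?thesis using y(1) by (intro bexI[of _ "cx (\<phi> y)"]) (auto simp: E_def)
      qed
      have C0: "C \<ge> 0" using bd[of 0] norm_ge_zero order_trans by blast
      \<comment> \<open>The bound by \<kappa> times \<open>C\<close> handles the main term; the
        bound 4 + \<kappa> absorbs the two corrections by 2 that come from the size of the
        square.\<close>
      have small: "(C + 2) * \<kappa>0 < e - 2"
      proof -
        have "(C + 2) * \<kappa>0 \<le> (C + 2) * (\<kappa> / 4)" using \<kappa>0 C0 by (intro mult_left_mono) auto
        also have "\<dots> = \<kappa> * C / 4 + \<kappa> / 2" by (simp add: field_simps)
        also have "\<dots> < e - 2" using e \<kappa> by linarith
        finally show ?thesis .
      qed
      obtain \<phi>0 where \<phi>0: "\<And>\<psi>. \<bar>\<psi> - \<phi>0\<bar> < \<kappa>0 \<Longrightarrow> (\<exists>r>0. of_real r * cis \<psi> \<in> E) \<and> (\<exists>r>0. - (of_real r * cis \<psi>) \<in> E)"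
        using opposite_rays_hit[OF E1 E2 E3 E4 \<kappa>0(1,2) small] by blast
      obtain w \<psi> r where w: "w \<noteq> 0" "norm (zv w) \<le> R" "\<bar>\<psi> - \<phi>0\<bar> < \<kappa>0" "r > 0" "zv w = r *\<^sub>R (cos \<psi>, sin \<psi>)"
        using spec[OF R, of \<phi>0] by blast
      obtain r1 r2 where r12: "r1 > 0" "r2 > 0" "of_real r1 * cis \<psi> \<in> E" "- (of_real r2 * cis \<psi>) \<in> E"
        using \<phi>0[OF w(3)] by blast
      have cxs: "cx (s *\<^sub>R zv w) = of_real (s * r) * cis \<psi>" for s
        by (simp add: cx_def w(5) complex_eq_iff)
      have mem: "z \<in> \<phi> ` D" if "cx z \<in> E" for z
      proof -
        from that obtain y where "cx z = cx y" "y \<in> \<phi> ` D" unfolding E_def by (rule imageE)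
        then show ?thesis by (simp only: cxi)
      qed
      have h1: "(r1 / r) *\<^sub>R zv w \<in> \<phi> ` D" by (rule mem) (unfold cxs, use r12 w(4) in simp)
      have h2: "(- (r2 / r)) *\<^sub>R zv w \<in> \<phi> ` D" by (rule mem) (unfold cxs, use r12 w(4) in simp)
      obtain g w0 L where gw: "g > 0" "w = imul g w0" "w0 \<noteq> 0" "linear (L :: real \<times> real \<Rightarrow> real \<times> real)" "inj L" "L (zv w0) = (1, 0)"
        using unimodular_coordinates[OF w(1)] by blast
      have Lw: "L (s *\<^sub>R zv w) = (s * of_int g, 0)" for s
        using gw(6) by (simp add: gw(2) zv_imul linear_scale[OF gw(4)])
      have Lc: "continuous_on UNIV L" using gw(4) by (simp add: linear_continuous_on linear_conv_bounded_linear)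
      obtain t where t: "\<bar>t\<bar> < 1" "(t, 0) \<in> L ` \<phi> ` D"
      proof (rule path_connected_meets_short_segment[of "L ` \<phi> ` D" "r1 / r * of_int g" "r2 / r * of_int g"])
        show "path_connected (L ` \<phi> ` D)"
          by (intro path_connected_continuous_image continuous_on_subset[OF Lc] continuous_on_subset[OF cont] cD) auto
        show "(r1 / r * of_int g, 0) \<in> L ` \<phi> ` D" using h1 Lw by (metis imageI)
        show "(- (r2 / r * of_int g), 0) \<in> L ` \<phi> ` D" using h2 Lw[of "- (r2 / r)"] by (metis imageI mult_minus_left)
        show "x + (1, 0) \<notin> L ` \<phi> ` D" if x: "x \<in> L ` \<phi> ` D" for x
        proof
          assume "x + (1, 0) \<in> L ` \<phi> ` D"
          then obtain a b where ab: "a \<in> D" "b \<in> D" "L (\<phi> a) + (1, 0) = L (\<phi> b)" using x by auto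
          then have "L (\<phi> (a + zv w0)) = L (\<phi> b)" using gw(6) by (simp add: comm linear_add[OF gw(4)])
          then have "a + zv w0 = b" using gw(5) by (simp add: inj_eq)
          then have "\<bar>real_of_int (fst w0)\<bar> < 1" "\<bar>real_of_int (snd w0)\<bar> < 1" using ab(1,2) by (auto simp: D_def mem_Times_iff)
          then have "fst w0 = 0" "snd w0 = 0" by linarith+
          then show False using gw(3) by (simp add: prod_eq_iff)
        qed
      qed (use r12 w gw in auto)
      then obtain x where x: "x \<in> D" "L (\<phi> x) = (t, 0)" by auto
      have "L (t *\<^sub>R zv w0) = (t, 0)" using gw(6) by (simp add: linear_scale[OF gw(4)])
      then have "\<phi> x = t *\<^sub>R zv w0" using x gw(5) by (metis injD)
      then have "norm (\<phi> x) = \<bar>t\<bar> * norm (zv w0)" by simp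
      also have "\<dots> \<le> 1 * norm (zv w0)" using t by (intro mult_right_mono) auto
      also have "\<dots> \<le> of_int g * norm (zv w0)" using gw by (intro mult_right_mono) auto
      also have "\<dots> = norm (zv w)" using gw by (simp add: gw(2) zv_imul)
      finally show ?thesis using close[OF x(1)] w(2) by (intro exI[of _ x]) auto
    qed
  qed
qed

section \<open>From displacement hulls to rotation vectors\<close>

context lift_map
begin

lemma funpow_displacement:
  assumes "\<And>x. norm (f x - x) \<le> B"
  shows "norm ((f ^^ n) x - x) \<le> real n * B"
proof (induction n)
  case (Suc n)
  have "norm ((f ^^ Suc n) x - x) \<le> norm (f ((f ^^ n) x) - (f ^^ n) x) + norm ((f ^^ n) x - x)"
    using norm_triangle_ineq[of "f ((f ^^ n) x) - (f ^^ n) x" "(f ^^ n) x - x"] by simp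
  then show ?case using Suc assms[of "(f ^^ n) x"] by (simp add: algebra_simps)
qed simp

lemma funpow_translate: "((\<lambda>x. f x + zv w) ^^ n) x = (f ^^ n) x + real n *\<^sub>R zv w"
proof (induction n)
  case (Suc n)
  have "real n *\<^sub>R zv w = zv (imul (int n) w)" by (simp add: zv_imul)
  then show ?case using Suc by (simp add: comm algebra_simps)
qed simp

text \<open>\<open>bounded_return\<close> is applied to the iterates of \<open>f ^^ k\<close> minus
  \<open>v\<close>. Displacement bound and hull radius both grow linearly in \<open>n\<close>, so a
  single \<open>R\<close> bounds some displacement of every large iterate; divided by k * n these
  displacements tend to 0.\<close>

lemma rational_point_in_rotation_set:
  fixes v :: "int \<times> int" and k :: nat
  assumes k: "k \<ge> 1" and \<epsilon>: "\<epsilon> > 0"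
    and hull: "\<And>n \<nu>. n \<ge> 1 \<Longrightarrow> norm \<nu> = 1 \<Longrightarrow> \<exists>x. \<nu> \<bullet> ((f ^^ n) x - x) \<ge> real n * (\<nu> \<bullet> ((1 / real k) *\<^sub>R zv v) + \<epsilon>)"
  shows "(1 / real k) *\<^sub>R zv v \<in> rotation_set f"
proof -
  define g gi where "g = (\<lambda>x. (f ^^ k) x + zv (- v))" and "gi = (\<lambda>x. (fi ^^ k) (x - zv (- v)))"
  interpret fk: lift_map "f ^^ k" "fi ^^ k" by (rule funpow)
  have lg: "lift_map g gi" unfolding g_def gi_def by (rule fk.translate)
  interpret g: lift_map g gi by (rule lg)
  obtain B where B: "B \<ge> 0" "\<And>x. dist (g x) x \<le> B" using g.bounded_displacement by blast
  have gn: "(g ^^ n) x = (f ^^ (k * n)) x - real n *\<^sub>R zv v" for n x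
    using fk.funpow_translate[where w = "- v" and n = n and x = x] by (simp add: g_def zv_uminus funpow_mult)
  have "B + 1 > 0" using B by simp
  then have \<kappa>: "real k * \<epsilon> / (B + 1) > 0" (is "?\<kappa> > 0") using k \<epsilon> by simp
  obtain R where R: "\<forall>\<phi> \<phi>i C e. lift_map \<phi> \<phi>i \<longrightarrow> (\<forall>x. norm (\<phi> x - x) \<le> C) \<longrightarrow>
      (\<forall>\<nu>. norm \<nu> = 1 \<longrightarrow> (\<exists>x. \<nu> \<bullet> (\<phi> x - x) \<ge> e)) \<longrightarrow> e \<ge> ?\<kappa> * C \<longrightarrow> e \<ge> 4 + ?\<kappa> \<longrightarrow> (\<exists>x. norm (\<phi> x - x) \<le> R)"
    using bounded_return[OF \<kappa>] by (elim exE)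
  have ret: "\<exists>x. norm ((g ^^ n) x - x) \<le> R" if n: "n \<ge> 1" "real n * (real k * \<epsilon>) \<ge> 4 + ?\<kappa>" for n
  proof (rule R[rule_format, OF g.funpow, where e = "real n * (real k * \<epsilon>)" and C = "real n * B"])
    show "norm ((g ^^ n) x - x) \<le> real n * B" for x
      using B by (intro g.funpow_displacement) (simp add: dist_norm)
    fix \<nu> :: "real \<times> real" assume \<nu>: "norm \<nu> = 1"
    have "k * n \<ge> 1" using k n by simp
    then obtain x where x: "\<nu> \<bullet> ((f ^^ (k * n)) x - x) \<ge> real (k * n) * (\<nu> \<bullet> ((1 / real k) *\<^sub>R zv v) + \<epsilon>)"
      using hull \<nu> by blast
    have "real (k * n) * (\<nu> \<bullet> ((1 / real k) *\<^sub>R zv v) + \<epsilon>) = real n * (\<nu> \<bullet> zv v) + real n * (real k * \<epsilon>)"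
      using k by (simp add: field_simps)
    then show "\<exists>x. \<nu> \<bullet> ((g ^^ n) x - x) \<ge> real n * (real k * \<epsilon>)"
      using x by (intro exI[of _ x]) (simp add: gn inner_diff_right)
  next
    have "?\<kappa> * (real n * B) \<le> ?\<kappa> * (real n * (B + 1))" using \<kappa> by (intro mult_left_mono) auto
    also have "\<dots> = real n * (real k * \<epsilon>)" using \<open>B + 1 > 0\<close> by simp
    finally show "real n * (real k * \<epsilon>) \<ge> ?\<kappa> * (real n * B)" .
  qed (use n in auto)
  show ?thesis
    unfolding rotation_set_def
  proof (intro INT_I)
    fix m :: nat assume "m \<in> {1..}"
    show "(1 / real k) *\<^sub>R zv v \<in> closure (\<Union>n\<in>{m..}. {((f ^^ n) x - x) /\<^sub>R real n |x. True})"
      unfolding closure_approachable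
    proof (intro allI impI)
      fix e :: real assume e: "e > 0"
      obtain n :: nat where n: "real n > real m + 1 + (4 + ?\<kappa>) / (real k * \<epsilon>) + \<bar>R\<bar> / (real k * e)" using reals_Archimedean2 by blast
      have p: "(4 + ?\<kappa>) / (real k * \<epsilon>) > 0" "\<bar>R\<bar> / (real k * e) \<ge> 0" using \<kappa> k \<epsilon> e by auto
      then have n': "real n \<ge> real m + 1" "real n \<ge> (4 + ?\<kappa>) / (real k * \<epsilon>)" "real n > \<bar>R\<bar> / (real k * e)" using n by linarith+
      then have n1: "n \<ge> 1" "n \<ge> m" by linarith+
      have "real n * (real k * \<epsilon>) \<ge> 4 + ?\<kappa>" using n'(2) k \<epsilon> by (simp add: pos_divide_le_eq)
      then obtain x where x: "norm ((g ^^ n) x - x) \<le> R" using ret n1 by blast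
      have kn: "k * n \<ge> m" using n1 k by (metis One_nat_def le_trans mult_le_mono1 nat_mult_1)
      have "((f ^^ (k * n)) x - x) /\<^sub>R real (k * n) - (1 / real k) *\<^sub>R zv v = ((g ^^ n) x - x) /\<^sub>R real (k * n)"
        using k n1 by (simp add: gn algebra_simps divide_inverse_commute)
      then have "dist (((f ^^ (k * n)) x - x) /\<^sub>R real (k * n)) ((1 / real k) *\<^sub>R zv v) = norm ((g ^^ n) x - x) / real (k * n)"
        by (simp add: dist_norm divide_inverse_commute)
      also have "\<dots> \<le> \<bar>R\<bar> / real (k * n)" using x by (intro divide_right_mono) auto
      also have "\<dots> < e" using n'(3) k n1 e by (simp add: field_simps)
      finally show "\<exists>y\<in>\<Union>n\<in>{m..}. {((f ^^ n) x - x) /\<^sub>R real n |x. True}. dist y ((1 / real k) *\<^sub>R zv v) < e"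
        using kn by blast
    qed
  qed
qed

text \<open>Seen from the centroid \<open>G\<close>, the triangle has a support function with a
  positive minimum on the unit circle. One half of it is the radius of a ball about
  \<open>G\<close>, the other half remains as hull radius for each rational point of this ball.
  These points are dense in the ball, and the rotation set is closed.\<close>

lemma realizable_noncollinear:
  assumes P: "realizable P1" "realizable P2" "realizable P3"
    and nc: "\<And>\<nu>. \<nu> \<bullet> (P1 - P2) = 0 \<Longrightarrow> \<nu> \<bullet> (P1 - P3) = 0 \<Longrightarrow> \<nu> = 0"
  shows "interior (rotation_set f) \<noteq> {}"
proof -
  define G where "G = (1 / 3) *\<^sub>R (P1 + P2 + P3)"
  define h where "h = (\<lambda>\<nu>. max (\<nu> \<bullet> (P1 - G)) (max (\<nu> \<bullet> (P2 - G)) (\<nu> \<bullet> (P3 - G))))"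
  have "compact (sphere (0::real \<times> real) 1)" by simp
  moreover have "sphere (0::real \<times> real) 1 \<noteq> {}" by simp
  moreover have "continuous_on (sphere 0 1) h" unfolding h_def by (intro continuous_intros)
  ultimately have "\<exists>\<nu>0\<in>sphere 0 1. \<forall>\<nu>\<in>sphere 0 1. h \<nu>0 \<le> h \<nu>"
    by (rule continuous_attains_inf)
  then obtain \<nu>0 where "\<nu>0 \<in> sphere 0 1" "\<forall>\<nu>\<in>sphere 0 1. h \<nu>0 \<le> h \<nu>" by (elim bexE)
  then have \<nu>0: "norm \<nu>0 = 1" "\<And>\<nu>. norm \<nu> = 1 \<Longrightarrow> h \<nu>0 \<le> h \<nu>"
    by (simp_all only: mem_sphere_0)
  have pos: "h \<nu>0 > 0"
  proof (rule ccontr)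
    assume "\<not> ?thesis"
    then have le: "\<nu>0 \<bullet> (P1 - G) \<le> 0" "\<nu>0 \<bullet> (P2 - G) \<le> 0" "\<nu>0 \<bullet> (P3 - G) \<le> 0" by (auto simp: h_def)
    have "(P1 - G) + (P2 - G) + (P3 - G) = 0" by (simp add: G_def scaleR_add_right prod_eq_iff)
    then have "\<nu>0 \<bullet> (P1 - G) + \<nu>0 \<bullet> (P2 - G) + \<nu>0 \<bullet> (P3 - G) = 0" by (metis inner_add_right inner_zero_right)
    then have "\<nu>0 \<bullet> (P1 - G) = 0" "\<nu>0 \<bullet> (P2 - G) = 0" "\<nu>0 \<bullet> (P3 - G) = 0" using le by linarith+
    then have "\<nu>0 \<bullet> (P1 - P2) = 0" "\<nu>0 \<bullet> (P1 - P3) = 0" by (auto simp: inner_diff_right)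
    then have "\<nu>0 = 0" by (rule nc)
    then show False using \<nu>0 by simp
  qed
  define \<epsilon> where "\<epsilon> = h \<nu>0 / 2"
  have \<epsilon>: "\<epsilon> > 0" using pos by (simp add: \<epsilon>_def)
  have rat: "(1 / real k) *\<^sub>R zv v \<in> rotation_set f" if k: "k \<ge> 1" and d: "dist ((1 / real k) *\<^sub>R zv v) G < \<epsilon>" for k :: nat and v
  proof (rule rational_point_in_rotation_set[OF k \<epsilon>])
    fix n :: nat and \<nu> :: "real \<times> real" assume n: "1 \<le> n" and \<nu>: "norm \<nu> = 1"
    let ?r = "(1 / real k) *\<^sub>R zv v"
    have "\<nu> \<bullet> (?r - G) \<le> \<epsilon>" using norm_cauchy_schwarz[of \<nu> "?r - G"] \<nu> d by (simp add: dist_norm)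
    then have "\<nu> \<bullet> ?r + \<epsilon> \<le> \<nu> \<bullet> G + h \<nu>" using \<nu>0(2)[OF \<nu>] pos unfolding \<epsilon>_def inner_diff_right by linarith
    moreover have "\<nu> \<bullet> G + h \<nu> = \<nu> \<bullet> P1 \<or> \<nu> \<bullet> G + h \<nu> = \<nu> \<bullet> P2 \<or> \<nu> \<bullet> G + h \<nu> = \<nu> \<bullet> P3"
      by (auto simp: h_def max_def inner_diff_right)
    ultimately obtain Q where Q: "realizable Q" "\<nu> \<bullet> ?r + \<epsilon> \<le> \<nu> \<bullet> Q" using P by metis
    obtain x where x: "\<nu> \<bullet> ((f ^^ n) x - x) \<ge> real n * (\<nu> \<bullet> Q)" using Q(1) n unfolding realizable_def by blast
    have "real n * (\<nu> \<bullet> ?r + \<epsilon>) \<le> real n * (\<nu> \<bullet> Q)" using Q(2) by (intro mult_left_mono) auto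
    then show "\<exists>x. \<nu> \<bullet> ((f ^^ n) x - x) \<ge> real n * (\<nu> \<bullet> ?r + \<epsilon>)" using x by (intro exI[of _ x]) linarith
  qed
  have cl: "closed (rotation_set f)" unfolding rotation_set_def by (intro closed_INT) auto
  have "ball G \<epsilon> \<subseteq> closure (rotation_set f)"
  proof
    fix z assume z: "z \<in> ball G \<epsilon>"
    show "z \<in> closure (rotation_set f)"
      unfolding closure_approachable
    proof (intro allI impI)
      fix e :: real assume e: "e > 0"
      define d where "d = min e (\<epsilon> - dist z G)"
      have d: "d > 0" using e z by (simp add: d_def dist_commute)
      obtain k :: nat where k: "real k > 2 / d" using reals_Archimedean2 by blast
      have "2 / d > 0" using d by simp
      then have k1: "k \<ge> 1" using k by (cases k) auto
      have "z \<in> sq k (lattice_cell k z)" "(1 / real k) *\<^sub>R zv (lattice_cell k z) \<in> sq k (lattice_cell k z)"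
        using pos_in_sq[of k] k1 cell_in_sq by (auto simp: pos_def)
      then have "dist ((1 / real k) *\<^sub>R zv (lattice_cell k z)) z \<le> 2 / real k" using k1 by (intro sq_diameter) auto
      also have "\<dots> < d" using k k1 d by (simp add: field_simps)
      finally have dz: "dist ((1 / real k) *\<^sub>R zv (lattice_cell k z)) z < d" .
      then have "dist ((1 / real k) *\<^sub>R zv (lattice_cell k z)) G < \<epsilon>"
        using dist_triangle[of "(1 / real k) *\<^sub>R zv (lattice_cell k z)" G z] by (simp add: d_def)
      then show "\<exists>y\<in>rotation_set f. dist y z < e" using rat[OF k1] dz by (intro bexI[of _ "(1 / real k) *\<^sub>R zv (lattice_cell k z)"]) (auto simp: d_def)
    qed
  qed
  then have "ball G \<epsilon> \<subseteq> rotation_set f" using cl by simp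
  then have "G \<in> interior (rotation_set f)" using \<epsilon> by (meson centre_in_ball interiorI open_ball)
  then show ?thesis by blast
qed

end

section \<open>Neutral closed walks\<close>

text \<open>\<open>rot\<close> says that p/q belongs to the rotation set, with denominators cleared:
  arbitrarily long orbit segments have mean displacement close to p/q.\<close>

locale rational_rotation = lift_map +
  fixes p :: "int \<times> int" and q :: int
  assumes q: "q \<ge> 1"
    and rot: "\<And>\<epsilon> m. \<epsilon> > 0 \<Longrightarrow> \<exists>n\<ge>m. \<exists>x. norm (of_int q *\<^sub>R ((f ^^ n) x - x) - real n *\<^sub>R zv p) \<le> \<epsilon> * real n"
begin

text \<open>The deviation of the mean displacement \<open>v\<close>/\<open>n\<close> from p/q,
  multiplied by \<open>q\<close> * \<open>n\<close>. This makes it integral, and additive under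
  concatenation.\<close>

definition mu :: "nat \<Rightarrow> int \<times> int \<Rightarrow> int \<times> int" where
  "mu n v = imul q v - imul (int n) p"

abbreviation cyc :: "nat \<Rightarrow> int \<times> int \<Rightarrow> nat \<Rightarrow> int \<times> int \<Rightarrow> bool" where
  "cyc N \<equiv> periodic_graph.closed_walk (edge N) N"

definition nozero :: "nat \<Rightarrow> bool" where
  "nozero N \<longleftrightarrow> (\<forall>a n v. cyc N a n v \<longrightarrow> mu n v \<noteq> 0)"

lemma mu_add: "mu (n + m) (v + w) = mu n v + mu m w"
  and mu_imul: "mu (k * n) (imul (int k) v) = imul (int k) (mu n v)"
  by (auto simp: mu_def prod_eq_iff algebra_simps)

lemma zv_mu: "zv (mu n v) = of_int q *\<^sub>R zv v - real n *\<^sub>R zv p"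
  by (simp add: mu_def zv_diff zv_imul)

lemma cyc_bound:
  assumes "N > 0" and "\<And>a b. edge N a b \<Longrightarrow> dist (pos N a) (pos N b) \<le> D" and "cyc N a n v"
  shows "norm (zv v) \<le> real n * D"
proof -
  interpret G: periodic_graph "edge N" N by (rule periodic_graph[OF assms(1)])
  have "dist (pos N a) (pos N (a + imul (int N) v)) \<le> real n * D"
    using walk_bound[OF assms(1,2)] assms(3) by (auto simp: G.closed_walk_def)
  then show ?thesis by (simp add: pos_translate[OF assms(1)] dist_norm)
qed

text \<open>A uniform gain of short cycles in direction \<open>u\<close> spreads to all walks by
  \<open>walk_lower_bound\<close>, in particular to those that follow orbits. Orbits with mean
  displacement close to p/q show no such gain.\<close>

lemma short_cycles_not_positive:
  assumes N: "N > 0" and \<kappa>: "\<kappa> > 0"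
    and short: "\<And>a n v. cyc N a n v \<Longrightarrow> n \<le> N * N \<Longrightarrow> u \<bullet> zv (mu n v) \<ge> \<kappa> * real n"
  shows False
proof -
  interpret G: periodic_graph "edge N" N by (rule periodic_graph[OF N])
  obtain D where D: "D \<ge> 0" "\<And>a b. edge N a b \<Longrightarrow> dist (pos N a) (pos N b) \<le> D"
    using edge_bound N by metis
  define l where "l = (\<lambda>w. of_int q * (u \<bullet> zv w))"
  define S where "S = of_int q * (real N * (norm u * D))"
  define c where "c = real N * (u \<bullet> zv p + \<kappa>)"
  define K where "K = real (N * N) * (S + \<bar>c\<bar>)"
  have lower: "l b - l a \<ge> real n * c - K" if "(edge N ^^ n) a b" for n a b
    unfolding K_def
  proof (rule G.walk_lower_bound[OF _ _ _ _ that])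
    show "l (v + w) = l v + l w" for v w by (simp add: l_def zv_add algebra_simps)
    show "0 \<le> S" using q D by (simp add: S_def)
    show "- S \<le> l b - l a" if e: "edge N a b" for a b
    proof -
      have "zv b - zv a = real N *\<^sub>R (pos N b - pos N a)"
        using N by (simp add: pos_def scaleR_diff_right)
      then have "\<bar>u \<bullet> (zv b - zv a)\<bar> = real N * \<bar>u \<bullet> (pos N b - pos N a)\<bar>" by (simp add: abs_mult)
      also have "\<dots> \<le> real N * (norm u * D)"
        using Cauchy_Schwarz_ineq2[of u "pos N b - pos N a"] D(2)[OF e]
        by (intro mult_left_mono order_trans[OF Cauchy_Schwarz_ineq2]) (auto simp: dist_norm norm_minus_commute)
      finally have "of_int q * \<bar>u \<bullet> (zv b - zv a)\<bar> \<le> S" using q by (simp add: S_def mult_left_mono)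
      moreover have "\<bar>l b - l a\<bar> = of_int q * \<bar>u \<bullet> (zv b - zv a)\<bar>"
        using q by (simp add: l_def inner_diff_right abs_mult flip: right_diff_distrib)
      ultimately show ?thesis by linarith
    qed
    show "real n * c \<le> l (imul (int N) v)" if cy: "G.closed_walk a n v" "n \<le> N * N" for a n v
    proof -
      have "l (imul (int N) v) = real N * (u \<bullet> zv (mu n v) + real n * (u \<bullet> zv p))"
        by (simp add: l_def zv_imul zv_mu inner_diff_right algebra_simps)
      also have "\<dots> \<ge> real N * (\<kappa> * real n + real n * (u \<bullet> zv p))"
        using short[OF cy] by (intro mult_left_mono add_right_mono) auto
      finally show ?thesis by (simp add: c_def algebra_simps)
    qed
  qed
  have cell: "norm (zv (lattice_cell N z) - real N *\<^sub>R z) \<le> 2" for z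
  proof -
    have "norm (zv (lattice_cell N z) - real N *\<^sub>R z) \<le> \<bar>fst (zv (lattice_cell N z)) - fst (real N *\<^sub>R z)\<bar> + \<bar>snd (zv (lattice_cell N z)) - snd (real N *\<^sub>R z)\<bar>"
      using dist_prod_le_sum[of "zv (lattice_cell N z)" "real N *\<^sub>R z"] by (simp only: dist_norm)
    also have "\<dots> \<le> 1 + 1" by (intro add_mono) (simp add: lattice_cell_def, linarith)+
    finally show ?thesis by simp
  qed
  \<comment> \<open>Chosen so that the deviation of the orbit costs at most half of the gain
    \<kappa>.\<close>
  define \<epsilon> where "\<epsilon> = \<kappa> / (2 * (norm u + 1))"
  have \<epsilon>: "\<epsilon> > 0" "norm u * \<epsilon> \<le> \<kappa> / 2"
  proof -
    have "norm u + 1 > 0" by (simp add: add_nonneg_pos)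
    then show "\<epsilon> > 0" using \<kappa> by (simp add: \<epsilon>_def)
    have "norm u * \<epsilon> \<le> (norm u + 1) * \<epsilon>" using \<open>\<epsilon> > 0\<close> by simp
    also have "\<dots> = \<kappa> / 2"
    proof -
      have "X * (\<kappa> / (2 * X)) = \<kappa> / 2" if "X > 0" for X using that by (simp add: field_simps)
      then show ?thesis using \<open>norm u + 1 > 0\<close> unfolding \<epsilon>_def by blast
    qed
    finally show "norm u * \<epsilon> \<le> \<kappa> / 2" .
  qed
  obtain m :: nat where m: "real m > 2 * (K + 4 * of_int q * norm u) / (real N * \<kappa>)" using reals_Archimedean2 by blast
  obtain n x where n: "n \<ge> m" and x: "norm (of_int q *\<^sub>R ((f ^^ n) x - x) - real n *\<^sub>R zv p) \<le> \<epsilon> * real n"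
    using rot[OF \<epsilon>(1)] by blast
  define a b where "a = lattice_cell N x" and "b = lattice_cell N ((f ^^ n) x)"
  have "real n * c - K \<le> l b - l a" using lower orbit_walk by (simp add: a_def b_def)
  also have "l b - l a = of_int q * (u \<bullet> ((zv b - real N *\<^sub>R (f ^^ n) x) - (zv a - real N *\<^sub>R x))) + real N * (u \<bullet> (of_int q *\<^sub>R ((f ^^ n) x - x)))"
    by (simp add: l_def inner_diff_right algebra_simps)
  also have "\<dots> \<le> of_int q * (norm u * 4) + real N * (real n * (u \<bullet> zv p) + norm u * (\<epsilon> * real n))"
  proof (intro add_mono mult_left_mono)
    have "norm ((zv b - real N *\<^sub>R (f ^^ n) x) - (zv a - real N *\<^sub>R x)) \<le> 4"
      using norm_triangle_ineq4[of "zv b - real N *\<^sub>R (f ^^ n) x" "zv a - real N *\<^sub>R x"] cell[of x] cell[of "(f ^^ n) x"]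
      by (simp add: a_def b_def)
    then show "u \<bullet> ((zv b - real N *\<^sub>R (f ^^ n) x) - (zv a - real N *\<^sub>R x)) \<le> norm u * 4"
      using norm_cauchy_schwarz[of u] by (meson mult_left_mono norm_ge_zero order_trans)
    have "u \<bullet> (of_int q *\<^sub>R ((f ^^ n) x - x) - real n *\<^sub>R zv p) \<le> norm u * (\<epsilon> * real n)"
      using norm_cauchy_schwarz[of u] x by (meson mult_left_mono norm_ge_zero order_trans)
    then show "u \<bullet> of_int q *\<^sub>R ((f ^^ n) x - x) \<le> real n * (u \<bullet> zv p) + norm u * (\<epsilon> * real n)"
      by (simp add: inner_diff_right)
  qed (use q in auto)
  also have "norm u * (\<epsilon> * real n) \<le> \<kappa> / 2 * real n"
    using mult_right_mono[OF \<epsilon>(2), of "real n"] by (simp add: mult.assoc)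
  finally have "real n * c - K \<le> of_int q * (norm u * 4) + real N * (real n * (u \<bullet> zv p) + \<kappa> / 2 * real n)"
    using N by simp
  then have "real n * (real N * \<kappa>) \<le> 2 * (K + 4 * of_int q * norm u)"
    by (simp add: c_def algebra_simps)
  then have "real n \<le> 2 * (K + 4 * of_int q * norm u) / (real N * \<kappa>)"
    using N \<kappa> by (simp add: pos_le_divide_eq)
  then show False using m n by linarith
qed

text \<open>By \<open>nozero\<close> a neutral cycle lies strictly on one side. If all lay on the
  same side with normal \<open>w\<close>, adding a large multiple of \<open>l\<close> to
  \<open>w\<close> would give a vector positive on all short cycles, whose \<open>mu\<close> take
  finitely many values; \<open>short_cycles_not_positive\<close> excludes this.\<close>

lemma cycles_of_both_signs:
  fixes l :: "real \<times> real"
  assumes N: "N > 0" and nz: "nozero N" and l: "l \<noteq> 0"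
    and nonneg: "\<And>a n v. cyc N a n v \<Longrightarrow> l \<bullet> zv (mu n v) \<ge> 0" and s: "s \<in> {1, -1::real}"
  obtains a n v where "cyc N a n v" "l \<bullet> zv (mu n v) = 0" "s * ((- snd l, fst l) \<bullet> zv (mu n v)) > 0"
proof (rule ccontr)
  assume c: "\<not> thesis"
  note out = that
  define w where "w = - s *\<^sub>R (- snd l, fst l)"
  have w: "w \<bullet> zv (mu n v) > 0" if cy: "cyc N a n v" "l \<bullet> zv (mu n v) = 0" for a n v
  proof -
    have "w \<bullet> zv (mu n v) \<ge> 0" using c out[OF cy] unfolding w_def inner_scaleR_left by linarith
    moreover have "w \<bullet> zv (mu n v) \<noteq> 0"
    proof
      assume "w \<bullet> zv (mu n v) = 0"
      then have "- s * ((- snd l, fst l) \<bullet> zv (mu n v)) = 0" unfolding w_def inner_scaleR_left .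
      then have "(- snd l, fst l) \<bullet> zv (mu n v) = 0" using s by auto
      then have e: "fst l * snd (zv (mu n v)) = snd l * fst (zv (mu n v))" "fst l * fst (zv (mu n v)) + snd l * snd (zv (mu n v)) = 0"
        using cy(2) by (auto simp: inner_prod_def)
      define x y where "x = fst (zv (mu n v))" and "y = snd (zv (mu n v))"
      have "((fst l)\<^sup>2 + (snd l)\<^sup>2) * x = 0" "((fst l)\<^sup>2 + (snd l)\<^sup>2) * y = 0"
        using e unfolding x_def[symmetric] y_def[symmetric] by algebra+
      moreover have "(fst l)\<^sup>2 + (snd l)\<^sup>2 \<noteq> 0" using l by (auto simp: sum_power2_eq_zero_iff prod_eq_iff)
      ultimately have "zv (mu n v) = 0" by (auto simp: x_def y_def prod_eq_iff)
      then have "mu n v = 0" by simp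
      then show False using nz cy(1) unfolding nozero_def by blast
    qed
    ultimately show ?thesis by linarith
  qed
  obtain D where D: "D \<ge> 0" "\<And>a b. edge N a b \<Longrightarrow> dist (pos N a) (pos N b) \<le> D"
    using edge_bound N by metis
  define R where "R = \<lceil>real (N * N) * D\<rceil>"
  define \<Sigma> where "\<Sigma> = {mu n v | a n v. cyc N a n v \<and> n \<le> N * N}"
  have "\<Sigma> \<subseteq> (\<lambda>(n, v). mu n v) ` ({..N * N} \<times> ({-R..R} \<times> {-R..R}))"
  proof
    fix \<sigma> assume "\<sigma> \<in> \<Sigma>"
    then obtain a n v where v: "\<sigma> = mu n v" "cyc N a n v" "n \<le> N * N" by (auto simp: \<Sigma>_def)
    have "norm (zv v) \<le> real n * D" using cyc_bound[OF N D(2) v(2)] .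
    also have "\<dots> \<le> real (N * N) * D" using v D by (intro mult_right_mono) (auto simp flip: of_nat_mult)
    finally have "norm (zv v) \<le> real (N * N) * D" .
    moreover have "\<bar>real_of_int (fst v)\<bar> \<le> norm (zv v)" "\<bar>real_of_int (snd v)\<bar> \<le> norm (zv v)"
      using norm_fst_le[of "fst (zv v)" "snd (zv v)"] norm_snd_le[of "snd (zv v)" "fst (zv v)"] by (simp_all add: zv_def)
    ultimately have "\<bar>real_of_int (fst v)\<bar> \<le> of_int R" "\<bar>real_of_int (snd v)\<bar> \<le> of_int R" unfolding R_def by linarith+
    then have "\<bar>fst v\<bar> \<le> R" "\<bar>snd v\<bar> \<le> R" by linarith+
    then have "(n, v) \<in> {..N * N} \<times> ({-R..R} \<times> {-R..R})" using v(3) by (auto simp: mem_Times_iff)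
    then show "\<sigma> \<in> (\<lambda>(n, v). mu n v) ` ({..N * N} \<times> ({-R..R} \<times> {-R..R}))" using v(1) by force
  qed
  then have fin: "finite \<Sigma>" by (rule finite_subset) auto
  \<comment> \<open>The bound makes \<open>u\<close> at least 1 on cycles that are positive for
    \<open>l\<close>. Neutral cycles enter with the value 0 of a division by zero.\<close>
  have "bdd_above ((\<lambda>\<sigma>. (1 - w \<bullet> zv \<sigma>) / (l \<bullet> zv \<sigma>)) ` \<Sigma>)" using fin by (intro bdd_above_finite) auto
  then obtain C where C: "\<And>\<sigma>. \<sigma> \<in> \<Sigma> \<Longrightarrow> (1 - w \<bullet> zv \<sigma>) / (l \<bullet> zv \<sigma>) \<le> C" by (auto simp: bdd_above_def)
  define u where "u = C *\<^sub>R l + w"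
  have upos: "u \<bullet> zv \<sigma> > 0" if \<sigma>: "\<sigma> \<in> \<Sigma>" for \<sigma>
  proof -
    obtain a n v where v: "\<sigma> = mu n v" "cyc N a n v" using \<sigma> by (auto simp: \<Sigma>_def)
    show ?thesis
    proof (cases "l \<bullet> zv \<sigma> = 0")
      case True
      then show ?thesis using w[of a n v] v by (simp add: u_def inner_add_left)
    next
      case False
      then have "l \<bullet> zv \<sigma> > 0" using nonneg[OF v(2)] v(1) by simp
      then have "1 - w \<bullet> zv \<sigma> \<le> C * (l \<bullet> zv \<sigma>)" using C[OF \<sigma>] by (simp add: pos_divide_le_eq)
      then show ?thesis by (simp add: u_def inner_add_left)
    qed
  qed
  define \<kappa>0 where "\<kappa>0 = Min (insert 1 ((\<lambda>\<sigma>. u \<bullet> zv \<sigma>) ` \<Sigma>))"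
  have \<kappa>0: "\<kappa>0 > 0" unfolding \<kappa>0_def using fin upos by (subst Min_gr_iff) auto
  have \<kappa>0_le: "\<kappa>0 \<le> u \<bullet> zv \<sigma>" if "\<sigma> \<in> \<Sigma>" for \<sigma> unfolding \<kappa>0_def using fin that by (intro Min_le) auto
  show False
  proof (rule short_cycles_not_positive[OF N, of "\<kappa>0 / real (N * N)" u])
    show "\<kappa>0 / real (N * N) > 0" using \<kappa>0 N by simp
    fix a n v assume cy: "cyc N a n v" "n \<le> N * N"
    have "\<kappa>0 / real (N * N) * real n \<le> \<kappa>0 / real (N * N) * real (N * N)"
      using cy \<kappa>0 by (intro mult_left_mono) (auto simp flip: of_nat_mult)
    also have "\<dots> = \<kappa>0" using N by simp
    also have "\<dots> \<le> u \<bullet> zv (mu n v)" using cy unfolding \<Sigma>_def by (intro \<kappa>0_le[unfolded \<Sigma>_def]) blast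
    finally show "\<kappa>0 / real (N * N) * real n \<le> u \<bullet> zv (mu n v)" .
  qed
qed

text \<open>The two values of \<open>mu\<close> are opposite multiples of one vector; weighted with
  each other's determinants they cancel. A common base node allows the concatenation.\<close>

lemma opposite_cycles_contradiction:
  assumes N: "N > 0" and nz: "nozero N" and u: "u \<noteq> 0"
    and c1: "cyc N a n v" "idot u (mu n v) = 0" and c2: "cyc N a m w" "idot u (mu m w) = 0"
    and opp: "idet u (mu n v) > 0" "idet u (mu m w) < 0"
  shows False
proof -
  interpret G: periodic_graph "edge N" N by (rule periodic_graph[OF N])
  define i j where "i = nat (- idet u (mu m w))" and "j = nat (idet u (mu n v))"
  have ij: "i \<ge> 1" "j \<ge> 1" "int i = - idet u (mu m w)" "int j = idet u (mu n v)"
    using opp by (auto simp: i_def j_def)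
  have "cyc N a (i * n + j * m) (imul (int i) v + imul (int j) w)"
    using G.closed_walk_add G.closed_walk_mult c1 c2 ij by metis
  moreover have "mu (i * n + j * m) (imul (int i) v + imul (int j) w) = 0"
  proof -
    define a1 b1 a2 b2 x y where "a1 = fst (mu n v)" and "b1 = snd (mu n v)" and "a2 = fst (mu m w)" and "b2 = snd (mu m w)"
      and "x = fst u" and "y = snd u"
    have d: "x * a1 + y * b1 = 0" "x * a2 + y * b2 = 0" using c1(2) c2(2) by (auto simp: idot_def a1_def b1_def a2_def b2_def x_def y_def)
    have "(x * x + y * y) * (- (x * b2 - y * a2) * a1 + (x * b1 - y * a1) * a2) = 0"
      "(x * x + y * y) * (- (x * b2 - y * a2) * b1 + (x * b1 - y * a1) * b2) = 0"
      using d by algebra+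
    moreover have "x * x + y * y > 0" using idot_pos[OF u] by (simp add: idot_def x_def y_def)
    then have "x * x + y * y \<noteq> 0" by linarith
    ultimately have "- (x * b2 - y * a2) * a1 + (x * b1 - y * a1) * a2 = 0" "- (x * b2 - y * a2) * b1 + (x * b1 - y * a1) * b2 = 0"
      by auto
    moreover have "mu (i * n + j * m) (imul (int i) v + imul (int j) w) = imul (int i) (mu n v) + imul (int j) (mu m w)"
      by (simp only: mu_add mu_imul)
    ultimately show ?thesis
      unfolding ij idet_def by (simp add: prod_eq_iff a1_def b1_def a2_def b2_def x_def y_def)
  qed
  ultimately show False using nz unfolding nozero_def by blast
qed

text \<open>Closed pieces of length at most \<open>N * N\<close> are split off. They are neutral,
  because \<open>mu\<close> is additive and never negative along \<open>u\<close>, and they have the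
  sign of the whole cycle, with which they share a node. Each determinant is a non-zero integer, so
  at most \<open>N * N\<close> steps contribute at least 1.\<close>

lemma neutral_cycle_length:
  assumes N: "N > 0" and nz: "nozero N" and u: "u \<noteq> 0"
    and nonneg: "\<And>a n v. cyc N a n v \<Longrightarrow> idot u (mu n v) \<ge> 0"
    and s: "s \<in> {1, -1}" and c: "cyc N a n v" "idot u (mu n v) = 0" "s * idet u (mu n v) > 0"
  shows "int n \<le> int (N * N) * (s * idet u (mu n v))"
  using c
proof (induction n arbitrary: v rule: less_induct)
  case (less n)
  interpret G: periodic_graph "edge N" N by (rule periodic_graph[OF N])
  show ?case
  proof (cases "n \<le> N * N")
    case True
    have "int (N * N) * (s * idet u (mu n v)) \<ge> int (N * N) * 1"
      using less.prems by (intro mult_left_mono) auto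
    then show ?thesis using True by (simp flip: of_nat_mult)
  next
    case False
    then have "n > N * N" by simp
    then obtain x n1 n2 m w where d: "m \<ge> 1" "m \<le> N * N" "n = n1 + m + n2" "(edge N ^^ n1) a x" "(edge N ^^ m) x (x + imul (int N) w)"
      "(edge N ^^ n2) (x + imul (int N) w) (a + imul (int N) v)"
      using G.split_long_walk[OF less.prems(1)[unfolded G.closed_walk_def, THEN conjunct2]] by metis
    have sub: "cyc N x m w" using d by (simp add: G.closed_walk_def)
    have tail: "(edge N ^^ n2) x (a + imul (int N) (v - w))"
      using G.walk_translate[OF d(6), of "- w"] by (simp add: imul_minus imul_diff algebra_simps)
    have rest: "cyc N a (n1 + n2) (v - w)"
      using relpowp_trans[OF d(4) tail] d False by (simp add: G.closed_walk_def)
    \<comment> \<open>The whole cycle is rebased at \<open>x\<close>, to be compared there with the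
      piece \<open>sub\<close>.\<close>
    have "(edge N ^^ n1) (a + imul (int N) v) (x + imul (int N) v)" using G.walk_translate[OF d(4)] .
    then have "(edge N ^^ (m + (n2 + n1))) x (x + imul (int N) v)"
      using relpowp_trans[OF d(5) relpowp_trans[OF d(6)]] by blast
    then have whole: "cyc N x n v" using d by (simp add: G.closed_walk_def algebra_simps)
    have mu: "mu n v = mu m w + mu (n1 + n2) (v - w)"
      using mu_add[of m "n1 + n2" w "v - w"] d(3) by (simp add: algebra_simps)
    have "idot u (mu m w) \<ge> 0" "idot u (mu (n1 + n2) (v - w)) \<ge> 0" using nonneg sub rest by blast+
    moreover have "idot u (mu m w) + idot u (mu (n1 + n2) (v - w)) = 0"
      using less.prems(2) by (simp add: mu idot_def algebra_simps)
    ultimately have z: "idot u (mu m w) = 0" "idot u (mu (n1 + n2) (v - w)) = 0" by linarith+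
    have nonpar: "idet u (mu k y) \<noteq> 0" if "idot u (mu k y) = 0" "cyc N b k y" for k y b
    proof
      assume "idet u (mu k y) = 0"
      then have "idot u u * fst (mu k y) = 0" "idot u u * snd (mu k y) = 0"
        using that(1) unfolding idot_def idet_def by algebra+
      then have "mu k y = 0" using idot_pos[OF u] by (auto simp: prod_eq_iff)
      then show False using nz that(2) unfolding nozero_def by blast
    qed
    have pos: "s * idet u (mu k y) > 0" if k: "cyc N b k y" "idot u (mu k y) = 0" "cyc N b n v" for b k y
    proof (rule ccontr)
      assume "\<not> ?thesis"
      then have neg: "s * idet u (mu k y) < 0" using nonpar[OF k(2,1)] s by auto
      from s show False
      proof
        assume "s = 1"
        then show False using opposite_cycles_contradiction[OF N nz u k(3) less.prems(2) k(1,2)] neg less.prems(3) by simp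
      next
        assume "s \<in> {-1}"
        then show False using opposite_cycles_contradiction[OF N nz u k(1,2) k(3) less.prems(2)] neg less.prems(3) by simp
      qed
    qed
    have p1: "s * idet u (mu m w) > 0" by (rule pos[OF sub z(1) whole])
    have p2: "s * idet u (mu (n1 + n2) (v - w)) > 0" by (rule pos[OF rest z(2) less.prems(1)])
    have "int (n1 + n2) \<le> int (N * N) * (s * idet u (mu (n1 + n2) (v - w)))"
      by (rule less.IH[OF _ rest z(2) p2]) (use d in simp)
    moreover have "int m \<le> int (N * N) * (s * idet u (mu m w))"
    proof -
      have "int (N * N) * (s * idet u (mu m w)) \<ge> int (N * N) * 1" using p1 by (intro mult_left_mono) auto
      then show ?thesis using d(2) by (simp flip: of_nat_mult)
    qed
    moreover have "idet u (mu n v) = idet u (mu m w) + idet u (mu (n1 + n2) (v - w))"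
      by (simp add: mu idet_def algebra_simps)
    ultimately show ?thesis using d(3) by (simp add: algebra_simps)
  qed
qed

text \<open>Neutral cycles of sign \<open>s\<close> exist at every scale \<open>k * N\<close>.
  Projected to scale \<open>N\<close> they have, by \<open>neutral_cycle_length\<close>, rates
  bounded away from p/q on the side \<open>s\<close>, and so has a limit \<open>P\<close> of their
  mean displacements. At fine scales blocks of \<open>m\<close> steps shadow \<open>f ^^ m\<close>,
  and a block that gains at least the average shows that \<open>P\<close> is realizable.\<close>

lemma neutral_realizable_points:
  assumes N: "N > 0" and nz: "nozero N" and u: "u \<noteq> 0"
    and nonneg: "\<And>a n v. cyc N a n v \<Longrightarrow> idot u (mu n v) \<ge> 0"
    and s: "s \<in> {1, -1::int}"
  obtains P where "realizable P" "zv u \<bullet> (of_int q *\<^sub>R P - zv p) = 0" "of_int s * (zv (- snd u, fst u) \<bullet> (of_int q *\<^sub>R P - zv p)) > 0"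
proof -
  have iu: "real_of_int (idot u w) = zv u \<bullet> zv w" "real_of_int (idet u w) = zv (- snd u, fst u) \<bullet> zv w" for w
    by (auto simp: idot_def idet_def inner_prod_def)
  have step: "\<exists>a n v. cyc (k * N) a n v \<and> idot u (mu n v) = 0 \<and> s * idet u (mu n v) > 0 \<and> int n \<le> int (N * N) * (s * idet u (mu n v))"
    if k: "k > 0" for k
  proof -
    have kN: "k * N > 0" using k N by simp
    have ref: "\<exists>b. cyc N b n v" if "cyc (k * N) a n v" for a n v
      using closed_walk_refine[OF N k that] by blast
    have nzk: "nozero (k * N)" using nz ref unfolding nozero_def by blast
    have nk: "zv u \<bullet> zv (mu n v) \<ge> 0" if "cyc (k * N) a n v" for a n v
      using ref[OF that] nonneg by (metis iu(1) of_int_0_le_iff)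
    have "zv u \<noteq> 0" "real_of_int s \<in> {1, -1}" using u s by auto
    then obtain a n v where c: "cyc (k * N) a n v" "zv u \<bullet> zv (mu n v) = 0"
      "real_of_int s * ((- snd (zv u), fst (zv u)) \<bullet> zv (mu n v)) > 0"
      using cycles_of_both_signs[OF kN nzk, of "zv u" "real_of_int s"] nk by metis
    have c2: "idot u (mu n v) = 0" using c(2) iu(1) by (metis of_int_eq_0_iff)
    have "real_of_int (s * idet u (mu n v)) > 0" using c(3) by (simp add: iu(2) inner_prod_def)
    then have c3: "s * idet u (mu n v) > 0" by linarith
    obtain b where b: "cyc N b n v" using ref c by blast
    have "int n \<le> int (N * N) * (s * idet u (mu n v))"
      by (rule neutral_cycle_length[OF N nz u _ s b c2 c3]) (rule nonneg)
    then show ?thesis using c c2 c3 by blast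
  qed
  then have "\<forall>k. \<exists>a n v. cyc (Suc k * N) a n v \<and> idot u (mu n v) = 0 \<and> s * idet u (mu n v) > 0 \<and> int n \<le> int (N * N) * (s * idet u (mu n v))"
    by (intro allI step) simp
  then obtain A n V where c: "\<And>k. cyc (Suc k * N) (A k) (n k) (V k)" "\<And>k. idot u (mu (n k) (V k)) = 0"
    "\<And>k. int (n k) \<le> int (N * N) * (s * idet u (mu (n k) (V k)))" by metis
  have n1: "n k \<ge> 1" for k
    using c(1)[of k] periodic_graph.closed_walk_def[OF periodic_graph] N by (metis mult_pos_pos zero_less_Suc)
  define r where "r = (\<lambda>k. (1 / real (n k)) *\<^sub>R zv (V k))"
  have nr: "zv (V k) = real (n k) *\<^sub>R r k" for k using n1[of k] by (simp add: r_def)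
  have mur: "zv (mu (n k) (V k)) = real (n k) *\<^sub>R (of_int q *\<^sub>R r k - zv p)" for k
    by (simp add: zv_mu nr scaleR_diff_right)
  obtain D where D: "D \<ge> 0" "\<And>N a b. N > 0 \<Longrightarrow> edge N a b \<Longrightarrow> dist (pos N a) (pos N b) \<le> D"
    using edge_bound by metis
  have "norm (r k) \<le> D" for k
  proof -
    have "norm (zv (V k)) \<le> real (n k) * D" using N by (intro cyc_bound[OF _ D(2) c(1)]) auto
    then show ?thesis using n1[of k] by (simp add: nr)
  qed
  then have "\<forall>k. r k \<in> cball 0 D" by simp
  then obtain P \<phi> where P: "strict_mono (\<phi> :: nat \<Rightarrow> nat)" "(r \<circ> \<phi>) \<longlonglongrightarrow> P"
    using compact_cball[of "0::real \<times> real" D] unfolding compact_def by blast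
  have lim: "(\<lambda>k. w \<bullet> (of_int q *\<^sub>R r (\<phi> k) - zv p)) \<longlonglongrightarrow> w \<bullet> (of_int q *\<^sub>R P - zv p)" for w
    using P(2) by (intro tendsto_intros) (simp add: o_def)
  show ?thesis
  proof (rule that[of P])
    have "zv u \<bullet> (of_int q *\<^sub>R r k - zv p) = 0" for k
    proof -
      have "real (n k) * (zv u \<bullet> (of_int q *\<^sub>R r k - zv p)) = 0"
        using c(2)[of k] iu(1)[of "mu (n k) (V k)"] by (simp add: mur)
      then show ?thesis using n1[of k] by auto
    qed
    then have "(\<lambda>k. 0) \<longlonglongrightarrow> zv u \<bullet> (of_int q *\<^sub>R P - zv p)" using lim[of "zv u"] by simp
    then show "zv u \<bullet> (of_int q *\<^sub>R P - zv p) = 0" using LIMSEQ_unique tendsto_const by blast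
    have "1 / real (N * N) \<le> of_int s * (zv (- snd u, fst u) \<bullet> (of_int q *\<^sub>R r k - zv p))" (is "_ \<le> ?X k") for k
    proof -
      have "real_of_int (int (n k)) \<le> real_of_int (int (N * N) * (s * idet u (mu (n k) (V k))))" using c(3) of_int_le_iff by blast
      then have "real (n k) * 1 \<le> real (n k) * (real (N * N) * ?X k)"
        by (simp add: iu(2) mur algebra_simps)
      then have "1 \<le> real (N * N) * ?X k" using n1[of k] by (simp add: mult_le_cancel_left_pos)
      then show ?thesis using N by (simp add: pos_divide_le_eq mult.commute)
    qed
    then have "1 / real (N * N) \<le> of_int s * (zv (- snd u, fst u) \<bullet> (of_int q *\<^sub>R P - zv p))"
      by (intro LIMSEQ_le_const[OF tendsto_mult[OF tendsto_const lim]]) auto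
    moreover have "1 / real (N * N) > 0" using N by simp
    ultimately show "of_int s * (zv (- snd u, fst u) \<bullet> (of_int q *\<^sub>R P - zv p)) > 0" by linarith
    show "realizable P"
      unfolding realizable_def
    proof (intro allI impI)
      fix m :: nat and \<nu> :: "real \<times> real" assume m: "1 \<le> m"
      interpret fm: lift_map "f ^^ m" "fi ^^ m" by (rule funpow)
      obtain z where z: "\<And>x. \<nu> \<bullet> ((f ^^ m) x - x) \<le> \<nu> \<bullet> ((f ^^ m) z - z)"
        by (rule periodic_attains_sup[of "\<lambda>x. \<nu> \<bullet> ((f ^^ m) x - x)"])
          (auto intro!: continuous_intros fm.cont simp: funpow_comm)
      have "real m * (\<nu> \<bullet> P) \<le> \<nu> \<bullet> ((f ^^ m) z - z)"
      proof (rule field_le_epsilon)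
        fix e :: real assume e: "e > 0"
        define \<epsilon> where "\<epsilon> = e / (norm \<nu> + 1)"
        have np: "norm \<nu> + 1 > 0" by (simp add: add_nonneg_pos)
        have \<epsilon>: "\<epsilon> > 0" "norm \<nu> * \<epsilon> \<le> e"
          using e np by (auto simp: \<epsilon>_def field_simps)
        obtain N1 where N1: "\<And>N a b. N \<ge> N1 \<Longrightarrow> (edge N ^^ m) a b \<Longrightarrow> dist ((f ^^ m) (pos N a)) (pos N b) < \<epsilon>"
          using walk_tracks_orbit[OF \<epsilon>(1), of m] by blast
        have "real m * (\<nu> \<bullet> r k) \<le> \<nu> \<bullet> ((f ^^ m) z - z) + e" if k: "k \<ge> N1" for k
        proof -
          define M where "M = Suc k * N"
          have M: "M > 0" "M \<ge> N1" using N k by (auto simp: M_def) (metis Suc_leD le_trans mult_le_mono2 mult.right_neutral One_nat_def Suc_leI add.commute le_add2 mult_Suc)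
          interpret G: periodic_graph "edge M" M by (rule periodic_graph[OF M(1)])
          have "cyc M (A k) (n k) (V k)" using c(1) by (simp add: M_def)
          \<comment> \<open>Running through the cycle \<open>m\<close> times makes its length
            divisible by \<open>m\<close>, so it splits into \<open>n k\<close> blocks.\<close>
          then have "cyc M (A k) (m * n k) (imul (int m) (V k))" using G.closed_walk_mult m by blast
          then have "(edge M ^^ (m * n k)) (A k) (A k + imul (int M) (imul (int m) (V k)))" by (simp add: G.closed_walk_def)
          then obtain \<pi> where \<pi>: "\<pi> 0 = A k" "\<pi> (m * n k) = A k + imul (int M) (imul (int m) (V k))"
            "\<And>i. i < m * n k \<Longrightarrow> edge M (\<pi> i) (\<pi> (Suc i))"
            unfolding relpowp_fun_conv by blast
          define y where "y = (\<lambda>j. pos M (\<pi> j))"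
          obtain i where i: "i < n k" "\<nu> \<bullet> (y (Suc i * m) - y (i * m)) \<ge> \<nu> \<bullet> (y (n k * m) - y 0) / real (n k)"
            using average_block[OF n1[of k]] by blast
          have "y (n k * m) - y 0 = real m *\<^sub>R zv (V k)"
            by (simp add: y_def \<pi> mult.commute[of "n k"] pos_translate[OF M(1)] zv_imul)
          then have 1: "\<nu> \<bullet> (y (n k * m) - y 0) / real (n k) = real m * (\<nu> \<bullet> r k)"
            by (simp add: r_def)
          have "Suc i * m \<le> m * n k" using i(1) by (metis Suc_leI mult.commute mult_le_mono1)
          then have "(edge M ^^ (Suc i * m - i * m)) (\<pi> (i * m)) (\<pi> (Suc i * m))"
            by (intro relpowp_segment[where n = "m * n k"] \<pi>(3)) auto
          then have 2: "dist ((f ^^ m) (y (i * m))) (y (Suc i * m)) < \<epsilon>" using N1[OF M(2)] by (simp add: y_def)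
          have "\<nu> \<bullet> (y (Suc i * m) - (f ^^ m) (y (i * m))) \<le> norm \<nu> * norm (y (Suc i * m) - (f ^^ m) (y (i * m)))"
            by (rule norm_cauchy_schwarz)
          also have "\<dots> \<le> norm \<nu> * \<epsilon>" using 2 by (intro mult_left_mono) (auto simp: dist_norm norm_minus_commute)
          finally have "\<nu> \<bullet> (y (Suc i * m) - y (i * m)) \<le> \<nu> \<bullet> ((f ^^ m) (y (i * m)) - y (i * m)) + e"
            using \<epsilon>(2) by (simp add: inner_diff_right)
          then show ?thesis using i(2) 1 z[of "y (i * m)"] by linarith
        qed
        moreover have "\<phi> k \<ge> k" for k using P(1) by (rule seq_suble)
        ultimately have "\<exists>K. \<forall>k\<ge>K. real m * (\<nu> \<bullet> (r \<circ> \<phi>) k) \<le> \<nu> \<bullet> ((f ^^ m) z - z) + e"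
          by (metis comp_apply le_trans)
        then show "real m * (\<nu> \<bullet> P) \<le> \<nu> \<bullet> ((f ^^ m) z - z) + e"
          by (intro LIMSEQ_le_const2[OF tendsto_mult[OF tendsto_const tendsto_inner[OF tendsto_const P(2)]]])
      qed
      then show "\<exists>x. real m * (\<nu> \<bullet> P) \<le> \<nu> \<bullet> ((f ^^ m) x - x)" by blast
    qed
  qed
qed

end

section \<open>Essential sets and unions of squares\<close>

lemma connected_component_translate:
  assumes "\<And>x. x \<in> S \<Longrightarrow> x + w \<in> S" and "connected_component S x y"
  shows "connected_component S (x + w) (y + (w :: 'a :: real_normed_vector))"
proof -
  obtain T where T: "connected T" "T \<subseteq> S" "x \<in> T" "y \<in> T" using assms(2) by (auto simp: connected_component_def)
  have "connected ((\<lambda>z. z + w) ` T)" by (intro connected_continuous_image T continuous_intros)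
  then show ?thesis unfolding connected_component_def using T assms(1) by (intro exI[of _ "(\<lambda>z. z + w) ` T"]) auto
qed

lemma connected_component_shift_invariant:
  assumes inv: "\<And>x. x \<in> S \<Longrightarrow> x + w \<in> S" "\<And>x. x \<in> S \<Longrightarrow> x - w \<in> S" and w: "connected_component S x (x + w)"
    and y: "connected_component S x y"
  shows "connected_component S x (y + w)" "connected_component S x (y - (w :: 'a :: real_normed_vector))"
proof -
  show "connected_component S x (y + w)"
    using connected_component_translate[OF inv(1) y] w connected_component_trans by blast
  have "connected_component S (x + w) y" using w y connected_component_sym connected_component_trans by metis
  then have "connected_component S (x + w + - w) (y + - w)" using inv(2) by (intro connected_component_translate) auto
  then show "connected_component S x (y - w)" by simp
qed

lemma connected_translates:
  fixes S T :: "'a :: real_normed_vector set"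
  assumes "connected S" "connected T"
  shows "connected (\<Union>s\<in>S. (+) s ` T)"
proof -
  have "(\<Union>s\<in>S. (+) s ` T) = (\<lambda>p. fst p + snd p) ` (S \<times> T)" by force
  moreover have "connected ((\<lambda>p. fst p + snd p) ` (S \<times> T))"
    using assms by (intro connected_continuous_image connected_Times continuous_intros)
  ultimately show ?thesis by simp
qed

lemma connected_thickening:
  fixes S :: "'a :: real_normed_vector set"
  assumes "connected S"
  shows "connected (\<Union>s\<in>S. cball s e)" "connected (\<Union>s\<in>S. ball s e)"
  using connected_translates[OF assms connected_cball[of 0 e]] connected_translates[OF assms connected_ball[of 0 e]]
  by (simp_all add: cball_translation[symmetric] ball_translation[symmetric])

lemma connected_subset_clopen:
  assumes "connected T" "T \<inter> P \<noteq> {}" "closed P" "open V" "P \<subseteq> V" "T \<inter> V \<subseteq> P"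
  shows "T \<subseteq> P"
proof (rule ccontr)
  assume "\<not> T \<subseteq> P"
  then have "- P \<inter> T \<noteq> {}" "V \<inter> T \<noteq> {}" "T \<subseteq> V \<union> - P" "V \<inter> - P \<inter> T = {}" using assms by auto
  then show False using connectedD[OF assms(1), of V "- P"] assms(3,4) by auto
qed

lemma quasi_periodic_extension:
  fixes c :: "real \<Rightarrow> 'a :: real_normed_vector"
  assumes c: "continuous_on {0..1} c" and w: "c 1 = c 0 + w"
  defines "C \<equiv> \<lambda>s. c (frac s) + of_int \<lfloor>s\<rfloor> *\<^sub>R w"
  shows "continuous_on UNIV C"
proof (rule continuous_on_unit_intervals)
  fix k :: int
  show "continuous_on {of_int k..of_int k + 1} C"
  proof (rule continuous_on_eq)
    show "continuous_on {of_int k..of_int k + 1} (\<lambda>s. c (s - of_int k) + of_int k *\<^sub>R w)"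
      by (intro continuous_intros continuous_on_compose2[OF c]) auto
    fix s :: real assume s: "s \<in> {of_int k..of_int k + 1}"
    show "c (s - of_int k) + of_int k *\<^sub>R w = C s"
    proof (cases "s = of_int k + 1")
      case True
      then show ?thesis using w by (simp add: C_def algebra_simps)
    next
      case False
      then have "\<lfloor>s\<rfloor> = k" using s by (simp add: floor_eq_iff)
      then show ?thesis by (simp add: C_def frac_def)
    qed
  qed
qed

text \<open>Extended periodically, the curves stay at bounded distance from lines of directions
  \<open>w1\<close> and \<open>w2\<close>. In the coordinates of this basis their difference is a
  bounded perturbation of the identity of the plane and has a zero by Brouwer's fixed point
  theorem.\<close>

lemma nonparallel_lines_cross:
  fixes c1 c2 :: "real \<Rightarrow> real \<times> real"
  assumes c1: "continuous_on {0..1} c1" "c1 1 = c1 0 + zv w1" and c2: "continuous_on {0..1} c2" "c2 1 = c2 0 + zv w2"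
    and d: "idet w1 w2 \<noteq> 0"
  obtains s t v where "s \<in> {0..1}" "t \<in> {0..1}" "c1 s + zv v = c2 t"
proof -
  define C where "C = (\<lambda>(c :: real \<Rightarrow> real \<times> real) w (s :: real). c (frac s) + of_int \<lfloor>s\<rfloor> *\<^sub>R zv w)"
  have C1: "continuous_on UNIV (C c1 w1)" and C2: "continuous_on UNIV (C c2 w2)"
    unfolding C_def by (rule quasi_periodic_extension[OF c1] quasi_periodic_extension[OF c2])+
  have bdd: "\<exists>B. \<forall>s. norm (C c w s - s *\<^sub>R zv w) \<le> B" if c: "continuous_on {0..1} c" for c w
  proof -
    have "bounded (c ` {0..1})" using compact_continuous_image[OF c] compact_imp_bounded by blast
    then obtain B where "\<forall>x\<in>c ` {0..1}. norm x \<le> B" unfolding bounded_iff by blast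
    then have B: "norm (c s) \<le> B" if "s \<in> {0..1}" for s using that by blast
    have "norm (C c w s - s *\<^sub>R zv w) \<le> B + norm (zv w)" for s
    proof -
      have "C c w s - s *\<^sub>R zv w = c (frac s) - frac s *\<^sub>R zv w" by (simp add: C_def frac_def algebra_simps)
      then have "norm (C c w s - s *\<^sub>R zv w) \<le> norm (c (frac s)) + frac s * norm (zv w)"
        using norm_triangle_ineq4[of "c (frac s)" "frac s *\<^sub>R zv w"] by (simp add: frac_ge_0)
      also have "\<dots> \<le> B + 1 * norm (zv w)"
        using B[of "frac s"] frac_lt_1[of s] by (intro add_mono mult_right_mono) (auto simp: frac_ge_0)
      finally show ?thesis by simp
    qed
    then show ?thesis by blast
  qed
  obtain B1 where B1: "\<And>s. norm (C c1 w1 s - s *\<^sub>R zv w1) \<le> B1" using bdd[OF c1(1)] by blast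
  obtain B2 where B2: "\<And>s. norm (C c2 w2 s - s *\<^sub>R zv w2) \<le> B2" using bdd[OF c2(1)] by blast
  define e where "e = real_of_int (idet w1 w2)"
  \<comment> \<open>Cramer's rule for the inverse of the map from (s, t) to s w1 - t w2.\<close>
  define L where "L = (\<lambda>z::real \<times> real. ((fst z * of_int (snd w2) - snd z * of_int (fst w2)) / e, - (of_int (fst w1) * snd z - of_int (snd w1) * fst z) / e))"
  have e: "e \<noteq> 0" using d by (simp add: e_def)
  have linL: "linear L" by (rule linearI) (auto simp: L_def add_divide_distrib diff_divide_distrib algebra_simps)
  have L: "L (s *\<^sub>R zv w1 - t *\<^sub>R zv w2) = (s, t)" for s t
  proof -
    have "e = of_int (fst w1) * of_int (snd w2) - of_int (snd w1) * of_int (fst w2)" by (simp add: e_def idet_def)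
    then have "s * e = s * of_int (fst w1) * of_int (snd w2) - s * of_int (snd w1) * of_int (fst w2)"
      "t * e = t * of_int (fst w1) * of_int (snd w2) - t * of_int (snd w1) * of_int (fst w2)"
      by (simp_all add: right_diff_distrib mult.assoc)
    then show ?thesis using e by (simp add: L_def divide_eq_eq minus_divide_left) (simp add: algebra_simps)
  qed
  have L0: "z = 0" if "L z = 0" for z
  proof -
    define x y where "x = fst z" and "y = snd z"
    have "x * of_int (snd w2) - y * of_int (fst w2) = 0" "of_int (fst w1) * y - of_int (snd w1) * x = 0"
      using that e by (auto simp: L_def x_def y_def prod_eq_iff)
    moreover have "e = of_int (fst w1) * of_int (snd w2) - of_int (snd w1) * of_int (fst w2)" by (simp add: e_def idet_def)
    ultimately have "e * x = 0" "e * y = 0" by algebra+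
    then show ?thesis using e by (simp add: x_def y_def prod_eq_iff)
  qed
  obtain K where K: "K > 0" "\<And>z. norm (L z) \<le> norm z * K"
    using bounded_linear.pos_bounded[of L] linL linear_conv_bounded_linear by blast
  define \<Psi> where "\<Psi> = (\<lambda>z. C c1 w1 (fst z) - C c2 w2 (snd z))"
  define G where "G = (\<lambda>z. z - L (\<Psi> z))"
  have cG: "continuous_on UNIV G"
  proof -
    have cL: "continuous_on UNIV L" using linL by (simp add: linear_continuous_on linear_conv_bounded_linear)
    have "continuous_on UNIV (\<lambda>z::real \<times> real. C c1 w1 (fst z))"
      by (rule continuous_on_compose2[OF C1 continuous_on_fst[OF continuous_on_id]]) auto
    moreover have "continuous_on UNIV (\<lambda>z::real \<times> real. C c2 w2 (snd z))"
      by (rule continuous_on_compose2[OF C2 continuous_on_snd[OF continuous_on_id]]) auto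
    ultimately have "continuous_on UNIV \<Psi>" unfolding \<Psi>_def by (rule continuous_on_diff)
    then have "continuous_on UNIV (\<lambda>z. L (\<Psi> z))"
      by (rule continuous_on_compose2[OF cL]) auto
    then show ?thesis unfolding G_def by (intro continuous_on_diff continuous_on_id)
  qed
  define R where "R = (\<bar>B1\<bar> + \<bar>B2\<bar>) * K + 1"
  have GR: "norm (G z) \<le> R" for z
  proof -
    have "G z = L ((fst z *\<^sub>R zv w1 - snd z *\<^sub>R zv w2) - \<Psi> z)"
      by (simp add: G_def linear_diff[OF linL, of "fst z *\<^sub>R zv w1 - snd z *\<^sub>R zv w2"] L)
    also have "norm \<dots> \<le> norm ((fst z *\<^sub>R zv w1 - snd z *\<^sub>R zv w2) - \<Psi> z) * K" by (rule K)
    also have "(fst z *\<^sub>R zv w1 - snd z *\<^sub>R zv w2) - \<Psi> z = (C c2 w2 (snd z) - snd z *\<^sub>R zv w2) - (C c1 w1 (fst z) - fst z *\<^sub>R zv w1)"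
      by (simp add: \<Psi>_def)
    also have "norm \<dots> * K \<le> (\<bar>B1\<bar> + \<bar>B2\<bar>) * K"
    proof (intro mult_right_mono)
      show "norm ((C c2 w2 (snd z) - snd z *\<^sub>R zv w2) - (C c1 w1 (fst z) - fst z *\<^sub>R zv w1)) \<le> \<bar>B1\<bar> + \<bar>B2\<bar>"
        using norm_triangle_ineq4[of "C c2 w2 (snd z) - snd z *\<^sub>R zv w2" "C c1 w1 (fst z) - fst z *\<^sub>R zv w1"] B1[of "fst z"] B2[of "snd z"] by linarith
    qed (use K in simp)
    finally show ?thesis by (simp add: R_def)
  qed
  have "R > 0" using K by (simp add: R_def add_nonneg_pos)
  moreover have "G \<in> cball 0 R \<rightarrow> cball 0 R" using GR by (simp add: Pi_def)
  ultimately obtain z where "G z = z"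
    using brouwer_ball[of R 0 G] continuous_on_subset[OF cG, of "cball 0 R"] by blast
  then have "\<Psi> z = 0" using L0 by (simp add: G_def)
  then have eq: "c1 (frac (fst z)) + of_int \<lfloor>fst z\<rfloor> *\<^sub>R zv w1 = c2 (frac (snd z)) + of_int \<lfloor>snd z\<rfloor> *\<^sub>R zv w2"
    by (simp add: \<Psi>_def C_def)
  show ?thesis
  proof (rule that[of "frac (fst z)" "frac (snd z)" "imul \<lfloor>fst z\<rfloor> w1 - imul \<lfloor>snd z\<rfloor> w2"])
    show "c1 (frac (fst z)) + zv (imul \<lfloor>fst z\<rfloor> w1 - imul \<lfloor>snd z\<rfloor> w2) = c2 (frac (snd z))"
      using eq by (simp add: zv_diff zv_imul algebra_simps)
  qed (auto simp: frac_ge_0 less_imp_le[OF frac_lt_1])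
qed

lemma frontier_translates:
  fixes S :: "'a :: real_normed_vector set"
  assumes "\<And>x. x \<in> S \<Longrightarrow> x + w \<in> S" "\<And>x. x \<in> S \<Longrightarrow> x - w \<in> S" and z: "z \<in> frontier S"
  shows "z + w \<in> frontier S"
proof -
  have "(\<lambda>x. w + x) ` S = S"
  proof
    show "S \<subseteq> (\<lambda>x. w + x) ` S"
    proof
      fix u assume "u \<in> S"
      then have "u = w + (u - w)" "u - w \<in> S" using assms by auto
      then show "u \<in> (\<lambda>x. w + x) ` S" by blast
    qed
    show "(\<lambda>x. w + x) ` S \<subseteq> S" using assms(1) by (metis add.commute image_subsetI)
  qed
  then have "(\<lambda>x. w + x) ` frontier S = frontier S" by (metis frontier_translation)
  then show ?thesis using z by (metis add.commute imageI)
qed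

text \<open>A component joins a point to another lattice translate of it. For an open set this says
  that its projection to the torus carries an essential loop.\<close>

definition essential :: "(real \<times> real) set \<Rightarrow> bool" where
  "essential S \<longleftrightarrow> (\<exists>x v. v \<noteq> 0 \<and> connected_component S x (x + zv v))"

lemma parallel_common_multiple:
  assumes "w \<noteq> 0" "w' \<noteq> 0" "idet w w' = 0"
  obtains k k' where "imul k w = imul k' w'" "imul k w \<noteq> 0"
proof (rule that[of "idot w' w'" "idot w w'"])
  show "imul (idot w' w') w = imul (idot w w') w'"
    using assms(3) by (auto simp: idot_def idet_def prod_eq_iff) algebra+
  have "idot w' w' \<noteq> 0" using idot_pos[OF assms(2)] by simp
  then show "imul (idot w' w') w \<noteq> 0" using assms(1) by (auto simp: prod_eq_iff)
qed

lemma connected_component_multiples: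
  assumes inv: "\<And>x v. x \<in> S \<Longrightarrow> x + zv v \<in> S" and w: "connected_component S x (x + zv w)"
  shows "connected_component S x (x + zv (imul k w))"
proof -
  have inv': "y \<in> S \<Longrightarrow> y - zv w \<in> S" for y using inv[of y "- w"] by (simp add: zv_uminus)
  have xx: "connected_component S x x" using w connected_component_in by (metis connected_component_refl)
  have nat: "connected_component S x (x + zv (imul (int n) w)) \<and> connected_component S x (x + zv (imul (- int n) w))" for n
  proof (induction n)
    case (Suc n)
    note s = connected_component_shift_invariant[OF inv inv' w]
    have "x + zv (imul (int n) w) + zv w = x + zv (imul (int (Suc n)) w)"
      "x + zv (imul (- int n) w) - zv w = x + zv (imul (- int (Suc n)) w)"
      by (simp_all add: zv_imul algebra_simps)
    then show ?case using s(1)[of "x + zv (imul (int n) w)"] s(2)[of "x + zv (imul (- int n) w)"] Suc by metis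
  qed (use xx in simp)
  then show ?thesis by (cases k rule: int_cases2) auto
qed

context lift_map
begin

text \<open>If the periods of the two components are not parallel, the components would cross. If
  they are, there is a common period \<open>W\<close>; the frontier of a suitable complementary
  component of \<open>I\<close> is connected, invariant under \<open>W\<close> and contained in
  \<open>frontier X\<close>, against \<open>no_free_continuum\<close>.\<close>

lemma essential_imp_complement_inessential:
  assumes nf: "no_free_continuum f" and X: "closed X" "\<And>x v. x \<in> X \<Longrightarrow> x + zv v \<in> X"
    and fr: "f ` frontier X \<inter> frontier X = {}" and e1: "essential X" and e2: "essential (- X)"
  shows False
proof -
  have Xc: "x + zv v \<in> - X" if "x \<in> - X" for x v
    using that X(2)[of "x + zv v" "- v"] by (auto simp: zv_uminus)
  obtain x w where w: "w \<noteq> 0" "connected_component X x (x + zv w)" using e1 by (auto simp: essential_def)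
  obtain y w' where w': "w' \<noteq> 0" "connected_component (- X) y (y + zv w')" using e2 by (auto simp: essential_def)
  define I where "I = connected_component_set X x"
  have I: "connected I" "I \<subseteq> X" "x \<in> I" "x + zv w \<in> I" "I \<in> components X"
    using w by (auto simp: I_def connected_component_in connected_component_subset components_def dest: connected_component_in)
  show False
  proof (cases "idet w w' = 0")
    case False
    have "open (- X)" using X(1) by (rule open_Compl)
    then have "path_component (- X) y (y + zv w')"
      using w'(2) by (simp add: path_component_eq_connected_component open_imp_locally_path_connected)
    then obtain c2 where c2: "path c2" "path_image c2 \<subseteq> - X" "pathstart c2 = y" "pathfinish c2 = y + zv w'"
      by (auto simp: path_component_def)
    obtain d where d: "d > 0" "\<forall>u\<in>path_image c2. \<forall>z\<in>X. d \<le> dist u z"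
      using separate_compact_closed[of "path_image c2" X] compact_path_image[OF c2(1)] X c2(2) by blast
    \<comment> \<open>\<open>I\<close> need not be path connected, but this open neighbourhood is;
      its width keeps it away from all lattice translates of the path \<open>c2\<close>.\<close>
    define T where "T = (\<Union>s\<in>I. ball s d)"
    have "open T" by (auto simp: T_def)
    moreover have "connected T"
      unfolding T_def by (rule connected_thickening(2)[OF I(1)])
    ultimately have "path_connected T" using connected_open_path_connected by blast
    moreover have "x \<in> T" "x + zv w \<in> T"
      unfolding T_def using d by (intro UN_I[OF I(3)] UN_I[OF I(4)]; simp)+
    ultimately obtain c1 where c1: "path c1" "path_image c1 \<subseteq> T" "pathstart c1 = x" "pathfinish c1 = x + zv w"
      unfolding path_connected_def by blast
    obtain s t v where st: "s \<in> {0..1}" "t \<in> {0..1}" "c1 s + zv v = c2 t"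
      by (rule nonparallel_lines_cross[of c1 w c2 w'])
        (use c1 c2 False in \<open>auto simp: path_def pathstart_def pathfinish_def\<close>)
    have "c1 s \<in> T" using c1(2) st by (auto simp: path_image_def)
    then obtain i where i: "i \<in> I" "dist i (c1 s) < d" by (auto simp: T_def)
    have "c2 t \<in> path_image c2" using st by (auto simp: path_image_def)
    then have "d \<le> dist (c2 t) (i + zv v)" using d i I X(2) by blast
    also have "\<dots> = dist i (c1 s)" by (simp add: st(3)[symmetric] dist_commute)
    finally show False using i by simp
  next
    case True
    obtain k k' where k: "imul k w = imul k' w'" "imul k w \<noteq> 0"
      using parallel_common_multiple[OF w(1) w'(1) True] by blast
    define W where "W = imul k w"
    have xW: "connected_component X x (x + zv W)"
      unfolding W_def by (rule connected_component_multiples[OF X(2) w(2)])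
    have yW: "connected_component (- X) y (y + zv W)"
      unfolding W_def k(1) by (rule connected_component_multiples[OF Xc w'(2)])
    have XmW: "z - zv W \<in> X" if "z \<in> X" for z using X(2)[OF that, of "- W"] by (simp add: zv_uminus)
    have Iinv: "z + zv W \<in> I" "z - zv W \<in> I" if "z \<in> I" for z
      using connected_component_shift_invariant[OF X(2) XmW xW, of z] that by (auto simp: I_def)
    have mIinv: "z + zv W \<in> - I" "z - zv W \<in> - I" if "z \<in> - I" for z
      using that Iinv[of "z + zv W"] Iinv[of "z - zv W"] by auto
    define Q where "Q = connected_component_set (- I) y"
    have yIW: "connected_component (- I) y (y + zv W)"
      using yW I(2) by (meson Compl_anti_mono connected_component_of_subset)
    have yI: "y \<in> - I" using yIW connected_component_in by metis
    have Qinv: "z + zv W \<in> Q" "z - zv W \<in> Q" if "z \<in> Q" for z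
      using connected_component_shift_invariant[OF mIinv yIW, of z] that by (auto simp: Q_def)
    have Qc: "Q \<in> components (- I)" using yI by (auto simp: Q_def components_def)
    have cfr: "connected (frontier Q)" by (rule connected_frontier_component_complement[OF I(1) Qc])
    have frX: "frontier Q \<subseteq> frontier X"
      using frontier_of_components_subset[OF Qc] frontier_of_components_subset[OF I(5)] by auto
    have "y \<in> Q" using yI by (simp add: Q_def connected_component_refl_eq)
    moreover have "x \<notin> Q" using I(3) Qc in_components_subset by blast
    ultimately have "frontier Q \<noteq> {}" using frontier_not_empty by (metis UNIV_I empty_iff)
    then obtain z where z: "z \<in> frontier Q" by blast
    then have "z + zv W \<in> frontier Q" using frontier_translates[OF Qinv] by blast
    moreover have "\<forall>b v. b \<in> frontier X \<longrightarrow> b + zv v \<in> frontier X"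
    proof (intro allI impI)
      fix b v assume "b \<in> frontier X"
      moreover have "x - zv v \<in> X" if "x \<in> X" for x using X(2)[OF that, of "- v"] by (simp add: zv_uminus)
      ultimately show "b + zv v \<in> frontier X" using frontier_translates[OF X(2)] by blast
    qed
    ultimately have "W = 0"
      using nf cfr frX z fr frontier_closed unfolding no_free_continuum_def by metis
    then show False using k by (simp add: W_def)
  qed
qed

end

section \<open>Unions of grid squares\<close>

definition reg :: "nat \<Rightarrow> (int \<times> int) set \<Rightarrow> (real \<times> real) set" where
  "reg N U = (\<Union>a\<in>U. sq N a)"

definition osq :: "nat \<Rightarrow> int \<times> int \<Rightarrow> (real \<times> real) set" where
  "osq N a = {p. of_int (fst a) < real N * fst p \<and> real N * fst p < of_int (fst a) + 1 \<and>
     of_int (snd a) < real N * snd p \<and> real N * snd p < of_int (snd a) + 1}"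

text \<open>A point that determines its square, unlike the corner \<open>pos\<close>, which is
  shared by four squares.\<close>

definition ctr :: "nat \<Rightarrow> int \<times> int \<Rightarrow> real \<times> real" where
  "ctr N a = pos N a + (1 / (2 * real N), 1 / (2 * real N))"

lemma ctr_in_osq: "N > 0 \<Longrightarrow> ctr N a \<in> osq N a"
  by (simp add: ctr_def osq_def pos_def field_simps)

lemma osq_subset_sq: "osq N a \<subseteq> sq N a"
  by (auto simp: osq_def sq_def)

lemma ctr_in_sq: "N > 0 \<Longrightarrow> ctr N a \<in> sq N a"
  using ctr_in_osq osq_subset_sq by blast

lemma ctr_translate: "N > 0 \<Longrightarrow> ctr N (a + imul (int N) v) = ctr N a + zv v"
  by (simp add: ctr_def pos_translate)

lemma convex_sq: "convex (sq N a)" and convex_osq: "convex (osq N a)"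
proof -
  have *: "linear (\<lambda>p::real \<times> real. real N * fst p)" "linear (\<lambda>p::real \<times> real. real N * snd p)"
    by (auto intro!: linearI simp: algebra_simps)
  have "sq N a = (\<lambda>p. real N * fst p) -` {of_int (fst a)..of_int (fst a) + 1} \<inter> (\<lambda>p. real N * snd p) -` {of_int (snd a)..of_int (snd a) + 1}"
    by (auto simp: sq_def)
  then show "convex (sq N a)" by (simp add: * convex_Int convex_linear_vimage)
  have "osq N a = (\<lambda>p. real N * fst p) -` {of_int (fst a)<..<of_int (fst a) + 1} \<inter> (\<lambda>p. real N * snd p) -` {of_int (snd a)<..<of_int (snd a) + 1}"
    by (auto simp: osq_def)
  then show "convex (osq N a)" by (simp add: * convex_Int convex_linear_vimage)
qed

lemma closed_sq: "closed (sq N a)"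
  unfolding sq_def by (intro closed_Collect_conj closed_Collect_le continuous_intros)

lemma osq_sq_eq: "x \<in> osq N a \<Longrightarrow> x \<in> sq N b \<Longrightarrow> a = b"
  by (auto simp: osq_def sq_def prod_eq_iff)

lemma osq_segment:
  assumes N: "N > 0" and y: "y \<in> sq N a" and t: "0 < t" "t \<le> 1"
  shows "y + t *\<^sub>R (ctr N a - y) \<in> osq N a"
proof -
  have c: "real N * fst (ctr N a) = of_int (fst a) + 1/2" "real N * snd (ctr N a) = of_int (snd a) + 1/2"
    using N by (auto simp: ctr_def pos_def field_simps)
  have *: "k < (1 - t) * m + t * (k + 1/2) \<and> (1 - t) * m + t * (k + 1/2) < k + 1" if "k \<le> m" "m \<le> k + 1" for k m :: real
  proof -
    have "(1 - t) * k \<le> (1 - t) * m" "(1 - t) * m \<le> (1 - t) * (k + 1)" using that t by (auto intro: mult_left_mono)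
    then show ?thesis using t by (simp add: algebra_simps)
  qed
  have "real N * fst (y + t *\<^sub>R (ctr N a - y)) = (1 - t) * (real N * fst y) + t * (of_int (fst a) + 1/2)"
    "real N * snd (y + t *\<^sub>R (ctr N a - y)) = (1 - t) * (real N * snd y) + t * (of_int (snd a) + 1/2)"
    using c by (auto simp: algebra_simps)
  then show ?thesis using *[of "of_int (fst a)" "real N * fst y"] *[of "of_int (snd a)" "real N * snd y"] y
    unfolding osq_def sq_def mem_Collect_eq by presburger
qed

lemma near_osq:
  assumes N: "N > 0" and y: "y \<in> sq N a" and e: "e > 0"
  obtains z where "z \<in> osq N a" "dist z y < e"
proof -
  define n where "n = norm (ctr N a - y)"
  define t where "t = min 1 (e / (n + 1) / 2)"
  have n: "n \<ge> 0" by (simp add: n_def)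
  have t: "0 < t" "t \<le> 1" using e n by (auto simp: t_def)
  have "t * n \<le> e / (n + 1) / 2 * n" using n by (intro mult_right_mono) (auto simp: t_def)
  also have "\<dots> \<le> e / (n + 1) / 2 * (n + 1)" using n e by (intro mult_left_mono) auto
  also have "\<dots> = e / 2" using n by (simp add: add_pos_nonneg less_imp_neq[symmetric] divide_simps)
  finally have "t * n < e" using e by simp
  then show ?thesis using that[OF osq_segment[OF N y t]] t by (simp add: dist_norm n_def)
qed

text \<open>Local finiteness: near \<open>x\<close> only labels within distance 3 of its cell
  occur.\<close>

lemma closed_reg:
  assumes N: "N > 0"
  shows "closed (reg N U)"
  unfolding closed_def
proof (subst open_subopen, intro ballI)
  fix x assume x: "x \<in> - reg N U"
  define F where "F = {\<lfloor>real N * fst x\<rfloor> - 3..\<lfloor>real N * fst x\<rfloor> + 3} \<times> {\<lfloor>real N * snd x\<rfloor> - 3..\<lfloor>real N * snd x\<rfloor> + 3}"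
  define G where "G = {z::real \<times> real. \<bar>real N * fst z - real N * fst x\<bar> < 1 \<and> \<bar>real N * snd z - real N * snd x\<bar> < 1}"
  have "finite F" by (simp add: F_def)
  then have "closed (\<Union>a\<in>U \<inter> F. sq N a)" by (intro closed_UN ballI closed_sq) blast
  moreover have "open G" unfolding G_def by (intro open_Collect_conj open_Collect_less continuous_intros)
  ultimately have "open (G - (\<Union>a\<in>U \<inter> F. sq N a))" by (rule open_Diff[rotated])
  moreover have "x \<in> G - (\<Union>a\<in>U \<inter> F. sq N a)" using x by (auto simp: G_def reg_def)
  moreover have "G - (\<Union>a\<in>U \<inter> F. sq N a) \<subseteq> - reg N U"
  proof
    fix z assume z: "z \<in> G - (\<Union>a\<in>U \<inter> F. sq N a)"
    show "z \<in> - reg N U"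
    proof
      assume "z \<in> reg N U"
      then obtain a where a: "a \<in> U" "z \<in> sq N a" by (auto simp: reg_def)
      then have "a \<in> F" using z unfolding F_def G_def sq_def by (auto simp: mem_Times_iff) linarith+
      then show False using a z by auto
    qed
  qed
  ultimately show "\<exists>T. open T \<and> x \<in> T \<and> T \<subseteq> - reg N U" by blast
qed

lemma closure_complement_reg: "N > 0 \<Longrightarrow> closure (- reg N U) \<subseteq> reg N (- U)"
proof (rule closure_minimal)
  show "- reg N U \<subseteq> reg N (- U)"
  proof
    fix x assume "x \<in> - reg N U"
    then have "lattice_cell N x \<in> - U" using cell_in_sq[of x N] by (auto simp: reg_def)
    then show "x \<in> reg N (- U)" using cell_in_sq[of x N] by (auto simp: reg_def)
  qed
qed (rule closed_reg)

lemma not_in_closure_complement_reg: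
  assumes "N > 0" "\<And>a. x \<in> sq N a \<Longrightarrow> a \<in> U"
  shows "x \<notin> closure (- reg N U)"
proof
  assume "x \<in> closure (- reg N U)"
  then have "x \<in> reg N (- U)" using closure_complement_reg[OF assms(1)] by blast
  then show False using assms(2) by (auto simp: reg_def)
qed

lemma reg_translate:
  assumes "N > 0" "\<And>a v. a \<in> U \<Longrightarrow> a + imul (int N) v \<in> U" "x \<in> reg N U"
  shows "x + zv v \<in> reg N U"
proof -
  obtain a where "a \<in> U" "x \<in> sq N a" using assms(3) by (auto simp: reg_def)
  then have "a + imul (int N) v \<in> U" "x + zv v \<in> sq N (a + imul (int N) v)" using assms sq_translate by auto
  then show ?thesis by (auto simp: reg_def)
qed

text \<open>The complement of a union of squares is open and not itself such a union, yet its
  components are governed by labels: one that contains a point of a square outside \<open>U\<close>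
  contains the open square.\<close>

lemma complement_component_contains_osq:
  assumes N: "N > 0" and a: "a \<notin> U" and y: "y \<in> sq N a" "connected_component (- reg N U) x y"
  shows "osq N a \<subseteq> connected_component_set (- reg N U) x" "sq N a \<subseteq> closure (connected_component_set (- reg N U) x)"
proof -
  let ?Y = "connected_component_set (- reg N U) x"
  have "open ?Y" using closed_reg[OF N] by (intro open_connected_component) auto
  moreover have "y \<in> ?Y" using y by simp
  ultimately obtain e where e: "e > 0" "ball y e \<subseteq> ?Y" using open_contains_ball by metis
  obtain z where z: "z \<in> osq N a" "dist z y < e" by (rule near_osq[OF N y(1) e(1)])
  have zY: "z \<in> ?Y" using z e by (auto simp: dist_commute)
  have o: "osq N a \<subseteq> - reg N U"
  proof
    fix u assume u: "u \<in> osq N a"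
    show "u \<in> - reg N U"
    proof
      assume "u \<in> reg N U"
      then obtain b where "b \<in> U" "u \<in> sq N b" unfolding reg_def by blast
      then show False using osq_sq_eq[OF u] a by blast
    qed
  qed
  have "connected_component (- reg N U) z w" if "w \<in> osq N a" for w
    unfolding connected_component_def using z(1) that o convex_connected[OF convex_osq] by blast
  then show osq: "osq N a \<subseteq> ?Y" using zY by (auto intro: connected_component_trans)
  show "sq N a \<subseteq> closure ?Y"
  proof
    fix w assume w: "w \<in> sq N a"
    show "w \<in> closure ?Y"
      unfolding closure_approachable using near_osq[OF N w] osq by (metis subsetD)
  qed
qed

text \<open>If a coordinate varied by more than 3 * N * N, squares met at heights 3 apart would
  repeat modulo \<open>N\<close>. Their centres would differ by a lattice vector, which is 0 by
  \<open>ne\<close>, so the squares would coincide; but a square has diameter at most 2. Two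
  coordinates give the factor 6.\<close>

lemma inessential_bounded:
  assumes N: "N > 0" and T: "connected T" and sqT: "\<And>y. y \<in> T \<Longrightarrow> \<exists>a. y \<in> sq N a \<and> ctr N a \<in> T"
    and ne: "\<And>x v. x \<in> T \<Longrightarrow> x + zv v \<in> T \<Longrightarrow> v = 0" and xy: "x \<in> T" "y \<in> T"
  shows "dist x y \<le> 6 * real (N * N)"
proof -
  have *: "h y - h x \<le> 3 * real (N * N)" if h: "h = fst \<or> h = snd" and xy: "x \<in> T" "y \<in> T" for h and x y :: "real \<times> real"
  proof (rule ccontr)
    assume c: "\<not> ?thesis"
    have "continuous_on T h" using h by (auto intro!: continuous_intros)
    then have "connected (h ` T)" by (intro connected_continuous_image T)
    then have mem: "z \<in> h ` T" if "h x \<le> z" "z \<le> h y" for z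
      using that xy unfolding connected_iff_interval by blast
    have "\<exists>a. (\<exists>z\<in>T. h z = h x + 3 * real i \<and> z \<in> sq N a) \<and> ctr N a \<in> T" if i: "i \<le> N * N" for i
    proof -
      have "real i \<le> real (N * N)" using i of_nat_le_iff by blast
      then have "h x + 3 * real i \<in> h ` T" using c by (intro mem) auto
      then obtain z where "z \<in> T" "h z = h x + 3 * real i" by auto
      then show ?thesis using sqT[of z] by auto
    qed
    then obtain p where p: "\<And>i. i \<le> N * N \<Longrightarrow> (\<exists>z\<in>T. h z = h x + 3 * real i \<and> z \<in> sq N (p i)) \<and> ctr N (p i) \<in> T"
      by metis
    obtain i j v where ij: "i < j" "j \<le> N * N" "p j = p i + imul (int N) v" by (rule two_congruent_nodes[OF N])
    have "ctr N (p i) \<in> T" "ctr N (p i) + zv v \<in> T" using p[of i] p[of j] ij ctr_translate[OF N] by auto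
    then have "v = 0" by (rule ne)
    then have "p j = p i" using ij by simp
    then obtain z z' where z: "h z = h x + 3 * real i" "z \<in> sq N (p i)" "h z' = h x + 3 * real j" "z' \<in> sq N (p i)"
      using p[of i] p[of j] ij by auto
    have "dist (h z) (h z') \<le> dist z z'" using h dist_fst_le[of z z'] dist_snd_le[of z z'] by auto
    also have "\<dots> \<le> 2 / real N" using sq_diameter[OF N z(2,4)] .
    also have "\<dots> \<le> 2" using N by (simp add: field_simps)
    finally have "3 * (real j - real i) \<le> 2" using z ij by (simp add: dist_real_def)
    moreover have "real j \<ge> real i + 1" using ij(1) by simp
    ultimately show False by argo
  qed
  have "dist x y \<le> \<bar>fst x - fst y\<bar> + \<bar>snd x - snd y\<bar>" by (rule dist_prod_le_sum)
  moreover have "fst y - fst x \<le> 3 * real (N * N)" "fst x - fst y \<le> 3 * real (N * N)"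
    "snd y - snd x \<le> 3 * real (N * N)" "snd x - snd y \<le> 3 * real (N * N)"
    using *[of fst x y] *[of fst y x] *[of snd x y] *[of snd y x] xy by simp_all
  then have "\<bar>fst x - fst y\<bar> \<le> 3 * real (N * N)" "\<bar>snd x - snd y\<bar> \<le> 3 * real (N * N)" by (simp_all only: abs_diff_le_iff) argo+
  ultimately show ?thesis by argo
qed

text \<open>Formulated without a set of labels, because it is also applied to the complement of the
  unbounded region \<open>Z\<close>.\<close>

definition squares :: "nat \<Rightarrow> (real \<times> real) set \<Rightarrow> bool" where
  "squares N X \<longleftrightarrow> (\<forall>z\<in>X. \<exists>a. z \<in> sq N a \<and> sq N a \<subseteq> X)"

lemma squares_reg: "squares N (reg N U)"
  by (force simp: squares_def reg_def)

text \<open>Squares with points less than 1/\<open>N\<close> apart have labels differing by at most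
  1 in each coordinate and therefore share a corner. So components of a union of squares keep a
  distance of at least 1/\<open>N\<close>.\<close>

lemma squares_component_isolated:
  assumes N: "N > 0" and X: "squares N X" and p: "connected_component X x p" and z: "z \<in> X" "dist z p < 1 / real N"
  shows "connected_component X x z"
proof -
  have "p \<in> X" using p connected_component_in by metis
  then obtain b where b: "p \<in> sq N b" "sq N b \<subseteq> X" using X by (auto simp: squares_def)
  obtain a where a: "z \<in> sq N a" "sq N a \<subseteq> X" using X z by (auto simp: squares_def)
  have "\<bar>fst z - fst p\<bar> < 1 / real N" "\<bar>snd z - snd p\<bar> < 1 / real N"
    using dist_fst_le[of z p] dist_snd_le[of z p] z by (auto simp: dist_real_def)
  moreover have "\<bar>real N * u - real N * w\<bar> < 1" if "\<bar>u - w\<bar> < 1 / real N" for u w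
  proof -
    have "real N * u - real N * w = real N * (u - w)" by (simp add: right_diff_distrib)
    moreover have "real N * \<bar>u - w\<bar> < real N * (1 / real N)" using that N by (intro mult_strict_left_mono) auto
    ultimately show ?thesis using N by (simp add: abs_mult)
  qed
  ultimately have d: "\<bar>real N * fst z - real N * fst p\<bar> < 1" "\<bar>real N * snd z - real N * snd p\<bar> < 1"
    by blast+
  have "real_of_int (fst a) < of_int (fst b) + 2" "real_of_int (fst b) < of_int (fst a) + 2"
    "real_of_int (snd a) < of_int (snd b) + 2" "real_of_int (snd b) < of_int (snd a) + 2"
    using a(1) b(1) d unfolding sq_def mem_Collect_eq by linarith+
  then have ab: "fst a \<le> fst b + 1" "fst b \<le> fst a + 1" "snd a \<le> snd b + 1" "snd b \<le> snd a + 1" by linarith+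
  define c where "c = pos N (max (fst a) (fst b), max (snd a) (snd b))"
  have "c \<in> sq N a" "c \<in> sq N b" using N ab by (auto simp: c_def pos_def sq_def max_def)
  then have "connected_component X p c" "connected_component X c z"
    unfolding connected_component_def using a b convex_connected[OF convex_sq] by blast+
  then show ?thesis using p connected_component_trans by metis
qed

text \<open>Because of the gap 1/\<open>N\<close> between components, a connected set cannot leave a
  component if its points within the gap of that component all belong to \<open>X\<close>.\<close>

lemma squares_component_clopen:
  assumes N: "N > 0" and X: "squares N X" and clX: "closed X" and T: "connected T" "w \<in> T" "connected_component X x w"
    and sub: "\<And>z p. z \<in> T \<Longrightarrow> connected_component X x p \<Longrightarrow> dist z p < 1 / real N \<Longrightarrow> z \<in> X"
  shows "T \<subseteq> connected_component_set X x"
proof (rule connected_subset_clopen[OF T(1), where V = "\<Union>p\<in>connected_component_set X x. ball p (1 / real N)"])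
  show "closed (connected_component_set X x)" by (rule closed_connected_component[OF clX])
  show "T \<inter> (\<Union>p\<in>connected_component_set X x. ball p (1 / real N)) \<subseteq> connected_component_set X x"
  proof
    fix z assume "z \<in> T \<inter> (\<Union>p\<in>connected_component_set X x. ball p (1 / real N))"
    then obtain p where p: "z \<in> T" "connected_component X x p" "dist z p < 1 / real N" by (auto simp: dist_commute)
    then show "z \<in> connected_component_set X x" using squares_component_isolated[OF N X p(2) sub[OF p] p(3)] by simp
  qed
  show "connected_component_set X x \<subseteq> (\<Union>p\<in>connected_component_set X x. ball p (1 / real N))" using N by force
qed (use T in auto)

lemma component_diameter_closed:
  assumes N: "N > 0" and X: "squares N X" and ne: "\<not> essential X" and y: "connected_component X x y" and z: "connected_component X x z"
  shows "dist y z \<le> 6 * real (N * N)"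
proof (rule inessential_bounded[OF N, of "connected_component_set X x"])
  show "\<exists>a. y \<in> sq N a \<and> ctr N a \<in> connected_component_set X x" if y: "y \<in> connected_component_set X x" for y
  proof -
    have "y \<in> X" using y connected_component_in by blast
    then obtain a where a: "y \<in> sq N a" "sq N a \<subseteq> X" using X by (auto simp: squares_def)
    then have "connected_component X y (ctr N a)"
      unfolding connected_component_def using ctr_in_sq[OF N] convex_connected[OF convex_sq] by blast
    then show ?thesis using a y connected_component_trans by (metis mem_Collect_eq)
  qed
  show "v = 0" if "u \<in> connected_component_set X x" "u + zv v \<in> connected_component_set X x" for u v
    using ne that unfolding essential_def by (metis connected_component_sym connected_component_trans mem_Collect_eq)
qed (use y z in auto)

lemma component_diameter_open:
  assumes N: "N > 0" and ne: "\<not> essential (- reg N U)" and y: "connected_component (- reg N U) x y" and z: "connected_component (- reg N U) x z"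
  shows "dist y z \<le> 6 * real (N * N)"
proof (rule inessential_bounded[OF N, of "connected_component_set (- reg N U) x"])
  show "\<exists>a. y \<in> sq N a \<and> ctr N a \<in> connected_component_set (- reg N U) x" if y: "y \<in> connected_component_set (- reg N U) x" for y
  proof -
    have "y \<in> - reg N U" using y connected_component_in by blast
    then have "lattice_cell N y \<notin> U" using cell_in_sq[of y N] by (auto simp: reg_def)
    then show ?thesis using complement_component_contains_osq(1)[OF N _ cell_in_sq] y ctr_in_osq[OF N] cell_in_sq by blast
  qed
  show "v = 0" if "u \<in> connected_component_set (- reg N U) x" "u + zv v \<in> connected_component_set (- reg N U) x" for u v
    using ne that unfolding essential_def by (metis connected_component_sym connected_component_trans mem_Collect_eq)
qed (use y z in auto)

lemma bounded_components_not_essential: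
  assumes inv: "\<And>x v. x \<in> S \<Longrightarrow> x + zv v \<in> S" and b: "\<And>x. bounded (connected_component_set S x)"
  shows "\<not> essential S"
proof
  assume "essential S"
  then obtain x v where v: "v \<noteq> 0" "connected_component S x (x + zv v)" by (auto simp: essential_def)
  obtain B where B: "\<And>y. connected_component S x y \<Longrightarrow> norm y \<le> B" using b[of x] by (auto simp: bounded_iff)
  obtain k :: nat where k: "real k * norm (zv v) > B + norm x"
    using reals_Archimedean3[of "norm (zv v)"] v(1) by auto
  have "norm (x + zv (imul (int k) v)) \<le> B" by (rule B[OF connected_component_multiples[OF inv v(2)]])
  moreover have "norm (x + zv (imul (int k) v)) \<ge> norm (zv (imul (int k) v)) - norm x"
    by (metis add.commute norm_diff_ineq)
  moreover have "norm (zv (imul (int k) v)) = real k * norm (zv v)" by (simp add: zv_imul)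
  ultimately show False using k by linarith
qed

section \<open>The half plane of closed walks\<close>

context periodic_graph
begin

definition invariant :: "(int \<times> int) set \<Rightarrow> bool" where
  "invariant V \<longleftrightarrow> (\<forall>a\<in>V. \<forall>v. a + imul (int N) v \<in> V) \<and> (\<forall>a\<in>V. \<forall>b. E a b \<longrightarrow> b \<in> V)"

lemma invariant_translate: "invariant V \<Longrightarrow> a \<in> V \<Longrightarrow> a + imul (int N) v \<in> V"
  and invariant_succ: "invariant V \<Longrightarrow> a \<in> V \<Longrightarrow> E a b \<Longrightarrow> b \<in> V"
  unfolding invariant_def by blast+

lemma invariant_walk: "invariant V \<Longrightarrow> a \<in> V \<Longrightarrow> (E ^^ n) a b \<Longrightarrow> b \<in> V"
  by (induction n arbitrary: b) (auto intro: invariant_succ)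

text \<open>Reachability in the finite quotient graph: the target is prescribed only up to a lattice
  translation.\<close>

definition reach :: "int \<times> int \<Rightarrow> (int \<times> int) set" where
  "reach a = {b. \<exists>n v. (E ^^ n) a (b + imul (int N) v)}"

lemma reach_refl: "a \<in> reach a"
  unfolding reach_def by (intro CollectI exI[of _ 0]) simp

lemma reach_trans: assumes "b \<in> reach a" "c \<in> reach b" shows "c \<in> reach a"
proof -
  obtain n v where 1: "(E ^^ n) a (b + imul (int N) v)" using assms by (auto simp: reach_def)
  obtain m w where "(E ^^ m) b (c + imul (int N) w)" using assms by (auto simp: reach_def)
  then have "(E ^^ m) (b + imul (int N) v) (c + imul (int N) (w + v))" using walk_translate[of m b "c + imul (int N) w" v] by (simp add: imul_add add.assoc)
  then have "(E ^^ (n + m)) a (c + imul (int N) (w + v))" using relpowp_trans 1 by metis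
  then show ?thesis unfolding reach_def by blast
qed

lemma invariant_reach: "invariant (reach a)"
  unfolding invariant_def
proof (intro conjI ballI allI impI)
  fix b v assume "b \<in> reach a"
  then obtain n w where "(E ^^ n) a (b + imul (int N) w)" by (auto simp: reach_def)
  then have "(E ^^ n) a (b + imul (int N) v + imul (int N) (w - v))" by (simp add: imul_diff)
  then show "b + imul (int N) v \<in> reach a" unfolding reach_def by blast
next
  fix b c assume b: "b \<in> reach a" and "E b c"
  then have "(E ^^ Suc 0) b (c + imul (int N) 0)" by (simp add: eq_OO)
  then have "c \<in> reach b" unfolding reach_def by blast
  then show "c \<in> reach a" using b reach_trans by blast
qed

lemma invariant_Un: "invariant V \<Longrightarrow> invariant W \<Longrightarrow> invariant (V \<union> W)"
  unfolding invariant_def by blast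

text \<open>A fundamental domain. Counting nodes in it makes maximal and minimal invariant sets
  available.\<close>

definition box :: "(int \<times> int) set" where
  "box = {0..<int N} \<times> {0..<int N}"

lemma finite_box [simp]: "finite box"
  by (simp add: box_def)

lemma box_representative: obtains v where "a + imul (int N) v \<in> box"
proof (rule that[of "(- (fst a div int N), - (snd a div int N))"])
  show "a + imul (int N) (- (fst a div int N), - (snd a div int N)) \<in> box"
    using N by (simp add: box_def mem_Times_iff minus_mult_div_eq_mod)
qed

lemma invariant_subset_by_box:
  assumes "invariant V" "invariant W" "V \<inter> box \<subseteq> W"
  shows "V \<subseteq> W"
proof
  fix a assume a: "a \<in> V"
  obtain v where v: "a + imul (int N) v \<in> box" by (rule box_representative)
  then have "a + imul (int N) v \<in> W" using assms a invariant_translate by blast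
  then have "a + imul (int N) v + imul (int N) (- v) \<in> W" using assms invariant_translate by blast
  then show "a \<in> W" by (simp add: imul_minus)
qed

text \<open>\<open>V\<close> is a largest good invariant set, and \<open>a\<close> is a node outside
  it whose reach adds as little as possible. A node of \<open>C\<close> that did not reach back to
  \<open>a\<close> would add less, so any two nodes of \<open>C\<close> reach each other. By
  maximality adding \<open>C\<close> makes \<open>V\<close> bad.\<close>

lemma critical_class:
  assumes "good {}" "\<not> good UNIV"
  obtains V C where "invariant V" "good V" "C \<inter> V = {}" "invariant (V \<union> C)" "\<not> good (V \<union> C)" "C \<noteq> {}"
    "\<And>b c. b \<in> C \<Longrightarrow> c \<in> C \<Longrightarrow> c \<in> reach b"
proof -
  define \<V> where "\<V> = {V. invariant V \<and> good V}"
  have "{} \<in> \<V>" using assms by (simp add: \<V>_def invariant_def)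
  moreover have "\<forall>V. V \<in> \<V> \<longrightarrow> card (V \<inter> box) \<le> card box" by (auto intro: card_mono)
  ultimately obtain V where V: "V \<in> \<V>" "\<And>W. W \<in> \<V> \<Longrightarrow> card (W \<inter> box) \<le> card (V \<inter> box)"
    using ex_has_greatest_nat[of "\<lambda>V. V \<in> \<V>" "{}" "\<lambda>V. card (V \<inter> box)" "Suc (card box)"] by (metis less_Suc_eq_le)
  then have iV: "invariant V" and gV: "good V" by (auto simp: \<V>_def)
  have max: "\<not> good W" if W: "invariant W" "V \<subset> W" for W
  proof
    assume "good W"
    then have le: "card (W \<inter> box) \<le> card (V \<inter> box)" using V W by (auto simp: \<V>_def)
    have "V \<inter> box = W \<inter> box" using card_seteq[of "W \<inter> box" "V \<inter> box"] W le by auto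
    then show False using invariant_subset_by_box[OF W(1) iV] W(2) by blast
  qed
  have "V \<noteq> UNIV" using gV assms by blast
  then obtain a0 where "a0 \<notin> V" by blast
  then obtain a where a: "a \<notin> V" "\<And>b. b \<notin> V \<Longrightarrow> card ((V \<union> reach a) \<inter> box) \<le> card ((V \<union> reach b) \<inter> box)"
    using ex_has_least_nat[of "\<lambda>a. a \<notin> V" a0 "\<lambda>a. card ((V \<union> reach a) \<inter> box)"] by blast
  define C where "C = reach a - V"
  have VC: "V \<union> C = V \<union> reach a" by (auto simp: C_def)
  have inv: "invariant (V \<union> reach b)" for b by (intro invariant_Un iV invariant_reach)
  have aC: "a \<in> C" using a reach_refl by (simp add: C_def)
  have return: "a \<in> reach b" if b: "b \<in> C" for b
  proof -
    have "reach b \<subseteq> reach a" using b reach_trans unfolding C_def by blast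
    then have sub: "V \<union> reach b \<subseteq> V \<union> reach a" by blast
    have "card ((V \<union> reach a) \<inter> box) \<le> card ((V \<union> reach b) \<inter> box)" using a(2) b by (simp add: C_def)
    then have "(V \<union> reach b) \<inter> box = (V \<union> reach a) \<inter> box" by (intro card_seteq finite_Int disjI2 finite_box Int_mono sub order_refl)
    then have "V \<union> reach a \<subseteq> V \<union> reach b" by (intro invariant_subset_by_box[OF inv inv]) blast
    then show ?thesis using a(1) reach_refl by blast
  qed
  show ?thesis
  proof (rule that[OF iV gV])
    show "C \<inter> V = {}" by (auto simp: C_def)
    show "invariant (V \<union> C)" unfolding VC by (rule inv)
    show "\<not> good (V \<union> C)" by (rule max) (use aC a inv VC in auto)
    show "C \<noteq> {}" using aC by blast
    show "c \<in> reach b" if "b \<in> C" "c \<in> C" for b c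
      using return[OF that(1)] that(2) reach_trans unfolding C_def by blast
  qed
qed

end

lemma nonneg_by_multiples:
  fixes x y :: real
  assumes "\<And>k::nat. k \<ge> 1 \<Longrightarrow> x + real k * y \<ge> 0"
  shows "y \<ge> 0"
proof (rule ccontr)
  assume "\<not> y \<ge> 0"
  then obtain k :: nat where k: "x < real k * (- y)" using reals_Archimedean3[of "- y"] by auto
  have "x + real (Suc k) * y \<ge> 0" using assms[of "Suc k"] by simp
  then show False using k \<open>\<not> y \<ge> 0\<close> by (simp add: algebra_simps)
qed

context rational_rotation
begin

text \<open>The values of \<open>mu\<close> at one node form a semigroup without 0. A closed walk at
  another node of the class is inserted \<open>k\<close> times into a fixed closed walk at the first
  node; the fixed part is negligible as \<open>k\<close> grows.\<close>

lemma class_half_plane: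
  assumes N: "N > 0" and nz: "nozero N" and C: "C \<noteq> {}" "\<And>b c. b \<in> C \<Longrightarrow> c \<in> C \<Longrightarrow> c \<in> periodic_graph.reach (edge N) N b"
  obtains l :: "real \<times> real" where "l \<noteq> 0" "\<And>b n v. b \<in> C \<Longrightarrow> cyc N b n v \<Longrightarrow> l \<bullet> zv (mu n v) \<ge> 0"
proof -
  interpret G: periodic_graph "edge N" N by (rule periodic_graph[OF N])
  obtain a where a: "a \<in> C" using C by blast
  define S where "S = {mu n v | n v. cyc N a n v}"
  have add: "s + t \<in> S" if "s \<in> S" "t \<in> S" for s t
  proof -
    obtain n v m w where "cyc N a n v" "cyc N a m w" "s = mu n v" "t = mu m w" using \<open>s \<in> S\<close> \<open>t \<in> S\<close> by (auto simp: S_def)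
    then have "cyc N a (n + m) (v + w)" "s + t = mu (n + m) (v + w)" by (auto simp: mu_add intro: G.closed_walk_add)
    then show ?thesis unfolding S_def by blast
  qed
  have "0 \<notin> S"
  proof
    assume "0 \<in> S"
    then obtain n v where "0 = mu n v" "cyc N a n v" by (auto simp: S_def)
    then show False using nz unfolding nozero_def by metis
  qed
  then obtain l :: "real \<times> real" where l: "l \<noteq> 0" "\<And>s. s \<in> S \<Longrightarrow> l \<bullet> zv s \<ge> 0"
    using integer_semigroup_half_plane[of S] add by blast
  show ?thesis
  proof (rule that[OF l(1)])
    fix b n v assume b: "b \<in> C" and c: "cyc N b n v"
    obtain i w where i: "(edge N ^^ i) a (b + imul (int N) w)" using C(2)[OF a b] by (auto simp: G.reach_def)
    obtain j w' where j: "(edge N ^^ j) b (a + imul (int N) w')" using C(2)[OF b a] by (auto simp: G.reach_def)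
    show "l \<bullet> zv (mu n v) \<ge> 0"
    proof (rule nonneg_by_multiples)
      fix k :: nat assume k: "k \<ge> 1"
      have kc: "k * n \<ge> 1" "(edge N ^^ (k * n)) b (b + imul (int N) (imul (int k) v))"
        using G.closed_walk_mult[OF c k] by (auto simp: G.closed_walk_def)
      have "(edge N ^^ (k * n)) (b + imul (int N) w) (b + imul (int N) (imul (int k) v) + imul (int N) w)"
        using kc G.walk_translate by blast
      moreover have "(edge N ^^ j) (b + imul (int N) (imul (int k) v) + imul (int N) w) (a + imul (int N) (w' + imul (int k) v + w))"
        using G.walk_translate[OF j, of "imul (int k) v + w"] by (simp add: imul_add add.assoc)
      ultimately have "(edge N ^^ (i + k * n + j)) a (a + imul (int N) (w' + imul (int k) v + w))"
        using i relpowp_trans by metis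
      moreover have "i + k * n + j \<ge> 1" using kc(1) by linarith
      ultimately have "cyc N a (i + k * n + j) (w' + imul (int k) v + w)" by (simp add: G.closed_walk_def)
      then have "l \<bullet> zv (mu (i + k * n + j) (w' + imul (int k) v + w)) \<ge> 0" using l(2) unfolding S_def by blast
      moreover have "mu (i + k * n + j) (w' + imul (int k) v + w) = mu (i + j) (w' + w) + imul (int k) (mu n v)"
        by (simp add: mu_def prod_eq_iff algebra_simps)
      ultimately show "l \<bullet> zv (mu (i + j) (w' + w)) + real k * (l \<bullet> zv (mu n v)) \<ge> 0"
        by (simp add: zv_add zv_imul inner_add_right)
    qed
  qed
qed

end

section \<open>Level sets sweeping the plane\<close>

lemma inner_diff_le_norm: "l \<bullet> x \<le> l \<bullet> y + norm l * dist x (y :: 'a :: real_inner)"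
  using norm_cauchy_schwarz[of l "x - y"] by (simp add: inner_diff_right dist_norm)

text \<open>If a closed set separates two points, one of its components does so already; a bounded
  component leaves only one unbounded complementary component.\<close>

lemma same_component_cobounded:
  fixes S :: "'a :: euclidean_space set"
  assumes "2 \<le> DIM('a)" "closed K" "\<And>x. bounded (connected_component_set K x)"
    and "\<not> bounded (connected_component_set (- K) x)" "\<not> bounded (connected_component_set (- K) (y :: 'a))"
  shows "connected_component (- K) x y"
proof (rule ccontr)
  assume "\<not> ?thesis"
  then obtain C where C: "C \<in> components K" "\<not> connected_component (- C) x y"
    using separation_by_component_closed_pointwise[OF assms(2)] by metis
  have sub: "- K \<subseteq> - C" using in_components_subset[OF C(1)] by blast
  have "bounded (- (- C))" using C(1) assms(3) by (auto simp: components_def)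
  moreover have "\<not> bounded (connected_component_set (- C) x)" "\<not> bounded (connected_component_set (- C) y)"
    using connected_component_mono[OF sub] assms(4,5) bounded_subset by blast+
  ultimately have "connected_component_set (- C) x = connected_component_set (- C) y"
    using assms(1) by (intro cobounded_unique_unbounded_component)
  moreover have "y \<in> - C"
  proof -
    have "connected_component_set (- K) y \<noteq> {}" using assms(5) by (metis bounded_empty)
    then have "y \<in> - K" using connected_component_in by blast
    then show ?thesis using sub by blast
  qed
  ultimately show False using C(2) by (metis connected_component_refl mem_Collect_eq)
qed

lemma lattice_far_left:
  fixes l :: "real \<times> real"
  assumes "l \<noteq> 0"
  obtains v where "l \<bullet> (x + zv v) < r"
proof -
  have *: "\<exists>w. l \<bullet> zv w < 0"
  proof -
    have "l \<bullet> zv (1, 0) = fst l" "l \<bullet> zv (0, 1) = snd l" "l \<bullet> zv (-1, 0) = - fst l" "l \<bullet> zv (0, -1) = - snd l"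
      by (auto simp: inner_prod_def)
    moreover have "fst l \<noteq> 0 \<or> snd l \<noteq> 0" using assms by (auto simp: prod_eq_iff)
    ultimately show ?thesis by (metis neg_less_0_iff_less not_less_iff_gr_or_eq)
  qed
  then obtain w where w: "l \<bullet> zv w < 0" by blast
  obtain k :: nat where k: "real k * (- (l \<bullet> zv w)) > l \<bullet> x - r" using reals_Archimedean3[of "- (l \<bullet> zv w)"] w by auto
  have "l \<bullet> (x + zv (imul (int k) w)) = l \<bullet> x + real k * (l \<bullet> zv w)" by (simp add: inner_add_right zv_imul)
  then show ?thesis using that[of "imul (int k) w"] k by simp
qed

text \<open>
  $A(t)$ is $V$ with the part of $C$ to the right of $t$ in direction $l$, up to the error $K'$, in
  the moving frame of speed $\<alpha>$.
\<close>

locale level_sets = lift_map +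
  fixes N :: nat and V C :: "(int \<times> int) set" and l :: "real \<times> real" and \<alpha> K' :: real and A :: "real \<Rightarrow> (int \<times> int) set"
  assumes N: "N > 0" and nf: "no_free_continuum f" and l: "l \<noteq> 0"
    and invV: "periodic_graph.invariant (edge N) N V"
    and unbV: "\<exists>x. \<not> bounded (connected_component_set (- reg N V) x)"
    and invU: "periodic_graph.invariant (edge N) N (V \<union> C)"
    and bddU: "\<And>x. bounded (connected_component_set (- reg N (V \<union> C)) x)"
    and A_sub: "\<And>t. V \<subseteq> A t" "\<And>t. A t \<subseteq> V \<union> C"
    and A_succ: "\<And>t c d. c \<in> A t \<Longrightarrow> edge N c d \<Longrightarrow> d \<in> A (t + \<alpha>)"
    and A_right: "\<And>t b. b \<in> C \<Longrightarrow> l \<bullet> pos N b \<ge> t \<Longrightarrow> b \<in> A t"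
    and A_left: "\<And>t b. b \<in> C \<Longrightarrow> b \<in> A t \<Longrightarrow> l \<bullet> pos N b \<ge> t - K'" and K': "K' \<ge> 0"
begin

sublocale G: periodic_graph "edge N" N
  by (rule periodic_graph[OF N])

abbreviation K where "K \<equiv> reg N V"
abbreviation B where "B t \<equiv> reg N (A t)"
abbreviation U where "U \<equiv> reg N (V \<union> C)"

text \<open>All unbounded components of the complement of \<open>K\<close> together; as
  \<open>K\<close> has only bounded components, there is in fact just one.\<close>

definition Z :: "(real \<times> real) set" where
  "Z = {x. \<not> bounded (connected_component_set (- K) x)}"

text \<open>\<open>D\<close> bounds the components of inessential sets made of squares, and \<sigma>
  bounds the variation of \<open>l\<close> over one square. To the left of t - M the region
  \<open>B t\<close> agrees with \<open>K\<close>; M' leaves room for one more component of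
  \<open>K\<close> and a unit.\<close>

definition D :: real where "D = 6 * real (N * N)"
definition L :: real where "L = norm l"
definition \<sigma> :: real where "\<sigma> = 2 * L / real N"
definition M :: real where "M = K' + \<sigma>"
definition M' :: real where "M' = M + L * (D + 1)"

lemma const_facts: "L > 0" "D \<ge> 0" "\<sigma> \<ge> 0" "M \<ge> 0" "L * D \<ge> 0" "M' \<ge> M" "M' = M + L * D + L"
  using l K' by (auto simp: L_def D_def \<sigma>_def M_def M'_def algebra_simps)

lemma K_inv: "x \<in> K \<Longrightarrow> x + zv v \<in> K"
  by (rule reg_translate[OF N G.invariant_translate[OF invV]])

lemma cK_inv: "x \<in> - K \<Longrightarrow> x + zv v \<in> - K"
  using K_inv[of "x + zv v" "- v"] by (auto simp: zv_uminus)

lemma edge_avoid: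
  assumes "\<And>c d. c \<in> W \<Longrightarrow> edge N c d \<Longrightarrow> d \<in> W'" "x \<in> reg N W" "dist (f x) y \<le> 1 / real N"
  shows "y \<notin> closure (- reg N W')"
proof (rule not_in_closure_complement_reg[OF N])
  fix b assume b: "y \<in> sq N b"
  obtain a where "a \<in> W" "x \<in> sq N a" using assms by (auto simp: reg_def)
  then show "b \<in> W'" using assms(1,3) b unfolding edge_def by blast
qed

lemma K_avoid: "x \<in> K \<Longrightarrow> dist (f x) y \<le> 1 / real N \<Longrightarrow> y \<notin> closure (- K)"
  by (rule edge_avoid[OF G.invariant_succ[OF invV]])

lemma B_avoid: "x \<in> B t \<Longrightarrow> dist (f x) y \<le> 1 / real N \<Longrightarrow> y \<notin> closure (- B (t + \<alpha>))"
  by (rule edge_avoid[OF A_succ])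

lemma frontier_K: "x \<in> frontier K \<Longrightarrow> f x \<notin> frontier K"
  using K_avoid[of x "f x"] closed_reg[OF N, of V] by (auto simp: frontier_closures)

text \<open>If the complement were inessential, its components would all be bounded, against
  \<open>unbV\<close>. So the complement is essential, and \<open>K\<close> is not, since its
  frontier is disjoint from the image of the frontier.\<close>

lemma K_inessential: "\<not> essential K"
proof
  assume e: "essential K"
  have "essential (- K)"
  proof (rule ccontr)
    assume ne: "\<not> essential (- K)"
    have "bounded (connected_component_set (- K) x)" for x
    proof (cases "x \<in> - K")
      case True
      have "connected_component_set (- K) x \<subseteq> cball x (6 * real (N * N))"
        using component_diameter_open[OF N ne, of x x] True by (auto simp: connected_component_refl)
      then show ?thesis using bounded_cball bounded_subset by blast
    next
      case False
      then show ?thesis by (metis bounded_empty connected_component_eq_empty)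
    qed
    then show False using unbV by blast
  qed
  then show False
    using essential_imp_complement_inessential[OF nf closed_reg[OF N] K_inv _ e] frontier_K by blast
qed

lemma bounded_component_K: "bounded (connected_component_set K x)"
proof (cases "x \<in> K")
  case True
  have "connected_component_set K x \<subseteq> cball x (6 * real (N * N))"
    using component_diameter_closed[OF N squares_reg K_inessential, of x x] True by (auto simp: connected_component_refl)
  then show ?thesis using bounded_cball bounded_subset by blast
next
  case False
  then show ?thesis by (metis bounded_empty connected_component_eq_empty)
qed

lemma Z_sub: "x \<in> Z \<Longrightarrow> x \<notin> K"
  unfolding Z_def by (metis (mono_tags) ComplD Compl_iff bounded_empty connected_component_eq_empty mem_Collect_eq)

lemma Z_connect: "x \<in> Z \<Longrightarrow> y \<in> Z \<Longrightarrow> connected_component (- K) x y"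
  by (rule same_component_cobounded) (auto simp: Z_def closed_reg[OF N] bounded_component_K)

lemma Z_eq: assumes "z \<in> Z" shows "Z = connected_component_set (- K) z"
proof (intro equalityI subsetI)
  fix y assume "y \<in> connected_component_set (- K) z"
  then have "connected_component_set (- K) y = connected_component_set (- K) z" by (metis connected_component_eq)
  then show "y \<in> Z" using assms by (simp add: Z_def)
qed (use Z_connect[OF assms] in simp)

lemma Z_ne: obtains z where "z \<in> Z"
  using unbV by (auto simp: Z_def)

lemma connected_Z: "connected Z" and open_Z: "open Z"
proof -
  obtain z where "z \<in> Z" by (rule Z_ne)
  then have "Z = connected_component_set (- K) z" by (rule Z_eq)
  then show "connected Z" "open Z" using closed_reg[OF N, of V] by (auto intro: open_connected_component)
qed

lemma Z_inv: assumes "x \<in> Z" shows "x + zv v \<in> Z"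
proof -
  have "(\<lambda>y. zv v + y) ` connected_component_set (- K) x \<subseteq> connected_component_set (- K) (x + zv v)"
  proof (rule image_subsetI)
    fix y assume "y \<in> connected_component_set (- K) x"
    then have "connected_component (- K) (x + zv v) (y + zv v)" using cK_inv by (intro connected_component_translate) auto
    then show "zv v + y \<in> connected_component_set (- K) (x + zv v)" by (simp add: add.commute)
  qed
  moreover have "\<not> bounded ((\<lambda>y. zv v + y) ` connected_component_set (- K) x)"
    using assms bounded_translation[of "(\<lambda>y. zv v + y) ` connected_component_set (- K) x" "- zv v"] by (auto simp: Z_def image_image)
  ultimately show ?thesis unfolding Z_def using bounded_subset by blast
qed

lemma cZ_inv: "x \<in> - Z \<Longrightarrow> x + zv v \<in> - Z"
  using Z_inv[of "x + zv v" "- v"] by (auto simp: zv_uminus)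

lemma far_left_Z: obtains z where "z \<in> Z" "l \<bullet> z < r"
  using Z_ne lattice_far_left[OF l] Z_inv by metis

lemma Z_outside: "- Z \<supseteq> K"
  using Z_sub by blast

lemma squares_cZ: "squares N (- Z)"
  unfolding squares_def
proof
  fix w assume w: "w \<in> - Z"
  show "\<exists>a. w \<in> sq N a \<and> sq N a \<subseteq> - Z"
  proof (cases "w \<in> K")
    case True
    then obtain a where "a \<in> V" "w \<in> sq N a" by (auto simp: reg_def)
    then have "w \<in> sq N a \<and> sq N a \<subseteq> - Z" using Z_outside by (auto simp: reg_def)
    then show ?thesis by blast
  next
    case False
    define a where "a = lattice_cell N w"
    have a: "w \<in> sq N a" by (simp add: a_def cell_in_sq)
    then have "a \<notin> V" using False by (auto simp: reg_def)
    then have "sq N a \<subseteq> closure (connected_component_set (- K) w)"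
      by (rule complement_component_contains_osq(2)[OF N _ a]) (use False in \<open>simp add: connected_component_refl_eq\<close>)
    moreover have "Z \<inter> connected_component_set (- K) w = {}"
    proof (rule ccontr)
      assume "\<not> ?thesis"
      then obtain z where z: "z \<in> Z" "connected_component (- K) w z" by auto
      then have "w \<in> Z" using Z_eq[OF z(1)] by (auto intro: connected_component_sym)
      then show False using w by simp
    qed
    then have "Z \<inter> closure (connected_component_set (- K) w) = {}" using open_Z by (simp add: open_Int_closure_eq_empty)
    ultimately show ?thesis using a by blast
  qed
qed

text \<open>\<open>Z\<close> is connected and invariant under all lattice translations, hence
  essential, and its frontier lies in the free frontier of \<open>K\<close>.\<close>

lemma cZ_inessential: "\<not> essential (- Z)"
proof
  assume e: "essential (- Z)"
  obtain z where z: "z \<in> Z" by (rule Z_ne)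
  have "connected_component Z z (z + zv (1, 0))"
    unfolding connected_component_def using z Z_inv connected_Z by blast
  then have "essential Z" unfolding essential_def by (intro exI[of _ z] exI[of _ "(1, 0)"]) (auto simp: zero_prod_def)
  moreover have "Z \<in> components (- K)"
    unfolding components_def using Z_eq[OF z] Z_sub[OF z] by blast
  then have "frontier (- Z) \<subseteq> frontier K" using frontier_of_components_subset[of Z "- K"] by (simp add: frontier_complement)
  then have "f ` frontier (- Z) \<inter> frontier (- Z) = {}" using frontier_K by blast
  ultimately show False
    using essential_imp_complement_inessential[OF nf _ cZ_inv _ e] open_Z by (simp add: closed_Compl)
qed

lemma diameter_cZ: "connected_component (- Z) x y \<Longrightarrow> connected_component (- Z) x z \<Longrightarrow> dist y z \<le> D"
  unfolding D_def by (rule component_diameter_closed[OF N squares_cZ cZ_inessential])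

text \<open>The slack is used on preimages: the preimage of the 1/\<open>N\<close>-thickening of
  \<open>S\<close> is connected, stays in \<open>W\<close> and joins \<open>x\<close> to the
  preimage of all of \<open>S\<close>.\<close>

lemma thick_preimage:
  assumes "connected S" "y \<in> S" "dist (f x) y \<le> 1 / real N"
    and avoid: "\<And>u y. y \<in> S \<Longrightarrow> dist (f u) y \<le> 1 / real N \<Longrightarrow> u \<in> W"
  obtains T where "connected T" "T \<subseteq> W" "x \<in> T" "fi ` S \<subseteq> T"
proof (rule that[of "fi ` (\<Union>s\<in>S. cball s (1 / real N))"])
  show "connected (fi ` (\<Union>s\<in>S. cball s (1 / real N)))"
    using lift_map.connected_image[OF inverse connected_thickening(1)[OF assms(1)]] .
  show "fi ` (\<Union>s\<in>S. cball s (1 / real N)) \<subseteq> W"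
  proof (rule image_subsetI)
    fix u assume "u \<in> (\<Union>s\<in>S. cball s (1 / real N))"
    then obtain s where "s \<in> S" "dist s u \<le> 1 / real N" by auto
    then show "fi u \<in> W" using avoid[of s "fi u"] by (simp add: dist_commute)
  qed
  show "x \<in> fi ` (\<Union>s\<in>S. cball s (1 / real N))"
  proof (rule image_eqI)
    show "x = fi (f x)" by simp
    show "f x \<in> (\<Union>s\<in>S. cball s (1 / real N))" using assms(2,3) by (intro UN_I[of y]) (auto simp: dist_commute)
  qed
  show "fi ` S \<subseteq> fi ` (\<Union>s\<in>S. cball s (1 / real N))" by (intro image_mono) force
qed

text \<open>The preimage of the thickening of \<open>Z\<close> is connected, avoids \<open>K\<close>
  and is unbounded, because the displacement of \<open>fi\<close> is bounded.\<close>

lemma Z_pull: assumes "y \<in> Z" "dist (f x) y \<le> 1 / real N" shows "x \<in> Z"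
proof -
  have av: "u \<in> - K" if "y \<in> Z" "dist (f u) y \<le> 1 / real N" for u y
    using K_avoid[OF _ that(2)] Z_sub[OF that(1)] closure_subset[of "- K"] by blast
  obtain T where T: "connected T" "T \<subseteq> - K" "x \<in> T" "fi ` Z \<subseteq> T"
    by (rule thick_preimage[OF connected_Z assms av])
  have "T \<subseteq> connected_component_set (- K) x" using T by (intro connected_component_maximal)
  moreover have "\<not> bounded (fi ` Z)"
  proof
    assume "bounded (fi ` Z)"
    then obtain b where b: "\<And>z. z \<in> Z \<Longrightarrow> norm (fi z) \<le> b" by (auto simp: bounded_iff)
    obtain d where d: "\<And>x. dist (fi x) x \<le> d" using lift_map.bounded_displacement[OF inverse] by metis
    obtain z where z: "z \<in> Z" "l \<bullet> z < - L * (b + d)" by (rule far_left_Z)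
    have "norm z \<le> b + d" using b[OF z(1)] d[of z] norm_triangle_sub[of z "fi z"] by (simp add: dist_norm norm_minus_commute)
    then have "L * norm z \<le> L * (b + d)" using const_facts by (intro mult_left_mono) auto
    then show False using z(2) Cauchy_Schwarz_ineq2[of l z] by (simp add: L_def)
  qed
  ultimately have "\<not> bounded (connected_component_set (- K) x)" using T(4) bounded_subset by blast
  then show ?thesis by (simp add: Z_def)
qed

lemma fi_Z: "z \<in> Z \<Longrightarrow> fi z \<in> Z"
  by (rule Z_pull[of z]) auto

lemma f_cZ: "x \<in> - Z \<Longrightarrow> f x \<in> - Z"
  using Z_pull[of "f x" x] by auto

lemma B_far_left: assumes "z \<in> B t" "l \<bullet> z < t - M" shows "z \<in> K"
proof -
  obtain a where a: "a \<in> A t" "z \<in> sq N a" using assms by (auto simp: reg_def)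
  have "l \<bullet> pos N a \<le> l \<bullet> z + L * dist (pos N a) z" unfolding L_def by (rule inner_diff_le_norm)
  also have "L * dist (pos N a) z \<le> L * (2 / real N)"
    using sq_diameter[OF N pos_in_sq[OF N] a(2)] const_facts by (intro mult_left_mono) auto
  finally have "l \<bullet> pos N a < t - K'" using assms(2) by (simp add: M_def \<sigma>_def)
  then have "a \<notin> C" using A_left[of a t] a by (meson not_le)
  then have "a \<in> V" using a A_sub by blast
  then show ?thesis using a by (auto simp: reg_def)
qed

lemma B_far_right: assumes "z \<notin> B t" "l \<bullet> z \<ge> t + \<sigma>" shows "z \<notin> U"
proof
  assume "z \<in> U"
  then obtain a where a: "a \<in> V \<union> C" "z \<in> sq N a" by (auto simp: reg_def)
  have "l \<bullet> z \<le> l \<bullet> pos N a + L * dist z (pos N a)" unfolding L_def by (rule inner_diff_le_norm)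
  also have "L * dist z (pos N a) \<le> L * (2 / real N)"
    using sq_diameter[OF N a(2) pos_in_sq[OF N]] const_facts by (intro mult_left_mono) auto
  finally have "l \<bullet> pos N a \<ge> t" using assms(2) by (simp add: \<sigma>_def mult.commute)
  then have "a \<in> A t" using a A_right A_sub by blast
  then show False using assms(1) a by (auto simp: reg_def)
qed

text \<open>If \<open>K\<close> together with the half plane to the right of t - M separated the two
  points, one component \<open>Q\<close> would. It does not lie in \<open>K\<close>, whose
  complement joins them. So it reaches the half plane and protrudes to its left by little more than
  one component of \<open>K\<close>, while both points lie beyond that in a half plane that misses
  \<open>Q\<close>.\<close>

lemma far_left_connect:
  assumes "x \<in> Z" "y \<in> Z" "l \<bullet> x < t - M'" "l \<bullet> y < t - M'"
  shows "connected_component (- B t) x y"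
proof -
  define S where "S = K \<union> {z. l \<bullet> z \<ge> t - M}"
  have "connected_component (- S) x y"
  proof (rule ccontr)
    assume "\<not> ?thesis"
    moreover have "closed S" unfolding S_def by (intro closed_Un closed_reg[OF N] closed_halfspace_ge)
    ultimately obtain Q where Q: "Q \<in> components S" "\<not> connected_component (- Q) x y"
      using separation_by_component_closed_pointwise by metis
    have cQ: "connected Q" "Q \<subseteq> S" using in_components_connected[OF Q(1)] in_components_subset[OF Q(1)] by simp_all
    show False
    proof (cases "Q \<subseteq> K")
      case True
      then have "- K \<subseteq> - Q" by blast
      then show False using connected_component_of_subset[OF Z_connect[OF assms(1,2)]] Q by blast
    next
      case False
      then obtain h where h: "h \<in> Q" "l \<bullet> h \<ge> t - M" using cQ by (auto simp: S_def)
      have "Q \<subseteq> {z. l \<bullet> z \<ge> t - M'}"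
      proof
        fix w assume w: "w \<in> Q"
        show "w \<in> {z. l \<bullet> z \<ge> t - M'}"
        proof (rule ccontr)
          assume "w \<notin> {z. l \<bullet> z \<ge> t - M'}"
          then have lw: "l \<bullet> w < t - M'" by simp
          then have "l \<bullet> w < t - M" using const_facts by linarith
          then have "w \<in> K" using w cQ by (auto simp: S_def)
          have close: "l \<bullet> p \<le> l \<bullet> w + L * D" if p: "connected_component K w p" for p
          proof -
            have "dist p w \<le> D"
              unfolding D_def by (rule component_diameter_closed[OF N squares_reg K_inessential p]) (simp add: \<open>w \<in> K\<close> connected_component_refl)
            then have "L * dist p w \<le> L * D" using const_facts by (intro mult_left_mono) auto
            then show ?thesis using inner_diff_le_norm[of l p w] by (simp add: L_def)
          qed
          have "Q \<subseteq> connected_component_set K w"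
          proof (rule squares_component_clopen[OF N squares_reg closed_reg[OF N] cQ(1) w])
            show "connected_component K w w" using \<open>w \<in> K\<close> by (simp add: connected_component_refl)
            fix z p assume z: "z \<in> Q" "connected_component K w p" "dist z p < 1 / real N"
            have "1 / real N \<le> 1" using N by simp
            then have "L * dist z p \<le> L * 1" using const_facts z by (intro mult_left_mono) auto
            then have "l \<bullet> z \<le> l \<bullet> p + L" using inner_diff_le_norm[of l z p] unfolding L_def by linarith
            then have "l \<bullet> z < t - M" using close[OF z(2)] lw const_facts(7) by linarith
            then show "z \<in> K" using z cQ by (auto simp: S_def)
          qed
          then have "connected_component K w h" using h by auto
          then show False using close[of h] lw h const_facts by auto
        qed
      qed
      then have "{z. l \<bullet> z < t - M'} \<subseteq> - Q" by auto
      moreover have "connected {z. l \<bullet> z < t - M'}" by (intro convex_connected convex_halfspace_lt)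
      ultimately show False using Q(2) assms unfolding connected_component_def by blast
    qed
  qed
  moreover have "- S \<subseteq> - B t"
  proof (rule subsetI)
    fix z assume "z \<in> - S"
    then have z: "z \<notin> K" "l \<bullet> z < t - M" unfolding S_def by auto
    show "z \<in> - B t" using B_far_left[OF _ z(2)] z(1) by blast
  qed
  ultimately show ?thesis by (rule connected_component_of_subset)
qed

text \<open>By \<open>far_left_connect\<close> this is a single component of the complement of
  \<open>B t\<close>. Restricting to it leaves aside the pockets enclosed by \<open>B t\<close>,
  whose position with respect to \<open>l\<close> is unknown.\<close>

definition Y :: "real \<Rightarrow> (real \<times> real) set" where
  "Y t = {y. \<exists>x\<in>Z. l \<bullet> x < t - M' \<and> connected_component (- B t) x y}"

lemma Y_eq: assumes "x \<in> Z" "l \<bullet> x < t - M'" shows "Y t = connected_component_set (- B t) x"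
proof (intro equalityI subsetI)
  fix y assume "y \<in> Y t"
  then obtain x' where "x' \<in> Z" "l \<bullet> x' < t - M'" "connected_component (- B t) x' y" by (auto simp: Y_def)
  then show "y \<in> connected_component_set (- B t) x"
    using far_left_connect[OF assms(1) _ assms(2)] connected_component_trans by fastforce
qed (use assms in \<open>auto simp: Y_def\<close>)

lemma Y_connected: "connected (Y t)"
proof -
  obtain z where "z \<in> Z" "l \<bullet> z < t - M'" by (rule far_left_Z)
  then show ?thesis using Y_eq by simp
qed

lemma Y_far_left: "x \<in> Z \<Longrightarrow> l \<bullet> x < t - M' \<Longrightarrow> x \<in> Y t"
  using far_left_connect[of x x t] by (auto simp: Y_def)

lemma Y_sub: "Y t \<subseteq> - B t"
  using connected_component_in by (force simp: Y_def)

text \<open>To the right of t + \<sigma> the complement of \<open>B t\<close> lies in the complement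
  of \<open>U\<close>, where components have diameter at most \<open>D\<close>. A point of
  \<open>Y t\<close> farther right than that would confine all of \<open>Y t\<close> to one of them,
  but \<open>Y t\<close> extends to the far left.\<close>

lemma Y_right: assumes y: "y \<in> Y t" shows "l \<bullet> y \<le> t + \<sigma> + L * D"
proof (rule ccontr)
  assume c: "\<not> ?thesis"
  define W where "W = connected_component_set (- U) y"
  have neU: "\<not> essential (- U)"
  proof (rule bounded_components_not_essential)
    fix x v assume "x \<in> - U"
    then show "x + zv v \<in> - U"
      using reg_translate[OF N G.invariant_translate[OF invU], of "x + zv v" "- v"] by (auto simp: zv_uminus)
  qed (rule bddU)
  have yU: "y \<notin> U" using B_far_right[of y t] Y_sub y c const_facts by force
  have close: "l \<bullet> w > t + \<sigma>" if w: "w \<in> closure W" for w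
  proof -
    have "W \<subseteq> cball y D"
      using component_diameter_open[OF N neU, of y y] yU by (auto simp: W_def D_def connected_component_refl)
    then have "dist y w \<le> D" using w closure_minimal[of W "cball y D"] by auto
    then have "L * dist y w \<le> L * D" using const_facts by (intro mult_left_mono) auto
    then show ?thesis using inner_diff_le_norm[of l y w] c by (simp add: L_def)
  qed
  have oW: "open W" unfolding W_def by (intro open_connected_component open_Compl closed_reg[OF N])
  have clo: "z \<in> W" if z: "z \<in> Y t" "z \<in> closure W" for z
  proof -
    have zU: "z \<in> - U" using B_far_right[of z t] Y_sub z close[OF z(2)] by force
    have "open (connected_component_set (- U) z)" by (intro open_connected_component open_Compl closed_reg[OF N])
    moreover have "z \<in> connected_component_set (- U) z" using zU by (simp add: connected_component_refl)
    ultimately obtain w where w: "w \<in> W" "connected_component (- U) z w" using z(2) unfolding closure_iff_nhds_not_empty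
      by (metis (no_types, lifting) disjoint_iff mem_Collect_eq subset_refl)
    then show ?thesis unfolding W_def using connected_component_sym connected_component_trans by (metis mem_Collect_eq)
  qed
  have yW: "y \<in> W" using yU by (simp add: W_def connected_component_refl)
  have sub: "Y t \<subseteq> W"
  proof (rule ccontr)
    assume "\<not> ?thesis"
    then have "- closure W \<inter> Y t \<noteq> {}" using clo by blast
    moreover have "W \<inter> Y t \<noteq> {}" using yW y by blast
    moreover have "Y t \<subseteq> W \<union> - closure W" using clo by blast
    moreover have "W \<inter> - closure W \<inter> Y t = {}" using closure_subset[of W] by blast
    ultimately show False using connectedD[OF Y_connected oW, of "- closure W" t] by auto
  qed
  obtain z where z: "z \<in> Z" "l \<bullet> z < t - M'" by (rule far_left_Z)
  then have "z \<in> closure W" using Y_far_left sub closure_subset by blast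
  then show False using close[of z] z const_facts by auto
qed

text \<open>The thickened preimage of the closure of \<open>Y (t + \<alpha>)\<close> is connected,
  avoids \<open>B t\<close> and contains a point of \<open>Z\<close> on the far left. So the
  complements of the sets \<open>Y\<close> are an attracting family moving with speed
  \<alpha>.\<close>

lemma Y_pull: assumes "y \<in> closure (Y (t + \<alpha>))" "dist (f x) y \<le> 1 / real N" shows "x \<in> Y t"
proof -
  have av: "u \<in> - B t" if "y \<in> closure (Y (t + \<alpha>))" "dist (f u) y \<le> 1 / real N" for u y
    using B_avoid[OF _ that(2), of t] closure_mono[OF Y_sub[of "t + \<alpha>"]] that(1) by blast
  obtain T where T: "connected T" "T \<subseteq> - B t" "x \<in> T" "fi ` closure (Y (t + \<alpha>)) \<subseteq> T"
    by (rule thick_preimage[OF connected_imp_connected_closure[OF Y_connected] assms av])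
  obtain d where d: "d \<ge> 0" "\<And>x. dist (fi x) x \<le> d" using lift_map.bounded_displacement[OF inverse] by metis
  obtain z where z: "z \<in> Z" "l \<bullet> z < min (t - M' - L * d) (t + \<alpha> - M')" by (rule far_left_Z)
  have "L * dist (fi z) z \<le> L * d" using const_facts d by (intro mult_left_mono) auto
  then have "l \<bullet> fi z < t - M'" using inner_diff_le_norm[of l "fi z" z] z by (simp add: L_def)
  then have "Y t = connected_component_set (- B t) (fi z)" using z by (intro Y_eq fi_Z)
  moreover have "z \<in> closure (Y (t + \<alpha>))" using Y_far_left[OF z(1), of "t + \<alpha>"] z closure_subset by auto
  then have "fi z \<in> T" using T(4) by blast
  then have "T \<subseteq> connected_component_set (- B t) (fi z)" using T by (intro connected_component_maximal)
  ultimately show ?thesis using T(3) by blast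
qed

lemma orbit_avoids_Y: "x \<notin> Y t \<Longrightarrow> (f ^^ n) x \<notin> Y (t + real n * \<alpha>)"
proof (induction n)
  case (Suc n)
  then have "f ((f ^^ n) x) \<notin> Y (t + real n * \<alpha> + \<alpha>)"
    using Y_pull[of "f ((f ^^ n) x)" "t + real n * \<alpha>" "(f ^^ n) x"] closure_subset by auto
  then show ?case by (simp add: algebra_simps)
qed simp

text \<open>This is where \<open>Y_pull\<close> is needed for the closure: a square that meets
  \<open>Y\<close> is only known to lie in the closure of \<open>Y\<close>.\<close>

lemma walk_avoids_Y:
  assumes "(edge N ^^ n) a b" "sq N a \<inter> Y t = {}" shows "sq N b \<inter> Y (t + real n * \<alpha>) = {}"
  using assms(1)
proof (induction n arbitrary: b)
  case (Suc n)
  then obtain c where c: "(edge N ^^ n) a c" "edge N c b" by auto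
  define s where "s = t + real n * \<alpha>"
  have cs: "sq N c \<inter> Y s = {}" using Suc.IH c by (simp add: s_def)
  have "sq N b \<inter> Y (s + \<alpha>) = {}"
  proof (rule ccontr)
    assume "\<not> ?thesis"
    then obtain w where w: "w \<in> sq N b" "w \<in> Y (s + \<alpha>)" by blast
    obtain x y where xy: "x \<in> sq N c" "y \<in> sq N b" "dist (f x) y \<le> 1 / real N" using c by (auto simp: edge_def)
    obtain z where z: "z \<in> Z" "l \<bullet> z < s + \<alpha> - M'" by (rule far_left_Z)
    have b: "b \<notin> A (s + \<alpha>)" using w Y_sub by (auto simp: reg_def)
    have "connected_component (- B (s + \<alpha>)) z w" using w Y_eq[OF z] by simp
    then have "sq N b \<subseteq> closure (Y (s + \<alpha>))" using complement_component_contains_osq(2)[OF N b w(1)] Y_eq[OF z] by simp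
    then have "x \<in> Y s" using xy by (intro Y_pull[of y]) auto
    then show False using cs xy by blast
  qed
  then show ?case by (simp add: s_def algebra_simps)
qed (use assms(2) in simp)

text \<open>If the orbit of \<open>x\<close> fell far behind the moving set \<open>Y\<close>, it
  would end in a pocket outside \<open>Z\<close>. The image of the whole half plane to the right of
  \<open>x\<close> avoids \<open>Y\<close> too and is connected, so it would be confined to the same
  pocket; but it contains two points that differ by a non-zero lattice vector, and the complement of
  \<open>Z\<close> is inessential.\<close>

lemma orbit_drift:
  obtains c where "\<And>n x. l \<bullet> (f ^^ n) x \<ge> l \<bullet> x + real n * \<alpha> - c"
proof (rule that[of "\<sigma> + L * D + 1 + M' + L * (D + 1)"], rule ccontr)
  fix n x assume far: "\<not> l \<bullet> (f ^^ n) x \<ge> l \<bullet> x + real n * \<alpha> - (\<sigma> + L * D + 1 + M' + L * (D + 1))"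
  \<comment> \<open>By \<open>Y_right\<close> this places \<open>Y t\<close> to the left of
    \<open>x\<close>. The other terms of the constant are M' for \<open>Y_far_left\<close> and L *
    (D + 1) for one pocket and the gap around it.\<close>
  define t where "t = l \<bullet> x - (\<sigma> + L * D + 1)"
  define s where "s = t + real n * \<alpha>"
  define w where "w = (f ^^ n) x"
  define T where "T = (f ^^ n) ` {z. l \<bullet> z \<ge> l \<bullet> x}"
  have lw: "l \<bullet> w < s - M' - L * (D + 1)" using far by (simp add: w_def s_def t_def)
  have TY: "z \<notin> Y s" if z: "z \<in> T" for z
  proof -
    obtain z0 where z0: "z = (f ^^ n) z0" "l \<bullet> z0 \<ge> l \<bullet> x" using z by (auto simp: T_def)
    have "z0 \<notin> Y t" using Y_right[of z0 t] z0 by (auto simp: t_def)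
    then show ?thesis unfolding z0 s_def by (rule orbit_avoids_Y)
  qed
  have cT: "connected T"
    unfolding T_def by (intro lift_map.connected_image[OF funpow] convex_connected convex_halfspace_ge)
  have wT: "w \<in> T" by (simp add: w_def T_def)
  have "L * (D + 1) \<ge> 0" using const_facts by simp
  then have "w \<notin> Z" using TY[OF wT] Y_far_left[of w s] lw by auto
  then have ww: "connected_component (- Z) w w" by (simp add: connected_component_refl)
  have sub: "T \<subseteq> connected_component_set (- Z) w"
  proof (rule squares_component_clopen[OF N squares_cZ _ cT wT ww])
    show "closed (- Z)" using open_Z by (simp add: closed_Compl)
    fix z p assume z: "z \<in> T" "connected_component (- Z) w p" "dist z p < 1 / real N"
    have "dist p w \<le> D" using diameter_cZ[OF z(2) ww] .
    then have "L * dist p w \<le> L * D" using const_facts by (intro mult_left_mono) auto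
    then have "l \<bullet> p \<le> l \<bullet> w + L * D" using inner_diff_le_norm[of l p w] by (simp add: L_def)
    moreover have "1 / real N \<le> 1" using N by simp
    then have "L * dist z p \<le> L * 1" using const_facts z by (intro mult_left_mono) auto
    then have "l \<bullet> z \<le> l \<bullet> p + L" using inner_diff_le_norm[of l z p] by (simp add: L_def)
    ultimately have "l \<bullet> z < s - M'" using lw by (simp add: algebra_simps)
    then show "z \<in> - Z" using Y_far_left[of z s] TY[OF z(1)] by blast
  qed
  obtain v where v: "l \<bullet> (0 + zv v) < 0" using lattice_far_left[OF l] by blast
  have "(f ^^ n) (x + zv (- v)) \<in> T" using v by (auto simp: T_def zv_uminus inner_diff_right)
  then have "connected_component (- Z) w (w + zv (- v))" using sub funpow_comm[of n x "- v"] by (auto simp: w_def)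
  moreover have "- v \<noteq> 0" using v by auto
  ultimately show False using cZ_inessential unfolding essential_def by blast
qed

text \<open>The sets \<open>Y\<close> overtake a cycle slower than \<alpha>. If it met
  \<open>Z\<close>, then after many rounds it would be so far to the left as to lie in
  \<open>Y\<close>, although it started outside.\<close>

lemma slow_cycle_avoids_Z:
  assumes c: "G.closed_walk a n v" and slow: "l \<bullet> zv v < real n * \<alpha>"
  shows "sq N a \<subseteq> - Z"
proof
  fix x assume x: "x \<in> sq N a"
  show "x \<in> - Z"
  proof
    assume xZ: "x \<in> Z"
    define t where "t = l \<bullet> pos N a - L * (2 / real N) - \<sigma> - L * D - 1"
    have avoid: "sq N a \<inter> Y t = {}"
    proof (rule ccontr)
      assume "\<not> ?thesis"
      then obtain y where y: "y \<in> sq N a" "y \<in> Y t" by blast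
      have "L * dist (pos N a) y \<le> L * (2 / real N)"
        using sq_diameter[OF N pos_in_sq[OF N] y(1)] const_facts by (intro mult_left_mono) auto
      then show False using Y_right[OF y(2)] inner_diff_le_norm[of l "pos N a" y] by (simp add: t_def L_def)
    qed
    obtain k :: nat where k: "real k * (real n * \<alpha> - l \<bullet> zv v) > l \<bullet> x - t + M'"
      using reals_Archimedean3[of "real n * \<alpha> - l \<bullet> zv v"] slow by auto
    have "(edge N ^^ (k * n)) a (a + imul (int N) (imul (int k) v))"
    proof (cases "k \<ge> 1")
      case True
      then show ?thesis using G.closed_walk_mult[OF c] by (simp add: G.closed_walk_def)
    next
      case False
      then have "k = 0" by simp
      then show ?thesis by simp
    qed
    then have "sq N (a + imul (int N) (imul (int k) v)) \<inter> Y (t + real (k * n) * \<alpha>) = {}"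
      using avoid by (rule walk_avoids_Y)
    moreover have "x + zv (imul (int k) v) \<in> sq N (a + imul (int N) (imul (int k) v))" using x sq_translate[OF N] by blast
    ultimately have "x + zv (imul (int k) v) \<notin> Y (t + real (k * n) * \<alpha>)" by blast
    moreover have "l \<bullet> (x + zv (imul (int k) v)) = l \<bullet> x + real k * (l \<bullet> zv v)" by (simp add: inner_add_right zv_imul)
    then have "l \<bullet> (x + zv (imul (int k) v)) < t + real (k * n) * \<alpha> - M'" using k by (simp add: algebra_simps)
    ultimately show False using Y_far_left Z_inv[OF xZ] by blast
  qed
qed

text \<open>All squares of the cycle lie outside \<open>Z\<close>, and so do the images of points
  outside \<open>Z\<close>. At each step the square, the orbit point and the ball of radius
  1/\<open>N\<close> that links an image to the next square stay in one component, of diameter at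
  most \<open>D\<close>.\<close>

lemma slow_cycle_traps_orbit:
  assumes c: "G.closed_walk a n v" and slow: "l \<bullet> zv v < real n * \<alpha>"
  shows "dist ((f ^^ n) (ctr N a)) (ctr N a + zv v) \<le> D"
proof -
  obtain p where p: "p 0 = a" "p n = a + imul (int N) v" "\<And>i. i < n \<Longrightarrow> edge N (p i) (p (Suc i))"
    using c unfolding G.closed_walk_def relpowp_fun_conv by blast
  note seg = relpowp_segment[where p = p and n = n and E = "edge N", OF p(3)]
  have sqp: "sq N (p i) \<subseteq> - Z" if i: "i \<le> n" for i
  proof (rule slow_cycle_avoids_Z[OF _ slow])
    have "(edge N ^^ (n - i)) (p i) (a + imul (int N) v)" using seg[of i n] i p(2) by simp
    moreover have "(edge N ^^ i) a (p i)" using seg[of 0 i] i p(1) by simp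
    then have "(edge N ^^ i) (a + imul (int N) v) (p i + imul (int N) v)" by (rule G.walk_translate)
    ultimately have "(edge N ^^ (n - i + i)) (p i) (p i + imul (int N) v)" by (rule relpowp_trans)
    then show "G.closed_walk (p i) n v" using i c by (simp add: G.closed_walk_def)
  qed
  have in_sq: "connected_component (- Z) x y" if "i \<le> n" "x \<in> sq N (p i)" "y \<in> sq N (p i)" for i x y
    unfolding connected_component_def using sqp[OF that(1)] that(2,3) convex_connected[OF convex_sq] by blast
  have "connected_component (- Z) (ctr N (p i)) ((f ^^ i) (ctr N a))" if "i \<le> n" for i
    using that
  proof (induction i)
    case 0
    then show ?case using in_sq[of 0 "ctr N a" "ctr N a"] p(1) ctr_in_sq[OF N] by simp
  next
    case (Suc i)
    then have IH: "connected_component (- Z) (ctr N (p i)) ((f ^^ i) (ctr N a))" by simp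
    obtain x y where xy: "x \<in> sq N (p i)" "y \<in> sq N (p (Suc i))" "dist (f x) y \<le> 1 / real N"
      using p(3)[of i] Suc.prems by (auto simp: edge_def)
    have "connected_component (- Z) x ((f ^^ i) (ctr N a))"
      using in_sq[of i x "ctr N (p i)"] xy(1) ctr_in_sq[OF N] Suc.prems IH connected_component_trans by fastforce
    then obtain T where T: "connected T" "T \<subseteq> - Z" "x \<in> T" "(f ^^ i) (ctr N a) \<in> T"
      by (auto simp: connected_component_def)
    have "connected_component (- Z) (f x) ((f ^^ Suc i) (ctr N a))"
      unfolding connected_component_def
      by (rule exI[of _ "f ` T"]) (use T connected_image f_cZ in auto)
    moreover have "connected_component (- Z) y (f x)"
    proof -
      have "cball (f x) (1 / real N) \<subseteq> - Z"
      proof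
        fix z assume "z \<in> cball (f x) (1 / real N)"
        then show "z \<in> - Z" using Z_pull[of z x] sqp[of i] xy(1) Suc.prems by auto
      qed
      then show ?thesis unfolding connected_component_def using xy(3)
        by (intro exI[of _ "cball (f x) (1 / real N)"]) (auto intro: convex_connected)
    qed
    moreover have "connected_component (- Z) (ctr N (p (Suc i))) y"
      using in_sq[of "Suc i"] xy(2) ctr_in_sq[OF N] Suc.prems by blast
    ultimately show ?case using connected_component_trans by metis
  qed
  from this[of n] have *: "connected_component (- Z) (ctr N a + zv v) ((f ^^ n) (ctr N a))"
    by (simp add: p(2) ctr_translate[OF N])
  then have "connected_component (- Z) (ctr N a + zv v) (ctr N a + zv v)"
    by (metis connected_component_in connected_component_refl)
  then show ?thesis using diameter_cZ[OF *] by blast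
qed

text \<open>The orbit of a centre would stay beside all multiples of the slow cycle, but it has to
  advance with speed \<alpha>.\<close>

lemma no_slow_cycle:
  assumes c: "G.closed_walk a n v" shows "l \<bullet> zv v \<ge> real n * \<alpha>"
proof (rule ccontr)
  assume "\<not> ?thesis"
  then have slow: "l \<bullet> zv v < real n * \<alpha>" by simp
  obtain b where b: "\<And>n x. l \<bullet> (f ^^ n) x \<ge> l \<bullet> x + real n * \<alpha> - b" using orbit_drift by blast
  have "(b + L * D) + real k * (l \<bullet> zv v - real n * \<alpha>) \<ge> 0" if k: "k \<ge> 1" for k
  proof -
    have "real k * (l \<bullet> zv v) < real k * (real n * \<alpha>)" using slow k by (intro mult_strict_left_mono) auto
    then have "dist ((f ^^ (k * n)) (ctr N a)) (ctr N a + zv (imul (int k) v)) \<le> D"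
      by (intro slow_cycle_traps_orbit G.closed_walk_mult[OF c k]) (simp add: zv_imul mult.assoc)
    then have "L * dist ((f ^^ (k * n)) (ctr N a)) (ctr N a + zv (imul (int k) v)) \<le> L * D"
      using const_facts by (intro mult_left_mono) auto
    then have "l \<bullet> (f ^^ (k * n)) (ctr N a) \<le> l \<bullet> (ctr N a + zv (imul (int k) v)) + L * D"
      using inner_diff_le_norm[of l "(f ^^ (k * n)) (ctr N a)" "ctr N a + zv (imul (int k) v)"] by (simp add: L_def)
    then show ?thesis using b[of "ctr N a" "k * n"] by (simp add: inner_add_right zv_imul algebra_simps)
  qed
  then have "l \<bullet> zv v - real n * \<alpha> \<ge> 0" by (rule nonneg_by_multiples)
  then show False using slow by simp
qed

end

context rational_rotation
begin

lemma cycles_half_plane: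
  assumes N: "N > 0" and nz: "nozero N" and nf: "no_free_continuum f"
  obtains l :: "real \<times> real" where "l \<noteq> 0" "\<And>a n v. cyc N a n v \<Longrightarrow> l \<bullet> zv (mu n v) \<ge> 0"
proof -
  interpret G: periodic_graph "edge N" N by (rule periodic_graph[OF N])
  define good where "good = (\<lambda>V. \<exists>x. \<not> bounded (connected_component_set (- reg N V) x))"
  have "good {}"
  proof -
    have "reg N {} = {}" by (simp add: reg_def)
    then show ?thesis unfolding good_def by (simp add: not_bounded_UNIV)
  qed
  moreover have "\<not> good UNIV"
  proof -
    have "reg N UNIV = UNIV" using cell_in_sq by (auto simp: reg_def)
    then show ?thesis unfolding good_def by (simp add: connected_component_eq_empty[THEN iffD2])
  qed
  ultimately obtain V C where VC: "G.invariant V" "good V" "C \<inter> V = {}" "G.invariant (V \<union> C)" "\<not> good (V \<union> C)" "C \<noteq> {}"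
    and reach: "\<And>b c. b \<in> C \<Longrightarrow> c \<in> C \<Longrightarrow> c \<in> G.reach b"
    by (rule G.critical_class) blast
  obtain l :: "real \<times> real" where l: "l \<noteq> 0" "\<And>b n v. b \<in> C \<Longrightarrow> cyc N b n v \<Longrightarrow> l \<bullet> zv (mu n v) \<ge> 0"
    using class_half_plane[OF N nz VC(6) reach] by blast
  define \<alpha> where "\<alpha> = (l \<bullet> zv p) / of_int q"
  have q0: "real_of_int q > 0" using q by simp
  have mu_iff: "l \<bullet> zv (mu n v) \<ge> 0 \<longleftrightarrow> l \<bullet> zv v \<ge> real n * \<alpha>" for n v
  proof -
    have "l \<bullet> zv (mu n v) = of_int q * (l \<bullet> zv v - real n * \<alpha>)"
      using q0 by (simp add: zv_mu inner_diff_right \<alpha>_def algebra_simps)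
    then show ?thesis using q0 by (simp add: zero_le_mult_iff)
  qed
  \<comment> \<open>A walk between nodes of \<open>C\<close> stays in \<open>C\<close>, since
    \<open>V\<close> cannot be left and its union with \<open>C\<close> is invariant. So the lower
    bound can be proved in this subgraph, where the half plane of the class is available.\<close>
  define E where "E = (\<lambda>a b. edge N a b \<and> a \<in> C \<and> b \<in> C)"
  have Ctr: "a + imul (int N) v \<in> C" if a: "a \<in> C" for a v
  proof -
    have "a + imul (int N) v \<in> V \<union> C" using G.invariant_translate[OF VC(4)] a by blast
    moreover have "a + imul (int N) v \<notin> V"
    proof
      assume "a + imul (int N) v \<in> V"
      then have "a + imul (int N) v + imul (int N) (- v) \<in> V" by (rule G.invariant_translate[OF VC(1)])
      then show False using VC(3) a by (auto simp: imul_minus)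
    qed
    ultimately show ?thesis by blast
  qed
  interpret H: periodic_graph E N
    by unfold_locales (use N Ctr G.E_translate in \<open>unfold E_def, blast+\<close>)
  have step: "d \<in> C" if "c \<in> V \<union> C" "edge N c d" "d \<notin> V" for c d
    using G.invariant_succ[OF VC(4)] that by blast
  have restrict: "(E ^^ n) a b" if "a \<in> C" "(edge N ^^ n) a b" "b \<in> C" for n a b
    using that(2,3)
  proof (induction n arbitrary: b)
    case (Suc n)
    then obtain c where c: "(edge N ^^ n) a c" "edge N c b" by auto
    have "c \<in> V \<union> C" using G.invariant_walk[OF VC(4) _ c(1)] that(1) by blast
    moreover have "c \<notin> V" using G.invariant_succ[OF VC(1) _ c(2)] Suc.prems(2) VC(3) by blast
    ultimately have "c \<in> C" by blast
    then have "(E ^^ n) a c" "E c b" using Suc c by (auto simp: E_def)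
    then show ?case by auto
  qed simp
  have unrestrict: "(edge N ^^ n) a b" if "(E ^^ n) a b" for n a b
    using that
  proof (induction n arbitrary: b)
    case (Suc n)
    then obtain c where "(E ^^ n) a c" "E c b" by auto
    then have "(edge N ^^ n) a c" "edge N c b" using Suc.IH by (auto simp: E_def)
    then show ?case by auto
  qed simp
  obtain S where S: "S \<ge> 0" "\<And>a b. edge N a b \<Longrightarrow> dist (pos N a) (pos N b) \<le> S" using edge_bound N by metis
  define k where "k = real (N * N) * (norm l * S + \<bar>\<alpha>\<bar>)"
  have bound: "l \<bullet> pos N b - l \<bullet> pos N a \<ge> real n * \<alpha> - k" if "a \<in> C" "b \<in> C" "(edge N ^^ n) a b" for n a b
    unfolding k_def
  proof (rule H.walk_lower_bound[where l = "\<lambda>w. l \<bullet> pos N w"])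
    show "(E ^^ n) a b" using restrict that by blast
    show "l \<bullet> pos N (v + w) = l \<bullet> pos N v + l \<bullet> pos N w" for v w
      by (simp add: pos_def zv_add scaleR_add_right inner_add_right)
    show "norm l * S \<ge> 0" using S by simp
    show "l \<bullet> pos N b - l \<bullet> pos N a \<ge> - (norm l * S)" if "E a b" for a b
    proof -
      have "norm l * dist (pos N a) (pos N b) \<le> norm l * S" using S that by (intro mult_left_mono) (auto simp: E_def)
      then show ?thesis using inner_diff_le_norm[of l "pos N a" "pos N b"] by simp
    qed
    fix a n v assume H: "H.closed_walk a n v"
    then have n: "n \<ge> 1" and w: "(E ^^ n) a (a + imul (int N) v)" by (auto simp: H.closed_walk_def)
    obtain m where "n = Suc m" using n by (cases n) auto
    then have "(E OO E ^^ m) a (a + imul (int N) v)" using w by (simp only: relpowp.simps relpowp_commute)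
    then have "a \<in> C" by (auto simp: E_def)
    moreover have "cyc N a n v" using n unrestrict[OF w] by (simp add: G.closed_walk_def)
    ultimately have "l \<bullet> zv v \<ge> real n * \<alpha>" using l(2) mu_iff by blast
    then show "l \<bullet> pos N (imul (int N) v) \<ge> real n * \<alpha>" using N by (simp add: pos_def zv_imul)
  qed
  \<comment> \<open>Nodes reached from nodes of \<open>C\<close> that were beyond the threshold in
    the moving frame. Closing under walks gives the step from \<open>t\<close> to t + \<alpha>, and
    \<open>bound\<close> keeps the set within \<open>k\<close> of the threshold.\<close>
  define A where "A = (\<lambda>t. V \<union> {b \<in> C. \<exists>n. \<exists>a\<in>C. (edge N ^^ n) a b \<and> l \<bullet> pos N a \<ge> t - real n * \<alpha>})"
  interpret level_sets f fi N V C l \<alpha> k A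
  proof
    show "\<exists>x. \<not> bounded (connected_component_set (- reg N V) x)" using VC(2) by (simp add: good_def)
    show "bounded (connected_component_set (- reg N (V \<union> C)) x)" for x using VC(5) unfolding good_def by blast
    show "V \<subseteq> A t" "A t \<subseteq> V \<union> C" for t by (auto simp: A_def)
    show "b \<in> A t" if "b \<in> C" "l \<bullet> pos N b \<ge> t" for t b
    proof -
      have "(edge N ^^ 0) b b \<and> l \<bullet> pos N b \<ge> t - real 0 * \<alpha>" using that by simp
      then show ?thesis using that(1) unfolding A_def by blast
    qed
    show "l \<bullet> pos N b \<ge> t - k" if b: "b \<in> C" "b \<in> A t" for t b
    proof -
      have "b \<notin> V" using b VC(3) by blast
      then obtain n a where a: "a \<in> C" "(edge N ^^ n) a b" "l \<bullet> pos N a \<ge> t - real n * \<alpha>" using b unfolding A_def by blast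
      then show ?thesis using bound[OF a(1) b(1) a(2)] by linarith
    qed
    show "d \<in> A (t + \<alpha>)" if c: "c \<in> A t" and e: "edge N c d" for t c d
    proof (cases "c \<in> V \<or> d \<in> V")
      case True
      then have "d \<in> V" using G.invariant_succ[OF VC(1) _ e] by blast
      then show ?thesis by (simp add: A_def)
    next
      case False
      then obtain n a where a: "c \<in> C" "a \<in> C" "(edge N ^^ n) a c" "l \<bullet> pos N a \<ge> t - real n * \<alpha>" using c unfolding A_def by blast
      have "d \<in> C" using step[OF _ e] a False by blast
      moreover have "(edge N ^^ Suc n) a d" using a(3) e by auto
      moreover have "l \<bullet> pos N a \<ge> (t + \<alpha>) - real (Suc n) * \<alpha>" using a(4) by (simp add: algebra_simps)
      ultimately show ?thesis using a(2) unfolding A_def by blast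
    qed
    show "k \<ge> 0" using S by (simp add: k_def)
  qed (use N nf l VC in auto)
  show ?thesis
    using that[OF l(1)] mu_iff no_slow_cycle by blast
qed

end

section \<open>A free curve in an integral direction\<close>

text \<open>\<open>e\<close> and the vector \<open>u\<close> turned by a right angle have
  determinant \<open>idot u e\<close>, so they form a basis of the lattice.\<close>

lemma lattice_decomposition:
  assumes "idot u e = 1"
  shows "v = imul (idot u v) e + imul (idet e v) (- snd u, fst u)"
proof -
  have ue: "fst u * fst e + snd u * snd e = 1" using assms by (simp add: idot_def)
  have "fst v = (fst u * fst v + snd u * snd v) * fst e + (fst e * snd v - snd e * fst v) * (- snd u)" using ue by algebra
  moreover have "snd v = (fst u * fst v + snd u * snd v) * snd e + (fst e * snd v - snd e * fst v) * fst u" using ue by algebra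
  ultimately show ?thesis by (simp add: prod_eq_iff idot_def idet_def)
qed

lemma zv_inner: "zv u \<bullet> zv v = of_int (idot u v)"
  by (simp add: idot_def inner_prod_def)

lemma closed_thickening:
  fixes S :: "'a :: euclidean_space set"
  assumes "closed S"
  shows "closed {x. \<exists>a\<in>S. dist x a \<le> e}"
proof -
  have "{x. \<exists>a\<in>S. dist x a \<le> e} = (\<Union>x\<in>S. \<Union>y\<in>cball 0 e. {x + y})"
  proof (intro equalityI subsetI)
    fix x assume "x \<in> {x. \<exists>a\<in>S. dist x a \<le> e}"
    then obtain a where a: "a \<in> S" "dist x a \<le> e" by blast
    have "x = a + (x - a)" "x - a \<in> cball 0 e" using a by (auto simp: dist_norm norm_minus_commute)
    then show "x \<in> (\<Union>x\<in>S. \<Union>y\<in>cball 0 e. {x + y})" using a(1) by blast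
  next
    fix x assume "x \<in> (\<Union>x\<in>S. \<Union>y\<in>cball 0 e. {x + y})"
    then obtain a y where "a \<in> S" "norm y \<le> e" "x = a + y" by auto
    then show "x \<in> {x. \<exists>a\<in>S. dist x a \<le> e}" by (auto intro!: bexI[of _ a] simp: dist_norm)
  qed
  then show ?thesis using closed_compact_sums[OF assms compact_cball[of 0 e]] by simp
qed

text \<open>\<open>S\<close> lies in a strip transverse to \<open>e\<close>, so only finitely many
  of the translates come near a given point.\<close>

lemma closed_strip_translates:
  fixes S :: "(real \<times> real) set"
  assumes S: "closed S" and strip: "\<And>x. x \<in> S \<Longrightarrow> \<bar>w \<bullet> x\<bar> \<le> b" and we: "w \<bullet> zv e = 1"
  shows "closed {x. \<exists>k::int. x - zv (imul k e) \<in> S}" (is "closed ?B")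
  unfolding closed_def
proof (subst open_subopen, intro ballI)
  fix x assume x: "x \<in> - ?B"
  define F where "F = {\<lfloor>w \<bullet> x - b - 2\<rfloor>..\<lceil>w \<bullet> x + b + 2\<rceil>}"
  define G where "G = {z. w \<bullet> z < w \<bullet> x + 1} \<inter> {z. w \<bullet> z > w \<bullet> x - 1}"
  have "closed {z. z - zv (imul k e) \<in> S}" for k
  proof -
    have "closed ((\<lambda>z. z - zv (imul k e)) -` S)" by (intro closed_vimage S continuous_intros)
    then show ?thesis by (simp add: vimage_def)
  qed
  then have "closed (\<Union>k\<in>F. {z. z - zv (imul k e) \<in> S})" by (intro closed_UN ballI) (simp_all add: F_def)
  moreover have "open G" unfolding G_def by (intro open_Int open_halfspace_lt open_halfspace_gt)
  ultimately have "open (G - (\<Union>k\<in>F. {z. z - zv (imul k e) \<in> S}))" by (intro open_Diff)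
  moreover have "x \<in> G - (\<Union>k\<in>F. {z. z - zv (imul k e) \<in> S})" using x by (simp add: G_def)
  moreover have "G - (\<Union>k\<in>F. {z. z - zv (imul k e) \<in> S}) \<subseteq> - ?B"
  proof
    fix z assume z: "z \<in> G - (\<Union>k\<in>F. {z. z - zv (imul k e) \<in> S})"
    show "z \<in> - ?B"
    proof
      assume "z \<in> ?B"
      then obtain k :: int where k: "z - zv (imul k e) \<in> S" by blast
      have "\<bar>w \<bullet> z - of_int k\<bar> \<le> b" using strip[OF k] we by (simp add: inner_diff_right zv_imul)
      moreover have "\<bar>w \<bullet> z - w \<bullet> x\<bar> < 1" using z by (auto simp: G_def)
      ultimately have "w \<bullet> x - b - 2 \<le> of_int k" "of_int k \<le> w \<bullet> x + b + 2" by linarith+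
      then have "k \<in> F" unfolding F_def by (simp add: floor_le_iff le_ceiling_iff) linarith
      then show False using z k by blast
    qed
  qed
  ultimately show "\<exists>T. open T \<and> x \<in> T \<and> T \<subseteq> - ?B" by blast
qed

lemma interior_translate_in:
  fixes S :: "'a :: real_normed_vector set"
  assumes "\<And>x. x \<in> S \<Longrightarrow> x + w \<in> S" and z: "z \<in> interior S"
  shows "z + w \<in> interior S"
proof -
  have "(\<lambda>x. w + x) ` interior S = interior ((\<lambda>x. w + x) ` S)" by (rule interior_translation[symmetric])
  also have "\<dots> \<subseteq> interior S" using assms(1) by (intro interior_mono) (auto simp: add.commute)
  finally show ?thesis using z by (auto simp: add.commute)
qed

context lift_map
begin

text \<open>The two inclusions put the image of the frontier of \<open>S\<close> strictly between
  the translates of the frontier by m e and by (m + 1) e. Hence the union of all translates is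
  disjoint from its image. It contains the connected frontier of \<open>Q\<close>, which has the
  period \<open>w\<close>.\<close>

lemma attracting_strip_contradiction:
  fixes m :: int
  assumes nf: "no_free_continuum f" and ue: "idot u e = 1" and cS: "closed S"
    and inv: "\<And>x v. x \<in> S \<Longrightarrow> idot u v \<ge> 0 \<Longrightarrow> x + zv v \<in> S"
    and right: "\<And>x. zv u \<bullet> x \<ge> b \<Longrightarrow> x \<in> S" and left: "\<And>x. x \<in> S \<Longrightarrow> zv u \<bullet> x \<ge> - b"
    and fS: "\<And>x. x \<in> S \<Longrightarrow> f x - zv (imul m e) \<in> interior S"
    and hS: "\<And>x. x \<in> S \<Longrightarrow> fi x + zv (imul (m + 1) e) \<in> interior S"
  shows False
proof -
  have uze: "zv u \<bullet> zv e = 1" using ue by (simp add: zv_inner)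
  define w where "w = (- snd u, fst u)"
  have uw: "idot u w = 0" "idot u (- w) = 0" by (auto simp: w_def idot_def)
  have w0: "w \<noteq> 0"
  proof
    assume "w = 0"
    then show False using ue by (simp add: w_def idot_def prod_eq_iff)
  qed
  have uzw: "zv u \<bullet> zv w = 0" using uw by (simp add: zv_inner)
  define R where "R = {x. zv u \<bullet> x \<ge> b}"
  have RS: "R \<subseteq> S" using right by (auto simp: R_def)
  have point: "\<exists>x. zv u \<bullet> x = r" for r
    by (rule exI[of _ "r *\<^sub>R zv e"]) (simp add: uze)
  obtain x0 where x0: "zv u \<bullet> x0 = b" using point by blast
  obtain y0 where y0: "zv u \<bullet> y0 = - b - 1" using point by blast
  define I where "I = connected_component_set S x0"
  have cR: "connected R" unfolding R_def by (intro convex_connected convex_halfspace_ge)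
  have x0R: "x0 \<in> R" "x0 + zv w \<in> R" using x0 uzw by (auto simp: R_def inner_add_right)
  have x0w: "connected_component S x0 (x0 + zv w)" unfolding connected_component_def using cR RS x0R by blast
  have Sw: "x + zv w \<in> S" "x - zv w \<in> S" if "x \<in> S" for x
    using inv[OF that, of w] inv[OF that, of "- w"] uw by (auto simp: zv_uminus)
  have I: "connected I" "I \<subseteq> S" "I \<in> components S" "x0 \<in> I"
    using x0R RS by (auto simp: I_def connected_component_subset components_def connected_component_refl)
  have Iw: "x + zv w \<in> I" "x - zv w \<in> I" if "x \<in> I" for x
    using connected_component_shift_invariant[OF Sw x0w, of x] that by (auto simp: I_def)
  have mIw: "x + zv w \<in> - I" "x - zv w \<in> - I" if "x \<in> - I" for x
    using that Iw[of "x + zv w"] Iw[of "x - zv w"] by auto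
  define H where "H = {x. zv u \<bullet> x < - b}"
  have HI: "H \<subseteq> - I" using I(2) left by (force simp: H_def)
  have y0H: "y0 \<in> H" "y0 + zv w \<in> H" using y0 uzw by (auto simp: H_def inner_add_right)
  have "connected H" unfolding H_def by (intro convex_connected convex_halfspace_lt)
  then have y0w: "connected_component (- I) y0 (y0 + zv w)" unfolding connected_component_def using HI y0H by blast
  define Q where "Q = connected_component_set (- I) y0"
  have y0I: "y0 \<in> - I" using HI y0H by blast
  have Qc: "Q \<in> components (- I)" using y0I by (auto simp: Q_def components_def)
  have Qw: "x + zv w \<in> Q" "x - zv w \<in> Q" if "x \<in> Q" for x
    using connected_component_shift_invariant[OF mIw y0w, of x] that by (auto simp: Q_def)
  have cfr: "connected (frontier Q)" by (rule connected_frontier_component_complement[OF I(1) Qc])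
  have frS: "frontier Q \<subseteq> frontier S"
    using frontier_of_components_subset[OF Qc] frontier_of_components_subset[OF I(3)] by auto
  have "y0 \<in> Q" using y0I by (simp add: Q_def connected_component_refl_eq)
  moreover have "x0 \<notin> Q" using I(4) Qc in_components_subset by blast
  ultimately have "frontier Q \<noteq> {}" using frontier_not_empty by (metis UNIV_I empty_iff)
  then obtain z where z: "z \<in> frontier Q" by blast
  then have zw: "z + zv w \<in> frontier Q" using frontier_translates[OF Qw] by blast
  \<comment> \<open>The frontier is already invariant along \<open>w\<close>; multiples of
    \<open>e\<close> then give all lattice translates.\<close>
  define B where "B = {x. \<exists>k::int. x - zv (imul k e) \<in> frontier S}"
  have frw: "x + zv (imul j w) \<in> frontier S" if "x \<in> frontier S" for x j
  proof (rule frontier_translates[OF _ _ that])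
    have "idot u (imul j w) = 0" "idot u (- imul j w) = 0" by (auto simp: w_def idot_def)
    then show "x \<in> S \<Longrightarrow> x + zv (imul j w) \<in> S" "x \<in> S \<Longrightarrow> x - zv (imul j w) \<in> S" for x
      using inv[of x "imul j w"] inv[of x "- imul j w"] by (auto simp: zv_uminus)
  qed
  have shift: "x + zv (imul k e) \<in> interior S" if "x \<in> interior S" "k \<ge> 0" for x k
  proof (rule interior_translate_in[OF _ that(1)])
    have "idot u (imul k e) = k * idot u e" by (simp add: idot_def algebra_simps)
    then show "x \<in> S \<Longrightarrow> x + zv (imul k e) \<in> S" for x using inv[of x "imul k e"] ue that(2) by simp
  qed
  have fr: "x \<in> S" "x \<notin> interior S" if "x \<in> frontier S" for x
    using that cS by (auto simp: frontier_def)
  have free: "f x - zv (imul k e) \<notin> frontier S" if x: "x \<in> frontier S" for x k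
  proof
    assume y: "f x - zv (imul k e) \<in> frontier S"
    show False
    proof (cases "k \<le> m")
      case True
      have "f x - zv (imul m e) + zv (imul (m - k) e) \<in> interior S"
        by (rule shift[OF fS[OF fr(1)[OF x]]]) (use True in simp)
      then show False using fr(2)[OF y] by (simp add: imul_diff zv_diff)
    next
      case False
      have "fi (f x - zv (imul k e)) + zv (imul (m + 1) e) + zv (imul (k - (m + 1)) e) \<in> interior S"
        by (rule shift[OF hS[OF fr(1)[OF y]]]) (use False in simp)
      moreover have "fi (f x - zv (imul k e)) = x - zv (imul k e)"
        using fi_comm[of "f x" "- imul k e"] by (simp add: zv_uminus)
      ultimately show False using fr(2)[OF x] by (simp add: imul_diff zv_diff)
    qed
  qed
  have "w = 0"
  proof (rule nf[unfolded no_free_continuum_def, rule_format, of B "frontier Q" z])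
    have "\<bar>zv u \<bullet> x\<bar> \<le> \<bar>b\<bar>" if x: "x \<in> frontier S" for x
    proof -
      have "zv u \<bullet> x \<ge> - b" using left fr(1)[OF x] by blast
      moreover have "zv u \<bullet> x \<le> b"
      proof (rule ccontr)
        assume "\<not> ?thesis"
        then have "x \<in> {x. zv u \<bullet> x > b}" by (simp add: not_le)
        moreover have "{x. zv u \<bullet> x > b} \<subseteq> interior S" using right by (intro interior_maximal open_halfspace_gt) auto
        ultimately show False using fr(2)[OF x] by blast
      qed
      ultimately show ?thesis by linarith
    qed
    then show "closed B" unfolding B_def by (intro closed_strip_translates[OF frontier_closed _ uze])
    show "x + zv v \<in> B" if xB: "x \<in> B" for x v
    proof -
      obtain k where k: "x - zv (imul k e) \<in> frontier S" using xB by (auto simp: B_def)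
      have "zv v = zv (imul (idot u v) e) + zv (imul (idet e v) w)"
        using lattice_decomposition[OF ue, of v] by (metis w_def zv_add)
      then have "x + zv v - zv (imul (k + idot u v) e) = x - zv (imul k e) + zv (imul (idet e v) w)"
        by (simp add: imul_add zv_add)
      then have "x + zv v - zv (imul (k + idot u v) e) \<in> frontier S" using frw[OF k] by metis
      then show ?thesis unfolding B_def by blast
    qed
    show "f ` B \<inter> B = {}"
    proof (rule ccontr)
      assume "f ` B \<inter> B \<noteq> {}"
      then obtain x k j where x: "x - zv (imul k e) \<in> frontier S" "f x - zv (imul j e) \<in> frontier S" by (auto simp: B_def)
      have "f (x - zv (imul k e)) = f x - zv (imul k e)" using comm[of x "- imul k e"] by (simp add: zv_uminus)
      then have "f (x - zv (imul k e)) - zv (imul (j - k) e) \<in> frontier S" using x(2) by (simp add: imul_diff zv_diff)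
      then show False using free[OF x(1)] by blast
    qed
    show "connected (frontier Q)" by (rule cfr)
    show "frontier Q \<subseteq> B"
    proof
      fix x assume "x \<in> frontier Q"
      then have "x - zv (imul 0 e) \<in> frontier S" using frS by auto
      then show "x \<in> B" unfolding B_def by blast
    qed
  qed (use z zw in auto)
  then show False using w0 by simp
qed

text \<open>By periodicity the strict gain has a positive minimum, which adds up under
  iteration.\<close>

lemma iterates_gain:
  assumes nu: "\<And>y. \<nu> \<bullet> (f ^^ n) y > \<nu> \<bullet> y"
  obtains j where "j \<ge> 1" "\<And>y. \<nu> \<bullet> (f ^^ (j * n)) y \<ge> \<nu> \<bullet> y + r"
proof -
  interpret fn: lift_map "f ^^ n" "fi ^^ n" by (rule funpow)
  obtain z where z: "\<And>y. \<nu> \<bullet> ((f ^^ n) z - z) \<le> \<nu> \<bullet> ((f ^^ n) y - y)"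
    by (rule periodic_attains_inf[of "\<lambda>x. \<nu> \<bullet> ((f ^^ n) x - x)"]) (auto intro!: continuous_intros fn.cont simp: funpow_comm)
  define d where "d = \<nu> \<bullet> ((f ^^ n) z - z)"
  have d: "d > 0" using nu[of z] by (simp add: d_def inner_diff_right)
  have step: "\<nu> \<bullet> (f ^^ n) y \<ge> \<nu> \<bullet> y + d" for y using z[of y] by (simp add: d_def inner_diff_right)
  have iter: "\<nu> \<bullet> (f ^^ (j * n)) y \<ge> \<nu> \<bullet> y + real j * d" for j y
  proof (induction j)
    case (Suc j)
    have "(f ^^ (Suc j * n)) y = (f ^^ n) ((f ^^ (j * n)) y)" by (simp add: funpow_add)
    then show ?case using Suc step[of "(f ^^ (j * n)) y"] by (simp add: algebra_simps)
  qed simp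
  obtain j :: nat where j: "real j * d > r" using reals_Archimedean3[OF d] by blast
  have "real (Suc j) * d \<ge> r" using j d by (simp add: algebra_simps)
  show ?thesis
  proof (rule that[of "Suc j"])
    show "\<nu> \<bullet> (f ^^ (Suc j * n)) y \<ge> \<nu> \<bullet> y + r" for y
      using iter[where j = "Suc j" and y = y] \<open>real (Suc j) * d \<ge> r\<close> by linarith
  qed simp
qed

text \<open>The squares reached from a half plane form a region \<open>A\<close> attracting for
  \<open>f\<close> minus m e, but not necessarily for \<open>h\<close>, the inverse plus (m + 1) e.
  The union \<open>T\<close> of the first \<open>n0\<close> images under \<open>h\<close> of
  thickenings of \<open>A\<close> is: \<open>h\<close> moves each image into the next and, by the
  speed assumption, the last one into the half plane. As \<open>h\<close> commutes with
  \<open>f\<close>, the region \<open>T\<close> stays attracting for \<open>f\<close>.\<close>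

lemma no_strip_between_integers:
  fixes m :: int and n1 :: nat
  assumes N: "N > 0" and nf: "no_free_continuum f" and ue: "idot u e = 1"
    and cyc: "\<And>a n v. periodic_graph.closed_walk (edge N) N a n v \<Longrightarrow> zv u \<bullet> zv v \<ge> real n * \<alpha>" and m: "of_int m \<le> \<alpha>"
    and slow: "\<And>x. zv u \<bullet> ((f ^^ n1) x - x) < real n1 * of_int (m + 1)"
  shows False
proof -
  interpret G: periodic_graph "edge N" N by (rule periodic_graph[OF N])
  define l where "l = zv u"
  have le: "l \<bullet> zv e = 1" using ue by (simp add: l_def zv_inner)
  define w where "w = imul (m + 1) e"
  have lw: "l \<bullet> zv w = of_int (m + 1)" using le by (simp add: w_def zv_imul)
  define h hi where "h = (\<lambda>x. fi x + zv w)" and "hi = (\<lambda>x. f (x - zv w))"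
  interpret H: lift_map h hi unfolding h_def hi_def by (rule lift_map.translate[OF inverse])
  obtain S where S: "S \<ge> 0" "\<And>a b. edge N a b \<Longrightarrow> dist (pos N a) (pos N b) \<le> S" using edge_bound N by metis
  define k where "k = real (N * N) * (norm l * S + \<bar>\<alpha>\<bar>)"
  have k: "k \<ge> 0" using S by (simp add: k_def)
  have bound: "l \<bullet> pos N b - l \<bullet> pos N a \<ge> real n * \<alpha> - k" if "(edge N ^^ n) a b" for n a b
    unfolding k_def
  proof (rule G.walk_lower_bound[where l = "\<lambda>w. l \<bullet> pos N w"])
    show "(edge N ^^ n) a b" by fact
    show "l \<bullet> pos N (v + w) = l \<bullet> pos N v + l \<bullet> pos N w" for v w
      by (simp add: pos_def zv_add scaleR_add_right inner_add_right)
    show "norm l * S \<ge> 0" using S by simp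
    show "l \<bullet> pos N b - l \<bullet> pos N a \<ge> - (norm l * S)" if "edge N a b" for a b
    proof -
      have "norm l * dist (pos N a) (pos N b) \<le> norm l * S" using S that by (intro mult_left_mono) auto
      then show ?thesis using inner_diff_le_norm[of l "pos N a" "pos N b"] by simp
    qed
    fix a n v assume "G.closed_walk a n v"
    then show "l \<bullet> pos N (imul (int N) v) \<ge> real n * \<alpha>" using cyc N by (simp add: pos_def zv_imul l_def)
  qed
  \<comment> \<open>The start may lie farther left the longer the walk is, at rate \<alpha>. As m
    \<le> \<alpha>, moving a successor back by m e keeps it in \<open>P\<close>.\<close>
  define P where "P = {b. \<exists>n a. (edge N ^^ n) a b \<and> l \<bullet> pos N a \<ge> - real n * \<alpha>}"
  define A where "A = reg N P"
  have P_translate: "b + imul (int N) v \<in> P" if b: "(edge N ^^ n) a b" "l \<bullet> pos N a \<ge> - real n * \<alpha> - l \<bullet> zv v" for n a b v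
  proof -
    have "(edge N ^^ n) (a + imul (int N) v) (b + imul (int N) v)" using b by (intro G.walk_translate)
    moreover have "l \<bullet> pos N (a + imul (int N) v) \<ge> - real n * \<alpha>" using b by (simp add: pos_translate[OF N] inner_add_right)
    ultimately show ?thesis unfolding P_def by blast
  qed
  have A_inv: "x + zv v \<in> A" if x: "x \<in> A" "idot u v \<ge> 0" for x v
  proof -
    obtain b where b: "b \<in> P" "x \<in> sq N b" using x by (auto simp: A_def reg_def)
    then obtain n a where a: "(edge N ^^ n) a b" "l \<bullet> pos N a \<ge> - real n * \<alpha>" by (auto simp: P_def)
    have "l \<bullet> zv v \<ge> 0" using x(2) by (simp add: l_def zv_inner)
    then have "b + imul (int N) v \<in> P" using a by (intro P_translate) auto
    then show ?thesis unfolding A_def reg_def using sq_translate[OF N] b(2) by blast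
  qed
  have A_step: "y - zv (imul m e) \<in> A" if x: "x \<in> A" and y: "dist (f x) y \<le> 1 / real N" for x y
  proof -
    obtain b where b: "b \<in> P" "x \<in> sq N b" using x by (auto simp: A_def reg_def)
    then obtain n a where a: "(edge N ^^ n) a b" "l \<bullet> pos N a \<ge> - real n * \<alpha>" by (auto simp: P_def)
    define c where "c = lattice_cell N y"
    have c: "y \<in> sq N c" by (simp add: c_def cell_in_sq)
    have "edge N b c" unfolding edge_def using b c y by blast
    then have "(edge N ^^ Suc n) a c" using a(1) by auto
    moreover have "l \<bullet> pos N a \<ge> - real (Suc n) * \<alpha> - l \<bullet> zv (- imul m e)"
      using a(2) m le by (simp add: zv_uminus zv_imul algebra_simps)
    ultimately have "c + imul (int N) (- imul m e) \<in> P" by (rule P_translate)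
    moreover have "y + zv (- imul m e) \<in> sq N (c + imul (int N) (- imul m e))" using c sq_translate[OF N] by blast
    ultimately show ?thesis unfolding A_def reg_def by (auto simp: zv_uminus)
  qed
  define \<sigma> where "\<sigma> = norm l * (2 / real N)"
  have \<sigma>: "\<sigma> \<ge> 0" by (simp add: \<sigma>_def)
  have sqd: "\<bar>l \<bullet> x - l \<bullet> pos N b\<bar> \<le> \<sigma>" if x: "x \<in> sq N b" for x b
  proof -
    have "norm l * dist x (pos N b) \<le> \<sigma>" unfolding \<sigma>_def
      using sq_diameter[OF N x pos_in_sq[OF N]] by (intro mult_left_mono) auto
    then show ?thesis using inner_diff_le_norm[of l x "pos N b"] inner_diff_le_norm[of l "pos N b" x] by (simp add: dist_commute)
  qed
  have A_right: "x \<in> A" if x: "l \<bullet> x \<ge> \<sigma>" for x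
  proof -
    define b where "b = lattice_cell N x"
    have b: "x \<in> sq N b" by (simp add: b_def cell_in_sq)
    have "(edge N ^^ 0) b b \<and> l \<bullet> pos N b \<ge> - real 0 * \<alpha>" using sqd[OF b] x by simp
    then have "b \<in> P" unfolding P_def by blast
    then show ?thesis using b by (auto simp: A_def reg_def)
  qed
  have A_left: "l \<bullet> x \<ge> - k - \<sigma>" if x: "x \<in> A" for x
  proof -
    obtain b where b: "b \<in> P" "x \<in> sq N b" using x by (auto simp: A_def reg_def)
    then obtain n a where a: "(edge N ^^ n) a b" "l \<bullet> pos N a \<ge> - real n * \<alpha>" by (auto simp: P_def)
    then show ?thesis using bound[OF a(1)] sqd[OF b(2)] by (simp add: algebra_simps abs_le_iff)
  qed
  have "l \<bullet> (h ^^ n1) y > l \<bullet> y" for y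
  proof -
    have "(f ^^ n) ((h ^^ n) y) = y + real n *\<^sub>R zv w" for n
    proof (induction n)
      case (Suc n)
      have "(f ^^ Suc n) ((h ^^ Suc n) y) = (f ^^ n) (f (h ((h ^^ n) y)))" by (simp add: funpow_swap1)
      also have "f (h ((h ^^ n) y)) = (h ^^ n) y + zv w" by (simp add: h_def comm)
      finally show ?case using Suc by (simp only: funpow_comm) (simp add: algebra_simps)
    qed simp
    then have "l \<bullet> (f ^^ n1) ((h ^^ n1) y) = l \<bullet> y + real n1 * of_int (m + 1)" using lw by (simp add: inner_add_right)
    then show ?thesis using slow[of "(h ^^ n1) y"] by (simp add: l_def inner_diff_right)
  qed
  \<comment> \<open>By \<open>A_left\<close>, \<open>A\<close> reaches left to -k - \<sigma> at
    most, and a thickening by at most 1 costs \<open>norm l\<close>. The rest of the gain leads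
    beyond \<sigma>, where all points belong to \<open>A\<close>.\<close>
  from H.iterates_gain[OF this, where r = "k + norm l + 2 * \<sigma> + 1"]
  obtain j where j: "j \<ge> 1" "\<And>y. l \<bullet> (h ^^ (j * n1)) y \<ge> l \<bullet> y + (k + norm l + 2 * \<sigma> + 1)"
    by blast
  define n0 where "n0 = j * n1"
  have gain: "l \<bullet> (h ^^ n0) y \<ge> l \<bullet> y + (k + norm l + 2 * \<sigma> + 1)" for y using j(2) by (simp add: n0_def)
  have "n0 \<noteq> 0"
  proof
    assume "n0 = 0"
    then show False using gain[of 0] k \<sigma> norm_ge_zero[of l] by (simp del: norm_ge_zero)
  qed
  then have n0: "n0 > 0" by simp
  have "1 / (2 * real N) > 0" using N by simp
  then obtain d where d: "d > 0" "\<And>x y :: real \<times> real. dist x y < d \<Longrightarrow> dist (f x) (f y) < 1 / (2 * real N)"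
    using uniformly_continuous by blast
  define \<eta> where "\<eta> = min (d / 2) 1"
  have \<eta>: "\<eta> > 0" "\<eta> < d" "\<eta> \<le> 1" using d by (auto simp: \<eta>_def)
  \<comment> \<open>The radii increase strictly, so that each closed thickening lies inside an open
    set contained in the next; the largest is \<eta>, small enough for the slack of the
    graph.\<close>
  define \<epsilon> where "\<epsilon> = (\<lambda>i. \<eta> * (real (Suc i) / real n0))"
  have \<epsilon>: "\<epsilon> i > 0" "\<epsilon> i < \<epsilon> (Suc i)" for i
    unfolding \<epsilon>_def using \<eta> n0 by (auto intro!: mult_pos_pos mult_strict_left_mono divide_strict_right_mono)
  have \<epsilon>_le: "\<epsilon> i \<le> \<eta>" if "i < n0" for i
  proof -
    have "\<eta> * (real (Suc i) / real n0) \<le> \<eta> * 1" using that \<eta> by (intro mult_left_mono) (auto simp: field_simps)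
    then show ?thesis by (simp add: \<epsilon>_def)
  qed
  define A\<epsilon> where "A\<epsilon> = (\<lambda>i. {x. \<exists>a\<in>A. dist x a \<le> \<epsilon> i})"
  have A_sub: "A \<subseteq> A\<epsilon> i" for i
  proof
    fix x assume "x \<in> A"
    then show "x \<in> A\<epsilon> i" using \<epsilon>(1)[of i] by (auto simp: A\<epsilon>_def intro!: bexI[of _ x])
  qed
  define T where "T = (\<Union>i<n0. (h ^^ i) ` A\<epsilon> i)"
  have sub_interior: "(h ^^ i) ` W \<subseteq> interior T" if "open W" "W \<subseteq> A\<epsilon> i" "i < n0" for i W
  proof (rule interior_maximal)
    show "(h ^^ i) ` W \<subseteq> T" using that by (auto simp: T_def)
    show "open ((h ^^ i) ` W)" by (rule lift_map.open_image[OF H.funpow that(1)])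
  qed
  have T_left: "\<exists>b. \<forall>x\<in>T. l \<bullet> x \<ge> - b"
  proof -
    obtain c where c: "\<And>x. dist (h x) x \<le> c" using H.bounded_displacement by metis
    have hc: "norm ((h ^^ i) y - y) \<le> real i * c" for i y
      using c by (intro H.funpow_displacement) (simp add: dist_norm)
    have c0: "c \<ge> 0" using c[of 0] by (meson zero_le_dist order_trans)
    have "l \<bullet> x \<ge> - (k + \<sigma> + norm l + norm l * (real n0 * c))" if x: "x \<in> T" for x
    proof -
      obtain i y a where iy: "i < n0" "a \<in> A" "dist y a \<le> \<epsilon> i" "x = (h ^^ i) y" using x by (auto simp: T_def A\<epsilon>_def)
      have "norm l * dist a y \<le> norm l * 1" using iy(3) \<epsilon>_le[OF iy(1)] \<eta> by (intro mult_left_mono) (auto simp: dist_commute)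
      then have 1: "l \<bullet> a \<le> l \<bullet> y + norm l" using inner_diff_le_norm[of l a y] by simp
      have "dist y x \<le> real i * c" using hc[of i y] iy(4) by (simp add: dist_norm norm_minus_commute)
      also have "\<dots> \<le> real n0 * c" using iy(1) c0 by (intro mult_right_mono) auto
      finally have "norm l * dist y x \<le> norm l * (real n0 * c)" by (intro mult_left_mono) auto
      then have "l \<bullet> y \<le> l \<bullet> x + norm l * (real n0 * c)" using inner_diff_le_norm[of l y x] by simp
      then show ?thesis using 1 A_left[OF iy(2)] by linarith
    qed
    then show ?thesis by blast
  qed
  then obtain b where b: "\<And>x. x \<in> T \<Longrightarrow> l \<bullet> x \<ge> - b" by blast
  have T_right: "x \<in> T" if "l \<bullet> x \<ge> \<sigma>" for x
  proof -
    have "x \<in> (h ^^ 0) ` A\<epsilon> 0" using A_right[OF that] A_sub by auto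
    then show ?thesis unfolding T_def using n0 by blast
  qed
  show False
  proof (rule attracting_strip_contradiction[OF nf ue, of T "max \<sigma> b" m])
    have "closed (A\<epsilon> i)" for i unfolding A\<epsilon>_def A_def by (intro closed_thickening closed_reg N)
    then show "closed T" unfolding T_def by (intro closed_UN finite_lessThan ballI lift_map.closed_image[OF H.funpow])
    show "x \<in> T" if "zv u \<bullet> x \<ge> max \<sigma> b" for x using that by (intro T_right) (simp add: l_def)
    show "zv u \<bullet> x \<ge> - max \<sigma> b" if "x \<in> T" for x using b[OF that] by (simp add: l_def)
    show "x + zv v \<in> T" if x: "x \<in> T" and v: "idot u v \<ge> 0" for x v
    proof -
      obtain i y a where iy: "i < n0" "a \<in> A" "dist y a \<le> \<epsilon> i" "x = (h ^^ i) y" using x by (auto simp: T_def A\<epsilon>_def)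
      have "y + zv v \<in> A\<epsilon> i" unfolding A\<epsilon>_def using A_inv[OF iy(2) v] iy(3) by (auto intro!: bexI[of _ "a + zv v"])
      moreover have "x + zv v = (h ^^ i) (y + zv v)" using iy(4) by (simp add: H.funpow_comm)
      ultimately show ?thesis unfolding T_def using iy(1) by blast
    qed
    fix x assume "x \<in> T"
    then obtain i y a where iy: "i < n0" "a \<in> A" "dist y a \<le> \<epsilon> i" "x = (h ^^ i) y" by (auto simp: T_def A\<epsilon>_def)
    have fh: "f (h z) = h (f z)" for z by (simp add: h_def comm)
    have fhi: "f ((h ^^ i) y) = (h ^^ i) (f y)" for i by (induction i) (auto simp: fh)
    have "f x - zv (imul m e) = (h ^^ i) (f y - zv (imul m e))"
      using H.funpow_comm[of i "f y" "- imul m e"] by (simp add: iy(4) fhi zv_uminus)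
    moreover have "ball (f y - zv (imul m e)) (1 / (2 * real N)) \<subseteq> A"
    proof
      fix z assume z: "z \<in> ball (f y - zv (imul m e)) (1 / (2 * real N))"
      have "dist y a < d" using iy(3) \<epsilon>_le[OF iy(1)] \<eta> by linarith
      then have "dist (f y) (f a) < 1 / (2 * real N)" by (rule d(2))
      moreover have "dist (f y) (z + zv (imul m e)) < 1 / (2 * real N)" using z by (simp add: dist_norm algebra_simps)
      moreover have "1 / (2 * real N) + 1 / (2 * real N) = 1 / real N" by simp
      ultimately have "dist (f a) (z + zv (imul m e)) \<le> 1 / real N"
        using dist_triangle3[of "f a" "z + zv (imul m e)" "f y"] by linarith
      then show "z \<in> A" using A_step[OF iy(2)] by fastforce
    qed
    then have "(h ^^ i) ` ball (f y - zv (imul m e)) (1 / (2 * real N)) \<subseteq> interior T"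
      using A_sub by (intro sub_interior iy(1)) auto
    moreover have "f y - zv (imul m e) \<in> ball (f y - zv (imul m e)) (1 / (2 * real N))" using N by simp
    ultimately show "f x - zv (imul m e) \<in> interior T" by blast
    have hx: "fi x + zv (imul (m + 1) e) = (h ^^ Suc i) y" by (simp add: iy(4) h_def w_def)
    show "fi x + zv (imul (m + 1) e) \<in> interior T"
    proof (cases "Suc i < n0")
      case True
      define W where "W = (\<Union>a\<in>A. ball a (\<epsilon> (Suc i)))"
      have "open W" by (auto simp: W_def)
      moreover have "W \<subseteq> A\<epsilon> (Suc i)"
      proof
        fix z assume "z \<in> W"
        then obtain a' where "a' \<in> A" "dist z a' < \<epsilon> (Suc i)" by (auto simp: W_def dist_commute)
        then show "z \<in> A\<epsilon> (Suc i)" unfolding A\<epsilon>_def using less_imp_le by blast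
      qed
      ultimately have "(h ^^ Suc i) ` W \<subseteq> interior T" using True by (rule sub_interior)
      moreover have "dist a y < \<epsilon> (Suc i)" using iy(3) \<epsilon>(2)[of i] by (simp add: dist_commute)
      then have "y \<in> W" using iy(2) by (auto simp: W_def)
      ultimately show ?thesis unfolding hx by blast
    next
      case False
      then have n0i: "Suc i = n0" using iy(1) by simp
      have "norm l * dist a y \<le> norm l * 1" using iy(3) \<epsilon>_le[OF iy(1)] \<eta> by (intro mult_left_mono) (auto simp: dist_commute)
      then have "l \<bullet> a \<le> l \<bullet> y + norm l" using inner_diff_le_norm[of l a y] by simp
      then have "l \<bullet> (h ^^ n0) y > \<sigma>" using gain[of y] A_left[OF iy(2)] by linarith
      moreover have "{z. l \<bullet> z > \<sigma>} \<subseteq> interior T" using T_right by (intro interior_maximal open_halfspace_gt) auto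
      ultimately show ?thesis unfolding hx n0i by blast
    qed
  qed
qed

text \<open>Iterates of factorial order are used because each \<open>m\<close> divides all but
  finitely many factorials. One limit of their mean displacements thus works for all
  \<open>m\<close>, by picking a block of length \<open>m\<close> that gains at least the
  average.\<close>

lemma realizable_of_directional_rates:
  assumes r: "\<And>n. n \<ge> 1 \<Longrightarrow> \<exists>x. w \<bullet> ((f ^^ n) x - x) \<ge> real n * c"
  obtains P where "realizable P" "w \<bullet> P \<ge> c"
proof -
  have "\<forall>j. \<exists>x. w \<bullet> ((f ^^ fact j) x - x) \<ge> real (fact j) * c" by (intro allI r) simp
  then obtain X where X: "\<And>j. w \<bullet> ((f ^^ fact j) (X j) - X j) \<ge> real (fact j) * c" by metis
  define s where "s = (\<lambda>j. (1 / real (fact j)) *\<^sub>R ((f ^^ fact j) (X j) - X j))"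
  obtain D where D: "\<And>x. dist (f x) x \<le> D" using bounded_displacement by metis
  have "norm (s j) \<le> D" for j
  proof -
    have "norm ((f ^^ fact j) (X j) - X j) \<le> real (fact j) * D" using D by (intro funpow_displacement) (simp add: dist_norm)
    then show ?thesis by (simp add: s_def pos_divide_le_eq mult.commute del: of_nat_fact)
  qed
  then have "\<forall>k. s k \<in> cball 0 D" by simp
  then obtain P \<phi> where P: "strict_mono (\<phi> :: nat \<Rightarrow> nat)" "(s \<circ> \<phi>) \<longlonglongrightarrow> P"
    using compact_cball[of "0::real \<times> real" D] unfolding compact_def by blast
  show ?thesis
  proof (rule that)
    have "w \<bullet> s j \<ge> c" for j
      using X[of j] by (simp add: s_def pos_le_divide_eq mult.commute del: of_nat_fact)
    then show "w \<bullet> P \<ge> c" by (intro LIMSEQ_le_const[OF tendsto_inner[OF tendsto_const P(2)]]) auto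
    show "realizable P"
      unfolding realizable_def
    proof (intro allI impI)
      fix m :: nat and \<nu> :: "real \<times> real" assume m: "1 \<le> m"
      interpret fm: lift_map "f ^^ m" "fi ^^ m" by (rule funpow)
      obtain z where z: "\<And>x. \<nu> \<bullet> ((f ^^ m) x - x) \<le> \<nu> \<bullet> ((f ^^ m) z - z)"
        by (rule periodic_attains_sup[of "\<lambda>x. \<nu> \<bullet> ((f ^^ m) x - x)"])
          (auto intro!: continuous_intros fm.cont simp: funpow_comm)
      have "real m * (\<nu> \<bullet> s j) \<le> \<nu> \<bullet> ((f ^^ m) z - z)" if j: "j \<ge> m" for j
      proof -
        have "m dvd fact j" using m j by (intro dvd_fact) auto
        then obtain k :: nat where "fact j = m * k" by (rule dvdE)
        then have k: "fact j = k * m" by (simp add: mult.commute)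
        have k1: "k \<ge> 1" using k fact_nonzero[of j, where 'a = nat] by (cases k) auto
        define y where "y = (\<lambda>i. (f ^^ i) (X j))"
        obtain i where i: "i < k" "\<nu> \<bullet> (y (Suc i * m) - y (i * m)) \<ge> \<nu> \<bullet> (y (k * m) - y 0) / real k"
          using average_block[OF k1] by blast
        have "y (k * m) - y 0 = real (k * m) *\<^sub>R s j" using k1 m by (simp add: y_def s_def k del: of_nat_fact of_nat_mult)
        then have "\<nu> \<bullet> (y (k * m) - y 0) / real k = real m * (\<nu> \<bullet> s j)" using k1 by simp
        moreover have "y (Suc i * m) = (f ^^ m) (y (i * m))" by (simp add: y_def funpow_add)
        ultimately show ?thesis using i(2) z[of "y (i * m)"] by simp
      qed
      moreover have "\<phi> k \<ge> k" for k using P(1) by (rule seq_suble)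
      ultimately have "\<exists>K. \<forall>k\<ge>K. real m * (\<nu> \<bullet> (s \<circ> \<phi>) k) \<le> \<nu> \<bullet> ((f ^^ m) z - z)"
        by (metis comp_apply le_trans)
      then have "real m * (\<nu> \<bullet> P) \<le> \<nu> \<bullet> ((f ^^ m) z - z)"
        by (intro LIMSEQ_le_const2[OF tendsto_mult[OF tendsto_const tendsto_inner[OF tendsto_const P(2)]]])
      then show "\<exists>x. real m * (\<nu> \<bullet> P) \<le> \<nu> \<bullet> ((f ^^ m) x - x)" by blast
    qed
  qed
qed

end

section \<open>The main theorem\<close>

context lift_map
begin

lemma no_closed_chain:
  assumes \<delta>: "\<delta> > 0" and free: "\<And>z. dist (f z) z \<ge> \<delta>"
    and n1: "n \<ge> 1" and cl: "x n = x 0" and ch: "\<And>i. i < n \<Longrightarrow> dist (f (x i)) (x (Suc i)) < \<delta>"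
  shows False
proof -
  define c where "c = (\<lambda>p::real \<times> real. Complex (fst p) (snd p))"
  define d where "d = (\<lambda>z. (Re z, Im z))"
  have cd: "c (d z) = z" "d (c p) = p" for z p by (auto simp: c_def d_def)
  have dist_c: "dist (c p) (c p') = dist p p'" for p p'
    by (simp add: c_def dist_prod_def dist_norm cmod_def dist_real_def)
  have cc: "continuous_on UNIV c" unfolding c_def by (intro continuous_intros)
  have cd': "continuous_on UNIV d" unfolding d_def by (intro continuous_intros)
  obtain B where B: "\<And>x. dist (f x) x \<le> B" using bounded_displacement by metis
  show False
  proof (rule no_closed_chain_complex[of "c \<circ> f \<circ> d" "c \<circ> fi \<circ> d" B \<delta> n "c \<circ> x"])
    show "homeomorphism UNIV UNIV (c \<circ> f \<circ> d) (c \<circ> fi \<circ> d)"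
    proof -
      have 1: "homeomorphism UNIV UNIV c d" "homeomorphism UNIV UNIV d c"
        using cc cd' cd unfolding homeomorphism_def by (metis surjI UNIV_I)+
      show ?thesis
        using homeomorphism_compose[OF homeomorphism_compose[OF 1(2) hom] 1(1)] by (simp add: o_assoc)
    qed
    show "norm ((c \<circ> f \<circ> d) z - z) \<le> B" for z
      using B[of "d z"] dist_c[of "f (d z)" "d z"] by (simp add: cd dist_norm)
    show "dist ((c \<circ> f \<circ> d) z) z \<ge> \<delta>" for z
      using free[of "d z"] dist_c[of "f (d z)" "d z"] by (simp add: cd)
    show "dist ((c \<circ> f \<circ> d) ((c \<circ> x) i)) ((c \<circ> x) (Suc i)) < \<delta>" if "i < n" for i
      using ch[OF that] by (simp add: cd dist_c)
  qed (use \<delta> n1 cl in auto)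
qed

end

context rational_rotation
begin

text \<open>If \<open>mu n v\<close> vanishes, coprimality makes \<open>n\<close> a multiple of
  \<open>q\<close> and \<open>v\<close> the same multiple of \<open>p\<close>. Taken in blocks of
  \<open>q\<close> steps, the walk is then a closed chain for \<open>f ^^ nat q\<close> minus
  \<open>p\<close>, whose displacement is at least \<delta> because it has no fixed point.\<close>

lemma scale_without_neutral_cycles:
  assumes coprime: "gcd (fst p) (gcd (snd p) q) = 1" and np: "\<And>x. (f ^^ nat q) x \<noteq> x + zv p"
  obtains N where "N > 0" "nozero N"
proof -
  define k where "k = nat q"
  have k: "int k = q" "k \<ge> 1" using q by (auto simp: k_def)
  define g gi where "g = (\<lambda>x. (f ^^ k) x + zv (- p))" and "gi = (\<lambda>x. (fi ^^ k) (x - zv (- p)))"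
  interpret fk: lift_map "f ^^ k" "fi ^^ k" by (rule funpow)
  interpret g: lift_map g gi unfolding g_def gi_def by (rule fk.translate)
  obtain z where z: "\<And>x. dist (g z) z \<le> dist (g x) x"
    by (rule periodic_attains_inf[of "\<lambda>x. dist (g x) x"]) (auto intro!: continuous_intros g.cont simp: g.comm)
  define \<delta> where "\<delta> = dist (g z) z"
  have "g z \<noteq> z" using np[of z] by (auto simp: g_def k_def zv_uminus algebra_simps)
  then have \<delta>: "\<delta> > 0" by (simp add: \<delta>_def)
  obtain N0 where N0: "\<And>N a b. N \<ge> N0 \<Longrightarrow> (edge N ^^ k) a b \<Longrightarrow> dist ((f ^^ k) (pos N a)) (pos N b) < \<delta>"
    using walk_tracks_orbit[OF \<delta>, of k] by blast
  define N where "N = Suc N0"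
  have N: "N > 0" "N \<ge> N0" by (auto simp: N_def)
  interpret G: periodic_graph "edge N" N by (rule periodic_graph[OF N(1)])
  have "mu n v \<noteq> 0" if c: "cyc N a n v" for a n v
  proof
    assume "mu n v = 0"
    then have e: "q * fst v = int n * fst p" "q * snd v = int n * snd p" by (auto simp: mu_def prod_eq_iff)
    have "q dvd int n * fst p" "q dvd int n * snd p" using e by (metis dvd_triv_left)+
    then have "q dvd gcd (int n * fst p) (gcd (int n * snd p) (int n * q))" by simp
    also have "gcd (int n * fst p) (gcd (int n * snd p) (int n * q)) = int n * gcd (fst p) (gcd (snd p) q)"
      by (simp add: gcd_mult_distrib_int[symmetric])
    finally have "int k dvd int n" using coprime k by simp
    then obtain j where j: "n = k * j" by (metis dvdE int_dvd_int_iff)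
    then have v: "v = imul (int j) p"
      using e k by (auto simp: prod_eq_iff)
    have "(edge N ^^ n) a (a + imul (int N) v)" "n \<ge> 1" using c by (auto simp: G.closed_walk_def)
    then obtain \<pi> where \<pi>: "\<pi> 0 = a" "\<pi> n = a + imul (int N) v" "\<And>i. i < n \<Longrightarrow> edge N (\<pi> i) (\<pi> (Suc i))"
      unfolding relpowp_fun_conv by blast
    \<comment> \<open>Subtracting i p, the displacement expected after i blocks, closes the
      chain.\<close>
    define x where "x = (\<lambda>i. pos N (\<pi> (i * k)) - real i *\<^sub>R zv p)"
    show False
    proof (rule g.no_closed_chain[OF \<delta>, of j x])
      show "\<delta> \<le> dist (g z) z" for z using z by (simp add: \<delta>_def)
      show "j \<ge> 1" using j \<open>n \<ge> 1\<close> by (cases j) auto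
      show "x j = x 0"
        using \<pi>(1,2) by (simp add: x_def mult.commute[of j] j[symmetric] pos_translate[OF N(1)] v zv_imul)
      fix i assume i: "i < j"
      have "Suc i * k \<le> n" using i j by (metis Suc_leI mult.commute mult_le_mono1)
      then have "(edge N ^^ (Suc i * k - i * k)) (\<pi> (i * k)) (\<pi> (Suc i * k))"
        by (intro relpowp_segment[where n = n] \<pi>(3)) auto
      then have d: "dist ((f ^^ k) (pos N (\<pi> (i * k)))) (pos N (\<pi> (Suc i * k))) < \<delta>" using N0[OF N(2)] by simp
      have "g (x i) = (f ^^ k) (pos N (\<pi> (i * k))) - real i *\<^sub>R zv p - zv p"
        using funpow_comm[of k "pos N (\<pi> (i * k))" "- imul (int i) p"] by (simp add: g_def x_def zv_uminus zv_imul)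
      then have "dist (g (x i)) (x (Suc i)) = dist ((f ^^ k) (pos N (\<pi> (i * k)))) (pos N (\<pi> (Suc i * k)))"
        by (simp add: x_def dist_norm algebra_simps)
      then show "dist (g (x i)) (x (Suc i)) < \<delta>" using d by simp
    qed
  qed
  then have "nozero N" unfolding nozero_def by blast
  then show ?thesis using that N by blast
qed

text \<open>The \<open>mu\<close> of a neutral cycle is a non-zero integer vector orthogonal to
  \<open>l\<close>. Its primitive part (x, y), turned by a right angle, gives \<open>u\<close> and
  its Bezout coefficients give \<open>e\<close>; the sign \<tau> orients \<open>u\<close> like
  \<open>l\<close>.\<close>

lemma integral_half_plane:
  assumes N: "N > 0" and nz: "nozero N" and nf: "no_free_continuum f"
  obtains u e where "idot u e = 1" "\<And>a n v. cyc N a n v \<Longrightarrow> idot u (mu n v) \<ge> 0"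
proof -
  obtain l :: "real \<times> real" where l: "l \<noteq> 0" "\<And>a n v. cyc N a n v \<Longrightarrow> l \<bullet> zv (mu n v) \<ge> 0"
    using cycles_half_plane[OF N nz nf] by blast
  obtain a n v where c: "cyc N a n v" "l \<bullet> zv (mu n v) = 0"
    using cycles_of_both_signs[OF N nz, of l 1] l by (metis insertI1)
  define s where "s = mu n v"
  have s0: "s \<noteq> 0" using nz c(1) unfolding nozero_def s_def by blast
  define d where "d = gcd (fst s) (snd s)"
  have d: "d > 0" using s0 by (auto simp: d_def prod_eq_iff)
  obtain x y where xy: "fst s = d * x" "snd s = d * y" unfolding d_def by (meson dvdE gcd_dvd1 gcd_dvd2)
  obtain b1 b2 where "b1 * fst s + b2 * snd s = d" using bezout_int[of "fst s" "snd s"] by (auto simp: d_def)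
  then have "d * (b1 * x + b2 * y) = d * 1" by (simp add: xy algebra_simps)
  then have bez: "b1 * x + b2 * y = 1" using d by simp
  have "of_int d * (fst l * of_int x + snd l * of_int y) = 0"
    using c(2) by (simp add: s_def[symmetric] inner_prod_def xy algebra_simps)
  then have perp: "fst l * of_int x + snd l * of_int y = 0" using d by simp
  define t where "t = - fst l * of_int b2 + snd l * of_int b1"
  have rb: "real_of_int b1 * of_int x + of_int b2 * of_int y = 1"
    using bez by (metis of_int_1 of_int_add of_int_mult)
  have lt: "l = t *\<^sub>R zv (- y, x)"
  proof -
    have "fst l = t * - of_int y" "snd l = t * of_int x" unfolding t_def using perp rb by algebra+
    then show ?thesis by (simp add: prod_eq_iff)
  qed
  then have t0: "t \<noteq> 0" using l(1) by auto
  define \<tau> where "\<tau> = (if t > 0 then 1 else - 1 :: int)"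
  have tau: "\<tau> * \<tau> = 1" "t = \<bar>t\<bar> * of_int \<tau>" by (auto simp: \<tau>_def)
  define u where "u = imul \<tau> (- y, x)"
  show ?thesis
  proof (rule that[of u "imul \<tau> (- b2, b1)"])
    have "idot u (imul \<tau> (- b2, b1)) = (\<tau> * \<tau>) * (b1 * x + b2 * y)" by (simp add: u_def idot_def algebra_simps)
    then show "idot u (imul \<tau> (- b2, b1)) = 1" by (simp add: tau bez)
    fix a n v assume "cyc N a n v"
    then have "l \<bullet> zv (mu n v) \<ge> 0" by (rule l(2))
    moreover have "l = \<bar>t\<bar> *\<^sub>R zv u" using lt tau(2) by (metis scaleR_scaleR u_def zv_imul)
    ultimately have "\<bar>t\<bar> * (zv u \<bullet> zv (mu n v)) \<ge> 0" by (metis inner_scaleR_left)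
    then have "zv u \<bullet> zv (mu n v) \<ge> 0" using t0 by (simp add: zero_le_mult_iff)
    then show "idot u (mu n v) \<ge> 0" by (simp add: zv_inner)
  qed
qed

lemma interior_rotation_set_nonempty:
  assumes N: "N > 0" and nz: "nozero N" and nf: "no_free_continuum f"
  shows "interior (rotation_set f) \<noteq> {}"
proof -
  obtain u e where ue: "idot u e = 1" and nonneg: "\<And>a n v. cyc N a n v \<Longrightarrow> idot u (mu n v) \<ge> 0"
    using integral_half_plane[OF N nz nf] by blast
  have u0: "u \<noteq> 0" using ue by (auto simp: idot_def)
  define \<alpha> where "\<alpha> = (zv u \<bullet> zv p) / of_int q"
  have q0: "real_of_int q > 0" using q by simp
  have \<alpha>q: "of_int q * \<alpha> = zv u \<bullet> zv p" using q0 by (simp add: \<alpha>_def)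
  define m where "m = \<lfloor>\<alpha>\<rfloor>"
  \<comment> \<open>The strict inequality holds also for integral \<alpha>, so a point of speed
    \<open>m + 1\<close> lies off the line of speed \<alpha>.\<close>
  have m: "of_int m \<le> \<alpha>" "\<alpha> < of_int (m + 1)" by (auto simp: m_def) 
  have cyc: "zv u \<bullet> zv v \<ge> real n * \<alpha>" if c: "cyc N a n v" for a n v
  proof -
    have "0 \<le> real_of_int (idot u (mu n v))" using nonneg[OF c] by simp
    also have "\<dots> = of_int q * (zv u \<bullet> zv v - real n * \<alpha>)"
      using \<alpha>q by (simp add: zv_inner[symmetric] zv_mu inner_diff_right algebra_simps)
    finally show ?thesis using q0 by (simp add: zero_le_mult_iff)
  qed
  have "\<exists>x. zv u \<bullet> ((f ^^ n) x - x) \<ge> real n * of_int (m + 1)" for n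
  proof (rule ccontr)
    assume "\<not> ?thesis"
    then have slow: "zv u \<bullet> ((f ^^ n) x - x) < real n * of_int (m + 1)" for x by (meson not_le)
    show False by (rule no_strip_between_integers[OF N nf ue cyc m(1) slow])
  qed
  then obtain P3 where P3: "realizable P3" "zv u \<bullet> P3 \<ge> of_int (m + 1)"
    using realizable_of_directional_rates by blast
  define w where "w = zv (- snd u, fst u)"
  obtain P1 where P1: "realizable P1" "zv u \<bullet> (of_int q *\<^sub>R P1 - zv p) = 0" "of_int 1 * (w \<bullet> (of_int q *\<^sub>R P1 - zv p)) > 0"
    unfolding w_def using neutral_realizable_points[OF N nz u0, of 1] nonneg by (metis insertI1)
  obtain P2 where P2: "realizable P2" "zv u \<bullet> (of_int q *\<^sub>R P2 - zv p) = 0" "of_int (-1) * (w \<bullet> (of_int q *\<^sub>R P2 - zv p)) > 0"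
    unfolding w_def using neutral_realizable_points[OF N nz u0, of "-1"] nonneg by (metis insertI1 insertI2)
  have uP: "zv u \<bullet> P1 = \<alpha>" "zv u \<bullet> P2 = \<alpha>"
    using P1(2) P2(2) \<alpha>q[symmetric] q0 by (auto simp: inner_diff_right)
  have "of_int q * (w \<bullet> P1) > of_int q * (w \<bullet> P2)" using P1(3) P2(3) by (simp add: inner_diff_right)
  then have wP: "w \<bullet> P1 \<noteq> w \<bullet> P2" by auto
  show ?thesis
  proof (rule realizable_noncollinear[OF P1(1) P2(1) P3(1)])
    fix \<nu> :: "real \<times> real" assume 1: "\<nu> \<bullet> (P1 - P2) = 0" and 2: "\<nu> \<bullet> (P1 - P3) = 0"
    define s where "s = zv u \<bullet> zv u"
    have s: "s > 0" using u0 by (simp add: s_def)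
    \<comment> \<open>\<open>zv u\<close> and \<open>w\<close> are orthogonal and of equal length,
      so this is the expansion of \<nu> in this basis, times the squared length.\<close>
    have dec: "s * (\<nu> \<bullet> y) = (\<nu> \<bullet> zv u) * (zv u \<bullet> y) + (\<nu> \<bullet> w) * (w \<bullet> y)" for y
      by (simp add: s_def w_def inner_prod_def algebra_simps)
    have "(\<nu> \<bullet> w) * (w \<bullet> (P1 - P2)) = 0" using dec[of "P1 - P2"] 1 uP by (simp add: inner_diff_right)
    then have \<nu>w: "\<nu> \<bullet> w = 0" using wP by (simp add: inner_diff_right)
    have "(\<nu> \<bullet> zv u) * (zv u \<bullet> (P1 - P3)) = 0" using dec[of "P1 - P3"] 2 \<nu>w by simp
    moreover have "zv u \<bullet> (P1 - P3) \<noteq> 0" using uP P3(2) m(2) by (simp add: inner_diff_right)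
    ultimately have "\<nu> \<bullet> zv u = 0" by simp
    then have "s * (\<nu> \<bullet> \<nu>) = 0" using dec[of \<nu>] \<nu>w by simp
    then show "\<nu> = 0" using s by simp
  qed
qed

end

theorem theoremA:
  fixes F :: "torus \<Rightarrow> torus"
    and f :: "real \<times> real \<Rightarrow> real \<times> real"
    and p\<^sub>1 p\<^sub>2 q :: int
  assumes "homeomorphic_map euclidean euclidean F"
    and "homotopic_with_canon (\<lambda>h. True) UNIV UNIV F id"
    and "curve_intersection_property F"
    and "is_lift F f"
    and "interior (rotation_set f) = {}"
    and "q \<ge> 1"
    and "gcd p\<^sub>1 (gcd p\<^sub>2 q) = 1"
    and "(real_of_int p\<^sub>1 / real_of_int q, real_of_int p\<^sub>2 / real_of_int q) \<in> rotation_set f"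
  shows "\<exists>x. (f ^^ nat q) x = x + (real_of_int p\<^sub>1, real_of_int p\<^sub>2)"
proof (rule ccontr)
  assume "\<not> ?thesis"
  then have np: "(f ^^ nat q) x \<noteq> x + zv (p\<^sub>1, p\<^sub>2)" for x unfolding zv_def fst_conv snd_conv by blast
  obtain fi where "lift_map f fi" by (rule is_lift_imp_lift_map[OF assms(2,4)])
  then interpret lift_map f fi .
  have nf: "no_free_continuum f"
    by (rule curve_intersection_imp_no_free_continuum[OF \<open>lift_map f fi\<close> assms(4,3)])
  have q0: "real_of_int q > 0" using assms(6) by simp
  interpret rational_rotation f fi "(p\<^sub>1, p\<^sub>2)" q
  proof
    fix \<epsilon> :: real and m :: nat assume \<epsilon>: "\<epsilon> > 0"
    define z where "z = (real_of_int p\<^sub>1 / real_of_int q, real_of_int p\<^sub>2 / real_of_int q)"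
    have qz: "of_int q *\<^sub>R z = zv (p\<^sub>1, p\<^sub>2)" using q0 by (simp add: z_def zv_def)
    \<comment> \<open>\<open>Suc m\<close> rather than \<open>m\<close>, so that the index is
      admissible in the intersection and the time \<open>n\<close> is positive.\<close>
    have "z \<in> closure (\<Union>n\<in>{Suc m..}. {((f ^^ n) x - x) /\<^sub>R real n | x. True})"
      using assms(8) unfolding rotation_set_def z_def by auto
    then obtain y where "y \<in> (\<Union>n\<in>{Suc m..}. {((f ^^ n) x - x) /\<^sub>R real n | x. True})" "dist y z < \<epsilon> / of_int q"
      using \<epsilon> q0 unfolding closure_approachable by (meson divide_pos_pos)
    then obtain n x where n: "n \<ge> Suc m" and d: "dist (((f ^^ n) x - x) /\<^sub>R real n) z < \<epsilon> / of_int q" by auto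
    have n0: "real n > 0" using n by simp
    have "of_int q *\<^sub>R ((f ^^ n) x - x) - real n *\<^sub>R zv (p\<^sub>1, p\<^sub>2) = (of_int q * real n) *\<^sub>R (((f ^^ n) x - x) /\<^sub>R real n - z)"
    proof -
      have "(of_int q * real n) *\<^sub>R (y /\<^sub>R real n) = of_int q *\<^sub>R y" for y :: "real \<times> real" using n0 by simp
      then show ?thesis unfolding qz[symmetric] scaleR_diff_right[of "of_int q * real n"] by (simp only: scaleR_scaleR mult.commute)
    qed
    then have "norm (of_int q *\<^sub>R ((f ^^ n) x - x) - real n *\<^sub>R zv (p\<^sub>1, p\<^sub>2))
        = of_int q * real n * dist (((f ^^ n) x - x) /\<^sub>R real n) z"
      using n0 q0 by (simp add: dist_norm)
    also have "\<dots> \<le> of_int q * real n * (\<epsilon> / of_int q)" using d n0 q0 by (intro mult_left_mono) auto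
    also have "\<dots> = \<epsilon> * real n" using q0 by simp
    finally show "\<exists>n\<ge>m. \<exists>x. norm (of_int q *\<^sub>R ((f ^^ n) x - x) - real n *\<^sub>R zv (p\<^sub>1, p\<^sub>2)) \<le> \<epsilon> * real n"
      using Suc_leD[OF n] by blast
  qed (rule assms(6))
  obtain N where "N > 0" "nozero N"
    using scale_without_neutral_cycles assms(7) np by auto
  then show False using interior_rotation_set_nonempty nf assms(5) by blast
qed

end
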